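(* Let $\gamma\in(0,1)$ and $\alpha_n=1-\gamma/n$ for $n\in\mathbb{N}$ (i.e. $\beta=1$). Let $(\sigma_n)$ be a sequence of positive numbers and, for each $n$, let $(X_{j,n})_{j\ge0}$ be the stationary process satisfying $X_{j,n}=\alpha_nX_{j-1,n}+\sigma_n\varepsilon_j$ for $j\ge1$, where $(\varepsilon_j)$ are i.i.d. $\mathcal{N}(0,1)$ independent of $X_{0,n}\sim\mathcal{N}(0,\sigma_n^2/(1-\alpha_n^2))$. Let $\hat S_{n,t}(f)$ be the standardized sequential additive functional and $W_{q,\gamma}$, $q\in\mathbb{N}$, the tempered Hermite processes (all built from the same Brownian motion) defined in the context. (i) If $\sigma_n^2\gg 1-\alpha_n^2$ and $f=\sum_{q=m}^pc_qH_q$ is a fixed polynomial with $p\ge1$ and $c_p\neq0$, then there are real constants $e_{p-2l}=e_{p-2l}(f)$, $0\le l\le\lfloor(p-1)/2\rfloor$, such that $$\big(\hat S_{n,t}(f)\big)_{t\in[0,1]}\longrightarrow_{\mathcal D}\Big(\sum_{l=0}^{\lfloor(p-1)/2\rfloor}e_{p-2l}\,W_{p-2l,\gamma}(t)\Big)_{t\in[0,1]}\quad\text{in }D[0,1]\text{ as }n\to\infty.$$ (ii) If $\sigma_n^2=1-\alpha_n^2$ and $f\in L^2(\mathcal{N}(0,1))$ is non-constant with Hermite rank $m$, then there are real constants $d_q=d_q(f)$, $q\ge m$, such that $$\big(\hat S_{n,t}(f)\big)_{t\in[0,1]}\longrightarrow_{\mathcal D}\Big(\sum_{q=m}^{\infty}d_q\,W_{q,\gamma}(t)\Big)_{t\in[0,1]}\quad\text{in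 }D[0,1]\text{ as }n\to\infty$$ (the series being a limit in $L^2$). (iii) If $\sigma_n^2\ll 1-\alpha_n^2$ and $f=\sum_{q=m}^pc_qH_q$ is a fixed non-constant polynomial with $p\ge 1$ and $c_p\ne 0$, then, with $m_*$ as defined in the context, there are real constants $g_q=g_q(f)$, $1\le q\le m_*$, such that $$\big(\hat S_{n,t}(f)\big)_{t\in[0,1]}\longrightarrow_{\mathcal D}\Big(\sum_{q=1}^{m_*}g_q\,W_{q,\gamma}(t)\Big)_{t\in[0,1]}\quad\text{in }D[0,1]\text{ as }n\to\infty.$$
   Context: For $t\in[0,1]$, $S_{n,t}(f)=\sum_{k=1}^{\lfloor nt\rfloor}f(X_{k,n})$ and $\hat S_{n,t}(f)=\dfrac{S_{n,t}(f)-\mathbb{E}S_{n,t}(f)}{\sqrt{\mathrm{Var}\,S_{n,1}(f)}}$. $H_q$ is the (probabilists') Hermite polynomial of order $q$; any $f\in L^2(\mathcal{N}(0,1))$ has an $L^2$-expansion $f=\sum_{q\ge0}c_qH_q$, and its Hermite rank is $m=\min\{q\ge1:c_q\ne0\}$. $D[0,1]$ is the Skorokhod space with the Skorokhod topology; $\longrightarrow_{\mathcal D}$ is convergence in distribution. For positive sequences, $x_n\gg y_n$ (equivalently $y_n\ll x_n$) means $y_n=o(x_n)$. The constants in the limits do not depend on $n$ or $t$ ($\gamma$ is fixed). Tempered Hermite processes: for a two-sided standard Brownian motion $B$ on $\mathbb{R}$ (the same for all $q$), as multiple Wiener–Itô integrals off the diagonals, $$W_{q,\gamma}(t)=K_q^{(\gamma)}\int_{\mathbb{R}^q}'\Big(\int_0^t\prod_{r=1}^qe^{-\gamma(s-x_r)}\mathbf{1}_{\{x_r\le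 s\}}\,ds\Big)dB(x_1)\cdots dB(x_q),\qquad K_q^{(\gamma)}=\sqrt{\frac{2^{q-1}q^2\gamma^{q+2}}{q!\,(e^{-\gamma q}-1+\gamma q)}} .$$ Definition of $m_*$ for a polynomial $f=\sum_{q=m}^pc_qH_q$: with $C_{q,l}=\frac{q!}{l!\,(q-2l)!\,2^l}$, put $$D_r^{(w,m,p)}=\sum_{s=0}^{\lfloor p/2\rfloor}\mathbf{1}_{\{w=2s+r\}}\sum_{u=0}^{\lfloor p/2\rfloor}\mathbf{1}_{\{m\le w+2u\le p\}}\,c_{w+2u}\,C_{w+2u,s+u}\binom{s+u}{s}(-1)^u ,$$ and $m_*=\min\{w\ge1:\sum_{r=1}^pD_r^{(w,m,p)}\ne0\}$. *)

theory Defs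
  imports "HOL-Probability.Probability" "HOL-Library.Landau_Symbols"
begin

section \<open>Hermite expansions\<close>

text \<open>Probabilists' Hermite polynomials.\<close>

fun hermite :: "nat \<Rightarrow> real \<Rightarrow> real" where
  "hermite 0 x = 1"
| "hermite (Suc 0) x = x"
| "hermite (Suc (Suc q)) x = x * hermite (Suc q) x - real (Suc q) * hermite q x"

definition std_normal :: "real measure" where
  "std_normal = density lborel std_normal_density"

text \<open>
  Mean-square convergence. The nonnegative integral is used because the Bochner integral of a
  non-integrable function is \<open>0\<close>.
\<close>

definition L2_tendsto :: "'a measure \<Rightarrow> (nat \<Rightarrow> 'a \<Rightarrow> real) \<Rightarrow> ('a \<Rightarrow> real) \<Rightarrow> bool" where
  "L2_tendsto M Y Z \<longleftrightarrow> (\<forall>k. Y k \<in> borel_measurable M) \<and> Z \<in> borel_measurable M \<and>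
     ((\<lambda>k. \<integral>\<^sup>+\<omega>. ennreal ((Y k \<omega> - Z \<omega>)\<^sup>2) \<partial>M) \<longlonglongrightarrow> 0)"

definition hermite_expansion :: "(real \<Rightarrow> real) \<Rightarrow> (nat \<Rightarrow> real) \<Rightarrow> bool" where
  "hermite_expansion f c \<longleftrightarrow> L2_tendsto std_normal (\<lambda>k x. \<Sum>q\<le>k. c q * hermite q x) f"

definition hermite_rank :: "(real \<Rightarrow> real) \<Rightarrow> nat" where
  "hermite_rank f = (LEAST q. 1 \<le> q \<and> (THE c. hermite_expansion f c) q \<noteq> 0)"

definition coeff_C :: "nat \<Rightarrow> nat \<Rightarrow> real" where
  "coeff_C q l = fact q / (fact l * fact (q - 2 * l) * 2 ^ l)"

text \<open>
  In \<open>coeff_D\<close> the constant \<open>coeff_C\<close> only occurs with \<open>w + 2 * u - 2 * (s + u) = r\<close>, so the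
  subtraction on \<^typ>\<open>nat\<close> does not truncate.
\<close>

definition coeff_D :: "(nat \<Rightarrow> real) \<Rightarrow> nat \<Rightarrow> nat \<Rightarrow> nat \<Rightarrow> nat \<Rightarrow> real" where
  "coeff_D c m p w r =
     (\<Sum>s=0..p div 2. if w = 2 * s + r then
        (\<Sum>u=0..p div 2. if m \<le> w + 2 * u \<and> w + 2 * u \<le> p then
           c (w + 2 * u) * coeff_C (w + 2 * u) (s + u) * real ((s + u) choose s) * (- 1) ^ u
         else 0)
      else 0)"

definition m_star :: "(nat \<Rightarrow> real) \<Rightarrow> nat \<Rightarrow> nat \<Rightarrow> nat" where
  "m_star c m p = (LEAST w. 1 \<le> w \<and> (\<Sum>r=1..p. coeff_D c m p w r) \<noteq> 0)"


section \<open>The Skorokhod space and convergence in distribution\<close>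

text \<open>
  The space \<open>D[0,1]\<close>. Functions are \<^const>\<open>undefined\<close> outside \<open>[0,1]\<close>, so that equality of
  elements is equality on \<open>[0,1]\<close>.
\<close>

definition skorokhod_D :: "(real \<Rightarrow> real) set" where
  "skorokhod_D = {x \<in> extensional {0..1}.
     (\<forall>t\<in>{0..<1}. (x \<longlongrightarrow> x t) (at_right t)) \<and> (\<forall>t\<in>{0<..1}. \<exists>l. (x \<longlongrightarrow> l) (at_left t))}"

definition time_changes :: "(real \<Rightarrow> real) set" where
  "time_changes = {\<mu>. strict_mono_on {0..1} \<mu> \<and> continuous_on {0..1} \<mu> \<and> \<mu> ` {0..1} = {0..1}}"

definition skorokhod_close :: "(real \<Rightarrow> real) \<Rightarrow> (real \<Rightarrow> real) \<Rightarrow> real \<Rightarrow> bool" where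
  "skorokhod_close x y e \<longleftrightarrow>
     (\<exists>\<mu>\<in>time_changes. \<forall>t\<in>{0..1}. \<bar>\<mu> t - t\<bar> \<le> e \<and> \<bar>x t - y (\<mu> t)\<bar> \<le> e)"

definition skorokhod_dist :: "(real \<Rightarrow> real) \<Rightarrow> (real \<Rightarrow> real) \<Rightarrow> real" where
  "skorokhod_dist x y =
     (if x \<in> skorokhod_D \<and> y \<in> skorokhod_D then Inf {e. 0 < e \<and> skorokhod_close x y e} else 0)"

lemma time_change_id: "(\<lambda>t. t) \<in> time_changes"
  by (auto simp: time_changes_def strict_mono_on_def)

lemma time_change_mem: "\<mu> \<in> time_changes \<Longrightarrow> t \<in> {0..1} \<Longrightarrow> \<mu> t \<in> {0..1}"
  unfolding time_changes_def by blast

lemma time_change_compose: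
  assumes "\<mu> \<in> time_changes" "\<nu> \<in> time_changes"
  shows "(\<lambda>t. \<nu> (\<mu> t)) \<in> time_changes"
proof -
  have im: "\<mu> ` {0..1} = {0..1}" "\<nu> ` {0..1} = {0..1}"
    using assms by (auto simp: time_changes_def)
  have "strict_mono_on {0..1} (\<lambda>t. \<nu> (\<mu> t))"
    using assms time_change_mem[OF assms(1)] unfolding time_changes_def strict_mono_on_def by blast
  moreover have "continuous_on {0..1} (\<lambda>t. \<nu> (\<mu> t))"
    using assms im by (intro continuous_on_compose2[of "{0..1}" \<nu> "{0..1}" \<mu>]) (auto simp: time_changes_def)
  moreover have "(\<lambda>t. \<nu> (\<mu> t)) ` {0..1} = {0..1}"
    using im by (simp add: image_image[symmetric])
  ultimately show ?thesis by (simp add: time_changes_def)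
qed

lemma time_change_inverse:
  assumes "\<mu> \<in> time_changes"
  obtains \<nu> where "\<nu> \<in> time_changes" "\<And>t. t \<in> {0..1} \<Longrightarrow> \<mu> (\<nu> t) = t"
proof
  let ?\<nu> = "inv_into {0..1} \<mu>"
  have m: "strict_mono_on {0..1} \<mu>" "continuous_on {0..1} \<mu>" "\<mu> ` {0..1} = {0..1}"
    using assms by (auto simp: time_changes_def)
  have inj: "inj_on \<mu> {0..1}"
    using m(1) strict_mono_on_imp_inj_on by blast
  show r: "\<mu> (?\<nu> t) = t" if "t \<in> {0..1}" for t
    using that m(3) by (simp add: f_inv_into_f)
  have mem: "?\<nu> t \<in> {0..1}" if "t \<in> {0..1}" for t
    using that m(3) by (metis inv_into_into)
  have "continuous_on (\<mu> ` {0..1}) ?\<nu>"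
    using m(2) inj by (intro continuous_on_inv) auto
  moreover have "strict_mono_on {0..1} ?\<nu>"
  proof (rule strict_mono_onI)
    fix s t :: real assume st: "s \<in> {0..1}" "t \<in> {0..1}" "s < t"
    show "?\<nu> s < ?\<nu> t"
    proof (rule ccontr)
      assume "\<not> ?\<nu> s < ?\<nu> t"
      then have "\<mu> (?\<nu> t) \<le> \<mu> (?\<nu> s)"
        using strict_mono_onD[OF m(1) mem[OF st(2)] mem[OF st(1)]] by (cases "?\<nu> t = ?\<nu> s") auto
      then show False using st r by simp
    qed
  qed
  moreover have "?\<nu> ` {0..1} = {0..1}"
    using inj m(3) by (metis inv_into_image_cancel order_refl)
  ultimately show "?\<nu> \<in> time_changes"
    using m(3) by (simp add: time_changes_def)
qed

lemma time_change_endpoint: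
  assumes "\<mu> \<in> time_changes"
  shows "\<mu> 1 = 1"
proof -
  have "1 \<in> \<mu> ` {0..1}" using assms by (simp add: time_changes_def)
  then obtain s where s: "s \<in> {0..1}" "\<mu> s = 1" by (metis imageE)
  then have "1 \<le> \<mu> 1"
    using strict_mono_onD[of "{0..1}" \<mu> s 1] assms by (cases "s = 1") (auto simp: time_changes_def)
  then show ?thesis using time_change_mem[OF assms, of 1] by simp
qed

lemma skorokhod_close_sym:
  assumes "skorokhod_close x y e"
  shows "skorokhod_close y x e"
proof -
  obtain \<mu> where \<mu>: "\<mu> \<in> time_changes"
    "\<And>t. t \<in> {0..1} \<Longrightarrow> \<bar>\<mu> t - t\<bar> \<le> e \<and> \<bar>x t - y (\<mu> t)\<bar> \<le> e"
    using assms unfolding skorokhod_close_def by blast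
  obtain \<nu> where \<nu>: "\<nu> \<in> time_changes" "\<And>t. t \<in> {0..1} \<Longrightarrow> \<mu> (\<nu> t) = t"
    using time_change_inverse[OF \<mu>(1)] by blast
  have "\<bar>\<nu> t - t\<bar> \<le> e \<and> \<bar>y t - x (\<nu> t)\<bar> \<le> e" if "t \<in> {0..1}" for t
    using \<mu>(2)[OF time_change_mem[OF \<nu>(1) that]] \<nu>(2)[OF that] by (auto simp: abs_minus_commute)
  with \<nu>(1) show ?thesis unfolding skorokhod_close_def by blast
qed

lemma skorokhod_close_trans:
  assumes "skorokhod_close x y e" "skorokhod_close y z e'"
  shows "skorokhod_close x z (e + e')"
proof -
  obtain \<mu> where \<mu>: "\<mu> \<in> time_changes"
    "\<And>t. t \<in> {0..1} \<Longrightarrow> \<bar>\<mu> t - t\<bar> \<le> e \<and> \<bar>x t - y (\<mu> t)\<bar> \<le> e"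
    using assms(1) unfolding skorokhod_close_def by blast
  obtain \<nu> where \<nu>: "\<nu> \<in> time_changes"
    "\<And>t. t \<in> {0..1} \<Longrightarrow> \<bar>\<nu> t - t\<bar> \<le> e' \<and> \<bar>y t - z (\<nu> t)\<bar> \<le> e'"
    using assms(2) unfolding skorokhod_close_def by blast
  have "\<bar>\<nu> (\<mu> t) - t\<bar> \<le> e + e' \<and> \<bar>x t - z (\<nu> (\<mu> t))\<bar> \<le> e + e'" if "t \<in> {0..1}" for t
    using \<mu>(2)[OF that] \<nu>(2)[OF time_change_mem[OF \<mu>(1) that]] by (auto simp: abs_le_iff)
  then show ?thesis
    unfolding skorokhod_close_def by (intro bexI[OF _ time_change_compose[OF \<mu>(1) \<nu>(1)]]) simp
qed

lemma skorokhod_D_bounded: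
  assumes "x \<in> skorokhod_D"
  obtains K where "\<And>t. t \<in> {0..1} \<Longrightarrow> \<bar>x t\<bar> \<le> K"
proof -
  have bdd: "\<exists>d>0. \<exists>K. \<forall>t. P t \<and> \<bar>t - s\<bar> < d \<longrightarrow> \<bar>x t\<bar> \<le> K"
    if lim: "(x \<longlongrightarrow> l) (at s within {t. P t})" for l s P
  proof -
    have "\<forall>\<^sub>F t in at s within {t. P t}. dist (x t) l < 1"
      using lim by (rule tendstoD) simp
    then obtain d where d: "d > 0" "\<And>t. P t \<Longrightarrow> t \<noteq> s \<Longrightarrow> dist t s < d \<Longrightarrow> dist (x t) l < 1"
      unfolding eventually_at by auto
    have "\<bar>x t\<bar> \<le> \<bar>l\<bar> + 1 + \<bar>x s\<bar>" if "P t" "\<bar>t - s\<bar> < d" for t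
      using d(2)[of t] that by (cases "t = s") (auto simp: dist_real_def)
    with d(1) show ?thesis by blast
  qed
  have "\<exists>K. \<forall>t\<in>{0..1}. \<bar>x t\<bar> \<le> K"
  proof (rule Bolzano[of 0 1 "\<lambda>a b. \<exists>K. \<forall>t\<in>{a..b}. 0 \<le> t \<and> t \<le> 1 \<longrightarrow> \<bar>x t\<bar> \<le> K", THEN exE])
    fix a b c :: real
    assume "\<exists>K. \<forall>t\<in>{a..b}. 0 \<le> t \<and> t \<le> 1 \<longrightarrow> \<bar>x t\<bar> \<le> K"
      "\<exists>K. \<forall>t\<in>{b..c}. 0 \<le> t \<and> t \<le> 1 \<longrightarrow> \<bar>x t\<bar> \<le> K"
    then obtain K L where "\<forall>t\<in>{a..b}. 0 \<le> t \<and> t \<le> 1 \<longrightarrow> \<bar>x t\<bar> \<le> K"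
      "\<forall>t\<in>{b..c}. 0 \<le> t \<and> t \<le> 1 \<longrightarrow> \<bar>x t\<bar> \<le> L" by blast
    then have "\<bar>x t\<bar> \<le> max K L" if "t \<in> {a..c}" "0 \<le> t \<and> t \<le> 1" for t
      using that by (cases "t \<le> b") (simp_all add: le_max_iff_disj)
    then show "\<exists>K. \<forall>t\<in>{a..c}. 0 \<le> t \<and> t \<le> 1 \<longrightarrow> \<bar>x t\<bar> \<le> K" by blast
  next
    fix s :: real assume s: "0 \<le> s" "s \<le> 1"
    have R: "\<exists>d>0. \<exists>K. \<forall>t. s < t \<and> t \<le> 1 \<and> \<bar>t - s\<bar> < d \<longrightarrow> \<bar>x t\<bar> \<le> K"
    proof (cases "s < 1")
      case True
      then have "(x \<longlongrightarrow> x s) (at s within {t. s < t})"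
        using assms s by (simp add: skorokhod_D_def greaterThan_def)
      from bdd[OF this] show ?thesis by blast
    qed (use s in \<open>auto intro: exI[of _ 1]\<close>)
    have L: "\<exists>d>0. \<exists>K. \<forall>t. t < s \<and> 0 \<le> t \<and> \<bar>t - s\<bar> < d \<longrightarrow> \<bar>x t\<bar> \<le> K"
    proof (cases "0 < s")
      case True
      then obtain l where "(x \<longlongrightarrow> l) (at s within {t. t < s})"
        using assms s unfolding skorokhod_D_def lessThan_def by fastforce
      from bdd[OF this] show ?thesis by blast
    qed (use s in \<open>auto intro: exI[of _ 1]\<close>)
    obtain d1 K1 where R: "d1 > 0" "\<And>t. s < t \<Longrightarrow> t \<le> 1 \<Longrightarrow> \<bar>t - s\<bar> < d1 \<Longrightarrow> \<bar>x t\<bar> \<le> K1"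
      using R by blast
    obtain d2 K2 where L: "d2 > 0" "\<And>t. t < s \<Longrightarrow> 0 \<le> t \<Longrightarrow> \<bar>t - s\<bar> < d2 \<Longrightarrow> \<bar>x t\<bar> \<le> K2"
      using L by blast
    show "\<exists>d>0. \<forall>a b. a \<le> s \<and> s \<le> b \<and> b - a < d \<longrightarrow>
        (\<exists>K. \<forall>t\<in>{a..b}. 0 \<le> t \<and> t \<le> 1 \<longrightarrow> \<bar>x t\<bar> \<le> K)"
    proof (rule exI[of _ "min d1 d2"], intro conjI allI impI)
      fix a b assume ab: "a \<le> s \<and> s \<le> b \<and> b - a < min d1 d2"
      have "\<bar>x t\<bar> \<le> max \<bar>x s\<bar> (max K1 K2)" if "t \<in> {a..b}" "0 \<le> t \<and> t \<le> 1" for t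
        using R(2)[of t] L(2)[of t] ab that by (cases t s rule: linorder_cases) (auto simp: le_max_iff_disj)
      then show "\<exists>K. \<forall>t\<in>{a..b}. 0 \<le> t \<and> t \<le> 1 \<longrightarrow> \<bar>x t\<bar> \<le> K" by blast
    qed (use R(1) L(1) in simp)
  qed auto
  with that show ?thesis by blast
qed

lemma skorokhod_close_exists:
  assumes "x \<in> skorokhod_D" "y \<in> skorokhod_D"
  shows "\<exists>e>0. skorokhod_close x y e"
proof -
  obtain K where K: "\<And>t. t \<in> {0..1} \<Longrightarrow> \<bar>x t\<bar> \<le> K" using skorokhod_D_bounded[OF assms(1)] by blast
  obtain L where L: "\<And>t. t \<in> {0..1} \<Longrightarrow> \<bar>y t\<bar> \<le> L" using skorokhod_D_bounded[OF assms(2)] by blast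
  have "\<bar>x t - y t\<bar> \<le> max 1 (K + L)" if "t \<in> {0..1}" for t
    using K[OF that] L[OF that] by linarith
  then have "skorokhod_close x y (max 1 (K + L))"
    unfolding skorokhod_close_def by (intro bexI[OF _ time_change_id]) auto
  then show ?thesis by (intro exI[of _ "max 1 (K + L)"]) auto
qed

lemma skorokhod_close_all_imp_eq:
  assumes D: "x \<in> skorokhod_D" "y \<in> skorokhod_D" and close: "\<And>e. e > 0 \<Longrightarrow> skorokhod_close x y e"
  shows "x = y"
proof (rule extensionalityI[of _ "{0..1}"])
  show "x \<in> extensional {0..1}" "y \<in> extensional {0..1}" using D by (auto simp: skorokhod_D_def)
  fix t :: real assume t: "t \<in> {0..1}"
  show "x t = y t"
  proof (rule ccontr)
    assume "x t \<noteq> y t"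
    define \<delta> where "\<delta> = \<bar>x t - y t\<bar> / 4"
    have \<delta>: "\<delta> > 0" using \<open>x t \<noteq> y t\<close> by (simp add: \<delta>_def)
    have "t \<noteq> 1"
    proof
      assume "t = 1"
      obtain \<mu> where "\<mu> \<in> time_changes" "\<bar>x 1 - y (\<mu> 1)\<bar> \<le> \<delta>"
        using close[OF \<delta>] unfolding skorokhod_close_def by force
      then show False
        using time_change_endpoint \<open>t = 1\<close> \<delta> unfolding \<delta>_def by fastforce
    qed
    then have t: "0 \<le> t" "t < 1" using t by auto
    have right: "\<exists>b>t. \<forall>s. t < s \<and> s < b \<longrightarrow> dist (z s) (z t) < \<delta>" if "z \<in> skorokhod_D" for z
    proof -
      have "(z \<longlongrightarrow> z t) (at_right t)" using that t by (auto simp: skorokhod_D_def)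
      from tendstoD[OF this \<delta>] show ?thesis by (auto simp: eventually_at_right_field)
    qed
    obtain b where b: "b > t" "\<And>s. t < s \<Longrightarrow> s < b \<Longrightarrow> dist (x s) (x t) < \<delta>"
      using right[OF D(1)] by blast
    obtain c where c: "c > t" "\<And>s. t < s \<Longrightarrow> s < c \<Longrightarrow> dist (y s) (y t) < \<delta>"
      using right[OF D(2)] by blast
    define h where "h = min 1 (min b c) - t"
    have h: "h > 0" "t + h \<le> 1" "t + h \<le> b" "t + h \<le> c"
      using b(1) c(1) t by (auto simp: h_def)
    define e where "e = min \<delta> (h / 3)"
    define s where "s = t + h / 2"
    have s: "s \<in> {0..1}" "t < s" "s < b" using h t by (auto simp: s_def)
    have "e > 0" using \<delta> h(1) by (simp add: e_def)
    then obtain \<mu> where "\<bar>\<mu> s - s\<bar> \<le> e" "\<bar>x s - y (\<mu> s)\<bar> \<le> e"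
      using close s(1) unfolding skorokhod_close_def by blast
    then have m: "\<bar>\<mu> s - s\<bar> \<le> h / 3" "\<bar>x s - y (\<mu> s)\<bar> \<le> \<delta>" by (auto simp: e_def)
    then have "t < \<mu> s" "\<mu> s < c" using h by (auto simp: s_def abs_if split: if_splits)
    then have "\<bar>y (\<mu> s) - y t\<bar> < \<delta>" "\<bar>x s - x t\<bar> < \<delta>"
      using c(2) b(2)[OF s(2,3)] by (auto simp: dist_real_def)
    then have "\<bar>x t - y t\<bar> < 3 * \<delta>" using m(2) by linarith
    then show False using \<delta> by (simp add: \<delta>_def)
  qed
qed

lemma Metric_space_skorokhod: "Metric_space skorokhod_D skorokhod_dist"
proof
  let ?S = "\<lambda>x y. {e. 0 < e \<and> skorokhod_close x y e}"
  have ne: "?S x y \<noteq> {}" if "x \<in> skorokhod_D" "y \<in> skorokhod_D" for x y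
    using skorokhod_close_exists[OF that] by blast
  have bdd: "bdd_below (?S x y)" for x y by (rule bdd_belowI[of _ 0]) auto
  have small: "\<exists>e\<in>?S x y. e < r" if "x \<in> skorokhod_D" "y \<in> skorokhod_D" "skorokhod_dist x y < r" for x y r
    using that cInf_lessD[OF ne[OF that(1,2)], of r] by (simp add: skorokhod_dist_def)
  show nonneg: "0 \<le> skorokhod_dist x y" for x y
    using ne[of x y] by (auto simp: skorokhod_dist_def intro!: cInf_greatest)
  show "skorokhod_dist x y = skorokhod_dist y x" for x y
  proof -
    have "?S x y = ?S y x" using skorokhod_close_sym by blast
    then show ?thesis by (simp add: skorokhod_dist_def)
  qed
  show "skorokhod_dist x y = 0 \<longleftrightarrow> x = y" if xy: "x \<in> skorokhod_D" "y \<in> skorokhod_D" for x y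
  proof
    assume 0: "skorokhod_dist x y = 0"
    show "x = y"
    proof (rule skorokhod_close_all_imp_eq[OF xy])
      fix r :: real assume "r > 0"
      then obtain e where "0 < e" "e < r" "skorokhod_close x y e" using small[OF xy] 0 by auto
      then show "skorokhod_close x y r" unfolding skorokhod_close_def by force
    qed
  next
    assume "x = y"
    have "skorokhod_dist x y \<le> r" if "r > 0" for r
    proof -
      have "skorokhod_close x y r"
        unfolding skorokhod_close_def using \<open>x = y\<close> that by (intro bexI[OF _ time_change_id]) auto
      then show ?thesis using xy that bdd by (auto simp: skorokhod_dist_def intro!: cInf_lower)
    qed
    then show "skorokhod_dist x y = 0"
      using nonneg[of x y] field_le_epsilon[of "skorokhod_dist x y" 0] by fastforce
  qed
  show "skorokhod_dist x z \<le> skorokhod_dist x y + skorokhod_dist y z"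
    if D: "x \<in> skorokhod_D" "y \<in> skorokhod_D" "z \<in> skorokhod_D" for x y z
  proof (rule field_le_epsilon)
    fix r :: real assume r: "r > 0"
    obtain e where e: "0 < e" "skorokhod_close x y e" "e < skorokhod_dist x y + r / 2"
      using small[OF D(1,2), of "skorokhod_dist x y + r / 2"] r by auto
    obtain e' where e': "0 < e'" "skorokhod_close y z e'" "e' < skorokhod_dist y z + r / 2"
      using small[OF D(2,3), of "skorokhod_dist y z + r / 2"] r by auto
    have "skorokhod_dist x z \<le> e + e'"
      using skorokhod_close_trans[OF e(2) e'(2)] e(1) e'(1) D bdd
      by (auto simp: skorokhod_dist_def intro!: cInf_lower)
    then show "skorokhod_dist x z \<le> skorokhod_dist x y + skorokhod_dist y z + r"
      using e(3) e'(3) by linarith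
  qed
qed

definition skorokhod_topology :: "(real \<Rightarrow> real) topology" where
  "skorokhod_topology = Metric_space.mtopology skorokhod_D skorokhod_dist"

definition borel_of :: "'c topology \<Rightarrow> 'c measure" where
  "borel_of T = sigma (topspace T) {U. openin T U}"

definition conv_in_distr ::
  "'c topology \<Rightarrow> 'a measure \<Rightarrow> (nat \<Rightarrow> 'a \<Rightarrow> 'c) \<Rightarrow> 'b measure \<Rightarrow> ('b \<Rightarrow> 'c) \<Rightarrow> bool" where
  "conv_in_distr T M Y N Z \<longleftrightarrow>
     (\<forall>n. Y n \<in> measurable M (borel_of T)) \<and> Z \<in> measurable N (borel_of T) \<and>
     (\<forall>g. continuous_map T euclideanreal g \<and> bounded (g ` topspace T) \<longrightarrow>
        (\<lambda>n. \<integral>\<omega>. g (Y n \<omega>) \<partial>M) \<longlonglongrightarrow> (\<integral>\<omega>. g (Z \<omega>) \<partial>N))"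

text \<open>
  Convergence in distribution in \<open>D[0,1]\<close> of processes indexed by \<open>[0,1]\<close>. The values of the limit
  \<open>V\<close> are multiple Wiener integrals and so given only up to null sets, separately for each \<open>t\<close>;
  the limiting random element of \<open>D[0,1]\<close> is a modification of \<open>V\<close> with paths in \<open>D[0,1]\<close>
  (unique up to indistinguishability), and its existence is part of the assertion.
\<close>

definition conv_in_D ::
  "'a measure \<Rightarrow> (nat \<Rightarrow> real \<Rightarrow> 'a \<Rightarrow> real) \<Rightarrow> 'b measure \<Rightarrow> (real \<Rightarrow> 'b \<Rightarrow> real) \<Rightarrow> bool" where
  "conv_in_D M Y N V \<longleftrightarrow>
     (\<exists>Z. (\<forall>t\<in>{0..1}. AE \<omega> in N. Z \<omega> t = V t \<omega>) \<and>
          conv_in_distr skorokhod_topology M (\<lambda>n \<omega>. \<lambda>t\<in>{0..1}. Y n t \<omega>) N Z)"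


section \<open>Brownian motion, multiple Wiener integrals, tempered Hermite processes\<close>

definition two_sided_BM :: "'b measure \<Rightarrow> (real \<Rightarrow> 'b \<Rightarrow> real) \<Rightarrow> bool" where
  "two_sided_BM N B \<longleftrightarrow> prob_space N \<and>
     (\<forall>t. B t \<in> borel_measurable N) \<and>
     (AE \<omega> in N. B 0 \<omega> = 0) \<and>
     (\<forall>s t. s < t \<longrightarrow> distributed N lborel (\<lambda>\<omega>. B t \<omega> - B s \<omega>) (normal_density 0 (sqrt (t - s)))) \<and>
     (\<forall>k \<tau>. strict_mono_on {..k} \<tau> \<longrightarrow>
        prob_space.indep_vars N (\<lambda>_. borel) (\<lambda>i \<omega>. B (\<tau> (Suc i)) \<omega> - B (\<tau> i) \<omega>) {..<k::nat}) \<and>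
     (AE \<omega> in N. continuous_on UNIV (\<lambda>t. B t \<omega>))"

text \<open>
  Multi-indices of length \<open>q\<close> with pairwise distinct entries below \<open>k\<close>: restricting to these is
  what makes the integral run off the diagonals. The step kernel is constant on the products of the
  cells \<open>(\<tau> i, \<tau> (i + 1)]\<close> and vanishes on those meeting a diagonal.
\<close>

definition offdiag :: "nat \<Rightarrow> nat \<Rightarrow> (nat \<Rightarrow> nat) set" where
  "offdiag q k = {i \<in> {..<q} \<rightarrow>\<^sub>E {..<k}. inj_on i {..<q}}"

definition step_kernel ::
  "nat \<Rightarrow> nat \<Rightarrow> (nat \<Rightarrow> real) \<Rightarrow> ((nat \<Rightarrow> nat) \<Rightarrow> real) \<Rightarrow> (nat \<Rightarrow> real) \<Rightarrow> real" where
  "step_kernel q k \<tau> a x =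
     (\<Sum>i\<in>offdiag q k. a i * (\<Prod>r<q. indicator {\<tau> (i r)<..\<tau> (Suc (i r))} (x r)))"

definition step_integral ::
  "(real \<Rightarrow> 'b \<Rightarrow> real) \<Rightarrow> nat \<Rightarrow> nat \<Rightarrow> (nat \<Rightarrow> real) \<Rightarrow> ((nat \<Rightarrow> nat) \<Rightarrow> real) \<Rightarrow> 'b \<Rightarrow> real" where
  "step_integral B q k \<tau> a \<omega> =
     (\<Sum>i\<in>offdiag q k. a i * (\<Prod>r<q. B (\<tau> (Suc (i r))) \<omega> - B (\<tau> (i r)) \<omega>))"

text \<open>
  \<open>Y\<close> is (a version of) the \<open>q\<close>-fold integral of \<open>h\<close>: the \<open>L\<^sup>2\<close>-limit of the integrals of
  off-diagonal step kernels that approximate \<open>h\<close> in \<open>L\<^sup>2(\<real>\<^sup>q)\<close>.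
\<close>

definition is_multiple_wiener_integral ::
  "'b measure \<Rightarrow> (real \<Rightarrow> 'b \<Rightarrow> real) \<Rightarrow> nat \<Rightarrow> ((nat \<Rightarrow> real) \<Rightarrow> real) \<Rightarrow> ('b \<Rightarrow> real) \<Rightarrow> bool" where
  "is_multiple_wiener_integral N B q h Y \<longleftrightarrow>
     (\<exists>k \<tau> a. (\<forall>j::nat. strict_mono_on {..k j} (\<tau> j)) \<and>
        L2_tendsto (Pi\<^sub>M {..<q} (\<lambda>_. lborel)) (\<lambda>j. step_kernel q (k j) (\<tau> j) (a j)) h \<and>
        L2_tendsto N (\<lambda>j. step_integral B q (k j) (\<tau> j) (a j)) Y)"

text \<open>Well defined up to null sets.\<close>

definition multiple_wiener_integral ::
  "'b measure \<Rightarrow> (real \<Rightarrow> 'b \<Rightarrow> real) \<Rightarrow> nat \<Rightarrow> ((nat \<Rightarrow> real) \<Rightarrow> real) \<Rightarrow> 'b \<Rightarrow> real" where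
  "multiple_wiener_integral N B q h = (SOME Y. is_multiple_wiener_integral N B q h Y)"

definition tempered_kernel :: "real \<Rightarrow> nat \<Rightarrow> real \<Rightarrow> (nat \<Rightarrow> real) \<Rightarrow> real" where
  "tempered_kernel \<gamma> q t x =
     (LINT s:{0..t}|lborel. (\<Prod>r<q. exp (- \<gamma> * (s - x r)) * indicator {..s} (x r)))"

definition tempered_const :: "real \<Rightarrow> nat \<Rightarrow> real" where
  "tempered_const \<gamma> q =
     sqrt (2 ^ (q - 1) * (real q)\<^sup>2 * \<gamma> ^ (q + 2) / (fact q * (exp (- \<gamma> * real q) - 1 + \<gamma> * real q)))"

definition tempered_hermite ::
  "'b measure \<Rightarrow> (real \<Rightarrow> 'b \<Rightarrow> real) \<Rightarrow> real \<Rightarrow> nat \<Rightarrow> real \<Rightarrow> 'b \<Rightarrow> real" where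
  "tempered_hermite N B \<gamma> q t \<omega> =
     tempered_const \<gamma> q * multiple_wiener_integral N B q (tempered_kernel \<gamma> q t) \<omega>"


section \<open>The autoregressive model and its additive functionals\<close>

definition ar_coeff :: "real \<Rightarrow> nat \<Rightarrow> real" where
  "ar_coeff \<gamma> n = 1 - \<gamma> / real n"

text \<open>
  \<open>X n j\<close> is the \<open>j\<close>-th observation of the \<open>n\<close>-th process, \<open>n \<ge> 1\<close>. The family whose independence
  is required is \<open>X n 0, \<epsilon> 1, \<epsilon> 2, \<dots>\<close>, that is, the noise is independent and also independent of
  the initial value.
\<close>

definition ar_model ::
  "'a measure \<Rightarrow> real \<Rightarrow> (nat \<Rightarrow> real) \<Rightarrow> (nat \<Rightarrow> 'a \<Rightarrow> real) \<Rightarrow> (nat \<Rightarrow> nat \<Rightarrow> 'a \<Rightarrow> real) \<Rightarrow> bool" where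
  "ar_model M \<gamma> \<sigma> \<epsilon> X \<longleftrightarrow> prob_space M \<and>
     (\<forall>j\<ge>1. distributed M lborel (\<epsilon> j) std_normal_density) \<and>
     (\<forall>n\<ge>1. \<sigma> n > 0 \<and>
        distributed M lborel (X n 0) (normal_density 0 (sqrt ((\<sigma> n)\<^sup>2 / (1 - (ar_coeff \<gamma> n)\<^sup>2)))) \<and>
        prob_space.indep_vars M (\<lambda>_. borel) (\<lambda>j. if j = 0 then X n 0 else \<epsilon> j) UNIV \<and>
        (\<forall>j\<ge>1. \<forall>\<omega>\<in>space M. X n j \<omega> = ar_coeff \<gamma> n * X n (j - 1) \<omega> + \<sigma> n * \<epsilon> j \<omega>))"

definition add_functional ::
  "(nat \<Rightarrow> nat \<Rightarrow> 'a \<Rightarrow> real) \<Rightarrow> (real \<Rightarrow> real) \<Rightarrow> nat \<Rightarrow> real \<Rightarrow> 'a \<Rightarrow> real" where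
  "add_functional X f n t \<omega> = (\<Sum>k=1..nat \<lfloor>real n * t\<rfloor>. f (X n k \<omega>))"

definition std_functional ::
  "'a measure \<Rightarrow> (nat \<Rightarrow> nat \<Rightarrow> 'a \<Rightarrow> real) \<Rightarrow> (real \<Rightarrow> real) \<Rightarrow> nat \<Rightarrow> real \<Rightarrow> 'a \<Rightarrow> real" where
  "std_functional M X f n t \<omega> =
     (add_functional X f n t \<omega> - (\<integral>\<omega>'. add_functional X f n t \<omega>' \<partial>M)) /
     sqrt (\<integral>\<omega>'. (add_functional X f n 1 \<omega>' - (\<integral>\<omega>''. add_functional X f n 1 \<omega>'' \<partial>M))\<^sup>2 \<partial>M)"

end

(*
  After rescaling, X_{k,n} is tau_n times a chain with unit variance, tau_n^2 = sigma_n^2 / (1 - alpha_n^2).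
  The law of such a chain can be realised on the space of the Brownian motion B itself: its noise is
  taken from the increments of B over cells of length 1/n, and then X_{k,n} / tau_n is close in mean square,
  uniformly in k, to the stationary Ornstein-Uhlenbeck process U driven by B at time k/n.  Since
  E H_q(Y) H_q(Z) = q! (E Y Z)^q for standard jointly Gaussian Y, Z, this passes to square integrable
  functions F of the chain, and the normalised partial sums converge, uniformly in t and in mean, to the
  integral of F(U_s) over [0,t].  The function F is f - E f if tau_n = 1; for polynomial f it is the
  centred monomial of f of the highest (tau_n to infinity) or lowest (tau_n to 0) positive degree, which
  is m_* in the last case.  Finally the integral of H_q(U_s) over [0,t] is a multiple of the tempered
  Hermite process of order q: the mean square distance between a q-fold off-diagonal step integral and
  that time integral is bounded by q! times the squared L^2 distance of the kernels.
*)

theory Submission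
  imports Defs "HOL-Real_Asymp.Real_Asymp"
begin

section \<open>Gaussian random variables and Hermite polynomials\<close>

text \<open>Up to the scale of \<open>f\<close>, the standard deviation of the sums is of order n
  and not of its square root: \<alpha>_n^n tends to exp(-\<gamma>), so correlations persist over the
  whole time window and the partial sums behave like Riemann sums. The integral over [0,1] of the
  absolute error therefore controls all times t at once. For each n only the law of one row of the
  array matters, so every row may be rebuilt separately from the same \<open>B\<close>, and
  convergence in distribution follows from almost sure convergence along subsequences. The constants
  of the theorem are chosen before the probability spaces; hence the limiting standard deviation is
  computed from \<gamma> and the Hermite coefficients alone. It is positive because the covariances
  exp(-\<gamma>|s-u|)^q are bounded below on the unit square. Fubini in time and outcome is applied
  throughout and asks for a jointly measurable version of U, which is why U is a pointwise limit of
  explicit sums of increments.\<close>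

lemma std_normal_space [simp]: "space std_normal = UNIV"
  and std_normal_sets [simp, measurable_cong]: "sets std_normal = sets borel"
  by (simp_all add: std_normal_def)

interpretation std_normal: prob_space std_normal
  unfolding std_normal_def using prob_space_normal_density[of 1 0] by simp

text \<open>Described through the law of \<open>sqrt v * x\<close> instead of a density, so that
  \<open>v = 0\<close> is included: it occurs for increments over an empty interval and for trivial
  linear combinations.\<close>

definition gaussian_rv :: "'a measure \<Rightarrow> real \<Rightarrow> ('a \<Rightarrow> real) \<Rightarrow> bool" where
  "gaussian_rv M v X \<longleftrightarrow>
     X \<in> borel_measurable M \<and> 0 \<le> v \<and> distr M borel X = distr std_normal borel (\<lambda>x. sqrt v * x)"

lemma gaussian_rv_measurable: "gaussian_rv M v X \<Longrightarrow> X \<in> borel_measurable M"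
  and gaussian_rv_nonneg: "gaussian_rv M v X \<Longrightarrow> 0 \<le> v"
  by (auto simp: gaussian_rv_def)

lemma gaussian_rv_integral:
  fixes f :: "real \<Rightarrow> 'b::{banach, second_countable_topology}"
  assumes "gaussian_rv M v X" "f \<in> borel_measurable borel"
  shows "(\<integral>\<omega>. f (X \<omega>) \<partial>M) = (\<integral>x. f (sqrt v * x) \<partial>std_normal)"
    and "integrable M (\<lambda>\<omega>. f (X \<omega>)) \<longleftrightarrow> integrable std_normal (\<lambda>x. f (sqrt v * x))"
proof -
  have [measurable]: "X \<in> borel_measurable M" and d: "distr M borel X = distr std_normal borel (\<lambda>x. sqrt v * x)"
    using assms by (auto simp: gaussian_rv_def)
  note [measurable] = assms(2)
  have "(\<integral>\<omega>. f (X \<omega>) \<partial>M) = (\<integral>x. f x \<partial>distr M borel X)" by (simp add: integral_distr)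
  also have "\<dots> = (\<integral>x. f (sqrt v * x) \<partial>std_normal)" unfolding d by (subst integral_distr) auto
  finally show "(\<integral>\<omega>. f (X \<omega>) \<partial>M) = (\<integral>x. f (sqrt v * x) \<partial>std_normal)" .
  have "integrable M (\<lambda>\<omega>. f (X \<omega>)) \<longleftrightarrow> integrable (distr M borel X) f"
    by (simp add: integrable_distr_eq)
  also have "\<dots> \<longleftrightarrow> integrable std_normal (\<lambda>x. f (sqrt v * x))" unfolding d
    by (subst integrable_distr_eq) auto
  finally show "integrable M (\<lambda>\<omega>. f (X \<omega>)) \<longleftrightarrow> integrable std_normal (\<lambda>x. f (sqrt v * x))" .
qed

section \<open>Characteristic functions of centred Gaussian laws\<close>

lemma char_std_normal_scaled:
  "char (distr std_normal borel (\<lambda>x. s * x)) t = complex_of_real (exp (- (s\<^sup>2 * t\<^sup>2) / 2))"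
proof -
  have "char (distr std_normal borel (\<lambda>x. s * x)) t = char std_normal (s * t)"
    by (simp add: char_def integral_distr mult_ac)
  also have "\<dots> = complex_of_real (exp (- (s\<^sup>2 * t\<^sup>2) / 2))"
    unfolding std_normal_def char_std_normal_distribution by (simp add: power_mult_distrib)
  finally show ?thesis .
qed

lemma gaussian_rv_iff_char:
  assumes "prob_space M" and [measurable]: "X \<in> borel_measurable M" and v: "0 \<le> v"
  shows "gaussian_rv M v X \<longleftrightarrow> (\<forall>t. char (distr M borel X) t = complex_of_real (exp (- (v * t\<^sup>2) / 2)))"
proof
  assume "gaussian_rv M v X"
  then show "\<forall>t. char (distr M borel X) t = complex_of_real (exp (- (v * t\<^sup>2) / 2))"
    using v by (simp add: gaussian_rv_def char_std_normal_scaled)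
next
  interpret prob_space M by fact
  assume c: "\<forall>t. char (distr M borel X) t = complex_of_real (exp (- (v * t\<^sup>2) / 2))"
  have "distr M borel X = distr std_normal borel (\<lambda>x. sqrt v * x)"
    by (rule Levy_uniqueness)
       (auto simp: c char_std_normal_scaled v fun_eq_iff real_distribution_def real_distribution_axioms_def
          intro!: prob_space_distr std_normal.prob_space_distr)
  then show "gaussian_rv M v X" using v by (simp add: gaussian_rv_def)
qed

text \<open>Characteristic functions pass to an almost sure limit by dominated convergence, the
  Gaussian ones converge with their variances, and Levy uniqueness identifies the law. This carries
  Gaussianity from finite sums of increments to Wiener integrals.\<close>

lemma gaussian_rv_limit:
  assumes "prob_space M" and X: "\<And>n::nat. gaussian_rv M (v n) (X n)"
    and v: "v \<longlonglongrightarrow> w" and [measurable]: "Y \<in> borel_measurable M"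
    and lim: "AE \<omega> in M. (\<lambda>n. X n \<omega>) \<longlonglongrightarrow> Y \<omega>"
  shows "gaussian_rv M w Y"
proof -
  interpret prob_space M by fact
  have [measurable]: "X n \<in> borel_measurable M" and vn: "0 \<le> v n" for n
    using X[of n] by (auto simp: gaussian_rv_def)
  have w: "0 \<le> w" using v vn by (intro LIMSEQ_le_const) auto
  have "char (distr M borel Y) t = complex_of_real (exp (- (w * t\<^sup>2) / 2))" for t
  proof (rule LIMSEQ_unique)
    have "(\<lambda>n. CLINT \<omega>|M. iexp (t * X n \<omega>)) \<longlonglongrightarrow> (CLINT \<omega>|M. iexp (t * Y \<omega>))"
    proof (rule integral_dominated_convergence[where w="\<lambda>_. 1"])
      show "AE \<omega> in M. (\<lambda>n. iexp (t * X n \<omega>)) \<longlonglongrightarrow> iexp (t * Y \<omega>)"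
        using lim by eventually_elim (intro tendsto_intros)
    qed auto
    then show "(\<lambda>n. char (distr M borel (X n)) t) \<longlonglongrightarrow> char (distr M borel Y) t"
      by (simp add: char_def integral_distr)
    have "char (distr M borel (X n)) t = complex_of_real (exp (- (v n * t\<^sup>2) / 2))" for n
      using X[of n] vn gaussian_rv_iff_char[OF assms(1)] by simp
    moreover have "(\<lambda>n. complex_of_real (exp (- (v n * t\<^sup>2) / 2))) \<longlonglongrightarrow> complex_of_real (exp (- (w * t\<^sup>2) / 2))"
      by (intro tendsto_intros v) simp
    ultimately show "(\<lambda>n. char (distr M borel (X n)) t) \<longlonglongrightarrow> complex_of_real (exp (- (w * t\<^sup>2) / 2))"
      by simp
  qed
  then show ?thesis using w by (simp add: gaussian_rv_iff_char[OF assms(1)])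
qed

lemma gaussian_rv_scale:
  assumes "gaussian_rv M v X"
  shows "gaussian_rv M (a\<^sup>2 * v) (\<lambda>\<omega>. a * X \<omega>)"
proof -
  have [measurable]: "X \<in> borel_measurable M" and d: "distr M borel X = distr std_normal borel (\<lambda>x. sqrt v * x)"
    and v: "0 \<le> v"
    using assms by (auto simp: gaussian_rv_def)
  have "distr M borel (\<lambda>\<omega>. a * X \<omega>) = distr (distr M borel X) borel (\<lambda>x. a * x)"
    by (subst distr_distr) (auto simp: comp_def)
  also have "\<dots> = distr std_normal borel (\<lambda>x. (a * sqrt v) * x)"
    unfolding d by (subst distr_distr) (auto simp: comp_def mult.assoc[symmetric] intro!: distr_cong)
  \<comment> \<open>For negative \<open>a\<close> the two scale factors differ in sign. The laws
    agree by symmetry, which is visible because the characteristic function depends on the square of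
    the factor only.\<close>
  also have "\<dots> = distr std_normal borel (\<lambda>x. sqrt (a\<^sup>2 * v) * x)"
  proof (rule Levy_uniqueness)
    show "char (distr std_normal borel (\<lambda>x. a * sqrt v * x)) = char (distr std_normal borel (\<lambda>x. sqrt (a\<^sup>2 * v) * x))"
      unfolding fun_eq_iff char_std_normal_scaled using v by (simp add: power_mult_distrib real_sqrt_mult)
  qed (auto simp: real_distribution_def real_distribution_axioms_def intro!: std_normal.prob_space_distr)
  finally show ?thesis using v by (simp add: gaussian_rv_def)
qed

lemma gaussian_rv_of_normal:
  assumes "prob_space M" "distributed M lborel X (normal_density 0 s)" "s > 0"
  shows "gaussian_rv M (s\<^sup>2) X"
proof -
  interpret prob_space M by fact
  have "distributed M lborel (\<lambda>x. X x / s) std_normal_density"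
    using normal_standard_normal_convert[of s X 0] assms by simp
  then have g: "gaussian_rv M 1 (\<lambda>x. X x / s)"
    unfolding gaussian_rv_def distributed_def std_normal_def
    by (auto simp: distr_id2 cong: distr_cong)
  show ?thesis using gaussian_rv_scale[OF g, of s] assms(3) by simp
qed

section \<open>Moments of a single Gaussian variable\<close>

lemma std_normal_integrable_power: "integrable std_normal (\<lambda>x. x ^ k)"
  using integrable_std_normal_distribution_moment by (simp add: std_normal_def)

text \<open>Gaussian integration by parts for monomials, read off from the closed form of the even
  moments; for odd \<open>k\<close> both sides vanish. Wick's formula is derived from it
  below.\<close>

lemma std_normal_moment_rec:
  "(\<integral>x. x ^ (k + 2) \<partial>std_normal) = real (k + 1) * (\<integral>x. x ^ k \<partial>std_normal)"
proof (cases "even k")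
  case True
  then obtain j where k: "k = 2 * j" by (elim evenE)
  have "k + 2 = 2 * Suc j" using k by simp
  then have "(\<integral>x. x ^ (k + 2) \<partial>std_normal) = fact (2 * Suc j) / (2 ^ Suc j * fact (Suc j))"
    using std_normal_distribution_even_moments(1)[of "Suc j"] by (simp only: std_normal_def)
  also have "\<dots> = real (k + 1) * (fact (2 * j) / (2 ^ j * fact j))"
  proof -
    have "fact (2 * Suc j) = real (2 * Suc j) * (real (k + 1) * fact (2 * j))"
      by (simp add: k algebra_simps)
    moreover have "2 ^ Suc j * fact (Suc j) = real (2 * Suc j) * (2 ^ j * fact j)" by simp
    ultimately show ?thesis by (simp only: mult_divide_mult_cancel_left_if times_divide_eq_right) simp
  qed
  also have "\<dots> = real (k + 1) * (\<integral>x. x ^ k \<partial>std_normal)"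
    using std_normal_distribution_even_moments(1)[of j] k by (simp only: std_normal_def)
  finally show ?thesis .
next
  case False
  then show ?thesis
    using integral_std_normal_distribution_moment_odd[of k] integral_std_normal_distribution_moment_odd[of "k+2"]
    by (simp add: std_normal_def)
qed

lemma gaussian_rv_integrable_power:
  "gaussian_rv M v X \<Longrightarrow> integrable M (\<lambda>\<omega>. X \<omega> ^ k)"
  by (subst gaussian_rv_integral(2)) (auto simp: power_mult_distrib intro!: std_normal_integrable_power)

lemma gaussian_rv_moment:
  "gaussian_rv M v X \<Longrightarrow> (\<integral>\<omega>. X \<omega> ^ k \<partial>M) = sqrt v ^ k * (\<integral>x. x ^ k \<partial>std_normal)"
  by (subst gaussian_rv_integral(1)) (auto simp: power_mult_distrib)

lemma gaussian_rv_moment_rec: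
  assumes "gaussian_rv M v X"
  shows "(\<integral>\<omega>. X \<omega> ^ (k + 2) \<partial>M) = real (k + 1) * v * (\<integral>\<omega>. X \<omega> ^ k \<partial>M)"
  unfolding gaussian_rv_moment[OF assms] std_normal_moment_rec
  using gaussian_rv_nonneg[OF assms] by (simp add: power_add)

lemma gaussian_rv_mean: "gaussian_rv M v X \<Longrightarrow> (\<integral>\<omega>. X \<omega> \<partial>M) = 0"
  using gaussian_rv_moment[of M v X 1] integral_std_normal_distribution_moment_odd[of 1]
  by (simp add: std_normal_def)

lemma gaussian_rv_variance:
  assumes "prob_space M" "gaussian_rv M v X" 
  shows "(\<integral>\<omega>. (X \<omega>)\<^sup>2 \<partial>M) = v"
proof -
  interpret prob_space M by fact
  show ?thesis using gaussian_rv_moment_rec[of M v X 0] assms(2)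
    by (simp add: prob_space power2_eq_square)
qed

section \<open>Mixed moments of Gaussian pairs\<close>

text \<open>A centred Gaussian pair with variances \<open>u\<close>, \<open>v\<close> and covariance
  \<open>c\<close>, in Cramer-Wold form. Linear combinations are what sums of Brownian increments
  provide directly, and degenerate pairs are covered.\<close>

definition joint_gaussian ::
  "'a measure \<Rightarrow> ('a \<Rightarrow> real) \<Rightarrow> ('a \<Rightarrow> real) \<Rightarrow> real \<Rightarrow> real \<Rightarrow> real \<Rightarrow> bool" where
  "joint_gaussian M U V u c v \<longleftrightarrow>
     (\<forall>x y. gaussian_rv M (x\<^sup>2 * u + 2 * x * y * c + y\<^sup>2 * v) (\<lambda>\<omega>. x * U \<omega> + y * V \<omega>))"

lemma joint_gaussianD:
  assumes "joint_gaussian M U V u c v"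
  shows "gaussian_rv M u U" "gaussian_rv M v V"
    "gaussian_rv M (u + 2 * b * c + b\<^sup>2 * v) (\<lambda>\<omega>. U \<omega> + b * V \<omega>)"
  using assms[unfolded joint_gaussian_def, rule_format, of 1 0]
    assms[unfolded joint_gaussian_def, rule_format, of 0 1]
    assms[unfolded joint_gaussian_def, rule_format, of 1 b] by auto

lemma joint_gaussian_integrable:
  assumes "joint_gaussian M U V u c v"
  shows "integrable M (\<lambda>\<omega>. U \<omega> ^ i * V \<omega> ^ j)"
proof (rule Bochner_Integration.integrable_bound)
  show "integrable M (\<lambda>\<omega>. U \<omega> ^ (2 * i) + V \<omega> ^ (2 * j))"
    using joint_gaussianD(1,2)[OF assms]
    by (intro Bochner_Integration.integrable_add gaussian_rv_integrable_power)
  have [measurable]: "U \<in> borel_measurable M" "V \<in> borel_measurable M"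
    using joint_gaussianD(1,2)[OF assms] by (auto simp: gaussian_rv_def)
  show "(\<lambda>\<omega>. U \<omega> ^ i * V \<omega> ^ j) \<in> borel_measurable M" by simp
  have "\<bar>a * b\<bar> \<le> a\<^sup>2 + b\<^sup>2" for a b :: real
    using sum_squares_bound[of "\<bar>a\<bar>" "\<bar>b\<bar>"] mult_nonneg_nonneg[of "\<bar>a\<bar>" "\<bar>b\<bar>"]
    unfolding abs_mult power2_abs by linarith
  from this[of "U \<omega> ^ i" "V \<omega> ^ j" for \<omega>]
  show "AE \<omega> in M. norm (U \<omega> ^ i * V \<omega> ^ j) \<le> norm (U \<omega> ^ (2 * i) + V \<omega> ^ (2 * j))"
    unfolding power_even_eq by simp
qed

text \<open>
  Wick's formula for two variables. Both sides of the moment recursion for \<open>U + b V\<close> are polynomials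
  in \<open>b\<close>; the formula is the comparison of the coefficients of their derivatives.
\<close>

lemma joint_gaussian_wick:
  assumes P: "prob_space M" and G: "joint_gaussian M U V u c v"
  defines "mo \<equiv> \<lambda>i j. \<integral>\<omega>. U \<omega> ^ i * V \<omega> ^ j \<partial>M"
  shows "mo i (Suc j) = real i * c * mo (i - 1) j + real j * v * mo i (j - 1)"
proof -
  interpret prob_space M by fact
  define p where "p n = (\<Sum>j\<le>n. monom (real (n choose j) * mo (n - j) j) j)" for n
  have coeff_p: "coeff (p n) j = real (n choose j) * mo (n - j) j" for n j
    by (simp add: p_def coeff_sum binomial_eq_0)
  have poly_p: "poly (p n) b = (\<integral>\<omega>. (U \<omega> + b * V \<omega>) ^ n \<partial>M)" for n b
  proof -
    have "(\<integral>\<omega>. (U \<omega> + b * V \<omega>) ^ n \<partial>M) = (\<integral>\<omega>. (\<Sum>j\<le>n. real (n choose j) * b ^ j * (U \<omega> ^ (n - j) * V \<omega> ^ j)) \<partial>M)"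
      by (subst add.commute) (simp add: binomial_ring power_mult_distrib mult_ac)
    also have "\<dots> = (\<Sum>j\<le>n. real (n choose j) * b ^ j * mo (n - j) j)"
      unfolding mo_def using joint_gaussian_integrable[OF G]
      by (subst Bochner_Integration.integral_sum) auto
    finally show ?thesis by (simp add: p_def poly_sum poly_monom mult_ac)
  qed
  let ?Q = "[:u, 2 * c, v:]"
  have rec: "p (n + 2) = smult (real (n + 1)) (?Q * p n)" for n
  proof -
    have "poly (p (n + 2)) b = poly (smult (real (n + 1)) (?Q * p n)) b" for b
      using gaussian_rv_moment_rec[OF joint_gaussianD(3)[OF G, of b], of n]
      by (simp add: poly_p power2_eq_square algebra_simps)
    then show ?thesis by (metis poly_eq_poly_eq_iff ext)
  qed
  have p0: "p 0 = 1"
    by (simp add: p_def mo_def prob_space)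
  have p1: "p 1 = 0"
  proof -
    have "poly (p 1) b = poly 0 b" for b
      using gaussian_rv_mean[OF joint_gaussianD(3)[OF G, of b]] by (simp add: poly_p)
    then show ?thesis by (metis poly_eq_poly_eq_iff ext)
  qed
  have dQ: "pderiv ?Q = smult 2 [:c, v:]" by (simp add: pderiv_pCons)
  \<comment> \<open>For even \<open>n\<close>, \<open>p n\<close> is a constant times
    \<open>?Q ^ (n div 2)\<close>, and for odd \<open>n\<close> it is 0. Hence
    \<open>?Q * pderiv (p n)\<close> equals \<open>n / 2\<close> times
    \<open>pderiv ?Q * p n\<close>; the induction proves this in steps of two, without half-integer
    powers.\<close>
  have der: "pderiv (p (n + 2)) = smult (real (n + 2) * real (n + 1)) ([:c, v:] * p n)" for n
  proof (induction n rule: nat_less_induct)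
    case (1 n)
    have *: "?Q * pderiv (p n) = smult (real n) ([:c, v:] * p n)"
    proof (cases "n < 2")
      case True
      then have "n = 0 \<or> n = 1" by auto
      then show ?thesis using p0 p1 by auto
    next
      case False
      then obtain k where k: "n = k + 2" by (metis add.commute le_Suc_ex not_less)
      have "pderiv (p n) = smult (real n * real (k + 1)) ([:c, v:] * p k)"
        using 1 k by simp
      then have "?Q * pderiv (p n) = smult (real n) ([:c, v:] * (smult (real (k + 1)) (?Q * p k)))"
        by (simp only: mult_smult_right mult_smult_left smult_smult mult.left_commute)
      also have "smult (real (k + 1)) (?Q * p k) = p n" using rec[of k] k by simp
      finally show ?thesis .
    qed
    have "pderiv (p (n + 2)) = smult (real (n + 1)) (pderiv ?Q * p n + ?Q * pderiv (p n))"
      by (simp only: rec pderiv_smult pderiv_mult add.commute mult.commute)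
    also have "\<dots> = smult (real (n + 1)) (smult 2 ([:c, v:] * p n) + smult (real n) ([:c, v:] * p n))"
      by (simp only: * dQ mult_smult_left)
    also have "\<dots> = smult (real (n + 2) * real (n + 1)) ([:c, v:] * p n)"
      by (simp only: smult_add_left[symmetric] smult_smult) (simp add: mult_ac add_ac)
    finally show ?case .
  qed
  show ?thesis
  proof (cases "i + j")
    case 0
    then show ?thesis using gaussian_rv_mean[OF joint_gaussianD(2)[OF G]] by (simp add: mo_def)
  next
    case (Suc n)
    then have i: "i = Suc n - j" "j \<le> Suc n" by auto
    \<comment> \<open>The absorption identities bring both contributions to the common factor
      \<open>Suc n choose j\<close>, which is nonzero because \<open>j \<le> Suc n\<close> and can
      be cancelled at the end.\<close>
    have b1: "real (n + 1) * real (n choose j) = real i * real (Suc n choose j)"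
    proof -
      have "(Suc n) * (n choose j) = (Suc n - j) * (Suc n choose j)"
        using i(2) binomial_absorb_comp[of "Suc n" j] by simp
      then show ?thesis unfolding i(1) by (metis Suc_eq_plus1 of_nat_mult)
    qed
    have b2: "j \<noteq> 0 \<Longrightarrow> real (n + 1) * real (n choose (j - 1)) = real j * real (Suc n choose j)"
    proof (cases j)
      case (Suc k)
      have "Suc k * (Suc n choose Suc k) = Suc n * (n choose k)" by (rule Suc_times_binomial)
      then have "real (Suc k) * real (Suc n choose Suc k) = real (n + 1) * real (n choose k)"
        by (metis Suc_eq_plus1 of_nat_mult)
      then show ?thesis using Suc by simp
    qed simp
    have c1: "coeff (p n) j = real (n choose j) * mo (i - 1) j"
      using i by (cases "j = Suc n") (auto simp: coeff_p Suc_diff_le)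
    have c2: "j \<noteq> 0 \<Longrightarrow> coeff (p n) (j - 1) = real (n choose (j - 1)) * mo i (j - 1)"
      using i by (simp add: coeff_p)
    have "real (Suc j) * (real (n + 2 choose Suc j) * mo i (Suc j)) = coeff (pderiv (p (n + 2))) j"
      using i by (simp add: coeff_pderiv coeff_p)
    also have "\<dots> = real (n + 2) * (c * (real (n + 1) * coeff (p n) j)
        + v * (if j = 0 then 0 else real (n + 1) * coeff (p n) (j - 1)))"
      unfolding der by (cases j) (simp_all add: algebra_simps)
    also have "\<dots> = real (n + 2) * (c * (real i * real (Suc n choose j) * mo (i - 1) j)
        + v * (real j * real (Suc n choose j) * mo i (j - 1)))"
      using c1 c2 b1 b2 by (cases "j = 0") (simp_all only: mult.assoc[symmetric] if_True if_False, simp_all)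
    finally have A: "real (Suc j) * (real (n + 2 choose Suc j) * mo i (Suc j)) =
       real (n + 2) * real (Suc n choose j) * (real i * c * mo (i - 1) j + real j * v * mo i (j - 1))"
      by (simp only: algebra_simps)
    have "Suc j * (Suc (Suc n) choose Suc j) = Suc (Suc n) * (Suc n choose j)" by (rule Suc_times_binomial)
    then have B: "real (Suc j) * real (n + 2 choose Suc j) = real (n + 2) * real (Suc n choose j)"
      by (metis add_2_eq_Suc' of_nat_mult)
    have "real (n + 2) * real (Suc n choose j) \<noteq> 0" using i(2) by simp
    then show ?thesis using A B by (metis mult.assoc mult_cancel_left)
  qed
qed

section \<open>Hermite polynomials evaluated at Gaussian pairs\<close>

fun hermite_poly :: "nat \<Rightarrow> real poly" where
  "hermite_poly 0 = 1"
| "hermite_poly (Suc 0) = [:0, 1:]"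
| "hermite_poly (Suc (Suc q)) = [:0, 1:] * hermite_poly (Suc q) - smult (real (Suc q)) (hermite_poly q)"

lemma poly_hermite_poly [simp]: "poly (hermite_poly q) x = hermite q x"
  by (induction q rule: hermite_poly.induct) (simp_all del: of_nat_Suc)

lemma hermite_measurable [measurable]: "hermite q \<in> borel_measurable borel"
proof -
  have "(\<lambda>x. poly (hermite_poly q) x) \<in> borel_measurable borel"
    by (intro borel_measurable_continuous_onI continuous_intros)
  then show ?thesis by simp
qed

text \<open>The Appell property. Differentiating the three-term recursion gives the polynomial of
  order \<open>k + 1\<close> plus \<open>k + 1\<close> times an expression that the recursion one
  level lower recognises as that same polynomial. Derivatives at two lower levels enter, hence
  strong induction.\<close>

lemma pderiv_hermite_poly: "pderiv (hermite_poly (Suc q)) = smult (real (Suc q)) (hermite_poly q)"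
proof (induction q rule: less_induct)
  case (less q)
  show ?case
  proof (cases q)
    case 0
    then show ?thesis by (simp add: pderiv_pCons one_pCons)
  next
    case (Suc k)
    note q = Suc
    have IH: "pderiv (hermite_poly (Suc k)) = smult (real (Suc k)) (hermite_poly k)"
      using less q by simp
    have IH2: "pderiv (hermite_poly k) = smult (real k) (hermite_poly (k - 1))"
      using less q by (cases k) (simp_all del: hermite_poly.simps(3) add: pderiv_1)
    have H: "hermite_poly (Suc k) = [:0, 1:] * hermite_poly k - smult (real k) (hermite_poly (k - 1))"
      by (cases k) simp_all
    have "poly (pderiv (hermite_poly (Suc (Suc k)))) x = poly (smult (real (Suc (Suc k))) (hermite_poly (Suc k))) x" for x
    proof -
      have "poly (pderiv (hermite_poly (Suc (Suc k)))) x = poly (hermite_poly (Suc k)) x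
         + real (Suc k) * poly ([:0, 1:] * hermite_poly k - smult (real k) (hermite_poly (k - 1))) x"
        unfolding hermite_poly.simps(3) pderiv_diff pderiv_mult pderiv_smult IH IH2
        by (simp add: pderiv_pCons algebra_simps del: of_nat_Suc poly_hermite_poly)
      then show ?thesis unfolding H[symmetric] by (simp add: algebra_simps del: hermite_poly.simps)
    qed
    then have "pderiv (hermite_poly (Suc (Suc k))) = smult (real (Suc (Suc k))) (hermite_poly (Suc k))"
      by (metis poly_eq_poly_eq_iff ext)
    then show ?thesis by (simp only: q)
  qed
qed

lemma joint_gaussian_integrable_poly:
  assumes "joint_gaussian M U V u c v"
  shows "integrable M (\<lambda>\<omega>. U \<omega> ^ i * poly f (V \<omega>))"
  unfolding poly_altdef sum_distrib_left
  using joint_gaussian_integrable[OF assms, of i]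
  by (auto simp: mult.left_commute[of "_ ^ i"] intro!: Bochner_Integration.integrable_sum)

text \<open>Integration by parts in \<open>V\<close> for a Gaussian pair: Wick's formula for
  monomials, extended by linearity in \<open>f\<close>.\<close>

lemma joint_gaussian_wick_poly:
  assumes P: "prob_space M" and G: "joint_gaussian M U V u c v"
  shows "(\<integral>\<omega>. U \<omega> ^ i * (V \<omega> * poly f (V \<omega>)) \<partial>M) =
     real i * c * (\<integral>\<omega>. U \<omega> ^ (i - 1) * poly f (V \<omega>) \<partial>M) + v * (\<integral>\<omega>. U \<omega> ^ i * poly (pderiv f) (V \<omega>) \<partial>M)"
proof -
  note int = joint_gaussian_integrable[OF G]
  have pd: "poly (pderiv f) x = (\<Sum>j\<le>degree f. coeff f j * (real j * x ^ (j - 1)))" for x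
  proof -
    have pderiv_sum: "pderiv (sum g A) = (\<Sum>j\<in>A. pderiv (g j))" for g :: "nat \<Rightarrow> real poly" and A
      by (induction A rule: infinite_finite_induct) (simp_all add: pderiv_add)
    have "pderiv f = pderiv (\<Sum>j\<le>degree f. monom (coeff f j) j)" by (simp add: poly_as_sum_of_monoms)
    then show ?thesis
      by (simp add: pderiv_sum pderiv_monom poly_sum poly_monom mult_ac del: poly_as_sum_of_monoms)
  qed
  have "(\<integral>\<omega>. U \<omega> ^ i * (V \<omega> * poly f (V \<omega>)) \<partial>M)
      = (\<integral>\<omega>. (\<Sum>j\<le>degree f. coeff f j * (U \<omega> ^ i * V \<omega> ^ Suc j)) \<partial>M)"
    by (simp add: poly_altdef sum_distrib_left mult_ac)
  also have "\<dots> = (\<Sum>j\<le>degree f. coeff f j * (\<integral>\<omega>. U \<omega> ^ i * V \<omega> ^ Suc j \<partial>M))"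
    using int by (subst Bochner_Integration.integral_sum) (auto simp del: power_Suc)
  also have "\<dots> = (\<Sum>j\<le>degree f. real i * c * (coeff f j * (\<integral>\<omega>. U \<omega> ^ (i - 1) * V \<omega> ^ j \<partial>M))
       + v * (coeff f j * real j * (\<integral>\<omega>. U \<omega> ^ i * V \<omega> ^ (j - 1) \<partial>M)))"
    unfolding joint_gaussian_wick[OF P G] by (simp add: algebra_simps)
  also have "\<dots> = real i * c * (\<integral>\<omega>. (\<Sum>j\<le>degree f. coeff f j * (U \<omega> ^ (i - 1) * V \<omega> ^ j)) \<partial>M)
       + v * (\<integral>\<omega>. (\<Sum>j\<le>degree f. coeff f j * real j * (U \<omega> ^ i * V \<omega> ^ (j - 1))) \<partial>M)"
    using int by (simp add: Bochner_Integration.integral_sum sum.distrib sum_distrib_left)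
  also have "(\<lambda>\<omega>. (\<Sum>j\<le>degree f. coeff f j * (U \<omega> ^ (i - 1) * V \<omega> ^ j))) = (\<lambda>\<omega>. U \<omega> ^ (i - 1) * poly f (V \<omega>))"
    by (simp add: poly_altdef sum_distrib_left mult_ac)
  also have "(\<lambda>\<omega>. (\<Sum>j\<le>degree f. coeff f j * real j * (U \<omega> ^ i * V \<omega> ^ (j - 1)))) = (\<lambda>\<omega>. U \<omega> ^ i * poly (pderiv f) (V \<omega>))"
    by (simp add: pd sum_distrib_left mult_ac)
  finally show ?thesis .
qed

text \<open>With variance 1 for \<open>V\<close>, the derivative term of the integration by parts
  cancels the second term of the Hermite recursion. Each step then lowers the power of
  \<open>U\<close> and the order by one at the price of a factor \<open>p * c\<close>, and this
  factor becomes 0 if the power is exhausted first. The variance \<open>u\<close> stays arbitrary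
  because \<open>U\<close> will be a sum of Brownian increments.\<close>

lemma joint_gaussian_power_hermite:
  assumes P: "prob_space M" and G: "joint_gaussian M U V u c 1"
  shows "p < q \<Longrightarrow> (\<integral>\<omega>. U \<omega> ^ p * hermite q (V \<omega>) \<partial>M) = 0"
    and "(\<integral>\<omega>. U \<omega> ^ q * hermite q (V \<omega>) \<partial>M) = fact q * c ^ q"
proof -
  interpret prob_space M by fact
  have int: "integrable M (\<lambda>\<omega>. U \<omega> ^ i * hermite q (V \<omega>))" for i q
    using joint_gaussian_integrable_poly[OF G, of i "hermite_poly q"] by simp
  have step: "(\<integral>\<omega>. U \<omega> ^ p * hermite (Suc q) (V \<omega>) \<partial>M) = real p * c * (\<integral>\<omega>. U \<omega> ^ (p - 1) * hermite q (V \<omega>) \<partial>M)" for p q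
  proof -
    have int2: "integrable M (\<lambda>\<omega>. U \<omega> ^ p * (V \<omega> * hermite q (V \<omega>)))"
      using joint_gaussian_integrable_poly[OF G, of p "[:0, 1:] * hermite_poly q"] by simp
    have h: "hermite (Suc q) x = x * hermite q x - real q * hermite (q - 1) x" for x
      by (cases q) simp_all
    have d: "poly (pderiv (hermite_poly q)) x = real q * hermite (q - 1) x" for x
      by (cases q) (simp_all add: pderiv_hermite_poly del: hermite_poly.simps(2,3))
    have "(\<integral>\<omega>. U \<omega> ^ p * hermite (Suc q) (V \<omega>) \<partial>M) =
       (\<integral>\<omega>. U \<omega> ^ p * (V \<omega> * hermite q (V \<omega>)) - real q * (U \<omega> ^ p * hermite (q - 1) (V \<omega>)) \<partial>M)"
      unfolding h by (simp add: algebra_simps)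
    also have "\<dots> = (\<integral>\<omega>. U \<omega> ^ p * (V \<omega> * hermite q (V \<omega>)) \<partial>M) - real q * (\<integral>\<omega>. U \<omega> ^ p * hermite (q - 1) (V \<omega>) \<partial>M)"
      using int int2 by simp
    also have "\<dots> = real p * c * (\<integral>\<omega>. U \<omega> ^ (p - 1) * hermite q (V \<omega>) \<partial>M)"
      using joint_gaussian_wick_poly[OF P G, of p "hermite_poly q"]
      by (simp add: d mult.left_commute[of _ "real q"])
    finally show ?thesis .
  qed
  show "p < q \<Longrightarrow> (\<integral>\<omega>. U \<omega> ^ p * hermite q (V \<omega>) \<partial>M) = 0"
  proof (induction q arbitrary: p)
    case (Suc q)
    then show ?case unfolding step by (cases p) simp_all
  qed simp
  show "(\<integral>\<omega>. U \<omega> ^ q * hermite q (V \<omega>) \<partial>M) = fact q * c ^ q"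
  proof (induction q)
    case (Suc q)
    then show ?case unfolding step by (simp add: mult_ac)
  qed (simp add: prob_space)
qed

lemma degree_hermite_poly: "degree (hermite_poly q) = q" and lead_coeff_hermite_poly: "coeff (hermite_poly q) q = 1"
proof -
  have "degree (hermite_poly q) = q \<and> coeff (hermite_poly q) q = 1"
  proof (induction q rule: hermite_poly.induct)
    case (3 q)
    let ?a = "[:0, 1:] * hermite_poly (Suc q)" and ?b = "smult (real (Suc q)) (hermite_poly q)"
    have n: "hermite_poly (Suc q) \<noteq> 0" using 3 by auto
    have a: "degree ?a = Suc (Suc q)" using 3 n by (simp add: degree_mult_eq)
    have b: "degree ?b < degree ?a" unfolding a using 3 by simp
    have "degree (?a - ?b) = Suc (Suc q)"
      using degree_add_eq_left[of "- ?b" ?a] a b by simp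
    moreover have "coeff (?a - ?b) (Suc (Suc q)) = 1"
      using 3 coeff_eq_0[of ?b "Suc (Suc q)"] b a by simp
    ultimately show ?case by simp
  qed (simp_all add: one_pCons)
  then show "degree (hermite_poly q) = q" "coeff (hermite_poly q) q = 1" by auto
qed

lemma hermite_eq_sum: "hermite q x = (\<Sum>i\<le>q. coeff (hermite_poly q) i * x ^ i)"
  using poly_altdef[of "hermite_poly q" x] by (simp add: degree_hermite_poly)

lemma joint_gaussian_integrable_hermite:
  assumes G: "joint_gaussian M U V u c v"
  shows "integrable M (\<lambda>\<omega>. hermite p (U \<omega>) * hermite q (V \<omega>))"
proof -
  have "integrable M (\<lambda>\<omega>. \<Sum>i\<le>p. coeff (hermite_poly p) i * (U \<omega> ^ i * poly (hermite_poly q) (V \<omega>)))"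
    using joint_gaussian_integrable_poly[OF G] by (intro Bochner_Integration.integrable_sum integrable_mult_right)
  also have "(\<lambda>\<omega>. \<Sum>i\<le>p. coeff (hermite_poly p) i * (U \<omega> ^ i * poly (hermite_poly q) (V \<omega>))) =
    (\<lambda>\<omega>. hermite p (U \<omega>) * hermite q (V \<omega>))"
    by (simp only: hermite_eq_sum[of p] sum_distrib_right sum_distrib_left mult_ac poly_hermite_poly)
  finally show ?thesis .
qed

text \<open>Expanding the polynomial of smaller order in powers, all terms are killed by the other
  polynomial except the leading one, whose coefficient is 1, and that one survives only for equal
  orders. The case \<open>q < p\<close> follows by exchanging the variables.\<close>

lemma joint_gaussian_hermite:
  assumes P: "prob_space M" and G: "joint_gaussian M U V 1 c 1"
  shows "(\<integral>\<omega>. hermite p (U \<omega>) * hermite q (V \<omega>) \<partial>M) = (if p = q then fact q * c ^ q else 0)"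
proof -
  have le: "(\<integral>\<omega>. hermite p (U \<omega>) * hermite q (V \<omega>) \<partial>M) = (if p = q then fact q * c ^ q else 0)"
    if pq: "p \<le> q" and G: "joint_gaussian M U V 1 c 1" for p q U V
  proof -
    have "(\<integral>\<omega>. hermite p (U \<omega>) * hermite q (V \<omega>) \<partial>M) =
       (\<integral>\<omega>. (\<Sum>i\<le>p. coeff (hermite_poly p) i * (U \<omega> ^ i * hermite q (V \<omega>))) \<partial>M)"
      by (simp only: hermite_eq_sum[of p] sum_distrib_right sum_distrib_left mult_ac poly_hermite_poly)
    also have "\<dots> = (\<Sum>i\<le>p. coeff (hermite_poly p) i * (\<integral>\<omega>. U \<omega> ^ i * hermite q (V \<omega>) \<partial>M))"
      using joint_gaussian_integrable_poly[OF G, of _ "hermite_poly q"]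
      by (subst Bochner_Integration.integral_sum) auto
    also have "\<dots> = (\<Sum>i\<le>p. if i = q then fact q * c ^ q else 0)"
      using pq joint_gaussian_power_hermite[OF P G] lead_coeff_hermite_poly[of q]
      by (intro sum.cong) (auto simp: le_less)
    also have "\<dots> = (if p = q then fact q * c ^ q else 0)" using pq by simp
    finally show ?thesis .
  qed
  show ?thesis
  proof (cases "p \<le> q")
    case True then show ?thesis using le G by blast
  next
    case False
    have "joint_gaussian M V U 1 c 1"
    proof (unfold joint_gaussian_def, intro allI)
      fix x y
      show "gaussian_rv M (x\<^sup>2 * 1 + 2 * x * y * c + y\<^sup>2 * 1) (\<lambda>\<omega>. x * V \<omega> + y * U \<omega>)"
        using G[unfolded joint_gaussian_def, rule_format, of y x] by (simp add: algebra_simps)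
    qed
    from le[OF _ this, of q p] False show ?thesis by (simp add: mult.commute)
  qed
qed

text \<open>Polarization, by taking iterated finite differences of \<open>y ^ n\<close>.\<close>

lemma iterated_difference_power:
  fixes x :: "'i \<Rightarrow> real"
  assumes "finite A" "n \<le> card A"
  shows "(\<Sum>S\<in>Pow A. (- 1) ^ (card A - card S) * (y + sum x S) ^ n) = (if n = card A then fact n * prod x A else 0)"
  using assms
proof (induction A arbitrary: n y rule: finite_induct)
  case empty
  then show ?case by simp
next
  case (insert a A)
  let ?D = "\<lambda>n y. \<Sum>S\<in>Pow A. (- 1) ^ (card A - card S) * (y + sum x S) ^ n"
  have fin: "\<And>S. S \<subseteq> A \<Longrightarrow> finite S" and na: "\<And>S. S \<subseteq> A \<Longrightarrow> a \<notin> S" 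
    and cd: "\<And>S. S \<subseteq> A \<Longrightarrow> card S \<le> card A"
    using insert.hyps finite_subset card_mono by blast+
  have inj: "inj_on (insert a) (Pow A)" using insert.hyps(2) by (auto simp: inj_on_def)
  have disj: "Pow A \<inter> insert a ` Pow A = {}" using insert.hyps(2) by auto
  have "(\<Sum>S\<in>Pow (insert a A). (- 1) ^ (card (insert a A) - card S) * (y + sum x S) ^ n)
      = (\<Sum>S\<in>Pow A. (- 1) ^ (Suc (card A) - card S) * (y + sum x S) ^ n)
        + (\<Sum>S\<in>Pow A. (- 1) ^ (Suc (card A) - card (insert a S)) * (y + sum x (insert a S)) ^ n)"
    unfolding Pow_insert using insert.hyps inj disj by (simp add: sum.union_disjoint sum.reindex)
  also have "\<dots> = (\<Sum>S\<in>Pow A. (- 1) ^ (card A - card S) * ((y + sum x S + x a) ^ n - (y + sum x S) ^ n))"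
    using fin na cd by (simp add: Suc_diff_le sum.distrib[symmetric] sum_subtractf[symmetric] algebra_simps)
  also have "\<dots> = (\<Sum>S\<in>Pow A. \<Sum>k<n. real (n choose k) * x a ^ (n - k) * ((- 1) ^ (card A - card S) * (y + sum x S) ^ k))"
  proof (rule sum.cong[OF refl])
    fix S
    have "(y + sum x S + x a) ^ n = (\<Sum>k\<le>n. real (n choose k) * (y + sum x S) ^ k * x a ^ (n - k))"
      by (rule binomial_ring)
    also have "{..n} = insert n {..<n}" by auto
    finally have "(y + sum x S + x a) ^ n - (y + sum x S) ^ n = (\<Sum>k<n. real (n choose k) * (y + sum x S) ^ k * x a ^ (n - k))"
      by simp
    then show "(- 1) ^ (card A - card S) * ((y + sum x S + x a) ^ n - (y + sum x S) ^ n) =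
       (\<Sum>k<n. real (n choose k) * x a ^ (n - k) * ((- 1) ^ (card A - card S) * (y + sum x S) ^ k))"
      by (simp add: sum_distrib_left mult_ac)
  qed
  also have "\<dots> = (\<Sum>k<n. real (n choose k) * x a ^ (n - k) * ?D k y)"
    by (subst sum.swap) (simp add: sum_distrib_left)
  \<comment> \<open>Differencing in the direction of \<open>a\<close> has lowered the degree:
    \<open>k < n \<le> card A + 1\<close>. The induction hypothesis removes every \<open>k\<close>
    except \<open>card A\<close>, and that value forces \<open>n = Suc k\<close>.\<close>
  also have "\<dots> = (\<Sum>k<n. if k = card A then real n * x a * (fact k * prod x A) else 0)"
  proof (rule sum.cong[OF refl])
    fix k assume k: "k \<in> {..<n}"
    then have "k \<le> card A" using insert by simp
    then have D: "?D k y = (if k = card A then fact k * prod x A else 0)" using insert.IH by simp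
    have "k = card A \<Longrightarrow> n = Suc k" using k insert by simp
    then show "real (n choose k) * x a ^ (n - k) * ?D k y = (if k = card A then real n * x a * (fact k * prod x A) else 0)"
      unfolding D by auto
  qed
  also have "\<dots> = (if n = card (insert a A) then fact n * prod x (insert a A) else 0)"
    using insert.prems insert.hyps by (auto simp: sum.delta)
  finally show ?case .
qed

lemma polarization:
  fixes x :: "'i \<Rightarrow> real"
  assumes "finite A"
  shows "prod x A = (\<Sum>S\<in>Pow A. (- 1) ^ (card A - card S) * sum x S ^ card A) / fact (card A)"
  using iterated_difference_power[OF assms order_refl, of 0 x] by simp

section \<open>Gaussian increments of Brownian motion\<close>

lemma strict_mono_cells_disjoint:
  fixes \<tau> :: "nat \<Rightarrow> real"
  assumes "strict_mono_on {..k} \<tau>"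
  shows "disjoint_family_on (\<lambda>j. {\<tau> j<..\<tau> (Suc j)}) {..<k}"
proof (unfold disjoint_family_on_def, intro ballI impI)
  fix i j assume ij: "i \<in> {..<k}" "j \<in> {..<k}" "i \<noteq> j"
  have m: "mono_on {..k} \<tau>" using assms by (rule strict_mono_on_imp_mono_on)
  have "Suc i \<le> j \<or> Suc j \<le> i" using ij(3) by auto
  then show "{\<tau> i<..\<tau> (Suc i)} \<inter> {\<tau> j<..\<tau> (Suc j)} = {}"
    using ij mono_onD[OF m, of "Suc i" j] mono_onD[OF m, of "Suc j" i] by force
qed

lemma cells_telescope:
  fixes \<tau> :: "nat \<Rightarrow> real"
  assumes \<tau>: "strict_mono_on {..k} \<tau>" and pq: "p \<le> q" "q \<le> k"
  shows "indicat_real {\<tau> p<..\<tau> q} x = (\<Sum>j\<in>{p..<q}. indicator {\<tau> j<..\<tau> (Suc j)} x)"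
  using pq
proof (induction q)
  case 0 then show ?case by simp
next
  case (Suc q)
  have m: "mono_on {..k} \<tau>" using \<tau> by (rule strict_mono_on_imp_mono_on)
  show ?case
  proof (cases "p = Suc q")
    case False
    then have pq: "p \<le> q" using Suc by simp
    have "\<tau> p \<le> \<tau> q" "\<tau> q \<le> \<tau> (Suc q)"
      using Suc.prems pq mono_onD[OF m, of p q] mono_onD[OF m, of q "Suc q"] by auto
    then have "indicat_real {\<tau> p<..\<tau> (Suc q)} x = indicator {\<tau> p<..\<tau> q} x + indicator {\<tau> q<..\<tau> (Suc q)} x"
      by (auto simp: indicator_def)
    then show ?thesis using Suc pq by simp
  qed simp
qed

lemma sum_disjoint_indicator_power2:
  fixes d :: "'i \<Rightarrow> real"
  assumes "disjoint_family_on A P" "finite P"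
  shows "(\<Sum>j\<in>P. d j * indicator (A j) x)\<^sup>2 = (\<Sum>j\<in>P. (d j)\<^sup>2 * indicator (A j) x)"
proof (cases "\<exists>j\<in>P. x \<in> A j")
  case True
  then obtain j where "j \<in> P" "x \<in> A j" by blast
  note eq = sum_indicator_disjoint_family[OF assms(1) \<open>x \<in> A j\<close> assms(2) \<open>j \<in> P\<close>]
  show ?thesis unfolding eq ..
next
  case False
  then show ?thesis by (simp add: indicator_def)
qed

locale brownian = prob_space N for N :: "'b measure" +
  fixes B :: "real \<Rightarrow> 'b \<Rightarrow> real"
  assumes BM: "two_sided_BM N B"
begin

lemma B_measurable [measurable]: "B t \<in> borel_measurable N"
  using BM by (simp add: two_sided_BM_def)

lemma B_increment_gaussian: "s \<le> t \<Longrightarrow> gaussian_rv N (t - s) (\<lambda>\<omega>. B t \<omega> - B s \<omega>)"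
proof (cases "s = t")
  case True
  have "gaussian_rv N 0 (\<lambda>_. 0)"
    by (simp add: gaussian_rv_def distr_const std_normal.distr_const)
  then show ?thesis using True by simp
next
  case False
  assume "s \<le> t"
  then have st: "s < t" using False by simp
  then have "distributed N lborel (\<lambda>\<omega>. B t \<omega> - B s \<omega>) (normal_density 0 (sqrt (t - s)))"
    using BM by (simp add: two_sided_BM_def)
  from gaussian_rv_of_normal[OF prob_space_axioms this] st show ?thesis by simp
qed

lemma B_increments_indep:
  "strict_mono_on {..k} \<tau> \<Longrightarrow> indep_vars (\<lambda>_. borel) (\<lambda>i \<omega>. B (\<tau> (Suc i)) \<omega> - B (\<tau> i) \<omega>) {..<k}"
  using BM by (simp add: two_sided_BM_def)

text \<open>Independence of the increments over disjoint cells turns the characteristic function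
  into a product of Gaussian ones, so the variances add up.\<close>

lemma grid_sum_gaussian:
  assumes \<tau>: "strict_mono_on {..k} \<tau>"
  shows "gaussian_rv N (\<Sum>j<k. (d j)\<^sup>2 * (\<tau> (Suc j) - \<tau> j)) (\<lambda>\<omega>. \<Sum>j<k. d j * (B (\<tau> (Suc j)) \<omega> - B (\<tau> j) \<omega>))"
proof -
  have le: "\<tau> j \<le> \<tau> (Suc j)" if "j < k" for j
    using strict_mono_onD[OF \<tau>, of j "Suc j"] that by simp
  have g: "gaussian_rv N ((d j)\<^sup>2 * (\<tau> (Suc j) - \<tau> j)) (\<lambda>\<omega>. d j * (B (\<tau> (Suc j)) \<omega> - B (\<tau> j) \<omega>))" if "j < k" for j
    by (intro gaussian_rv_scale B_increment_gaussian le that)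
  have nn: "0 \<le> (\<Sum>j<k. (d j)\<^sup>2 * (\<tau> (Suc j) - \<tau> j))"
    using le by (intro sum_nonneg mult_nonneg_nonneg) auto
  have ind: "indep_vars (\<lambda>_. borel) (\<lambda>j \<omega>. d j * (B (\<tau> (Suc j)) \<omega> - B (\<tau> j) \<omega>)) {..<k}"
    by (rule indep_vars_compose2[OF B_increments_indep[OF \<tau>], where Y="\<lambda>j x. d j * x"]) simp
  show ?thesis
  proof (subst gaussian_rv_iff_char[OF prob_space_axioms _ nn], simp, rule allI)
    fix t
    have "char (distr N borel (\<lambda>\<omega>. \<Sum>j<k. d j * (B (\<tau> (Suc j)) \<omega> - B (\<tau> j) \<omega>))) t =
       (\<Prod>j<k. char (distr N borel (\<lambda>\<omega>. d j * (B (\<tau> (Suc j)) \<omega> - B (\<tau> j) \<omega>))) t)"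
      by (rule char_distr_sum[OF ind])
    also have "\<dots> = (\<Prod>j<k. complex_of_real (exp (- (((d j)\<^sup>2 * (\<tau> (Suc j) - \<tau> j)) * t\<^sup>2) / 2)))"
    proof (rule prod.cong[OF refl])
      fix j assume "j \<in> {..<k}"
      then have j: "j < k" by simp
      show "char (distr N borel (\<lambda>\<omega>. d j * (B (\<tau> (Suc j)) \<omega> - B (\<tau> j) \<omega>))) t =
         complex_of_real (exp (- (((d j)\<^sup>2 * (\<tau> (Suc j) - \<tau> j)) * t\<^sup>2) / 2))"
        using g[OF j] gaussian_rv_iff_char[OF prob_space_axioms gaussian_rv_measurable[OF g[OF j]] gaussian_rv_nonneg[OF g[OF j]]]
        by blast
    qed
    also have "\<dots> = complex_of_real (exp (- ((\<Sum>j<k. (d j)\<^sup>2 * (\<tau> (Suc j) - \<tau> j)) * t\<^sup>2) / 2))"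
      by (simp add: of_real_prod[symmetric] exp_sum[symmetric] sum_negf[symmetric] sum_divide_distrib sum_distrib_right del: of_real_exp)
    finally show "char (distr N borel (\<lambda>\<omega>. \<Sum>j<k. d j * (B (\<tau> (Suc j)) \<omega> - B (\<tau> j) \<omega>))) t =
      complex_of_real (exp (- ((\<Sum>j<k. (d j)\<^sup>2 * (\<tau> (Suc j) - \<tau> j)) * t\<^sup>2) / 2))" .
  qed
qed

text \<open>The intervals may overlap, so their increments are in general dependent. Sorting all
  endpoints into one grid writes every interval as a union of grid cells; the combination of
  increments and the step function telescope to sums over cells with the same weights. The variance
  is the squared norm of the step function because the cells are disjoint.\<close>

lemma increments_gaussian:
  assumes I: "finite I" and ab: "\<And>i. i \<in> I \<Longrightarrow> a i \<le> b i"
  shows "gaussian_rv N (\<integral>x. (\<Sum>i\<in>I. c i * indicator {a i<..b i} x)\<^sup>2 \<partial>lborel)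
     (\<lambda>\<omega>. \<Sum>i\<in>I. c i * (B (b i) \<omega> - B (a i) \<omega>))"
proof -
  define T where "T = sorted_list_of_set (a ` I \<union> b ` I)"
  define k where "k = length T - 1"
  define \<tau> where "\<tau> j = T ! j" for j
  have T: "set T = a ` I \<union> b ` I" "sorted T" "distinct T"
    using I by (auto simp: T_def)
  have \<tau>: "strict_mono_on {..k} \<tau>"
  proof (rule strict_mono_onI)
    fix r s assume rs: "r \<in> {..k}" "s \<in> {..k}" "r < s"
    then have "s < length T" unfolding k_def by auto
    with rs T(2,3) show "\<tau> r < \<tau> s"
      unfolding \<tau>_def using strict_sorted_iff[of T] sorted_wrt_nth_less[of "(<)" T r s] by auto
  qed
  have ex: "\<exists>j\<le>k. \<tau> j = x" if x: "x \<in> set T" for x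
  proof -
    obtain j where "j < length T" "T ! j = x" using x by (auto simp: in_set_conv_nth)
    then show ?thesis by (intro exI[of _ j]) (auto simp: \<tau>_def k_def)
  qed
  define p where "p i = (SOME j. j \<le> k \<and> \<tau> j = a i)" for i
  define q where "q i = (SOME j. j \<le> k \<and> \<tau> j = b i)" for i
  have p: "p i \<le> k" "\<tau> (p i) = a i" if "i \<in> I" for i
    using someI_ex[OF ex[of "a i"]] T(1) that by (auto simp: p_def)
  have q: "q i \<le> k" "\<tau> (q i) = b i" if "i \<in> I" for i
    using someI_ex[OF ex[of "b i"]] T(1) that by (auto simp: q_def)
  have pq: "p i \<le> q i" if i: "i \<in> I" for i
  proof (rule ccontr)
    assume "\<not> p i \<le> q i"
    then show False using strict_mono_onD[OF \<tau>, of "q i" "p i"] p[OF i] q[OF i] ab[OF i] by auto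
  qed
  \<comment> \<open>The weight of a cell is the sum of the coefficients of all intervals that
    contain it; \<open>comb\<close> exchanges the two summations for increments and indicators
    alike.\<close>
  define d where "d j = (\<Sum>i\<in>I. if j \<in> {p i..<q i} then c i else 0)" for j
  have sub: "{p i..<q i} = {..<k} \<inter> {p i..<q i}" if "i \<in> I" for i
    using q[OF that] by auto
  have comb: "(\<Sum>i\<in>I. c i * (\<Sum>j\<in>{p i..<q i}. h j)) = (\<Sum>j<k. d j * h j)" for h :: "nat \<Rightarrow> real"
  proof -
    have "(\<Sum>i\<in>I. c i * (\<Sum>j\<in>{p i..<q i}. h j)) = (\<Sum>i\<in>I. \<Sum>j<k. (if j \<in> {p i..<q i} then c i else 0) * h j)"
    proof (rule sum.cong[OF refl])
      fix i assume i: "i \<in> I"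
      have "(\<Sum>j\<in>{p i..<q i}. h j) = (\<Sum>j<k. if j \<in> {p i..<q i} then h j else 0)"
        by (subst sub[OF i], subst sum.inter_restrict) auto
      then show "c i * (\<Sum>j\<in>{p i..<q i}. h j) = (\<Sum>j<k. (if j \<in> {p i..<q i} then c i else 0) * h j)"
        by (simp add: sum_distrib_left if_distrib if_distribR cong: if_cong)
    qed
    also have "\<dots> = (\<Sum>j<k. d j * h j)"
      unfolding d_def by (subst sum.swap) (simp add: sum_distrib_right)
    finally show ?thesis .
  qed
  have J: "(\<Sum>i\<in>I. c i * (B (b i) \<omega> - B (a i) \<omega>)) = (\<Sum>j<k. d j * (B (\<tau> (Suc j)) \<omega> - B (\<tau> j) \<omega>))" for \<omega>
    unfolding comb[symmetric]
    by (intro sum.cong refl) (simp add: sum_Suc_diff'[OF pq, of _ "\<lambda>j. B (\<tau> j) \<omega>"] p q)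
  have F: "(\<Sum>i\<in>I. c i * indicator {a i<..b i} x) = (\<Sum>j<k. d j * indicator {\<tau> j<..\<tau> (Suc j)} x)" for x
    unfolding comb[symmetric]
    by (intro sum.cong refl) (simp add: cells_telescope[OF \<tau> pq q(1), symmetric] p q)
  have "(\<integral>x. (\<Sum>i\<in>I. c i * indicator {a i<..b i} x)\<^sup>2 \<partial>lborel)
      = (\<integral>x. (\<Sum>j<k. (d j)\<^sup>2 * indicator {\<tau> j<..\<tau> (Suc j)} x) \<partial>lborel)"
    unfolding F sum_disjoint_indicator_power2[OF strict_mono_cells_disjoint[OF \<tau>] finite_lessThan] ..
  also have "\<dots> = (\<Sum>j<k. (d j)\<^sup>2 * (\<tau> (Suc j) - \<tau> j))"
    using strict_mono_onD[OF \<tau>] by (subst Bochner_Integration.integral_sum) (auto intro!: sum.cong simp: less_imp_le)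
  finally show ?thesis using grid_sum_gaussian[OF \<tau>, of d] by (simp add: J)
qed

end

section \<open>Square integrable functions\<close>

definition square_integrable :: "'a measure \<Rightarrow> ('a \<Rightarrow> real) \<Rightarrow> bool" where
  "square_integrable M f \<longleftrightarrow> f \<in> borel_measurable M \<and> integrable M (\<lambda>x. (f x)\<^sup>2)"

text \<open>Meaningful together with \<open>square_integrable\<close> only, since the Bochner
  integral of a non-integrable square is 0. This is why square integrability accompanies almost
  every statement on norms.\<close>

definition l2norm :: "'a measure \<Rightarrow> ('a \<Rightarrow> real) \<Rightarrow> real" where
  "l2norm M f = sqrt (\<integral>x. (f x)\<^sup>2 \<partial>M)"

lemma square_integrable_measurable: "square_integrable M f \<Longrightarrow> f \<in> borel_measurable M"
  and square_integrable_integrable: "square_integrable M f \<Longrightarrow> integrable M (\<lambda>x. (f x)\<^sup>2)"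
  by (simp_all add: square_integrable_def)

lemma l2norm_nonneg [simp]: "0 \<le> l2norm M f"
  by (simp add: l2norm_def)

lemma l2norm_power2: "(l2norm M f)\<^sup>2 = (\<integral>x. (f x)\<^sup>2 \<partial>M)"
  by (simp add: l2norm_def)

lemma square_integrable_bound:
  assumes "square_integrable M g" "f \<in> borel_measurable M" "AE x in M. \<bar>f x\<bar> \<le> \<bar>g x\<bar>"
  shows "square_integrable M f"
  unfolding square_integrable_def
proof
  show "integrable M (\<lambda>x. (f x)\<^sup>2)"
    using assms by (intro Bochner_Integration.integrable_bound[OF square_integrable_integrable[OF assms(1)]])
      (auto simp: abs_le_square_iff)
qed fact

lemma l2norm_mono:
  assumes "square_integrable M g" "f \<in> borel_measurable M" "AE x in M. \<bar>f x\<bar> \<le> \<bar>g x\<bar>"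
  shows "l2norm M f \<le> l2norm M g"
  unfolding l2norm_def
  using square_integrable_bound[OF assms] assms
  by (intro real_sqrt_le_mono integral_mono_AE) (auto simp: square_integrable_def abs_le_square_iff)

lemma square_integrable_cmult:
  "square_integrable M f \<Longrightarrow> square_integrable M (\<lambda>x. c * f x)"
  by (auto simp: square_integrable_def power_mult_distrib)

lemma square_integrable_add:
  assumes "square_integrable M f" "square_integrable M g"
  shows "square_integrable M (\<lambda>x. f x + g x)"
  unfolding square_integrable_def
proof
  have [measurable]: "f \<in> borel_measurable M" "g \<in> borel_measurable M" using assms by (auto simp: square_integrable_def)
  show "(\<lambda>x. f x + g x) \<in> borel_measurable M" by simp
  show "integrable M (\<lambda>x. (f x + g x)\<^sup>2)"
  proof (rule Bochner_Integration.integrable_bound)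
    show "integrable M (\<lambda>x. 2 * (f x)\<^sup>2 + 2 * (g x)\<^sup>2)" using assms by (auto simp: square_integrable_def)
    have "(a + b)\<^sup>2 \<le> 2 * a\<^sup>2 + 2 * b\<^sup>2" for a b :: real
      using sum_squares_bound[of a b] by (simp add: power2_sum)
    then show "AE x in M. norm ((f x + g x)\<^sup>2) \<le> norm (2 * (f x)\<^sup>2 + 2 * (g x)\<^sup>2)"
      by (intro AE_I2) (simp add: order.trans[OF _ abs_ge_self])
  qed simp
qed

lemma square_integrable_diff:
  "square_integrable M f \<Longrightarrow> square_integrable M g \<Longrightarrow> square_integrable M (\<lambda>x. f x - g x)"
  using square_integrable_add[of M f "\<lambda>x. - 1 * g x"] square_integrable_cmult[of M g "- 1"] by simp

lemma square_integrable_zero [simp]: "square_integrable M (\<lambda>_. 0)"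
  by (simp add: square_integrable_def)

lemma square_integrable_sum:
  "(\<And>i. i \<in> I \<Longrightarrow> square_integrable M (f i)) \<Longrightarrow> square_integrable M (\<lambda>x. \<Sum>i\<in>I. f i x)"
  by (induction I rule: infinite_finite_induct) (auto intro: square_integrable_add)

lemma (in finite_measure) square_integrable_const: "square_integrable M (\<lambda>_. c)"
  by (simp add: square_integrable_def)

lemma square_integrable_mult:
  assumes "square_integrable M f" "square_integrable M g"
  shows "integrable M (\<lambda>x. f x * g x)"
proof (rule Bochner_Integration.integrable_bound)
  have [measurable]: "f \<in> borel_measurable M" "g \<in> borel_measurable M" using assms by (auto simp: square_integrable_def)
  show "integrable M (\<lambda>x. (f x)\<^sup>2 + (g x)\<^sup>2)" using assms by (auto simp: square_integrable_def)
  have "\<bar>a * b\<bar> \<le> a\<^sup>2 + b\<^sup>2" for a b :: real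
    using sum_squares_bound[of "\<bar>a\<bar>" "\<bar>b\<bar>"] mult_nonneg_nonneg[of "\<bar>a\<bar>" "\<bar>b\<bar>"]
    unfolding abs_mult power2_abs by linarith
  then show "AE x in M. norm (f x * g x) \<le> norm ((f x)\<^sup>2 + (g x)\<^sup>2)"
    by (intro AE_I2) simp
qed (use assms in \<open>auto simp: square_integrable_def\<close>)

lemma l2norm_eq_0:
  assumes "square_integrable M f" "l2norm M f = 0"
  shows "AE x in M. f x = 0"
  using integral_nonneg_eq_0_iff_AE[OF square_integrable_integrable[OF assms(1)]] assms(2)
  by (simp add: l2norm_def)

lemma cauchy_schwarz_abs:
  assumes f: "square_integrable M f" and g: "square_integrable M g"
  shows "(\<integral>x. \<bar>f x * g x\<bar> \<partial>M) \<le> l2norm M f * l2norm M g"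
proof (cases "l2norm M f = 0 \<or> l2norm M g = 0")
  case True
  then have "AE x in M. \<bar>f x * g x\<bar> = 0"
    using l2norm_eq_0[OF f] l2norm_eq_0[OF g] by auto
  then have "(\<integral>x. \<bar>f x * g x\<bar> \<partial>M) = (\<integral>x. 0 \<partial>M)"
    using f g by (intro integral_cong_AE) (auto simp: square_integrable_def)
  then show ?thesis by simp
next
  case False
  define a b where "a = l2norm M f" and "b = l2norm M g"
  have ab: "a > 0" "b > 0" using False by (simp_all add: a_def b_def less_le)
  have [measurable]: "f \<in> borel_measurable M" "g \<in> borel_measurable M" using f g by (auto simp: square_integrable_def)
  \<comment> \<open>Young's inequality with weights \<open>b / a\<close> and \<open>a / b\<close>,
    chosen so that each of the two terms integrates to \<open>a * b / 2\<close>.\<close>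
  have "\<bar>f x * g x\<bar> \<le> (b / a) / 2 * (f x)\<^sup>2 + (a / b) / 2 * (g x)\<^sup>2" for x
  proof -
    have "0 \<le> (b * \<bar>f x\<bar> - a * \<bar>g x\<bar>)\<^sup>2" by simp
    then have "2 * (a * b) * \<bar>f x * g x\<bar> \<le> b\<^sup>2 * (f x)\<^sup>2 + a\<^sup>2 * (g x)\<^sup>2"
      by (simp add: power2_diff power_mult_distrib abs_mult mult_ac)
    then show ?thesis using ab by (simp add: field_simps power2_eq_square)
  qed
  then have "(\<integral>x. \<bar>f x * g x\<bar> \<partial>M) \<le> (\<integral>x. (b / a) / 2 * (f x)\<^sup>2 + (a / b) / 2 * (g x)\<^sup>2 \<partial>M)"
    using square_integrable_mult[OF f g] f g
    by (intro integral_mono) (auto simp: square_integrable_def)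
  also have "\<dots> = (b / a) / 2 * a\<^sup>2 + (a / b) / 2 * b\<^sup>2"
    using f g by (simp add: a_def b_def l2norm_power2 square_integrable_def)
  also have "\<dots> = a * b" using ab by (simp add: field_simps power2_eq_square)
  finally show ?thesis by (simp add: a_def b_def)
qed

lemma cauchy_schwarz:
  assumes f: "square_integrable M f" and g: "square_integrable M g"
  shows "\<bar>\<integral>x. f x * g x \<partial>M\<bar> \<le> l2norm M f * l2norm M g"
  by (rule order_trans[OF integral_norm_bound[of M "\<lambda>x. f x * g x", unfolded real_norm_def] cauchy_schwarz_abs[OF f g]])

lemma (in prob_space) l1_le_l2norm:
  assumes f: "square_integrable M f"
  shows "(\<integral>x. \<bar>f x\<bar> \<partial>M) \<le> l2norm M f"
  using cauchy_schwarz_abs[OF f square_integrable_const[of 1]] by (simp add: l2norm_def prob_space)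

lemma (in finite_measure) square_integrable_L1: "square_integrable M f \<Longrightarrow> integrable M f"
  using square_integrable_mult[OF _ square_integrable_const[of 1], of f] by simp

lemma l2norm_triangle:
  assumes f: "square_integrable M f" and g: "square_integrable M g"
  shows "l2norm M (\<lambda>x. f x + g x) \<le> l2norm M f + l2norm M g"
proof (rule power2_le_imp_le)
  have "(l2norm M (\<lambda>x. f x + g x))\<^sup>2 = (\<integral>x. (f x)\<^sup>2 + (g x)\<^sup>2 + 2 * (f x * g x) \<partial>M)"
    by (simp add: l2norm_power2 power2_sum mult_ac)
  also have "\<dots> = (l2norm M f)\<^sup>2 + (l2norm M g)\<^sup>2 + 2 * (\<integral>x. f x * g x \<partial>M)"
    using square_integrable_mult[OF f g] f g by (simp add: l2norm_power2 square_integrable_def)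
  also have "\<dots> \<le> (l2norm M f)\<^sup>2 + (l2norm M g)\<^sup>2 + 2 * (l2norm M f * l2norm M g)"
    using cauchy_schwarz[OF f g] by linarith
  also have "\<dots> = (l2norm M f + l2norm M g)\<^sup>2" by (simp add: power2_sum)
  finally show "(l2norm M (\<lambda>x. f x + g x))\<^sup>2 \<le> (l2norm M f + l2norm M g)\<^sup>2" .
qed simp

lemma l2norm_cmult: "l2norm M (\<lambda>x. c * f x) = \<bar>c\<bar> * l2norm M f"
  by (simp add: l2norm_def power_mult_distrib real_sqrt_mult)

lemma l2norm_minus_commute: "l2norm M (\<lambda>x. f x - g x) = l2norm M (\<lambda>x. g x - f x)"
  by (simp add: l2norm_def power2_commute)

lemma l2norm_triangle_diff:
  assumes "square_integrable M f" "square_integrable M g" "square_integrable M h"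
  shows "l2norm M (\<lambda>x. f x - h x) \<le> l2norm M (\<lambda>x. f x - g x) + l2norm M (\<lambda>x. g x - h x)"
  using l2norm_triangle[OF square_integrable_diff[OF assms(1,2)] square_integrable_diff[OF assms(2,3)]] by simp

lemma l2norm_diff_abs:
  assumes f: "square_integrable M f" and g: "square_integrable M g"
  shows "\<bar>l2norm M f - l2norm M g\<bar> \<le> l2norm M (\<lambda>x. f x - g x)"
  using l2norm_triangle[OF square_integrable_diff[OF f g] g] l2norm_triangle[OF square_integrable_diff[OF g f] f]
    l2norm_minus_commute[of M f g] by simp

lemma l2norm_tendsto:
  assumes "\<And>n. square_integrable M (f n)" "square_integrable M g"
    and "(\<lambda>n. l2norm M (\<lambda>x. f n x - g x)) \<longlonglongrightarrow> 0"
  shows "(\<lambda>n. l2norm M (f n)) \<longlonglongrightarrow> l2norm M g"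
proof (rule LIM_zero_cancel, rule Lim_null_comparison[OF _ assms(3)])
  show "\<forall>\<^sub>F n in sequentially. norm (l2norm M (f n) - l2norm M g) \<le> l2norm M (\<lambda>x. f n x - g x)"
    using l2norm_diff_abs[OF assms(1,2)] by simp
qed

lemma l2_inner_tendsto:
  assumes f: "\<And>n. square_integrable M (f n)" and g: "square_integrable M g" and h: "square_integrable M h"
    and lim: "(\<lambda>n. l2norm M (\<lambda>x. f n x - g x)) \<longlonglongrightarrow> 0"
  shows "(\<lambda>n. \<integral>x. f n x * h x \<partial>M) \<longlonglongrightarrow> (\<integral>x. g x * h x \<partial>M)"
proof (rule LIM_zero_cancel, rule Lim_null_comparison)
  show "(\<lambda>n. l2norm M (\<lambda>x. f n x - g x) * l2norm M h) \<longlonglongrightarrow> 0"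
    using tendsto_mult_left_zero[OF lim] by simp
  have "\<bar>(\<integral>x. f n x * h x \<partial>M) - (\<integral>x. g x * h x \<partial>M)\<bar> \<le> l2norm M (\<lambda>x. f n x - g x) * l2norm M h" for n
  proof -
    have "(\<integral>x. f n x * h x \<partial>M) - (\<integral>x. g x * h x \<partial>M) = (\<integral>x. (f n x - g x) * h x \<partial>M)"
      using square_integrable_mult[OF f h] square_integrable_mult[OF g h] by (simp add: left_diff_distrib)
    then show ?thesis using cauchy_schwarz[OF square_integrable_diff[OF f g] h] by simp
  qed
  then show "\<forall>\<^sub>F n in sequentially. norm ((\<integral>x. f n x * h x \<partial>M) - (\<integral>x. g x * h x \<partial>M)) \<le> l2norm M (\<lambda>x. f n x - g x) * l2norm M h"
    by simp
qed

lemma nn_integral_power2_l2norm: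
  "square_integrable M f \<Longrightarrow> (\<integral>\<^sup>+x. ennreal ((f x)\<^sup>2) \<partial>M) = ennreal ((l2norm M f)\<^sup>2)"
  by (simp add: l2norm_power2 nn_integral_eq_integral square_integrable_def)

lemma square_integrableI_nn:
  assumes "f \<in> borel_measurable M" "(\<integral>\<^sup>+x. ennreal ((f x)\<^sup>2) \<partial>M) < \<infinity>"
  shows "square_integrable M f"
  using assms by (auto simp: square_integrable_def intro!: integrableI_bounded)

text \<open>For square integrable functions the nonnegative integral and the Bochner integral of the
  squared difference agree, so mean-square convergence may be handled with norms.\<close>

lemma L2_tendsto_iff_l2norm:
  assumes Y: "\<And>k. square_integrable M (Y k)" and Z: "square_integrable M Z"
  shows "L2_tendsto M Y Z \<longleftrightarrow> (\<lambda>k. l2norm M (\<lambda>x. Y k x - Z x)) \<longlonglongrightarrow> 0"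
proof -
  have "L2_tendsto M Y Z \<longleftrightarrow> (\<lambda>k. ennreal ((l2norm M (\<lambda>x. Y k x - Z x))\<^sup>2)) \<longlonglongrightarrow> 0"
    using Y Z unfolding L2_tendsto_def nn_integral_power2_l2norm[OF square_integrable_diff[OF Y Z]]
    by (simp add: square_integrable_def)
  also have "\<dots> \<longleftrightarrow> (\<lambda>k. (l2norm M (\<lambda>x. Y k x - Z x))\<^sup>2) \<longlonglongrightarrow> 0"
    by (subst ennreal_0[symmetric], subst tendsto_ennreal_iff) auto
  also have "\<dots> \<longleftrightarrow> (\<lambda>k. l2norm M (\<lambda>x. Y k x - Z x)) \<longlonglongrightarrow> 0"
  proof
    assume "(\<lambda>k. (l2norm M (\<lambda>x. Y k x - Z x))\<^sup>2) \<longlonglongrightarrow> 0"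
    from tendsto_real_sqrt[OF this] show "(\<lambda>k. l2norm M (\<lambda>x. Y k x - Z x)) \<longlonglongrightarrow> 0" by simp
  next
    assume "(\<lambda>k. l2norm M (\<lambda>x. Y k x - Z x)) \<longlonglongrightarrow> 0"
    from tendsto_power[OF this, of 2] show "(\<lambda>k. (l2norm M (\<lambda>x. Y k x - Z x))\<^sup>2) \<longlonglongrightarrow> 0" by simp
  qed
  finally show ?thesis .
qed

text \<open>Argued with nonnegative integrals, since only measurability of the limits is given. It
  serves to compare the version of a multiple integral picked by \<open>SOME\<close> with an
  explicit one.\<close>

lemma L2_tendsto_AE_unique:
  assumes "L2_tendsto M Y Z" "L2_tendsto M Y Z'"
  shows "AE x in M. Z x = Z' x"
proof -
  have [measurable]: "Y k \<in> borel_measurable M" "Z \<in> borel_measurable M" "Z' \<in> borel_measurable M" for k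
    using assms by (auto simp: L2_tendsto_def)
  let ?d = "\<lambda>k Z. \<integral>\<^sup>+x. ennreal ((Y k x - Z x)\<^sup>2) \<partial>M"
  have "(\<integral>\<^sup>+x. ennreal ((Z x - Z' x)\<^sup>2) \<partial>M) \<le> 2 * ?d k Z + 2 * ?d k Z'" for k
  proof -
    have "(a - c)\<^sup>2 \<le> 2 * (b - a)\<^sup>2 + 2 * (b - c)\<^sup>2" for a b c :: real
      using sum_squares_bound[of "b - a" "c - b"] by (simp add: power2_eq_square algebra_simps)
    then have "(\<integral>\<^sup>+x. ennreal ((Z x - Z' x)\<^sup>2) \<partial>M) \<le> (\<integral>\<^sup>+x. ennreal (2 * (Y k x - Z x)\<^sup>2 + 2 * (Y k x - Z' x)\<^sup>2) \<partial>M)"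
      by (intro nn_integral_mono ennreal_leI)
    also have "\<dots> = 2 * ?d k Z + 2 * ?d k Z'"
      by (simp add: nn_integral_add nn_integral_cmult ennreal_mult)
    finally show ?thesis .
  qed
  moreover have "(\<lambda>k. 2 * ?d k Z + 2 * ?d k Z') \<longlonglongrightarrow> 2 * 0 + 2 * 0"
    using assms by (intro tendsto_add tendsto_mult_ennreal tendsto_const) (auto simp: L2_tendsto_def)
  ultimately have "(\<integral>\<^sup>+x. ennreal ((Z x - Z' x)\<^sup>2) \<partial>M) \<le> 0"
    by (intro LIMSEQ_le_const[of _ 0]) auto
  then have "(\<integral>\<^sup>+x. ennreal ((Z x - Z' x)\<^sup>2) \<partial>M) = 0" by simp
  then show ?thesis by (subst (asm) nn_integral_0_iff_AE) (auto simp: ennreal_eq_0_iff)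
qed

lemma has_bochner_integral_exp_left:
  fixes c s :: real
  assumes c: "c > 0"
  shows "has_bochner_integral lborel (\<lambda>x. exp (c * x) * indicator {..s} x) (exp (c * s) / c)"
proof (rule has_bochner_integral_nn_integral)
  have "(\<integral>\<^sup>+x. ennreal (exp (c * x) * indicator {..s} x) \<partial>lborel)
      = (\<integral>\<^sup>+x. ennreal (exp (- c * x)) * indicator {-s..} x \<partial>lborel)"
    by (subst nn_integral_real_affine[where c="-1" and t=0])
       (auto intro!: nn_integral_cong simp: indicator_def)
  also have "\<dots> = ennreal (0 - (- exp (- c * (- s)) / c))"
  proof (rule nn_integral_FTC_atLeast)
    have "((\<lambda>x. exp (- (c * x))) \<longlongrightarrow> 0) at_top"
      by (intro filterlim_compose[OF exp_at_bot] filterlim_uminus_at_bot_at_top[THEN filterlim_compose]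
          filterlim_tendsto_pos_mult_at_top[OF tendsto_const c] filterlim_ident)
    from tendsto_mult[OF this tendsto_const[of "- 1 / c"]] show "((\<lambda>x. - exp (- c * x) / c) \<longlongrightarrow> 0) at_top" by simp
  qed (use c in \<open>auto intro!: derivative_eq_intros\<close>)
  finally show "(\<integral>\<^sup>+x. ennreal (exp (c * x) * indicator {..s} x) \<partial>lborel) = ennreal (exp (c * s) / c)"
    by simp
qed (use c in auto)

section \<open>Wiener integrals\<close>

context brownian
begin

text \<open>A finite combination of increments, paired with the step function that it integrates.
  Lists of triples make sums a matter of concatenation and allow overlapping intervals.\<close>

definition step_pair :: "('b \<Rightarrow> real) \<Rightarrow> (real \<Rightarrow> real) \<Rightarrow> bool" where
  "step_pair J g \<longleftrightarrow> (\<exists>L. (\<forall>(c, a, b)\<in>set L. a \<le> b) \<and>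
     J = (\<lambda>\<omega>. \<Sum>(c, a, b)\<leftarrow>L. c * (B b \<omega> - B a \<omega>)) \<and> g = (\<lambda>x. \<Sum>(c, a, b)\<leftarrow>L. c * indicator {a<..b} x))"

lemma step_pair_zero: "step_pair (\<lambda>_. 0) (\<lambda>_. 0)"
  unfolding step_pair_def by (intro exI[of _ "[]"]) simp

lemma step_pair_increment: "a \<le> b \<Longrightarrow> step_pair (\<lambda>\<omega>. c * (B b \<omega> - B a \<omega>)) (\<lambda>x. c * indicator {a<..b} x)"
  unfolding step_pair_def by (intro exI[of _ "[(c, a, b)]"]) simp

lemma step_pair_add:
  assumes "step_pair J g" "step_pair K h"
  shows "step_pair (\<lambda>\<omega>. J \<omega> + K \<omega>) (\<lambda>x. g x + h x)"
proof -
  obtain L where L: "\<forall>(c, a, b)\<in>set L. a \<le> b" "J = (\<lambda>\<omega>. \<Sum>(c, a, b)\<leftarrow>L. c * (B b \<omega> - B a \<omega>))"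
     "g = (\<lambda>x. \<Sum>(c, a, b)\<leftarrow>L. c * indicator {a<..b} x)" using assms(1) unfolding step_pair_def by blast
  obtain L' where L': "\<forall>(c, a, b)\<in>set L'. a \<le> b" "K = (\<lambda>\<omega>. \<Sum>(c, a, b)\<leftarrow>L'. c * (B b \<omega> - B a \<omega>))"
     "h = (\<lambda>x. \<Sum>(c, a, b)\<leftarrow>L'. c * indicator {a<..b} x)" using assms(2) unfolding step_pair_def by blast
  show ?thesis
    unfolding step_pair_def using L L' by (intro exI[of _ "L @ L'"]) auto
qed

lemma step_pair_cmult:
  assumes "step_pair J g"
  shows "step_pair (\<lambda>\<omega>. y * J \<omega>) (\<lambda>x. y * g x)"
proof -
  obtain L where L: "\<forall>(c, a, b)\<in>set L. a \<le> b" "J = (\<lambda>\<omega>. \<Sum>(c, a, b)\<leftarrow>L. c * (B b \<omega> - B a \<omega>))"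
     "g = (\<lambda>x. \<Sum>(c, a, b)\<leftarrow>L. c * indicator {a<..b} x)" using assms(1) unfolding step_pair_def by blast
  show ?thesis
    unfolding step_pair_def
    using L by (intro exI[of _ "map (\<lambda>(c, a, b). (y * c, a, b)) L"])
      (auto simp: sum_list_const_mult[symmetric] o_def case_prod_unfold mult.assoc)
qed

lemma step_pair_sum:
  "(\<And>i. i \<in> I \<Longrightarrow> step_pair (J i) (g i)) \<Longrightarrow> step_pair (\<lambda>\<omega>. \<Sum>i\<in>I. J i \<omega>) (\<lambda>x. \<Sum>i\<in>I. g i x)"
  by (induction I rule: infinite_finite_induct) (auto intro: step_pair_zero step_pair_add)

lemma step_pair_square_integrable:
  assumes "step_pair J g"
  shows "square_integrable lborel g"
proof -
  obtain L where g: "\<forall>(c, a, b)\<in>set L. a \<le> b" "g = (\<lambda>x. \<Sum>(c, a, b)\<leftarrow>L. c * indicator {a<..b} x)"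
    using assms unfolding step_pair_def by blast
  have "square_integrable lborel (indicat_real {a<..b})" for a b :: real
    by (cases "a \<le> b") (auto simp: square_integrable_def power2_eq_square indicator_inter_arith[symmetric])
  then have "square_integrable lborel (\<lambda>x. \<Sum>(c, a, b)\<leftarrow>L. c * indicator {a<..b} x)"
    by (induction L) (auto intro!: square_integrable_add square_integrable_cmult)
  then show ?thesis using g by simp
qed

lemma step_pair_gaussian:
  assumes "step_pair J g"
  shows "gaussian_rv N (\<integral>x. (g x)\<^sup>2 \<partial>lborel) J"
proof -
  obtain L where L: "\<forall>(c, a, b)\<in>set L. a \<le> b" "J = (\<lambda>\<omega>. \<Sum>(c, a, b)\<leftarrow>L. c * (B b \<omega> - B a \<omega>))"
     "g = (\<lambda>x. \<Sum>(c, a, b)\<leftarrow>L. c * indicator {a<..b} x)" using assms(1) unfolding step_pair_def by blast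
  define c where "c i = fst (L ! i)" for i
  define a where "a i = fst (snd (L ! i))" for i
  define b where "b i = snd (snd (L ! i))" for i
  have ab: "i \<in> {0..<length L} \<Longrightarrow> a i \<le> b i" for i
    using L(1) nth_mem[of i L] by (fastforce simp: a_def b_def)
  have J: "J = (\<lambda>\<omega>. \<Sum>i\<in>{0..<length L}. c i * (B (b i) \<omega> - B (a i) \<omega>))"
    unfolding L(2) by (auto simp: sum_list_sum_nth a_def b_def c_def case_prod_unfold)
  have g: "g = (\<lambda>x. \<Sum>i\<in>{0..<length L}. c i * indicator {a i<..b i} x)"
    unfolding L(3) by (auto simp: sum_list_sum_nth a_def b_def c_def case_prod_unfold)
  show ?thesis unfolding J g by (rule increments_gaussian) (auto intro: ab)
qed

text \<open>\<open>J\<close> is a version of the Wiener integral of \<open>g\<close>. The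
  approximants converge almost surely while the kernels converge in mean square: the former makes
  linearity and the Gaussian limit immediate, the latter determines the variance.\<close>

definition wiener :: "('b \<Rightarrow> real) \<Rightarrow> (real \<Rightarrow> real) \<Rightarrow> bool" where
  "wiener J g \<longleftrightarrow> J \<in> borel_measurable N \<and> square_integrable lborel g \<and>
     (\<exists>Jn gn. (\<forall>n::nat. step_pair (Jn n) (gn n)) \<and> (AE \<omega> in N. (\<lambda>n. Jn n \<omega>) \<longlonglongrightarrow> J \<omega>) \<and>
        (\<lambda>n. l2norm lborel (\<lambda>x. gn n x - g x)) \<longlonglongrightarrow> 0)"

lemma wiener_step:
  assumes "step_pair J g"
  shows "wiener J g"
  unfolding wiener_def
  using assms step_pair_square_integrable[OF assms] gaussian_rv_measurable[OF step_pair_gaussian[OF assms]]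
  by (auto intro!: exI[of _ "\<lambda>_. J"] exI[of _ "\<lambda>_. g"] simp: l2norm_def)

lemma wiener_lin:
  assumes J: "wiener J g" and K: "wiener K h"
  shows "wiener (\<lambda>\<omega>. x * J \<omega> + y * K \<omega>) (\<lambda>z. x * g z + y * h z)"
proof -
  obtain Jn gn where Jn: "\<And>n::nat. step_pair (Jn n) (gn n)" "AE \<omega> in N. (\<lambda>n. Jn n \<omega>) \<longlonglongrightarrow> J \<omega>"
     "(\<lambda>n. l2norm lborel (\<lambda>x. gn n x - g x)) \<longlonglongrightarrow> 0" using J unfolding wiener_def by blast
  obtain Kn hn where Kn: "\<And>n::nat. step_pair (Kn n) (hn n)" "AE \<omega> in N. (\<lambda>n. Kn n \<omega>) \<longlonglongrightarrow> K \<omega>"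
     "(\<lambda>n. l2norm lborel (\<lambda>x. hn n x - h x)) \<longlonglongrightarrow> 0" using K unfolding wiener_def by blast
  have [measurable]: "J \<in> borel_measurable N" "K \<in> borel_measurable N" 
    and sq: "square_integrable lborel g" "square_integrable lborel h"
    using J K by (auto simp: wiener_def)
  note sqn = step_pair_square_integrable[OF Jn(1)] step_pair_square_integrable[OF Kn(1)]
  have "AE \<omega> in N. (\<lambda>n. x * Jn n \<omega> + y * Kn n \<omega>) \<longlonglongrightarrow> x * J \<omega> + y * K \<omega>"
    using Jn(2) Kn(2) by eventually_elim (intro tendsto_intros)
  moreover have "step_pair (\<lambda>\<omega>. x * Jn n \<omega> + y * Kn n \<omega>) (\<lambda>z. x * gn n z + y * hn n z)" for n
    using Jn(1) Kn(1) by (intro step_pair_add step_pair_cmult)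
  moreover have "(\<lambda>n. l2norm lborel (\<lambda>z. (x * gn n z + y * hn n z) - (x * g z + y * h z))) \<longlonglongrightarrow> 0"
  proof (rule Lim_null_comparison)
    have "l2norm lborel (\<lambda>z. (x * gn n z + y * hn n z) - (x * g z + y * h z)) \<le>
        \<bar>x\<bar> * l2norm lborel (\<lambda>x. gn n x - g x) + \<bar>y\<bar> * l2norm lborel (\<lambda>x. hn n x - h x)" for n
      using l2norm_triangle[OF square_integrable_cmult[OF square_integrable_diff[OF sqn(1)[of n] sq(1)], of x]
          square_integrable_cmult[OF square_integrable_diff[OF sqn(2)[of n] sq(2)], of y]]
      unfolding l2norm_cmult by (simp add: algebra_simps)
    then show "\<forall>\<^sub>F n in sequentially. norm (l2norm lborel (\<lambda>z. (x * gn n z + y * hn n z) - (x * g z + y * h z))) \<le>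
        \<bar>x\<bar> * l2norm lborel (\<lambda>x. gn n x - g x) + \<bar>y\<bar> * l2norm lborel (\<lambda>x. hn n x - h x)" by simp
    show "(\<lambda>n. \<bar>x\<bar> * l2norm lborel (\<lambda>x. gn n x - g x) + \<bar>y\<bar> * l2norm lborel (\<lambda>x. hn n x - h x)) \<longlonglongrightarrow> 0"
      using tendsto_add[OF tendsto_mult_right_zero[OF Jn(3)] tendsto_mult_right_zero[OF Kn(3)]] by simp
  qed
  ultimately show ?thesis
    unfolding wiener_def by (auto intro!: square_integrable_add square_integrable_cmult sq exI)
qed

lemma wiener_gaussian:
  assumes "wiener J g"
  shows "gaussian_rv N (\<integral>x. (g x)\<^sup>2 \<partial>lborel) J"
proof -
  obtain Jn gn where Jn: "\<And>n::nat. step_pair (Jn n) (gn n)" "AE \<omega> in N. (\<lambda>n. Jn n \<omega>) \<longlonglongrightarrow> J \<omega>"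
     "(\<lambda>n. l2norm lborel (\<lambda>x. gn n x - g x)) \<longlonglongrightarrow> 0" using assms unfolding wiener_def by blast
  have J: "J \<in> borel_measurable N" "square_integrable lborel g" using assms by (auto simp: wiener_def)
  have "(\<lambda>n. l2norm lborel (gn n)) \<longlonglongrightarrow> l2norm lborel g"
    by (rule l2norm_tendsto[OF step_pair_square_integrable[OF Jn(1)] J(2) Jn(3)])
  from tendsto_power[OF this, of 2]
  have "(\<lambda>n. \<integral>x. (gn n x)\<^sup>2 \<partial>lborel) \<longlonglongrightarrow> (\<integral>x. (g x)\<^sup>2 \<partial>lborel)" by (simp add: l2norm_power2)
  from gaussian_rv_limit[OF prob_space_axioms step_pair_gaussian[OF Jn(1)] this J(1) Jn(2)] show ?thesis .
qed

lemma wiener_square_integrable: "wiener J g \<Longrightarrow> square_integrable lborel g"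
  by (simp add: wiener_def)

text \<open>A linear combination of Wiener integrals is the Wiener integral of the combined kernel;
  expanding the squared norm of that kernel yields the covariance matrix.\<close>

lemma wiener_joint_gaussian:
  assumes J: "wiener J g" and K: "wiener K h"
  shows "joint_gaussian N J K (\<integral>x. (g x)\<^sup>2 \<partial>lborel) (\<integral>x. g x * h x \<partial>lborel) (\<integral>x. (h x)\<^sup>2 \<partial>lborel)"
  unfolding joint_gaussian_def
proof (intro allI)
  fix x y
  note sq = wiener_square_integrable[OF J] wiener_square_integrable[OF K]
  have "(\<integral>z. (x * g z + y * h z)\<^sup>2 \<partial>lborel) = (\<integral>z. x\<^sup>2 * (g z)\<^sup>2 + 2 * x * y * (g z * h z) + y\<^sup>2 * (h z)\<^sup>2 \<partial>lborel)"
    by (simp add: power2_sum power_mult_distrib algebra_simps)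
  also have "\<dots> = x\<^sup>2 * (\<integral>x. (g x)\<^sup>2 \<partial>lborel) + 2 * x * y * (\<integral>x. g x * h x \<partial>lborel) + y\<^sup>2 * (\<integral>x. (h x)\<^sup>2 \<partial>lborel)"
    using sq square_integrable_mult[OF sq] by (simp add: square_integrable_def)
  finally show "gaussian_rv N (x\<^sup>2 * (\<integral>x. (g x)\<^sup>2 \<partial>lborel) + 2 * x * y * (\<integral>x. g x * h x \<partial>lborel) + y\<^sup>2 * (\<integral>x. (h x)\<^sup>2 \<partial>lborel))
     (\<lambda>\<omega>. x * J \<omega> + y * K \<omega>)"
    using wiener_gaussian[OF wiener_lin[OF J K, of x y]] by simp
qed

end

section \<open>The stationary Ornstein-Uhlenbeck process\<close>

text \<open>The factor \<open>sqrt (2 * \<gamma>)\<close> gives the kernel norm 1, so that the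
  process has unit variance and Hermite polynomials apply to it directly.\<close>

definition ou_kernel :: "real \<Rightarrow> real \<Rightarrow> real \<Rightarrow> real" where
  "ou_kernel \<gamma> s x = sqrt (2 * \<gamma>) * exp (- \<gamma> * (s - x)) * indicator {..s} x"

text \<open>Mesh \<open>1 / 4 ^ n\<close> starting at \<open>- n\<close>; the index
  \<open>Suc n * 4 ^ n\<close> is the time 1. The cell at the jump of the kernel costs the square
  root of the mesh in norm, and with base 4 this is the summable \<open>1 / 2 ^ n\<close>.\<close>

definition ou_grid :: "nat \<Rightarrow> nat \<Rightarrow> real" where
  "ou_grid n j = real j / 4 ^ n - real n"

text \<open>The kernel increases up to its jump at \<open>s\<close>. Its value at the left endpoint,
  taken only on cells that lie entirely to the left of \<open>s\<close>, therefore approximates it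
  from below.\<close>

definition ou_coeff :: "real \<Rightarrow> nat \<Rightarrow> real \<Rightarrow> nat \<Rightarrow> real" where
  "ou_coeff \<gamma> n s j = (if ou_grid n (Suc j) \<le> s then sqrt (2 * \<gamma>) * exp (- \<gamma> * (s - ou_grid n j)) else 0)"

definition ou_step :: "real \<Rightarrow> nat \<Rightarrow> real \<Rightarrow> real \<Rightarrow> real" where
  "ou_step \<gamma> n s x = (\<Sum>j<Suc n * 4 ^ n. ou_coeff \<gamma> n s j * indicator {ou_grid n j<..ou_grid n (Suc j)} x)"

lemma ou_kernel_measurable [measurable]:
  "(\<lambda>p. ou_kernel \<gamma> (fst p) (snd p)) \<in> borel_measurable (borel \<Otimes>\<^sub>M borel)"
  "ou_kernel \<gamma> s \<in> borel_measurable borel" 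
proof -
  have "(\<lambda>p. ou_kernel \<gamma> (fst p) (snd p)) = (\<lambda>p. sqrt (2 * \<gamma>) * exp (- \<gamma> * (fst p - snd p)) * indicator {p. snd p \<le> fst p} p)"
    by (auto simp: ou_kernel_def fun_eq_iff indicator_def)
  moreover have "\<dots> \<in> borel_measurable (borel \<Otimes>\<^sub>M borel)" by measurable
  ultimately show "(\<lambda>p. ou_kernel \<gamma> (fst p) (snd p)) \<in> borel_measurable (borel \<Otimes>\<^sub>M borel)" by simp
  show "ou_kernel \<gamma> s \<in> borel_measurable borel"
    unfolding ou_kernel_def by measurable
qed

lemma ou_grid_strict_mono: "strict_mono_on A (ou_grid n)"
  by (auto simp: strict_mono_on_def ou_grid_def divide_strict_right_mono)

text \<open>Both factors live to the left of \<open>min s u\<close>, where their product is a single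
  exponential. The value is the covariance of the stationary Ornstein-Uhlenbeck process.\<close>

lemma has_bochner_integral_ou_kernel_mult:
  assumes \<gamma>: "\<gamma> > 0"
  shows "has_bochner_integral lborel (\<lambda>x. ou_kernel \<gamma> s x * ou_kernel \<gamma> u x) (exp (- \<gamma> * \<bar>s - u\<bar>))"
proof -
  have "has_bochner_integral lborel (\<lambda>x. 2 * \<gamma> * exp (- \<gamma> * (s + u)) * (exp (2 * \<gamma> * x) * indicator {..min s u} x))
     (2 * \<gamma> * exp (- \<gamma> * (s + u)) * (exp (2 * \<gamma> * min s u) / (2 * \<gamma>)))"
    using \<gamma> by (intro has_bochner_integral_mult_right has_bochner_integral_exp_left) auto
  also have "2 * \<gamma> * exp (- \<gamma> * (s + u)) * (exp (2 * \<gamma> * min s u) / (2 * \<gamma>)) = exp (- \<gamma> * \<bar>s - u\<bar>)"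
    using \<gamma> by (simp add: exp_add[symmetric] min_def abs_real_def) (simp add: algebra_simps)
  also have "(\<lambda>x. 2 * \<gamma> * exp (- \<gamma> * (s + u)) * (exp (2 * \<gamma> * x) * indicator {..min s u} x)) =
     (\<lambda>x. ou_kernel \<gamma> s x * ou_kernel \<gamma> u x)"
    using \<gamma> by (auto simp: ou_kernel_def fun_eq_iff indicator_def exp_add[symmetric] algebra_simps)
  finally show ?thesis .
qed

lemma ou_kernel_square_integrable: "\<gamma> > 0 \<Longrightarrow> square_integrable lborel (ou_kernel \<gamma> s)"
  using has_bochner_integral_ou_kernel_mult[of \<gamma> s s]
  by (auto simp: square_integrable_def power2_eq_square has_bochner_integral_iff)

lemma ou_kernel_norm: "\<gamma> > 0 \<Longrightarrow> (\<integral>x. (ou_kernel \<gamma> s x)\<^sup>2 \<partial>lborel) = 1"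
  using has_bochner_integral_ou_kernel_mult[of \<gamma> s s]
  by (auto simp: power2_eq_square has_bochner_integral_iff)

section \<open>Step approximation of the Ornstein-Uhlenbeck kernel\<close>

text \<open>In the first case \<open>y\<close> is the left endpoint of the cell that contains
  \<open>x\<close>. The second case collects the points before the start of the grid and those
  closer than one mesh to \<open>s\<close> or beyond it.\<close>

lemma ou_step_cases:
  assumes s: "s \<le> 1"
  obtains y where "y < x" "x \<le> y + 1 / 4 ^ n" "y + 1 / 4 ^ n \<le> s" "ou_step \<gamma> n s x = sqrt (2 * \<gamma>) * exp (- \<gamma> * (s - y))"
  | "ou_step \<gamma> n s x = 0" "x \<le> - real n \<or> s < x + 1 / 4 ^ n"
proof -
  have disj: "disjoint_family_on (\<lambda>j. {ou_grid n j<..ou_grid n (Suc j)}) {..<Suc n * 4 ^ n}"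
    by (rule strict_mono_cells_disjoint[OF ou_grid_strict_mono])
  have Suc: "ou_grid n (Suc j) = ou_grid n j + 1 / 4 ^ n" for j
    by (simp add: ou_grid_def add_divide_distrib)
  show thesis
  proof (cases "- real n < x \<and> x \<le> 1")
    case True
    \<comment> \<open>The cells are open on the left and closed on the right, so the index is the
      ceiling minus one and not the floor.\<close>
    define j where "j = nat (\<lceil>(x + real n) * 4 ^ n\<rceil> - 1)"
    have pos: "0 < (x + real n) * 4 ^ n" using True by simp
    then have j: "real j = of_int \<lceil>(x + real n) * 4 ^ n\<rceil> - 1" by (simp add: j_def)
    then have j1: "real j < (x + real n) * 4 ^ n" "(x + real n) * 4 ^ n \<le> real j + 1" by linarith+
    have j2: "ou_grid n j < x" "x \<le> ou_grid n j + 1 / 4 ^ n"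
      using j1 by (simp_all add: ou_grid_def field_simps)
    have "(x + real n) * 4 ^ n \<le> (1 + real n) * 4 ^ n" using True by simp
    then have "real j < (1 + real n) * 4 ^ n" using j1(1) by linarith
    then have "real j < real (Suc n * 4 ^ n)" by (simp add: algebra_simps)
    then have j3: "j < Suc n * 4 ^ n" by (simp only: of_nat_less_iff)
    have st: "ou_step \<gamma> n s x = ou_coeff \<gamma> n s j"
      unfolding ou_step_def
    proof (rule sum_indicator_disjoint_family[OF disj])
      show "x \<in> {ou_grid n j<..ou_grid n (Suc j)}" using j2 Suc by auto
    qed (use j3 in auto)
    show thesis
    proof (cases "ou_grid n (Suc j) \<le> s")
      case True
      show thesis by (rule that(1)[of "ou_grid n j"]) (use st True j2 Suc in \<open>auto simp: ou_coeff_def\<close>)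
    next
      case False
      show thesis by (rule that(2)) (use st False j2 Suc in \<open>auto simp: ou_coeff_def\<close>)
    qed
  next
    case False
    have "ou_step \<gamma> n s x = 0"
      unfolding ou_step_def
    proof (rule sum.neutral, rule ballI)
      fix j assume j: "j \<in> {..<Suc n * 4 ^ n}"
      have "Suc j \<le> Suc n * 4 ^ n" using j by simp
      then have "real (Suc j) \<le> real (Suc n * 4 ^ n)" by (simp only: of_nat_le_iff)
      then have "real (Suc j) / 4 ^ n \<le> 1 + real n" by (simp add: field_simps)
      then have "ou_grid n (Suc j) \<le> 1" "- real n \<le> ou_grid n j" by (simp_all add: ou_grid_def)
      then show "ou_coeff \<gamma> n s j * indicator {ou_grid n j<..ou_grid n (Suc j)} x = 0"
        using False by auto
    qed
    moreover have "x \<le> - real n \<or> s < x + 1 / 4 ^ n"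
      using False s by (smt (verit) divide_pos_pos zero_less_power)
    ultimately show thesis by (rule that(2))
  qed
qed

lemma ou_step_bounds:
  assumes "\<gamma> > 0" "s \<le> 1"
  shows "0 \<le> ou_step \<gamma> n s x" "ou_step \<gamma> n s x \<le> ou_kernel \<gamma> s x"
  by (cases rule: ou_step_cases[OF assms(2), of x n \<gamma>]; use assms(1) in \<open>simp add: ou_kernel_def indicator_def\<close>)+

text \<open>Three sources of error, one per summand: the relative error within a cell, at most
  \<open>\<gamma> / 4 ^ n\<close> by \<open>1 - exp (- z) \<le> z\<close>; the incomplete cell next
  to the jump at \<open>s\<close>; and the past before time \<open>- n\<close>, where the
  approximation is 0.\<close>

lemma ou_step_error:
  assumes \<gamma>: "\<gamma> > 0" and s: "s \<le> 1"
  shows "(ou_kernel \<gamma> s x - ou_step \<gamma> n s x)\<^sup>2 \<le> (\<gamma> / 4 ^ n)\<^sup>2 * (ou_kernel \<gamma> s x)\<^sup>2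
     + 2 * \<gamma> * indicator {s - 1 / 4 ^ n<..s} x + (ou_kernel \<gamma> s x)\<^sup>2 * indicator {..- real n} x"
proof -
  have pos: "0 \<le> (\<gamma> / 4 ^ n)\<^sup>2 * (ou_kernel \<gamma> s x)\<^sup>2" "0 \<le> (ou_kernel \<gamma> s x)\<^sup>2 * indicator {..- real n} x"
    "0 \<le> 2 * \<gamma> * indicator {s - 1 / 4 ^ n<..s} x" using \<gamma> by simp_all
  show ?thesis
  proof (cases rule: ou_step_cases[OF s, of x n \<gamma>])
    case (1 y)
    have K: "ou_kernel \<gamma> s x = sqrt (2 * \<gamma>) * exp (- \<gamma> * (s - x))" using 1 by (simp add: ou_kernel_def)
    have "exp (- \<gamma> * (s - y)) = exp (- \<gamma> * (s - x)) * exp (- \<gamma> * (x - y))"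
      by (simp add: exp_add[symmetric] algebra_simps)
    then have "ou_kernel \<gamma> s x - ou_step \<gamma> n s x = ou_kernel \<gamma> s x * (1 - exp (- \<gamma> * (x - y)))"
      unfolding K 1 by (simp add: algebra_simps)
    moreover have "0 \<le> 1 - exp (- \<gamma> * (x - y))" using 1 \<gamma> by simp
    moreover have "1 - exp (- \<gamma> * (x - y)) \<le> \<gamma> / 4 ^ n"
    proof -
      have "1 - exp (- \<gamma> * (x - y)) \<le> \<gamma> * (x - y)" using exp_ge_add_one_self[of "- \<gamma> * (x - y)"] by linarith
      also have "\<dots> \<le> \<gamma> * (1 / 4 ^ n)" using 1 \<gamma> by (intro mult_left_mono) auto
      finally show ?thesis by simp
    qed
    ultimately have "(ou_kernel \<gamma> s x - ou_step \<gamma> n s x)\<^sup>2 \<le> (\<gamma> / 4 ^ n)\<^sup>2 * (ou_kernel \<gamma> s x)\<^sup>2"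
      by (simp add: power_mult_distrib mult.commute mult_left_mono power_mono)
    then show ?thesis using pos by linarith
  next
    case 2
    from 2(2) show ?thesis
    proof
      assume "x \<le> - real n"
      then show ?thesis using pos 2(1) by simp
    next
      assume "s < x + 1 / 4 ^ n"
      show ?thesis
      proof (cases "x \<le> s")
        case True
        have "(ou_kernel \<gamma> s x)\<^sup>2 = 2 * \<gamma> * exp (- \<gamma> * (s - x)) ^ 2"
          using True \<gamma> by (simp add: ou_kernel_def power_mult_distrib)
        also have "\<dots> \<le> 2 * \<gamma> * 1" using True \<gamma> by (intro mult_left_mono power_le_one) auto
        also have "\<dots> = 2 * \<gamma> * indicator {s - 1 / 4 ^ n<..s} x" using True \<open>s < x + 1 / 4 ^ n\<close> by simp
        finally have "(ou_kernel \<gamma> s x)\<^sup>2 \<le> 2 * \<gamma> * indicator {s - 1 / 4 ^ n<..s} x" .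
        then show ?thesis using pos(1,2) unfolding 2(1) diff_0_right by linarith
      next
        case False
        then have "ou_kernel \<gamma> s x = 0" by (simp add: ou_kernel_def)
        then show ?thesis using pos 2(1) by simp
      qed
    qed
  qed
qed

lemma ou_step_measurable [measurable]:
  "(\<lambda>p. ou_step \<gamma> n (fst p) (snd p)) \<in> borel_measurable (borel \<Otimes>\<^sub>M borel)"
  "ou_step \<gamma> n s \<in> borel_measurable borel"
  unfolding ou_step_def ou_coeff_def by measurable

text \<open>Integrates the pointwise estimate. The tail of the past is uniform in \<open>s\<close>
  because \<open>s \<ge> 0\<close>. The three terms are summable in \<open>n\<close>, which later
  upgrades mean-square approximation to almost sure convergence.\<close>

lemma ou_step_l2_error:
  assumes \<gamma>: "\<gamma> > 0" and s: "0 \<le> s" "s \<le> 1"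
  shows "l2norm lborel (\<lambda>x. ou_step \<gamma> n s x - ou_kernel \<gamma> s x) \<le> \<gamma> / 4 ^ n + sqrt (2 * \<gamma>) / 2 ^ n + exp (- \<gamma>) ^ n"
proof -
  let ?K = "ou_kernel \<gamma> s"
  note K = ou_kernel_square_integrable[OF \<gamma>, of s]
  have tail: "has_bochner_integral lborel (\<lambda>x. (?K x)\<^sup>2 * indicator {..- real n} x) (exp (- 2 * \<gamma> * (s + real n)))"
  proof -
    have "has_bochner_integral lborel (\<lambda>x. 2 * \<gamma> * exp (- 2 * \<gamma> * s) * (exp (2 * \<gamma> * x) * indicator {..- real n} x))
     (2 * \<gamma> * exp (- 2 * \<gamma> * s) * (exp (2 * \<gamma> * (- real n)) / (2 * \<gamma>)))"
      using \<gamma> by (intro has_bochner_integral_mult_right has_bochner_integral_exp_left) auto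
    also have "2 * \<gamma> * exp (- 2 * \<gamma> * s) * (exp (2 * \<gamma> * (- real n)) / (2 * \<gamma>)) = exp (- 2 * \<gamma> * (s + real n))"
      using \<gamma> by (simp add: exp_add[symmetric] algebra_simps)
    also have "(\<lambda>x. 2 * \<gamma> * exp (- 2 * \<gamma> * s) * (exp (2 * \<gamma> * x) * indicator {..- real n} x)) =
      (\<lambda>x. (?K x)\<^sup>2 * indicator {..- real n} x)"
      using \<gamma> s by (auto simp: ou_kernel_def fun_eq_iff indicator_def power_mult_distrib exp_add[symmetric] exp_double[symmetric] algebra_simps)
    finally show ?thesis .
  qed
  have tail_le: "exp (- 2 * \<gamma> * (s + real n)) \<le> (exp (- \<gamma>) ^ n)\<^sup>2"
    using \<gamma> s by (simp add: exp_of_nat_mult[symmetric] exp_double[symmetric] algebra_simps)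
  have sq: "square_integrable lborel (\<lambda>x. ou_step \<gamma> n s x - ?K x)"
  proof (rule square_integrable_bound[OF K])
    show "AE x in lborel. \<bar>ou_step \<gamma> n s x - ?K x\<bar> \<le> \<bar>?K x\<bar>"
      using ou_step_bounds[OF \<gamma> s(2), of n] by (intro AE_I2) (simp add: abs_le_iff, smt (verit))
  qed simp
  have "(l2norm lborel (\<lambda>x. ou_step \<gamma> n s x - ?K x))\<^sup>2 = (\<integral>x. (?K x - ou_step \<gamma> n s x)\<^sup>2 \<partial>lborel)"
    by (simp add: l2norm_power2 power2_commute)
  also have "\<dots> \<le> (\<integral>x. (\<gamma> / 4 ^ n)\<^sup>2 * (?K x)\<^sup>2 + 2 * \<gamma> * indicator {s - 1 / 4 ^ n<..s} x + (?K x)\<^sup>2 * indicator {..- real n} x \<partial>lborel)"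
    using sq K tail ou_step_error[OF \<gamma> s(2), of _ n]
    by (intro integral_mono) (auto simp: square_integrable_def power2_commute has_bochner_integral_iff)
  also have "\<dots> = (\<gamma> / 4 ^ n)\<^sup>2 + 2 * \<gamma> * (1 / 4 ^ n) + exp (- 2 * \<gamma> * (s + real n))"
    using K tail ou_kernel_norm[OF \<gamma>, of s] by (simp add: square_integrable_def has_bochner_integral_iff)
  also have "\<dots> \<le> (\<gamma> / 4 ^ n)\<^sup>2 + (sqrt (2 * \<gamma>) / 2 ^ n)\<^sup>2 + (exp (- \<gamma>) ^ n)\<^sup>2"
  proof -
    have "(sqrt (2 * \<gamma>) / 2 ^ n)\<^sup>2 = 2 * \<gamma> * (1 / 4 ^ n)"
    proof -
      have "(2 ^ n)\<^sup>2 = (4::real) ^ n" unfolding power2_eq_square power_mult_distrib[symmetric] by simp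
      then show ?thesis using \<gamma> by (simp add: power_divide)
    qed
    then show ?thesis using tail_le by linarith
  qed
  also have "\<dots> \<le> (\<gamma> / 4 ^ n + sqrt (2 * \<gamma>) / 2 ^ n + exp (- \<gamma>) ^ n)\<^sup>2"
  proof -
    have "a\<^sup>2 + b\<^sup>2 + c\<^sup>2 \<le> (a + b + c)\<^sup>2" if "0 \<le> a" "0 \<le> b" "0 \<le> c" for a b c :: real
      using mult_nonneg_nonneg[OF that(1,2)] mult_nonneg_nonneg[OF that(1,3)] mult_nonneg_nonneg[OF that(2,3)]
      by (simp add: power2_eq_square algebra_simps)
    note sq = this
    show ?thesis by (rule sq) (use \<gamma> in auto)
  qed
  finally show ?thesis by (rule power2_le_imp_le) (use \<gamma> in auto)
qed

section \<open>Averages over the unit interval\<close>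

text \<open>Tonelli: a bound on the inner integral that is uniform in \<open>s\<close> can be
  integrated over the probability measure \<open>M\<close>.\<close>

lemma square_integrable_pairI:
  assumes "prob_space M" "sigma_finite_measure R"
    and [measurable]: "g \<in> borel_measurable (M \<Otimes>\<^sub>M R)"
    and sq: "\<And>s. s \<in> space M \<Longrightarrow> square_integrable R (\<lambda>x. g (s, x))"
    and bd: "\<And>s. s \<in> space M \<Longrightarrow> (\<integral>x. (g (s, x))\<^sup>2 \<partial>R) \<le> C"
  shows "square_integrable (M \<Otimes>\<^sub>M R) g" "(l2norm (M \<Otimes>\<^sub>M R) g)\<^sup>2 = (\<integral>s. (l2norm R (\<lambda>x. g (s, x)))\<^sup>2 \<partial>M)"
proof -
  interpret M: prob_space M by fact
  interpret R: sigma_finite_measure R by fact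
  interpret pair_sigma_finite M R ..
  have "(\<integral>\<^sup>+p. ennreal ((g p)\<^sup>2) \<partial>(M \<Otimes>\<^sub>M R)) = (\<integral>\<^sup>+s. (\<integral>\<^sup>+x. ennreal ((g (s, x))\<^sup>2) \<partial>R) \<partial>M)"
    by (subst R.nn_integral_fst[symmetric]) auto
  also have "\<dots> \<le> (\<integral>\<^sup>+s. ennreal C \<partial>M)"
  proof (rule nn_integral_mono)
    fix s assume s: "s \<in> space M"
    have "(\<integral>\<^sup>+x. ennreal ((g (s, x))\<^sup>2) \<partial>R) = ennreal (\<integral>x. (g (s, x))\<^sup>2 \<partial>R)"
      using sq[OF s] by (simp add: nn_integral_eq_integral square_integrable_def)
    then show "(\<integral>\<^sup>+x. ennreal ((g (s, x))\<^sup>2) \<partial>R) \<le> ennreal C" using bd[OF s] by (simp add: ennreal_leI)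
  qed
  also have "\<dots> < \<infinity>" by (simp add: M.emeasure_space_1)
  finally show *: "square_integrable (M \<Otimes>\<^sub>M R) g" by (intro square_integrableI_nn) auto
  then have "integrable (M \<Otimes>\<^sub>M R) (\<lambda>p. (g p)\<^sup>2)" by (simp add: square_integrable_def)
  from integral_fst'[OF this] show "(l2norm (M \<Otimes>\<^sub>M R) g)\<^sup>2 = (\<integral>s. (l2norm R (\<lambda>x. g (s, x)))\<^sup>2 \<partial>M)"
    by (simp add: l2norm_power2)
qed

text \<open>Averaging over a probability measure contracts the mean-square norm: Cauchy-Schwarz in
  \<open>s\<close> for almost every \<open>x\<close>, followed by Fubini.\<close>

lemma average_square_integrable:
  assumes "prob_space M" "sigma_finite_measure R" and g: "square_integrable (M \<Otimes>\<^sub>M R) g"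
  shows "square_integrable R (\<lambda>x. \<integral>s. g (s, x) \<partial>M)"
    and "l2norm R (\<lambda>x. \<integral>s. g (s, x) \<partial>M) \<le> l2norm (M \<Otimes>\<^sub>M R) g"
    and "AE x in R. square_integrable M (\<lambda>s. g (s, x))"
proof -
  interpret M: prob_space M by fact
  interpret R: sigma_finite_measure R by fact
  interpret pair_sigma_finite M R ..
  have gm [measurable]: "g \<in> borel_measurable (M \<Otimes>\<^sub>M R)" and gi: "integrable (M \<Otimes>\<^sub>M R) (\<lambda>p. (g p)\<^sup>2)"
    using g by (auto simp: square_integrable_def)
  have gi': "integrable (M \<Otimes>\<^sub>M R) (\<lambda>(s, x). (g (s, x))\<^sup>2)" using gi by (simp add: case_prod_unfold)
  have m [measurable]: "(\<lambda>x. \<integral>s. g (s, x) \<partial>M) \<in> borel_measurable R"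
    by (rule M.borel_measurable_lebesgue_integral) simp
  show ae: "AE x in R. square_integrable M (\<lambda>s. g (s, x))"
    using AE_integrable_snd[OF gi'] AE_space by eventually_elim (auto simp: square_integrable_def)
  have bd: "AE x in R. (\<integral>s. g (s, x) \<partial>M)\<^sup>2 \<le> (\<integral>s. (g (s, x))\<^sup>2 \<partial>M)"
    using ae
  proof eventually_elim
    fix x assume sq: "square_integrable M (\<lambda>s. g (s, x))"
    have "\<bar>\<integral>s. g (s, x) \<partial>M\<bar> \<le> l2norm M (\<lambda>s. g (s, x))"
      by (rule order_trans[OF integral_abs_bound M.l1_le_l2norm[OF sq]])
    then have "\<bar>\<integral>s. g (s, x) \<partial>M\<bar>\<^sup>2 \<le> (l2norm M (\<lambda>s. g (s, x)))\<^sup>2" by (intro power_mono) auto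
    then show "(\<integral>s. g (s, x) \<partial>M)\<^sup>2 \<le> (\<integral>s. (g (s, x))\<^sup>2 \<partial>M)" by (simp add: l2norm_power2)
  qed
  note int = integrable_snd[OF gi']
  show sq: "square_integrable R (\<lambda>x. \<integral>s. g (s, x) \<partial>M)"
    unfolding square_integrable_def
  proof
    show "integrable R (\<lambda>x. (\<integral>s. g (s, x) \<partial>M)\<^sup>2)"
      by (rule Bochner_Integration.integrable_bound[OF int]) (use bd in auto)
  qed simp
  have "(l2norm R (\<lambda>x. \<integral>s. g (s, x) \<partial>M))\<^sup>2 \<le> (\<integral>x. (\<integral>s. (g (s, x))\<^sup>2 \<partial>M) \<partial>R)"
    unfolding l2norm_power2 using sq int bd by (intro integral_mono_AE) (auto simp: square_integrable_def)
  also have "\<dots> = (l2norm (M \<Otimes>\<^sub>M R) g)\<^sup>2"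
    using integral_snd[OF gi'] by (simp add: l2norm_power2 case_prod_unfold)
  finally show "l2norm R (\<lambda>x. \<integral>s. g (s, x) \<partial>M) \<le> l2norm (M \<Otimes>\<^sub>M R) g"
    by (rule power2_le_imp_le) simp
qed

lemma average_inner:
  assumes "prob_space M" "sigma_finite_measure R" and g: "square_integrable (M \<Otimes>\<^sub>M R) g"
    and h: "square_integrable R h"
  shows "(\<integral>x. (\<integral>s. g (s, x) \<partial>M) * h x \<partial>R) = (\<integral>s. (\<integral>x. g (s, x) * h x \<partial>R) \<partial>M)"
proof -
  interpret M: prob_space M by fact
  interpret R: sigma_finite_measure R by fact
  interpret pair_sigma_finite M R ..
  have [measurable]: "h \<in> borel_measurable R" using h by (simp add: square_integrable_def)
  have "square_integrable (M \<Otimes>\<^sub>M R) (\<lambda>p. h (snd p))"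
    by (rule square_integrable_pairI(1)[OF assms(1,2), of _ "\<integral>x. (h x)\<^sup>2 \<partial>R"]) (use h in auto)
  from square_integrable_mult[OF g this]
  have "integrable (M \<Otimes>\<^sub>M R) (\<lambda>(s, x). g (s, x) * h x)" by (simp add: case_prod_unfold)
  from Fubini_integral[OF this] show ?thesis by simp
qed

text \<open>Two applications of \<open>average_inner\<close>, first with the average itself and then
  with a single section as the second factor. It evaluates both the variance of time integrals and
  the norm of their kernels as double time integrals of covariances.\<close>

lemma average_l2norm:
  assumes "prob_space M" "sigma_finite_measure R" and g: "square_integrable (M \<Otimes>\<^sub>M R) g"
    and sq: "\<And>s. s \<in> space M \<Longrightarrow> square_integrable R (\<lambda>x. g (s, x))"
  shows "(l2norm R (\<lambda>x. \<integral>s. g (s, x) \<partial>M))\<^sup>2 = (\<integral>s. (\<integral>u. (\<integral>x. g (s, x) * g (u, x) \<partial>R) \<partial>M) \<partial>M)"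
proof -
  note A = average_square_integrable(1)[OF assms(1-3)]
  have "(l2norm R (\<lambda>x. \<integral>s. g (s, x) \<partial>M))\<^sup>2 = (\<integral>x. (\<integral>s. g (s, x) \<partial>M) * (\<integral>s. g (s, x) \<partial>M) \<partial>R)"
    by (simp only: l2norm_power2) (simp only: power2_eq_square)
  also have "\<dots> = (\<integral>s. (\<integral>x. g (s, x) * (\<integral>u. g (u, x) \<partial>M) \<partial>R) \<partial>M)"
    by (rule average_inner[OF assms(1-3) A])
  also have "\<dots> = (\<integral>s. (\<integral>u. (\<integral>x. g (s, x) * g (u, x) \<partial>R) \<partial>M) \<partial>M)"
  proof (rule Bochner_Integration.integral_cong[OF refl])
    fix s assume s: "s \<in> space M"
    show "(\<integral>x. g (s, x) * (\<integral>u. g (u, x) \<partial>M) \<partial>R) = (\<integral>u. (\<integral>x. g (s, x) * g (u, x) \<partial>R) \<partial>M)"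
      using average_inner[OF assms(1-3) sq[OF s]] by (simp add: mult.commute)
  qed
  finally show ?thesis .
qed

section \<open>The time interval as a probability space\<close>

definition unit_time :: "real measure" where
  "unit_time = restrict_space lborel {0..1}"

lemma space_unit_time [simp]: "space unit_time = {0..1}"
  by (simp add: unit_time_def space_restrict_space)

lemma unit_time_prob_space: "prob_space unit_time"
  by (rule prob_spaceI) (simp add: unit_time_def space_restrict_space emeasure_restrict_space)

lemma measurable_unit_time_id [measurable]: "(\<lambda>s. s) \<in> measurable unit_time borel"
  unfolding unit_time_def by (rule measurable_restrict_space1) simp

lemma measurable_unit_time_pair:
  assumes "f \<in> borel_measurable (borel \<Otimes>\<^sub>M R)"
  shows "f \<in> borel_measurable (unit_time \<Otimes>\<^sub>M R)"
proof -
  have "(\<lambda>p. (fst p, snd p)) \<in> measurable (unit_time \<Otimes>\<^sub>M R) (borel \<Otimes>\<^sub>M R)"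
    by (intro measurable_Pair measurable_compose[OF measurable_fst measurable_unit_time_id] measurable_snd)
  from measurable_compose[OF this assms] show ?thesis by simp
qed

lemma integral_unit_time:
  fixes f :: "real \<Rightarrow> real"
  shows "(\<integral>s. f s \<partial>unit_time) = (LINT s:{0..1}|lborel. f s)"
  unfolding unit_time_def set_lebesgue_integral_def by (rule Bochner_Integration.integral_restrict_space) simp

interpretation unit_time: prob_space unit_time
  by (rule unit_time_prob_space)

section \<open>Construction of the process from Brownian increments\<close>

locale ou_process = brownian N B for N :: "'b measure" and B +
  fixes \<gamma> :: real
  assumes \<gamma>_pos: "\<gamma> > 0"
begin

definition ou_sum :: "nat \<Rightarrow> real \<Rightarrow> 'b \<Rightarrow> real" where
  "ou_sum n s \<omega> = (\<Sum>j<Suc n * 4 ^ n. ou_coeff \<gamma> n s j * (B (ou_grid n (Suc j)) \<omega> - B (ou_grid n j) \<omega>))"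

text \<open>The pointwise limit of explicit sums is jointly measurable in time and outcome. On the
  exceptional null set of outcomes \<open>lim\<close> returns some fixed value, which does not
  disturb measurability.\<close>

definition OU :: "real \<Rightarrow> 'b \<Rightarrow> real" where
  "OU s \<omega> = lim (\<lambda>n. ou_sum n s \<omega>)"

lemma ou_sum_step_pair: "step_pair (ou_sum n s) (ou_step \<gamma> n s)"
proof -
  have "ou_grid n j \<le> ou_grid n (Suc j)" for j by (simp add: ou_grid_def divide_right_mono)
  then show ?thesis
    unfolding ou_sum_def[abs_def] ou_step_def[abs_def]
    by (intro step_pair_sum step_pair_increment)
qed

lemma ou_sum_measurable [measurable]:
  "(\<lambda>p. ou_sum n (fst p) (snd p)) \<in> borel_measurable (borel \<Otimes>\<^sub>M N)"
  "ou_sum n s \<in> borel_measurable N"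
  unfolding ou_sum_def ou_coeff_def by measurable

lemma OU_measurable [measurable]:
  "(\<lambda>p. OU (fst p) (snd p)) \<in> borel_measurable (borel \<Otimes>\<^sub>M N)"
  "OU s \<in> borel_measurable N"
  unfolding OU_def by measurable

lemma ou_error_summable: "summable (\<lambda>n. \<gamma> / 4 ^ n + sqrt (2 * \<gamma>) / 2 ^ n + exp (- \<gamma>) ^ n)"
proof -
  have "(\<lambda>n. \<gamma> / 4 ^ n + sqrt (2 * \<gamma>) / 2 ^ n + exp (- \<gamma>) ^ n)
      = (\<lambda>n. \<gamma> * (1 / 4) ^ n + sqrt (2 * \<gamma>) * (1 / 2) ^ n + exp (- \<gamma>) ^ n)"
    unfolding power_one_over by simp
  moreover have "summable (\<lambda>n. \<gamma> * (1 / 4) ^ n + sqrt (2 * \<gamma>) * (1 / 2) ^ n + exp (- \<gamma>) ^ n)"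
    using \<gamma>_pos by (intro summable_add summable_mult summable_geometric) auto
  ultimately show ?thesis by simp
qed

text \<open>The mean absolute value of successive differences is bounded by the summable
  approximation errors. Hence the series of absolute differences has a finite integral, is finite
  almost surely, and the sums converge by telescoping.\<close>

lemma OU_AE_limit:
  assumes s: "0 \<le> s" "s \<le> 1"
  shows "AE \<omega> in N. (\<lambda>n. ou_sum n s \<omega>) \<longlonglongrightarrow> OU s \<omega>"
proof -
  define e where "e n = \<gamma> / 4 ^ n + sqrt (2 * \<gamma>) / 2 ^ n + exp (- \<gamma>) ^ n" for n
  have e0: "0 \<le> e n" for n using \<gamma>_pos by (simp add: e_def)
  have se: "summable e" unfolding e_def by (rule ou_error_summable)
  let ?d = "\<lambda>n \<omega>. ou_sum (Suc n) s \<omega> - ou_sum n s \<omega>"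
  have d: "step_pair (?d n) (\<lambda>x. ou_step \<gamma> (Suc n) s x - ou_step \<gamma> n s x)" for n
    using step_pair_add[OF ou_sum_step_pair[of "Suc n" s] step_pair_cmult[OF ou_sum_step_pair[of n s], of "- 1"]] by simp
  have sqd: "square_integrable N (?d n)" for n
    using gaussian_rv_integrable_power[OF step_pair_gaussian[OF d], of n 2] by (simp add: square_integrable_def)
  have E: "(\<integral>\<omega>. \<bar>?d n \<omega>\<bar> \<partial>N) \<le> e (Suc n) + e n" for n
  proof -
    have "(\<integral>\<omega>. \<bar>?d n \<omega>\<bar> \<partial>N) \<le> l2norm N (?d n)" by (rule l1_le_l2norm[OF sqd])
    also have "\<dots> = l2norm lborel (\<lambda>x. ou_step \<gamma> (Suc n) s x - ou_step \<gamma> n s x)"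
      using gaussian_rv_variance[OF prob_space_axioms step_pair_gaussian[OF d]] by (simp add: l2norm_def)
    also have "\<dots> \<le> l2norm lborel (\<lambda>x. ou_step \<gamma> (Suc n) s x - ou_kernel \<gamma> s x) + l2norm lborel (\<lambda>x. ou_kernel \<gamma> s x - ou_step \<gamma> n s x)"
      by (intro l2norm_triangle_diff step_pair_square_integrable[OF ou_sum_step_pair] ou_kernel_square_integrable \<gamma>_pos)
    also have "\<dots> \<le> e (Suc n) + e n"
      using ou_step_l2_error[OF \<gamma>_pos s, of n] ou_step_l2_error[OF \<gamma>_pos s, of "Suc n"]
      unfolding l2norm_minus_commute[of lborel "ou_kernel \<gamma> s"] e_def by linarith
    finally show ?thesis .
  qed
  have "(\<integral>\<^sup>+\<omega>. (\<Sum>n. ennreal \<bar>?d n \<omega>\<bar>) \<partial>N) = (\<Sum>n. \<integral>\<^sup>+\<omega>. ennreal \<bar>?d n \<omega>\<bar> \<partial>N)"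
    by (rule nn_integral_suminf) simp
  also have "\<dots> \<le> (\<Sum>n. ennreal (e (Suc n) + e n))"
  proof (rule suminf_le)
    fix n
    have "(\<integral>\<^sup>+\<omega>. ennreal \<bar>?d n \<omega>\<bar> \<partial>N) = ennreal (\<integral>\<omega>. \<bar>?d n \<omega>\<bar> \<partial>N)"
      using square_integrable_L1[OF sqd[of n]] by (intro nn_integral_eq_integral) auto
    then show "(\<integral>\<^sup>+\<omega>. ennreal \<bar>?d n \<omega>\<bar> \<partial>N) \<le> ennreal (e (Suc n) + e n)" using E[of n] by (simp add: ennreal_leI)
  qed auto
  also have "\<dots> < \<infinity>"
  proof -
    have "summable (\<lambda>n. e (Suc n) + e n)" using se by (intro summable_add) (auto simp: summable_Suc_iff)
    then have "(\<Sum>n. ennreal (e (Suc n) + e n)) = ennreal (\<Sum>n. e (Suc n) + e n)"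
      using e0 by (intro suminf_ennreal_eq) (auto simp: summable_sums)
    then show ?thesis by simp
  qed
  finally have fin: "(\<integral>\<^sup>+\<omega>. (\<Sum>n. ennreal \<bar>?d n \<omega>\<bar>) \<partial>N) \<noteq> \<infinity>" by simp
  have "AE \<omega> in N. (\<Sum>n. ennreal \<bar>?d n \<omega>\<bar>) \<noteq> \<infinity>"
    by (rule nn_integral_noteq_infinite[OF _ fin]) simp
  then show ?thesis
  proof eventually_elim
    fix \<omega> assume "(\<Sum>n. ennreal \<bar>?d n \<omega>\<bar>) \<noteq> \<infinity>"
    then have "summable (\<lambda>n. \<bar>?d n \<omega>\<bar>)" by (intro summable_suminf_not_top) auto
    then have "summable (\<lambda>n. ?d n \<omega>)" by (rule summable_rabs_cancel)
    then have "convergent (\<lambda>m. \<Sum>n<m. ?d n \<omega>)" by (simp add: summable_iff_convergent)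
    then have "convergent (\<lambda>m. ou_sum m s \<omega> - ou_sum 0 s \<omega>)"
      unfolding sum_lessThan_telescope[of "\<lambda>n. ou_sum n s \<omega>"] .
    then have "convergent (\<lambda>m. ou_sum m s \<omega>)" by (simp add: convergent_diff_const_right_iff)
    then show "(\<lambda>n. ou_sum n s \<omega>) \<longlonglongrightarrow> OU s \<omega>" by (simp add: OU_def convergent_LIMSEQ_iff)
  qed
qed

lemma OU_wiener:
  assumes s: "0 \<le> s" "s \<le> 1"
  shows "wiener (OU s) (ou_kernel \<gamma> s)"
  unfolding wiener_def
proof (intro conjI exI allI)
  show "square_integrable lborel (ou_kernel \<gamma> s)" by (rule ou_kernel_square_integrable[OF \<gamma>_pos])
  show "step_pair (ou_sum n s) (ou_step \<gamma> n s)" for n by (rule ou_sum_step_pair)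
  show "AE \<omega> in N. (\<lambda>n. ou_sum n s \<omega>) \<longlonglongrightarrow> OU s \<omega>" by (rule OU_AE_limit[OF s])
  show "(\<lambda>n. l2norm lborel (\<lambda>x. ou_step \<gamma> n s x - ou_kernel \<gamma> s x)) \<longlonglongrightarrow> 0"
  proof (rule Lim_null_comparison)
    show "\<forall>\<^sub>F n in sequentially. norm (l2norm lborel (\<lambda>x. ou_step \<gamma> n s x - ou_kernel \<gamma> s x)) \<le> \<gamma> / 4 ^ n + sqrt (2 * \<gamma>) / 2 ^ n + exp (- \<gamma>) ^ n"
      using ou_step_l2_error[OF \<gamma>_pos s] by simp
    show "(\<lambda>n. \<gamma> / 4 ^ n + sqrt (2 * \<gamma>) / 2 ^ n + exp (- \<gamma>) ^ n) \<longlonglongrightarrow> 0"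
      by (rule summable_LIMSEQ_zero[OF ou_error_summable])
  qed
qed simp

lemma OU_gaussian: "0 \<le> s \<Longrightarrow> s \<le> 1 \<Longrightarrow> gaussian_rv N 1 (OU s)"
  using wiener_gaussian[OF OU_wiener, of s] ou_kernel_norm[OF \<gamma>_pos, of s] by simp

lemma OU_joint_gaussian:
  assumes "0 \<le> s" "s \<le> 1" "0 \<le> u" "u \<le> 1"
  shows "joint_gaussian N (OU s) (OU u) 1 (exp (- \<gamma> * \<bar>s - u\<bar>)) 1"
  using wiener_joint_gaussian[OF OU_wiener OU_wiener, of s u] assms ou_kernel_norm[OF \<gamma>_pos]
    has_bochner_integral_ou_kernel_mult[OF \<gamma>_pos, of s u] by (simp add: has_bochner_integral_iff)

lemma wiener_OU_joint_gaussian: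
  assumes "wiener J g" "0 \<le> s" "s \<le> 1"
  shows "joint_gaussian N J (OU s) (\<integral>x. (g x)\<^sup>2 \<partial>lborel) (\<integral>x. g x * ou_kernel \<gamma> s x \<partial>lborel) 1"
  using wiener_joint_gaussian[OF assms(1) OU_wiener, of s] assms ou_kernel_norm[OF \<gamma>_pos] by simp

end

section \<open>Multiple Wiener integrals of tensor powers\<close>

interpretation lborel_product: product_sigma_finite "\<lambda>_::nat. lborel :: real measure"
  by standard

lemma sigma_finite_lborel_power: "sigma_finite_measure (Pi\<^sub>M {..<q::nat} (\<lambda>_. lborel :: real measure))"
  by (rule lborel_product.sigma_finite) simp

lemma tensor_inner:
  assumes f: "\<And>r. r < q \<Longrightarrow> square_integrable lborel (f r)" and g: "\<And>r. r < q \<Longrightarrow> square_integrable lborel (g r)"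
  defines "R \<equiv> Pi\<^sub>M {..<q::nat} (\<lambda>_. lborel :: real measure)"
  shows "(\<integral>x. (\<Prod>r<q. f r (x r)) * (\<Prod>r<q. g r (x r)) \<partial>R) = (\<Prod>r<q. \<integral>x. f r x * g r x \<partial>lborel)"
  unfolding R_def prod.distrib[symmetric]
  by (rule lborel_product.product_integral_prod) (use square_integrable_mult[OF f g] in auto)

lemma tensor_square_integrable:
  assumes f: "\<And>r. r < q \<Longrightarrow> square_integrable lborel (f r)"
  shows "square_integrable (Pi\<^sub>M {..<q::nat} (\<lambda>_. lborel :: real measure)) (\<lambda>x. \<Prod>r<q. f r (x r))"
  unfolding square_integrable_def
proof
  show "(\<lambda>x. \<Prod>r<q. f r (x r)) \<in> borel_measurable (Pi\<^sub>M {..<q} (\<lambda>_. lborel))"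
    using f by (intro borel_measurable_prod measurable_compose[OF measurable_component_singleton]) (auto simp: square_integrable_def)
  show "integrable (Pi\<^sub>M {..<q} (\<lambda>_. lborel)) (\<lambda>x. (\<Prod>r<q. f r (x r))\<^sup>2)"
    unfolding prod_power_distrib
    by (rule lborel_product.product_integrable_prod) (use f in \<open>auto simp: square_integrable_def\<close>)
qed

lemma square_integrable_indicator:
  fixes a b :: real
  shows "square_integrable lborel (indicat_real {a<..b})"
  by (cases "a \<le> b") (auto simp: square_integrable_def power2_eq_square indicator_inter_arith[symmetric])

text \<open>An injective index with prescribed image is an arrangement of that image, and there are
  \<open>q!\<close> arrangements. This is the origin of the factor \<open>fact q\<close> in
  \<open>step_integral_l2norm\<close>.\<close>

lemma card_offdiag_image:
  assumes "i \<in> offdiag q k"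
  shows "card {i' \<in> offdiag q k. i' ` {..<q} = i ` {..<q}} \<le> fact q"
proof -
  have fin: "finite (i ` {..<q})" by simp
  have card: "card (i ` {..<q}) = q" using assms by (simp add: offdiag_def card_image)
  have "{i' \<in> offdiag q k. i' ` {..<q} = i ` {..<q}} \<subseteq> {f \<in> {..<q} \<rightarrow>\<^sub>E i ` {..<q}. inj_on f {..<q}}"
    by (auto simp: offdiag_def PiE_iff)
  moreover have "finite {f \<in> {..<q} \<rightarrow>\<^sub>E i ` {..<q}. inj_on f {..<q}}"
    by (rule finite_subset[OF _ finite_PiE[of "{..<q}" "\<lambda>_. i ` {..<q}"]]) auto
  ultimately have "card {i' \<in> offdiag q k. i' ` {..<q} = i ` {..<q}} \<le> card {f \<in> {..<q} \<rightarrow>\<^sub>E i ` {..<q}. inj_on f {..<q}}"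
    by (rule card_mono[rotated])
  also have "\<dots> = prod ((-) q) {0..<q}"
    using card_inj_on_subset_funcset[of "{..<q}" "i ` {..<q}" "{..<q}"] card by simp
  also have "\<dots> = fact q" by (simp add: fact_prod_rev)
  finally show ?thesis .
qed

lemma finite_offdiag: "finite (offdiag q k)"
  by (rule finite_subset[OF _ finite_PiE[of "{..<q}" "\<lambda>_. {..<k}"]]) (auto simp: offdiag_def)

lemma step_kernel_square_integrable:
  "square_integrable (Pi\<^sub>M {..<q} (\<lambda>_. lborel)) (step_kernel q k \<tau> a)"
  unfolding step_kernel_def
  by (intro square_integrable_sum square_integrable_cmult tensor_square_integrable square_integrable_indicator)

text \<open>Distinct multi-indices give disjoint boxes, so squaring the kernel produces no mixed
  terms, and the integral of each box is its volume.\<close>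

lemma l2norm_step_kernel:
  assumes \<tau>: "strict_mono_on {..k} \<tau>"
  shows "(l2norm (Pi\<^sub>M {..<q} (\<lambda>_. lborel)) (step_kernel q k \<tau> a))\<^sup>2 = (\<Sum>i\<in>offdiag q k. (a i)\<^sup>2 * (\<Prod>r<q. \<tau> (Suc (i r)) - \<tau> (i r)))"
proof -
  let ?R = "Pi\<^sub>M {..<q} (\<lambda>_. lborel)"
  have box: "(\<Prod>r<q. indicator {\<tau> (i r)<..\<tau> (Suc (i r))} (x r)) = indicat_real {x. \<forall>r<q. x r \<in> {\<tau> (i r)<..\<tau> (Suc (i r))}} x" for i x
    by (induction q) (auto simp: indicator_def less_Suc_eq)
  have disj: "disjoint_family_on (\<lambda>i. {x. \<forall>r<q. x r \<in> {\<tau> (i r)<..\<tau> (Suc (i r))}}) (offdiag q k)"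
    unfolding disjoint_family_on_def
  proof (intro ballI impI)
    fix i i' assume i: "i \<in> offdiag q k" "i' \<in> offdiag q k" "i \<noteq> i'"
    then obtain r where r: "r < q" "i r \<noteq> i' r"
      by (metis (no_types, lifting) PiE_ext lessThan_iff mem_Collect_eq offdiag_def)
    have "i r < k" "i' r < k" using i r by (auto simp: offdiag_def PiE_iff)
    then have "{\<tau> (i r)<..\<tau> (Suc (i r))} \<inter> {\<tau> (i' r)<..\<tau> (Suc (i' r))} = {}"
      using strict_mono_cells_disjoint[OF \<tau>] r(2) by (auto simp: disjoint_family_on_def)
    then show "{x. \<forall>r<q. x r \<in> {\<tau> (i r)<..\<tau> (Suc (i r))}} \<inter> {x. \<forall>r<q. x r \<in> {\<tau> (i' r)<..\<tau> (Suc (i' r))}} = {}"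
      using r(1) by blast
  qed
  have sq: "(step_kernel q k \<tau> a x)\<^sup>2 = (\<Sum>i\<in>offdiag q k. (a i)\<^sup>2 * (\<Prod>r<q. indicator {\<tau> (i r)<..\<tau> (Suc (i r))} (x r)))" for x
    unfolding step_kernel_def box by (rule sum_disjoint_indicator_power2[OF disj finite_offdiag])
  have int: "integrable ?R (\<lambda>x. \<Prod>r<q. indicat_real {\<tau> (i r)<..\<tau> (Suc (i r))} (x r))"
    and val: "i \<in> offdiag q k \<Longrightarrow> (\<integral>x. (\<Prod>r<q. indicat_real {\<tau> (i r)<..\<tau> (Suc (i r))} (x r)) \<partial>?R) = (\<Prod>r<q. \<tau> (Suc (i r)) - \<tau> (i r))" for i
  proof -
    have i1: "integrable lborel (indicat_real {a<..b})" for a b :: real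
      by (cases "a \<le> b") auto
    show "integrable ?R (\<lambda>x. \<Prod>r<q. indicat_real {\<tau> (i r)<..\<tau> (Suc (i r))} (x r))"
      by (rule lborel_product.product_integrable_prod) (auto intro: i1)
    assume i: "i \<in> offdiag q k"
    have "(\<integral>x. (\<Prod>r<q. indicat_real {\<tau> (i r)<..\<tau> (Suc (i r))} (x r)) \<partial>?R) = (\<Prod>r<q. \<integral>x. indicat_real {\<tau> (i r)<..\<tau> (Suc (i r))} x \<partial>lborel)"
      by (rule lborel_product.product_integral_prod) (auto intro: i1)
    also have "\<dots> = (\<Prod>r<q. \<tau> (Suc (i r)) - \<tau> (i r))"
    proof (rule prod.cong[OF refl])
      fix r assume "r \<in> {..<q}"
      then have "i r < k" using i by (auto simp: offdiag_def PiE_iff)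
      then have "\<tau> (i r) < \<tau> (Suc (i r))" using strict_mono_onD[OF \<tau>, of "i r" "Suc (i r)"] by simp
      then show "(\<integral>x. indicat_real {\<tau> (i r)<..\<tau> (Suc (i r))} x \<partial>lborel) = \<tau> (Suc (i r)) - \<tau> (i r)" by simp
    qed
    finally show "(\<integral>x. (\<Prod>r<q. indicat_real {\<tau> (i r)<..\<tau> (Suc (i r))} (x r)) \<partial>?R) = (\<Prod>r<q. \<tau> (Suc (i r)) - \<tau> (i r))" .
  qed
  show ?thesis
    unfolding l2norm_power2 sq using int val by (subst Bochner_Integration.integral_sum) auto
qed

lemma step_kernel_tensor_inner:
  assumes f: "\<And>r. r < q \<Longrightarrow> square_integrable lborel (f r)"
  shows "(\<integral>x. (\<Prod>r<q. f r (x r)) * step_kernel q k \<tau> a x \<partial>Pi\<^sub>M {..<q} (\<lambda>_. lborel)) =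
     (\<Sum>i\<in>offdiag q k. a i * (\<Prod>r<q. \<integral>x. f r x * indicator {\<tau> (i r)<..\<tau> (Suc (i r))} x \<partial>lborel))"
proof -
  let ?R = "Pi\<^sub>M {..<q} (\<lambda>_. lborel)"
  let ?b = "\<lambda>i x. \<Prod>r<q. indicat_real {\<tau> (i r)<..\<tau> (Suc (i r))} (x r)"
  have int: "integrable ?R (\<lambda>x. (\<Prod>r<q. f r (x r)) * ?b i x)" for i
    by (intro square_integrable_mult tensor_square_integrable f square_integrable_indicator)
  have "(\<integral>x. (\<Prod>r<q. f r (x r)) * step_kernel q k \<tau> a x \<partial>?R) = (\<integral>x. (\<Sum>i\<in>offdiag q k. a i * ((\<Prod>r<q. f r (x r)) * ?b i x)) \<partial>?R)"
    by (simp add: step_kernel_def sum_distrib_left mult_ac)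
  also have "\<dots> = (\<Sum>i\<in>offdiag q k. a i * (\<integral>x. (\<Prod>r<q. f r (x r)) * ?b i x \<partial>?R))"
    using int by (subst Bochner_Integration.integral_sum) auto
  also have "\<dots> = (\<Sum>i\<in>offdiag q k. a i * (\<Prod>r<q. \<integral>x. f r x * indicator {\<tau> (i r)<..\<tau> (Suc (i r))} x \<partial>lborel))"
    by (intro sum.cong refl arg_cong2[where f="(*)"] tensor_inner f square_integrable_indicator)
  finally show ?thesis .
qed

section \<open>Second moments of off-diagonal step integrals\<close>

context brownian
begin

text \<open>Written as one product over all cells with exponents 0, 1 or 2, the expectation factors
  by independence. A cell that lies in exactly one of the two sets contributes its mean, which is 0;
  a cell in both contributes its length.\<close>

lemma increment_products:
  assumes \<tau>: "strict_mono_on {..k} \<tau>" and A: "A \<subseteq> {..<k}" "A' \<subseteq> {..<k}"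
  defines "D \<equiv> \<lambda>j \<omega>. B (\<tau> (Suc j)) \<omega> - B (\<tau> j) \<omega>"
  shows "integrable N (\<lambda>\<omega>. (\<Prod>j\<in>A. D j \<omega>) * (\<Prod>j\<in>A'. D j \<omega>))"
    and "(\<integral>\<omega>. (\<Prod>j\<in>A. D j \<omega>) * (\<Prod>j\<in>A'. D j \<omega>) \<partial>N) = (if A = A' then \<Prod>j\<in>A. \<tau> (Suc j) - \<tau> j else 0)"
proof -
  define e where "e j = (if j \<in> A then 1 else 0) + (if j \<in> A' then 1 else 0 :: nat)" for j
  have g: "gaussian_rv N (\<tau> (Suc j) - \<tau> j) (D j)" if "j < k" for j
    unfolding D_def using strict_mono_onD[OF \<tau>, of j "Suc j"] that by (intro B_increment_gaussian) auto
  have eq: "(\<Prod>j\<in>A. D j \<omega>) * (\<Prod>j\<in>A'. D j \<omega>) = (\<Prod>j<k. D j \<omega> ^ e j)" for \<omega>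
  proof -
    have "(\<Prod>j\<in>A. D j \<omega>) = (\<Prod>j<k. if j \<in> A then D j \<omega> else 1)" if "A \<subseteq> {..<k}" for A
    proof -
      have "A = {..<k} \<inter> A" using that by auto
      then show ?thesis by (metis finite_lessThan prod.inter_restrict)
    qed
    from this[OF A(1)] this[OF A(2)] have "(\<Prod>j\<in>A. D j \<omega>) * (\<Prod>j\<in>A'. D j \<omega>) =
       (\<Prod>j<k. (if j \<in> A then D j \<omega> else 1) * (if j \<in> A' then D j \<omega> else 1))" by (simp add: prod.distrib)
    also have "\<dots> = (\<Prod>j<k. D j \<omega> ^ e j)" by (intro prod.cong) (auto simp: e_def power2_eq_square)
    finally show ?thesis .
  qed
  have ind: "indep_vars (\<lambda>_. borel) (\<lambda>j \<omega>. D j \<omega> ^ e j) {..<k}"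
    unfolding D_def by (rule indep_vars_compose2[OF B_increments_indep[OF \<tau>], where Y="\<lambda>j x. x ^ e j"]) simp
  have int: "integrable N (\<lambda>\<omega>. D j \<omega> ^ e j)" if "j \<in> {..<k}" for j
    using gaussian_rv_integrable_power[OF g] that by simp
  show "integrable N (\<lambda>\<omega>. (\<Prod>j\<in>A. D j \<omega>) * (\<Prod>j\<in>A'. D j \<omega>))"
    unfolding eq by (rule indep_vars_integrable[OF finite_lessThan ind int])
  have "(\<integral>\<omega>. (\<Prod>j\<in>A. D j \<omega>) * (\<Prod>j\<in>A'. D j \<omega>) \<partial>N) = (\<Prod>j<k. \<integral>\<omega>. D j \<omega> ^ e j \<partial>N)"
    unfolding eq by (rule indep_vars_lebesgue_integral[OF finite_lessThan ind int])
  also have "\<dots> = (if A = A' then \<Prod>j\<in>A. \<tau> (Suc j) - \<tau> j else 0)"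
  proof (cases "A = A'")
    case True
    have "(\<integral>\<omega>. D j \<omega> ^ e j \<partial>N) = (if j \<in> A then \<tau> (Suc j) - \<tau> j else 1)" if "j < k" for j
      using gaussian_rv_variance[OF prob_space_axioms g[OF that]] True
      by (simp add: e_def prob_space numeral_2_eq_2[symmetric])
    then have "(\<Prod>j<k. \<integral>\<omega>. D j \<omega> ^ e j \<partial>N) = (\<Prod>j<k. if j \<in> A then \<tau> (Suc j) - \<tau> j else 1)" by simp
    also have "\<dots> = prod (\<lambda>j. \<tau> (Suc j) - \<tau> j) ({..<k} \<inter> A)" by (rule prod.inter_restrict[symmetric]) simp
    also have "{..<k} \<inter> A = A" using A by auto
    finally show ?thesis using True by simp
  next
    case False
    then obtain j where "j \<in> A \<union> A'" "j \<in> A \<longleftrightarrow> j \<notin> A'" by blast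
    then have j: "j < k" "e j = 1" using A by (auto simp: e_def)
    have "(\<integral>\<omega>. D j \<omega> ^ e j \<partial>N) = 0" using gaussian_rv_mean[OF g[OF j(1)]] j(2) by simp
    then have "(\<Prod>j<k. \<integral>\<omega>. D j \<omega> ^ e j \<partial>N) = 0" using j(1) by (intro prod_zero) auto
    then show ?thesis using False by simp
  qed
  finally show "(\<integral>\<omega>. (\<Prod>j\<in>A. D j \<omega>) * (\<Prod>j\<in>A'. D j \<omega>) \<partial>N) = (if A = A' then \<Prod>j\<in>A. \<tau> (Suc j) - \<tau> j else 0)" .
qed

lemma offdiag_product_image:
  "i \<in> offdiag q k \<Longrightarrow> (\<Prod>r<q. h (i r)) = (\<Prod>j\<in>i ` {..<q}. h j)"
  by (simp add: offdiag_def prod.reindex)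

lemma offdiag_image_subset: "i \<in> offdiag q k \<Longrightarrow> i ` {..<q} \<subseteq> {..<k}"
  by (auto simp: offdiag_def PiE_iff)

lemma offdiag_product_square_integrable:
  assumes \<tau>: "strict_mono_on {..k} \<tau>" and i: "i \<in> offdiag q k"
  shows "square_integrable N (\<lambda>\<omega>. \<Prod>r<q. B (\<tau> (Suc (i r))) \<omega> - B (\<tau> (i r)) \<omega>)"
  using increment_products(1)[OF \<tau> offdiag_image_subset[OF i] offdiag_image_subset[OF i]]
  unfolding square_integrable_def offdiag_product_image[OF i, of "\<lambda>j. B (\<tau> (Suc j)) _ - B (\<tau> j) _"]
  by (simp add: power2_eq_square)

lemma step_integral_square_integrable:
  assumes \<tau>: "strict_mono_on {..k} \<tau>"
  shows "square_integrable N (step_integral B q k \<tau> a)"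
  unfolding step_integral_def[abs_def]
  by (intro square_integrable_sum square_integrable_cmult offdiag_product_square_integrable[OF \<tau>])

text \<open>Two products of increments are correlated only if their indices have the same image, and
  then they are the same variable. Bounding \<open>a i * a i'\<close> by the mean of the squares and
  counting the arrangements of each image gives the factor \<open>fact q\<close>. It is an
  inequality because the coefficients need not be symmetric; for symmetric ones equality
  holds.\<close>

lemma step_integral_l2norm:
  assumes \<tau>: "strict_mono_on {..k} \<tau>"
  shows "(l2norm N (step_integral B q k \<tau> a))\<^sup>2 \<le> fact q * (l2norm (Pi\<^sub>M {..<q} (\<lambda>_. lborel)) (step_kernel q k \<tau> a))\<^sup>2"
proof -
  let ?D = "\<lambda>j \<omega>. B (\<tau> (Suc j)) \<omega> - B (\<tau> j) \<omega>"
  let ?O = "offdiag q k"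
  define v where "v i = (\<Prod>r<q. \<tau> (Suc (i r)) - \<tau> (i r))" for i
  have v0: "0 \<le> v i" if "i \<in> ?O" for i
    unfolding v_def
  proof (rule prod_nonneg)
    fix r assume "r \<in> {..<q}"
    then have "i r < k" using that by (auto simp: offdiag_def PiE_iff)
    then show "0 \<le> \<tau> (Suc (i r)) - \<tau> (i r)" using strict_mono_onD[OF \<tau>, of "i r" "Suc (i r)"] by simp
  qed
  define P where "P i \<omega> = (\<Prod>r<q. ?D (i r) \<omega>)" for i \<omega>
  define same where "same i i' \<longleftrightarrow> i ` {..<q} = i' ` {..<q}" for i i' :: "nat \<Rightarrow> nat"
  have v_same: "v i = v i'" if "i \<in> ?O" "i' \<in> ?O" "same i i'" for i i'
    using that offdiag_product_image[OF that(1), of "\<lambda>j. \<tau> (Suc j) - \<tau> j"]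
      offdiag_product_image[OF that(2), of "\<lambda>j. \<tau> (Suc j) - \<tau> j"] by (simp add: v_def same_def)
  have P: "integrable N (\<lambda>\<omega>. P i \<omega> * P i' \<omega>)" "(\<integral>\<omega>. P i \<omega> * P i' \<omega> \<partial>N) = (if same i i' then v i else 0)"
    if i: "i \<in> ?O" "i' \<in> ?O" for i i'
    using increment_products[OF \<tau> offdiag_image_subset[OF i(1)] offdiag_image_subset[OF i(2)]]
    unfolding P_def v_def same_def offdiag_product_image[OF i(1), of "\<lambda>j. \<tau> (Suc j) - \<tau> j"]
      offdiag_product_image[OF i(1), of "\<lambda>j. ?D j _"] offdiag_product_image[OF i(2), of "\<lambda>j. ?D j _"] by auto
  have "(l2norm N (step_integral B q k \<tau> a))\<^sup>2 = (\<integral>\<omega>. (\<Sum>i\<in>?O. \<Sum>i'\<in>?O. a i * a i' * (P i \<omega> * P i' \<omega>)) \<partial>N)"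
    unfolding l2norm_power2 step_integral_def P_def[symmetric]
    by (simp only: power2_eq_square sum_product) (simp only: mult_ac)
  also have "\<dots> = (\<Sum>i\<in>?O. \<Sum>i'\<in>?O. a i * a i' * (if same i i' then v i else 0))"
    using P by (simp add: Bochner_Integration.integral_sum)
  also have "\<dots> \<le> (\<Sum>i\<in>?O. \<Sum>i'\<in>?O. ((a i)\<^sup>2 + (a i')\<^sup>2) / 2 * (if same i i' then v i else 0))"
  proof (intro sum_mono mult_right_mono)
    fix i i' assume "i \<in> ?O"
    then show "0 \<le> (if same i i' then v i else 0)" using v0 by simp
    show "a i * a i' \<le> ((a i)\<^sup>2 + (a i')\<^sup>2) / 2" using sum_squares_bound[of "a i" "a i'"] by simp
  qed
  also have "\<dots> = (\<Sum>i\<in>?O. \<Sum>i'\<in>?O. (a i)\<^sup>2 / 2 * (if same i i' then v i else 0)) +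
      (\<Sum>i\<in>?O. \<Sum>i'\<in>?O. (a i')\<^sup>2 / 2 * (if same i i' then v i else 0))"
    unfolding sum.distrib[symmetric] by (intro sum.cong refl) (simp only: add_divide_distrib distrib_right)
  also have "(\<Sum>i\<in>?O. \<Sum>i'\<in>?O. (a i')\<^sup>2 / 2 * (if same i i' then v i else 0)) =
      (\<Sum>i\<in>?O. \<Sum>i'\<in>?O. (a i)\<^sup>2 / 2 * (if same i i' then v i else 0))"
  proof (subst sum.swap, intro sum.cong refl)
    fix i i' assume i: "i \<in> ?O" "i' \<in> ?O"
    have "same i' i \<longleftrightarrow> same i i'" by (auto simp: same_def)
    then show "(a i)\<^sup>2 / 2 * (if same i' i then v i' else 0) = (a i)\<^sup>2 / 2 * (if same i i' then v i else 0)"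
      using v_same[OF i] by simp
  qed
  also have "(\<Sum>i\<in>?O. \<Sum>i'\<in>?O. (a i)\<^sup>2 / 2 * (if same i i' then v i else 0)) +
     (\<Sum>i\<in>?O. \<Sum>i'\<in>?O. (a i)\<^sup>2 / 2 * (if same i i' then v i else 0)) =
     (\<Sum>i\<in>?O. real (card {i'\<in>?O. i' ` {..<q} = i ` {..<q}}) * ((a i)\<^sup>2 * v i))"
  proof -
    have "(\<Sum>i'\<in>?O. (a i)\<^sup>2 / 2 * (if same i i' then v i else 0)) = real (card {i'\<in>?O. i' ` {..<q} = i ` {..<q}}) * ((a i)\<^sup>2 * v i) / 2" for i
    proof -
      have "(\<Sum>i'\<in>?O. (a i)\<^sup>2 / 2 * (if same i i' then v i else 0)) = (\<Sum>i'\<in>{i'\<in>?O. same i i'}. (a i)\<^sup>2 / 2 * v i)"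
        by (subst sum.inter_filter[OF finite_offdiag]) (auto intro!: sum.cong)
      also have "{i'\<in>?O. same i i'} = {i'\<in>?O. i' ` {..<q} = i ` {..<q}}" by (auto simp: same_def)
      finally show ?thesis by simp
    qed
    then show ?thesis by (simp only: sum.distrib[symmetric] field_sum_of_halves)
  qed
  also have "\<dots> \<le> (\<Sum>i\<in>?O. fact q * ((a i)\<^sup>2 * v i))"
  proof (intro sum_mono mult_right_mono)
    fix i assume i: "i \<in> ?O"
    have "real (card {i'\<in>?O. i' ` {..<q} = i ` {..<q}}) \<le> real (fact q)"
      using card_offdiag_image[OF i] by (simp only: of_nat_le_iff)
    then show "real (card {i'\<in>?O. i' ` {..<q} = i ` {..<q}}) \<le> fact q" by simp
    show "0 \<le> (a i)\<^sup>2 * v i" using v0[OF i] by simp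
  qed
  also have "\<dots> = fact q * (l2norm (Pi\<^sub>M {..<q} (\<lambda>_. lborel)) (step_kernel q k \<tau> a))\<^sup>2"
    unfolding l2norm_step_kernel[OF \<tau>] v_def by (simp add: sum_distrib_left)
  finally show ?thesis .
qed

end

context ou_process
begin

text \<open>Polarization writes the product of increments through \<open>q\<close>-th powers of
  partial sums, each of which is jointly Gaussian with \<open>OU s\<close>. Against the Hermite
  polynomial of order \<open>q\<close> such a power yields \<open>fact q\<close> times the
  \<open>q\<close>-th power of the covariance, whatever its variance. Covariances are additive, so
  polarization can be reversed on them.\<close>

lemma offdiag_product_hermite:
  assumes \<tau>: "strict_mono_on {..k} \<tau>" and i: "i \<in> offdiag q k" and s: "0 \<le> s" "s \<le> 1"
  shows "(\<integral>\<omega>. (\<Prod>r<q. B (\<tau> (Suc (i r))) \<omega> - B (\<tau> (i r)) \<omega>) * hermite q (OU s \<omega>) \<partial>N) =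
    fact q * (\<Prod>r<q. \<integral>x. ou_kernel \<gamma> s x * indicator {\<tau> (i r)<..\<tau> (Suc (i r))} x \<partial>lborel)"
proof -
  let ?D = "\<lambda>r \<omega>. B (\<tau> (Suc (i r))) \<omega> - B (\<tau> (i r)) \<omega>"
  let ?c = "\<lambda>r. \<integral>x. ou_kernel \<gamma> s x * indicator {\<tau> (i r)<..\<tau> (Suc (i r))} x \<partial>lborel"
  have J: "joint_gaussian N (\<lambda>\<omega>. \<Sum>r\<in>S. ?D r \<omega>) (OU s)
     (\<integral>x. (\<Sum>r\<in>S. indicator {\<tau> (i r)<..\<tau> (Suc (i r))} x)\<^sup>2 \<partial>lborel) (\<Sum>r\<in>S. ?c r) 1" if S: "S \<subseteq> {..<q}" for S
  proof -
    have "step_pair (\<lambda>\<omega>. \<Sum>r\<in>S. 1 * ?D r \<omega>) (\<lambda>x. \<Sum>r\<in>S. 1 * indicator {\<tau> (i r)<..\<tau> (Suc (i r))} x)"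
    proof (intro step_pair_sum step_pair_increment)
      fix r assume "r \<in> S"
      then have "i r < k" using i S by (auto simp: offdiag_def PiE_iff)
      then show "\<tau> (i r) \<le> \<tau> (Suc (i r))" using strict_mono_onD[OF \<tau>, of "i r" "Suc (i r)"] by simp
    qed
    then have w: "wiener (\<lambda>\<omega>. \<Sum>r\<in>S. ?D r \<omega>) (\<lambda>x. \<Sum>r\<in>S. indicator {\<tau> (i r)<..\<tau> (Suc (i r))} x)"
      by (auto intro: wiener_step)
    have "(\<integral>x. (\<Sum>r\<in>S. indicator {\<tau> (i r)<..\<tau> (Suc (i r))} x) * ou_kernel \<gamma> s x \<partial>lborel) = (\<Sum>r\<in>S. ?c r)"
      using square_integrable_mult[OF ou_kernel_square_integrable[OF \<gamma>_pos] square_integrable_indicator]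
      unfolding sum_distrib_right by (simp add: mult.commute[of _ "ou_kernel \<gamma> s _"] Bochner_Integration.integral_sum)
    with wiener_OU_joint_gaussian[OF w s] show ?thesis by simp
  qed
  have int: "integrable N (\<lambda>\<omega>. (\<Sum>r\<in>S. ?D r \<omega>) ^ q * hermite q (OU s \<omega>))" if "S \<in> Pow {..<q}" for S
    using joint_gaussian_integrable_poly[OF J, of S q "hermite_poly q"] that by simp
  have "(\<integral>\<omega>. (\<Prod>r<q. ?D r \<omega>) * hermite q (OU s \<omega>) \<partial>N) =
     (\<integral>\<omega>. (\<Sum>S\<in>Pow {..<q}. (- 1) ^ (q - card S) / fact q * ((\<Sum>r\<in>S. ?D r \<omega>) ^ q * hermite q (OU s \<omega>))) \<partial>N)"
    by (subst polarization) (simp_all add: sum_distrib_right sum_distrib_left sum_divide_distrib mult_ac)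
  also have "\<dots> = (\<Sum>S\<in>Pow {..<q}. (- 1) ^ (q - card S) / fact q * (\<integral>\<omega>. (\<Sum>r\<in>S. ?D r \<omega>) ^ q * hermite q (OU s \<omega>) \<partial>N))"
    using int by (subst Bochner_Integration.integral_sum) auto
  also have "\<dots> = (\<Sum>S\<in>Pow {..<q}. (- 1) ^ (q - card S) / fact q * (fact q * (\<Sum>r\<in>S. ?c r) ^ q))"
    by (intro sum.cong refl arg_cong2[where f="(*)"] joint_gaussian_power_hermite(2)[OF prob_space_axioms J]) auto
  also have "\<dots> = fact q * (\<Prod>r<q. ?c r)"
    by (subst polarization[of "{..<q}" ?c]) (simp_all add: sum_divide_distrib sum_distrib_left mult_ac)
  finally show ?thesis .
qed

end

section \<open>Time integrals of functions of the process, and their kernels\<close>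

lemma measurable_std_normal [simp]: "measurable std_normal M = measurable borel M"
  by (rule measurable_cong_sets) simp_all

lemma gaussian_rv_std_normal_id: "gaussian_rv std_normal 1 (\<lambda>x. x)"
  by (simp add: gaussian_rv_def)

lemma joint_gaussian_std_normal: "joint_gaussian std_normal (\<lambda>x. x) (\<lambda>x. x) 1 1 1"
  unfolding joint_gaussian_def
proof (intro allI)
  fix x y
  show "gaussian_rv std_normal (x\<^sup>2 * 1 + 2 * x * y * 1 + y\<^sup>2 * 1) (\<lambda>\<omega>. x * \<omega> + y * \<omega>)"
    using gaussian_rv_scale[OF gaussian_rv_std_normal_id, of "x + y"]
    by (simp add: power2_sum algebra_simps)
qed

lemma hermite_square_integrable: "square_integrable std_normal (hermite q)"
  using joint_gaussian_integrable_hermite[OF joint_gaussian_std_normal, of q q]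
  by (simp add: square_integrable_def power2_eq_square)

lemma hermite_orthogonal:
  "(\<integral>x. hermite p x * hermite q x \<partial>std_normal) = (if p = q then fact q else 0)"
  using joint_gaussian_hermite[OF std_normal.prob_space_axioms joint_gaussian_std_normal, of p q] by simp

lemma gaussian_rv_unit_square_integrable:
  assumes "gaussian_rv M 1 X" "square_integrable std_normal f"
  shows "square_integrable M (\<lambda>\<omega>. f (X \<omega>))" "l2norm M (\<lambda>\<omega>. f (X \<omega>)) = l2norm std_normal f"
proof -
  have [measurable]: "f \<in> borel_measurable borel" "X \<in> borel_measurable M"
    using assms by (auto simp: square_integrable_def gaussian_rv_def cong: measurable_cong_sets)
  show "square_integrable M (\<lambda>\<omega>. f (X \<omega>))"
    using assms(2) gaussian_rv_integral(2)[OF assms(1), of "\<lambda>x. (f x)\<^sup>2"] by (simp add: square_integrable_def)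
  show "l2norm M (\<lambda>\<omega>. f (X \<omega>)) = l2norm std_normal f"
    using gaussian_rv_integral(1)[OF assms(1), of "\<lambda>x. (f x)\<^sup>2"] by (simp add: l2norm_def)
qed

definition ou_tensor :: "real \<Rightarrow> nat \<Rightarrow> real \<Rightarrow> (nat \<Rightarrow> real) \<Rightarrow> real" where
  "ou_tensor \<gamma> q s x = (\<Prod>r<q. ou_kernel \<gamma> s (x r))"

lemma ou_tensor_measurable:
  "(\<lambda>p. ou_tensor \<gamma> q (fst p) (snd p)) \<in> borel_measurable (borel \<Otimes>\<^sub>M Pi\<^sub>M {..<q} (\<lambda>_. lborel))"
  unfolding ou_tensor_def
proof (rule borel_measurable_prod)
  fix r assume r: "r \<in> {..<q}"
  have "(\<lambda>p. (fst p, snd p r)) \<in> measurable (borel \<Otimes>\<^sub>M Pi\<^sub>M {..<q} (\<lambda>_. lborel)) (borel \<Otimes>\<^sub>M borel)"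
    using r by (intro measurable_Pair measurable_fst measurable_compose[OF measurable_snd])
      (auto intro: measurable_component_singleton[where M="\<lambda>_. lborel", simplified])
  from measurable_compose[OF this ou_kernel_measurable(1)[of \<gamma>]]
  show "(\<lambda>p. ou_kernel \<gamma> (fst p) (snd p r)) \<in> borel_measurable (borel \<Otimes>\<^sub>M Pi\<^sub>M {..<q} (\<lambda>_. lborel))" by simp
qed

text \<open>Removes the normalising factor \<open>sqrt (2 * \<gamma>)\<close> of
  \<open>ou_kernel\<close> from each of the \<open>q\<close> factors; the tempered kernel has no
  such factor.\<close>

definition ou_weight :: "real \<Rightarrow> nat \<Rightarrow> real" where
  "ou_weight \<gamma> q = (1 / sqrt (2 * \<gamma>)) ^ q"

lemma tempered_kernel_eq:
  assumes \<gamma>: "\<gamma> > 0" and t: "0 \<le> t" "t \<le> 1"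
  shows "tempered_kernel \<gamma> q t x = ou_weight \<gamma> q * (\<integral>s. indicator {0..t} s * ou_tensor \<gamma> q s x \<partial>unit_time)"
proof -
  have k: "exp (- \<gamma> * (s - y)) * indicator {..s} y = 1 / sqrt (2 * \<gamma>) * ou_kernel \<gamma> s y" for s y
    using \<gamma> by (simp add: ou_kernel_def)
  have "tempered_kernel \<gamma> q t x = (LINT s|lborel. indicator {0..t} s * (ou_weight \<gamma> q * ou_tensor \<gamma> q s x))"
    unfolding tempered_kernel_def k set_lebesgue_integral_def prod.distrib ou_tensor_def ou_weight_def by simp
  also have "\<dots> = (LINT s|lborel. ou_weight \<gamma> q * (indicator {0..1} s *\<^sub>R (indicator {0..t} s * ou_tensor \<gamma> q s x)))"
    using t by (intro Bochner_Integration.integral_cong) (auto simp: indicator_def)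
  finally show ?thesis
    by (simp add: integral_unit_time set_lebesgue_integral_def)
qed

context ou_process
begin

lemma OU_function_square_integrable:
  assumes "square_integrable std_normal f" "0 \<le> s" "s \<le> 1"
  shows "square_integrable N (\<lambda>\<omega>. f (OU s \<omega>))" "l2norm N (\<lambda>\<omega>. f (OU s \<omega>)) = l2norm std_normal f"
  using gaussian_rv_unit_square_integrable[OF OU_gaussian[OF assms(2,3)] assms(1)] by auto

lemma OU_function_measurable:
  fixes f h :: "real \<Rightarrow> real"
  assumes "f \<in> borel_measurable borel" "h \<in> borel_measurable borel"
  shows "(\<lambda>p. h (fst p) * f (OU (fst p) (snd p))) \<in> borel_measurable (unit_time \<Otimes>\<^sub>M N)"
proof (rule measurable_unit_time_pair)
  show "(\<lambda>p. h (fst p) * f (OU (fst p) (snd p))) \<in> borel_measurable (borel \<Otimes>\<^sub>M N)"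
    by (intro borel_measurable_times measurable_compose[OF OU_measurable(1) assms(1)] measurable_compose[OF measurable_fst assms(2)])
qed

lemma OU_process_square_integrable:
  assumes f: "square_integrable std_normal f"
  shows "square_integrable (unit_time \<Otimes>\<^sub>M N) (\<lambda>p. indicator {0..t} (fst p) * f (OU (fst p) (snd p)))"
    and "l2norm (unit_time \<Otimes>\<^sub>M N) (\<lambda>p. indicator {0..t} (fst p) * f (OU (fst p) (snd p))) \<le> l2norm std_normal f"
proof -
  let ?g = "\<lambda>p. indicator {0..t} (fst p) * f (OU (fst p) (snd p))"
  have [measurable]: "f \<in> borel_measurable borel"
    using f by (auto simp: square_integrable_def cong: measurable_cong_sets)
  have sq: "square_integrable N (\<lambda>\<omega>. ?g (s, \<omega>))" if "s \<in> space unit_time" for s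
    using OU_function_square_integrable(1)[OF f, of s] that by (auto intro: square_integrable_cmult)
  have nrm: "(l2norm N (\<lambda>\<omega>. ?g (s, \<omega>)))\<^sup>2 \<le> (l2norm std_normal f)\<^sup>2" if "s \<in> space unit_time" for s
    using OU_function_square_integrable(2)[OF f, of s] that by (auto simp: l2norm_cmult indicator_def)
  have m: "?g \<in> borel_measurable (unit_time \<Otimes>\<^sub>M N)" by (rule OU_function_measurable) auto
  note * = square_integrable_pairI[OF unit_time_prob_space sigma_finite_measure_axioms m sq, of "(l2norm std_normal f)\<^sup>2"]
  show sqp: "square_integrable (unit_time \<Otimes>\<^sub>M N) ?g"
    by (rule *(1)) (use nrm in \<open>auto simp: l2norm_power2\<close>)
  have "(l2norm (unit_time \<Otimes>\<^sub>M N) ?g)\<^sup>2 = (\<integral>s. (l2norm N (\<lambda>\<omega>. ?g (s, \<omega>)))\<^sup>2 \<partial>unit_time)"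
    by (rule *(2)) (use nrm in \<open>auto simp: l2norm_power2\<close>)
  also have "\<dots> \<le> (\<integral>s. (l2norm std_normal f)\<^sup>2 \<partial>unit_time)"
  proof (rule integral_mono')
    show "integrable unit_time (\<lambda>s. (l2norm std_normal f)\<^sup>2)" by simp
  qed (use nrm in auto)
  also have "\<dots> = (l2norm std_normal f)\<^sup>2" using unit_time.prob_space by simp
  finally show "l2norm (unit_time \<Otimes>\<^sub>M N) ?g \<le> l2norm std_normal f" by (rule power2_le_imp_le) simp
qed

definition ou_average :: "(real \<Rightarrow> real) \<Rightarrow> real \<Rightarrow> 'b \<Rightarrow> real" where
  "ou_average f t \<omega> = (\<integral>s. indicator {0..t} s * f (OU s \<omega>) \<partial>unit_time)"

lemma ou_average_square_integrable:
  assumes "square_integrable std_normal f"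
  shows "square_integrable N (ou_average f t)" "l2norm N (ou_average f t) \<le> l2norm std_normal f"
  using average_square_integrable[OF unit_time_prob_space sigma_finite_measure_axioms OU_process_square_integrable(1)[OF assms, of t]]
    OU_process_square_integrable(2)[OF assms, of t] unfolding ou_average_def[abs_def] by auto

lemma OU_hermite_inner:
  assumes "0 \<le> s" "s \<le> 1" "0 \<le> u" "u \<le> 1"
  shows "(\<integral>\<omega>. hermite p (OU s \<omega>) * hermite q (OU u \<omega>) \<partial>N) = (if p = q then fact q * exp (- \<gamma> * \<bar>s - u\<bar>) ^ q else 0)"
  by (rule joint_gaussian_hermite[OF prob_space_axioms OU_joint_gaussian[OF assms]])

lemma ou_average_hermite_norm:
  "(l2norm N (ou_average (hermite q) t))\<^sup>2 =
    fact q * (\<integral>s. (\<integral>u. indicator {0..t} s * (indicator {0..t} u * exp (- \<gamma> * \<bar>s - u\<bar>) ^ q) \<partial>unit_time) \<partial>unit_time)"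
proof -
  let ?g = "\<lambda>p. indicator {0..t} (fst p) * hermite q (OU (fst p) (snd p))"
  have "(l2norm N (ou_average (hermite q) t))\<^sup>2 = (\<integral>s. (\<integral>u. (\<integral>\<omega>. ?g (s, \<omega>) * ?g (u, \<omega>) \<partial>N) \<partial>unit_time) \<partial>unit_time)"
  proof -
    have sq: "square_integrable N (\<lambda>\<omega>. ?g (s, \<omega>))" if "s \<in> space unit_time" for s
      using OU_function_square_integrable(1)[OF hermite_square_integrable, of s q] that
      by (auto intro!: square_integrable_cmult)
    show ?thesis
      unfolding ou_average_def[abs_def]
      using average_l2norm[OF unit_time_prob_space sigma_finite_measure_axioms
          OU_process_square_integrable(1)[OF hermite_square_integrable[of q], of t] sq] by simp
  qed
  also have "\<dots> = (\<integral>s. (\<integral>u. fact q * (indicator {0..t} s * (indicator {0..t} u * exp (- \<gamma> * \<bar>s - u\<bar>) ^ q)) \<partial>unit_time) \<partial>unit_time)"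
  proof (intro Bochner_Integration.integral_cong refl)
    fix s u assume "s \<in> space unit_time" "u \<in> space unit_time"
    then have "(\<integral>\<omega>. hermite q (OU s \<omega>) * hermite q (OU u \<omega>) \<partial>N) = fact q * exp (- \<gamma> * \<bar>s - u\<bar>) ^ q"
      using OU_hermite_inner[of s u q q] by simp
    moreover have "(\<integral>\<omega>. ?g (s, \<omega>) * ?g (u, \<omega>) \<partial>N) = indicator {0..t} s * (indicator {0..t} u * (\<integral>\<omega>. hermite q (OU s \<omega>) * hermite q (OU u \<omega>) \<partial>N))"
      by (simp add: mult.assoc mult.left_commute[of "hermite q _"])
    ultimately show "(\<integral>\<omega>. ?g (s, \<omega>) * ?g (u, \<omega>) \<partial>N) = fact q * (indicator {0..t} s * (indicator {0..t} u * exp (- \<gamma> * \<bar>s - u\<bar>) ^ q))"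
      by simp
  qed
  finally show ?thesis by simp
qed

text \<open>The kernel side of the comparison. Tensor powers of the Ornstein-Uhlenbeck kernels have
  the inner products \<open>exp (- \<gamma> * \<bar>s - u\<bar>) ^ q\<close>, which are the Hermite
  covariances without \<open>fact q\<close>; time averages therefore match
  \<open>ou_average_hermite_norm\<close> up to this factor.\<close>

lemma ou_tensor_average:
  fixes q :: nat and t :: real
  defines "R \<equiv> Pi\<^sub>M {..<q} (\<lambda>_. lborel)"
  defines "\<kappa> \<equiv> \<lambda>t x. \<integral>s. indicator {0..t} s * ou_tensor \<gamma> q s x \<partial>unit_time"
  shows "square_integrable R (\<kappa> t)"
    and "AE x in R. square_integrable unit_time (\<lambda>s. indicator {0..t} s * ou_tensor \<gamma> q s x)"
    and "(l2norm R (\<kappa> t))\<^sup>2 =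
      (\<integral>s. (\<integral>u. indicator {0..t} s * (indicator {0..t} u * exp (- \<gamma> * \<bar>s - u\<bar>) ^ q) \<partial>unit_time) \<partial>unit_time)"
    and "square_integrable R h \<Longrightarrow> (\<integral>x. \<kappa> t x * h x \<partial>R) = (\<integral>s. indicator {0..t} s * (\<integral>x. ou_tensor \<gamma> q s x * h x \<partial>R) \<partial>unit_time)"
proof -
  let ?g = "\<lambda>p. indicator {0..t} (fst p) * ou_tensor \<gamma> q (fst p) (snd p)"
  have sR: "sigma_finite_measure R" unfolding R_def by (rule sigma_finite_lborel_power)
  have T: "square_integrable R (ou_tensor \<gamma> q s)" for s
    unfolding R_def ou_tensor_def[abs_def] by (intro tensor_square_integrable ou_kernel_square_integrable \<gamma>_pos)
  have I: "(\<integral>x. ou_tensor \<gamma> q s x * ou_tensor \<gamma> q u x \<partial>R) = exp (- \<gamma> * \<bar>s - u\<bar>) ^ q" for s u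
    unfolding R_def ou_tensor_def using has_bochner_integral_ou_kernel_mult[OF \<gamma>_pos, of s u]
    by (subst tensor_inner) (auto intro: ou_kernel_square_integrable[OF \<gamma>_pos] simp: has_bochner_integral_iff)
  have m: "?g \<in> borel_measurable (unit_time \<Otimes>\<^sub>M R)"
  proof (rule measurable_unit_time_pair)
    note [measurable] = ou_tensor_measurable[of \<gamma> q, folded R_def]
    show "?g \<in> borel_measurable (borel \<Otimes>\<^sub>M R)" by measurable
  qed
  have sq: "square_integrable R (\<lambda>x. ?g (s, x))" for s
    using square_integrable_cmult[OF T] by simp
  have G: "square_integrable (unit_time \<Otimes>\<^sub>M R) ?g"
  proof (rule square_integrable_pairI(1)[OF unit_time_prob_space sR m sq])
    fix s
    show "(\<integral>x. (?g (s, x))\<^sup>2 \<partial>R) \<le> 1"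
      using I[of s s] by (simp add: power2_eq_square[symmetric] power_mult_distrib indicator_def)
  qed
  show "square_integrable R (\<kappa> t)" "AE x in R. square_integrable unit_time (\<lambda>s. indicator {0..t} s * ou_tensor \<gamma> q s x)"
    using average_square_integrable(1,3)[OF unit_time_prob_space sR G] by (simp_all add: \<kappa>_def)
  have "(l2norm R (\<kappa> t))\<^sup>2 = (\<integral>s. (\<integral>u. (\<integral>x. ?g (s, x) * ?g (u, x) \<partial>R) \<partial>unit_time) \<partial>unit_time)"
    unfolding \<kappa>_def using average_l2norm[OF unit_time_prob_space sR G sq] by simp
  also have "\<dots> = (\<integral>s. (\<integral>u. indicator {0..t} s * (indicator {0..t} u * exp (- \<gamma> * \<bar>s - u\<bar>) ^ q) \<partial>unit_time) \<partial>unit_time)"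
  proof (intro Bochner_Integration.integral_cong refl)
    fix s u
    show "(\<integral>x. ?g (s, x) * ?g (u, x) \<partial>R) = indicator {0..t} s * (indicator {0..t} u * exp (- \<gamma> * \<bar>s - u\<bar>) ^ q)"
      unfolding I[symmetric] by (simp add: mult.assoc mult.left_commute[of "ou_tensor \<gamma> q _ _"])
  qed
  finally show "(l2norm R (\<kappa> t))\<^sup>2 =
      (\<integral>s. (\<integral>u. indicator {0..t} s * (indicator {0..t} u * exp (- \<gamma> * \<bar>s - u\<bar>) ^ q) \<partial>unit_time) \<partial>unit_time)" .
  assume h: "square_integrable R h"
  show "(\<integral>x. \<kappa> t x * h x \<partial>R) = (\<integral>s. indicator {0..t} s * (\<integral>x. ou_tensor \<gamma> q s x * h x \<partial>R) \<partial>unit_time)"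
    unfolding \<kappa>_def using average_inner[OF unit_time_prob_space sR G h] by (simp add: mult.assoc)
qed

lemma l2norm_diff_power2:
  assumes f: "square_integrable M f" and g: "square_integrable M g"
  shows "(l2norm M (\<lambda>x. f x - c * g x))\<^sup>2 = (l2norm M f)\<^sup>2 - 2 * c * (\<integral>x. g x * f x \<partial>M) + c\<^sup>2 * (l2norm M g)\<^sup>2"
proof -
  have "(l2norm M (\<lambda>x. f x - c * g x))\<^sup>2 = (\<integral>x. (f x)\<^sup>2 - 2 * c * (g x * f x) + c\<^sup>2 * (g x)\<^sup>2 \<partial>M)"
    unfolding l2norm_power2 by (simp add: power2_diff power_mult_distrib algebra_simps)
  then show ?thesis
    using square_integrable_mult[OF g f] f g by (simp add: l2norm_power2 square_integrable_def)
qed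

text \<open>
  Expanding the square, the mixed terms and the squares of the limits on both sides agree up to the
  factor \<open>q!\<close>, and for the step integral there is the isometry inequality. So one estimate
  gives both the existence and the uniqueness of the multiple integral.
\<close>

lemma step_integral_error:
  assumes \<tau>: "strict_mono_on {..k} \<tau>" and t: "0 \<le> t" "t \<le> 1"
  shows "(l2norm N (\<lambda>\<omega>. step_integral B q k \<tau> a \<omega> - ou_weight \<gamma> q * ou_average (hermite q) t \<omega>))\<^sup>2
    \<le> fact q * (l2norm (Pi\<^sub>M {..<q} (\<lambda>_. lborel)) (\<lambda>x. step_kernel q k \<tau> a x - tempered_kernel \<gamma> q t x))\<^sup>2"
proof -
  define R where "R = Pi\<^sub>M {..<q} (\<lambda>_. lborel :: real measure)"
  define \<kappa> where "\<kappa> x = (\<integral>s. indicator {0..t} s * ou_tensor \<gamma> q s x \<partial>unit_time)" for x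
  let ?I = "step_integral B q k \<tau> a" and ?G = "ou_average (hermite q) t"
  let ?h = "step_kernel q k \<tau> a" and ?w = "ou_weight \<gamma> q"
  have I: "square_integrable N ?I" by (rule step_integral_square_integrable[OF \<tau>])
  have G: "square_integrable N ?G" by (rule ou_average_square_integrable[OF hermite_square_integrable])
  have h: "square_integrable R ?h" unfolding R_def by (rule step_kernel_square_integrable)
  have K: "square_integrable R \<kappa>" unfolding \<kappa>_def R_def by (rule ou_tensor_average(1))
  \<comment> \<open>At each fixed time the pairing of the step integral with the Hermite polynomial
    of \<open>OU s\<close> is \<open>fact q\<close> times the pairing of the kernels; averaging over
    \<open>s\<close> carries this over to the time integrals.\<close>
  have inner: "(\<integral>\<omega>. hermite q (OU s \<omega>) * ?I \<omega> \<partial>N) = fact q * (\<integral>x. ou_tensor \<gamma> q s x * ?h x \<partial>R)"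
    if s: "s \<in> space unit_time" for s
  proof -
    have s: "0 \<le> s" "s \<le> 1" using s by auto
    have int: "integrable N (\<lambda>\<omega>. (\<Prod>r<q. B (\<tau> (Suc (i r))) \<omega> - B (\<tau> (i r)) \<omega>) * hermite q (OU s \<omega>))" if "i \<in> offdiag q k" for i
      by (intro square_integrable_mult offdiag_product_square_integrable[OF \<tau> that]
        OU_function_square_integrable[OF hermite_square_integrable s])
    have "(\<integral>\<omega>. hermite q (OU s \<omega>) * ?I \<omega> \<partial>N) =
       (\<integral>\<omega>. (\<Sum>i\<in>offdiag q k. a i * ((\<Prod>r<q. B (\<tau> (Suc (i r))) \<omega> - B (\<tau> (i r)) \<omega>) * hermite q (OU s \<omega>))) \<partial>N)"
      unfolding step_integral_def by (simp add: sum_distrib_left mult_ac)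
    also have "\<dots> = (\<Sum>i\<in>offdiag q k. a i * (\<integral>\<omega>. (\<Prod>r<q. B (\<tau> (Suc (i r))) \<omega> - B (\<tau> (i r)) \<omega>) * hermite q (OU s \<omega>) \<partial>N))"
      using int by (subst Bochner_Integration.integral_sum) auto
    also have "\<dots> = fact q * (\<Sum>i\<in>offdiag q k. a i * (\<Prod>r<q. \<integral>x. ou_kernel \<gamma> s x * indicator {\<tau> (i r)<..\<tau> (Suc (i r))} x \<partial>lborel))"
      unfolding sum_distrib_left by (intro sum.cong refl) (subst offdiag_product_hermite[OF \<tau> _ s], simp_all)
    also have "\<dots> = fact q * (\<integral>x. ou_tensor \<gamma> q s x * ?h x \<partial>R)"
      unfolding R_def ou_tensor_def by (subst step_kernel_tensor_inner) (auto intro: ou_kernel_square_integrable[OF \<gamma>_pos])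
    finally show ?thesis .
  qed
  have "(\<integral>\<omega>. ?G \<omega> * ?I \<omega> \<partial>N) = (\<integral>s. (\<integral>\<omega>. indicator {0..t} s * hermite q (OU s \<omega>) * ?I \<omega> \<partial>N) \<partial>unit_time)"
    unfolding ou_average_def
    using average_inner[OF unit_time_prob_space sigma_finite_measure_axioms OU_process_square_integrable(1)[OF hermite_square_integrable[of q], of t] I] by simp
  also have "\<dots> = (\<integral>s. fact q * (indicator {0..t} s * (\<integral>x. ou_tensor \<gamma> q s x * ?h x \<partial>R)) \<partial>unit_time)"
    by (intro Bochner_Integration.integral_cong refl) (simp add: inner mult.assoc)
  also have "\<dots> = fact q * (\<integral>x. \<kappa> x * ?h x \<partial>R)"
    using ou_tensor_average(4)[OF h[unfolded R_def], of t] by (simp add: \<kappa>_def R_def)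
  finally have cross: "(\<integral>\<omega>. ?G \<omega> * ?I \<omega> \<partial>N) = fact q * (\<integral>x. \<kappa> x * ?h x \<partial>R)" .
  have norm: "(l2norm N ?G)\<^sup>2 = fact q * (l2norm R \<kappa>)\<^sup>2"
    using ou_average_hermite_norm[of q t] ou_tensor_average(3)[of q t] unfolding \<kappa>_def[abs_def] R_def by simp
  have "(l2norm N (\<lambda>\<omega>. ?I \<omega> - ?w * ?G \<omega>))\<^sup>2 \<le> fact q * (l2norm R (\<lambda>x. ?h x - ?w * \<kappa> x))\<^sup>2"
    unfolding l2norm_diff_power2[OF I G] l2norm_diff_power2[OF h K] cross norm
    using step_integral_l2norm[OF \<tau>, of q a] by (simp add: R_def algebra_simps)
  then show ?thesis
    using tempered_kernel_eq[OF \<gamma>_pos t, of q] by (simp add: \<kappa>_def R_def)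
qed

end

section \<open>Off-diagonal approximation of the tempered kernel\<close>

text \<open>
  The off-diagonal step kernels are built from the step functions approximating the
  Ornstein-Uhlenbeck kernels from below, so that everything is dominated by the limit.
\<close>

definition offdiag_approx :: "real \<Rightarrow> nat \<Rightarrow> nat \<Rightarrow> real \<Rightarrow> (nat \<Rightarrow> real) \<Rightarrow> real" where
  "offdiag_approx \<gamma> q n s x = (\<Sum>i\<in>offdiag q (Suc n * 4 ^ n).
     (\<Prod>r<q. ou_coeff \<gamma> n s (i r)) * (\<Prod>r<q. indicator {ou_grid n (i r)<..ou_grid n (Suc (i r))} (x r)))"

lemma ou_step_tensor_expand:
  fixes q :: nat
  shows "(\<Prod>r<q. ou_step \<gamma> n s (x r)) = (\<Sum>i\<in>{..<q} \<rightarrow>\<^sub>E {..<Suc n * 4 ^ n}.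
     (\<Prod>r<q. ou_coeff \<gamma> n s (i r)) * (\<Prod>r<q. indicator {ou_grid n (i r)<..ou_grid n (Suc (i r))} (x r)))"
  unfolding ou_step_def by (subst prod_sum_PiE) (simp_all add: prod.distrib)

lemma ou_coeff_bounds: "\<gamma> > 0 \<Longrightarrow> 0 \<le> ou_coeff \<gamma> n s j" "\<gamma> > 0 \<Longrightarrow> ou_coeff \<gamma> n s j \<le> sqrt (2 * \<gamma>)"
proof -
  assume \<gamma>: "\<gamma> > 0"
  show "0 \<le> ou_coeff \<gamma> n s j" using \<gamma> by (simp add: ou_coeff_def)
  have "ou_grid n j \<le> ou_grid n (Suc j)" by (simp add: ou_grid_def divide_right_mono)
  then have "ou_grid n (Suc j) \<le> s \<Longrightarrow> exp (- \<gamma> * (s - ou_grid n j)) \<le> 1" using \<gamma> by simp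
  then show "ou_coeff \<gamma> n s j \<le> sqrt (2 * \<gamma>)" using \<gamma> by (simp add: ou_coeff_def mult_left_le)
qed

lemma offdiag_approx_bounds:
  assumes \<gamma>: "\<gamma> > 0" and s: "s \<le> 1"
  shows "0 \<le> offdiag_approx \<gamma> q n s x" "offdiag_approx \<gamma> q n s x \<le> ou_tensor \<gamma> q s x"
proof -
  show "0 \<le> offdiag_approx \<gamma> q n s x"
    unfolding offdiag_approx_def using ou_coeff_bounds(1)[OF \<gamma>]
    by (intro sum_nonneg mult_nonneg_nonneg prod_nonneg) auto
  have "offdiag_approx \<gamma> q n s x \<le> (\<Prod>r<q. ou_step \<gamma> n s (x r))"
    unfolding offdiag_approx_def ou_step_tensor_expand using ou_coeff_bounds(1)[OF \<gamma>]
    by (intro sum_mono2 mult_nonneg_nonneg prod_nonneg finite_PiE) (auto simp: offdiag_def)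
  also have "\<dots> \<le> ou_tensor \<gamma> q s x"
    unfolding ou_tensor_def using ou_step_bounds[OF \<gamma> s] by (intro prod_mono) auto
  finally show "offdiag_approx \<gamma> q n s x \<le> ou_tensor \<gamma> q s x" .
qed

lemma ou_step_tendsto:
  assumes \<gamma>: "\<gamma> > 0" and s: "s \<le> 1" and x: "x \<noteq> s"
  shows "(\<lambda>n. ou_step \<gamma> n s x) \<longlonglongrightarrow> ou_kernel \<gamma> s x"
proof -
  have d: "(\<lambda>n. (1::real) / 4 ^ n) \<longlonglongrightarrow> 0"
    using LIMSEQ_realpow_zero[of "1 / 4 :: real"] by (simp add: power_one_over)
  let ?K = "ou_kernel \<gamma> s x"
  have "(\<lambda>n. (?K - ou_step \<gamma> n s x)\<^sup>2) \<longlonglongrightarrow> 0"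
  proof (rule Lim_null_comparison)
    have "\<forall>\<^sub>F n in sequentially. 1 / 4 ^ n < \<bar>x - s\<bar>"
      using order_tendstoD(2)[OF d, of "\<bar>x - s\<bar>"] x by simp
    moreover have "\<forall>\<^sub>F n in sequentially. - real n < x"
      using eventually_gt_at_top[of "nat \<lceil>- x\<rceil>"] by eventually_elim linarith
    ultimately show "\<forall>\<^sub>F n in sequentially. norm ((?K - ou_step \<gamma> n s x)\<^sup>2) \<le> (\<gamma> * (1 / 4 ^ n))\<^sup>2 * ?K\<^sup>2"
    proof eventually_elim
      fix n assume n: "1 / 4 ^ n < \<bar>x - s\<bar>" "- real n < x"
      then have "indicat_real {s - 1 / 4 ^ n<..s} x = 0" "indicat_real {..- real n} x = 0"
        by (auto simp: indicator_def)
      then show "norm ((?K - ou_step \<gamma> n s x)\<^sup>2) \<le> (\<gamma> * (1 / 4 ^ n))\<^sup>2 * ?K\<^sup>2"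
        using ou_step_error[OF \<gamma> s, of x n] by simp
    qed
    have "(\<lambda>n. (\<gamma> * (1 / 4 ^ n))\<^sup>2 * ?K\<^sup>2) \<longlonglongrightarrow> (\<gamma> * 0)\<^sup>2 * ?K\<^sup>2"
      by (intro tendsto_intros d)
    then show "(\<lambda>n. (\<gamma> * (1 / 4 ^ n))\<^sup>2 * ?K\<^sup>2) \<longlonglongrightarrow> 0" by simp
  qed
  from tendsto_real_sqrt[OF this] have "(\<lambda>n. \<bar>?K - ou_step \<gamma> n s x\<bar>) \<longlonglongrightarrow> 0" by simp
  then have "(\<lambda>n. ?K - ou_step \<gamma> n s x) \<longlonglongrightarrow> 0" by (rule tendsto_rabs_zero_cancel)
  from tendsto_diff[OF tendsto_const[of ?K] this] show ?thesis by simp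
qed

text \<open>Once the mesh is at most the smallest distance between coordinates of \<open>x\<close>,
  no half-open cell contains two of them. The omitted diagonal terms are then 0, and the
  approximation equals the full tensor power of the step functions, which converges factor by factor
  away from \<open>s\<close>.\<close>

lemma offdiag_approx_tendsto:
  assumes \<gamma>: "\<gamma> > 0" and s: "s \<le> 1" and x: "inj_on x {..<q}" and sx: "\<And>r. r < q \<Longrightarrow> x r \<noteq> s"
  shows "(\<lambda>n. offdiag_approx \<gamma> q n s x) \<longlonglongrightarrow> ou_tensor \<gamma> q s x"
proof -
  have d: "(\<lambda>n. (1::real) / 4 ^ n) \<longlonglongrightarrow> 0"
    using LIMSEQ_realpow_zero[of "1 / 4 :: real"] by (simp add: power_one_over)
  have ev: "\<forall>\<^sub>F n in sequentially. \<forall>r\<in>{..<q}. \<forall>r'\<in>{..<q}. r \<noteq> r' \<longrightarrow> 1 / 4 ^ n \<le> \<bar>x r - x r'\<bar>"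
  proof (intro eventually_ball_finite ballI finite_lessThan)
    fix r r' assume r: "r \<in> {..<q}" "r' \<in> {..<q}"
    show "\<forall>\<^sub>F n in sequentially. r \<noteq> r' \<longrightarrow> 1 / 4 ^ n \<le> \<bar>x r - x r'\<bar>"
    proof (cases "r = r'")
      case False
      then have "x r \<noteq> x r'" using x r by (auto simp: inj_on_def)
      then have "\<forall>\<^sub>F n in sequentially. 1 / 4 ^ n < \<bar>x r - x r'\<bar>"
        using order_tendstoD(2)[OF d, of "\<bar>x r - x r'\<bar>"] by simp
      then show ?thesis by eventually_elim simp
    qed simp
  qed
  have "\<forall>\<^sub>F n in sequentially. (\<Prod>r<q. ou_step \<gamma> n s (x r)) = offdiag_approx \<gamma> q n s x"
    using ev
  proof eventually_elim
    fix n assume n: "\<forall>r\<in>{..<q}. \<forall>r'\<in>{..<q}. r \<noteq> r' \<longrightarrow> 1 / 4 ^ n \<le> \<bar>x r - x r'\<bar>"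
    show "(\<Prod>r<q. ou_step \<gamma> n s (x r)) = offdiag_approx \<gamma> q n s x"
      unfolding offdiag_approx_def ou_step_tensor_expand
    proof (rule sum.mono_neutral_right)
      show "\<forall>i\<in>({..<q} \<rightarrow>\<^sub>E {..<Suc n * 4 ^ n}) - offdiag q (Suc n * 4 ^ n).
        (\<Prod>r<q. ou_coeff \<gamma> n s (i r)) * (\<Prod>r<q. indicat_real {ou_grid n (i r)<..ou_grid n (Suc (i r))} (x r)) = 0"
      proof
        fix i assume "i \<in> ({..<q} \<rightarrow>\<^sub>E {..<Suc n * 4 ^ n}) - offdiag q (Suc n * 4 ^ n)"
        then have "\<not> inj_on i {..<q}" by (auto simp: offdiag_def)
        then obtain r r' where r: "r < q" "r' < q" "r \<noteq> r'" "i r = i r'" by (auto simp: inj_on_def)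
        have "ou_grid n (Suc (i r)) = ou_grid n (i r) + 1 / 4 ^ n" by (simp add: ou_grid_def add_divide_distrib)
        moreover have "1 / 4 ^ n \<le> \<bar>x r - x r'\<bar>" using n r by simp
        ultimately have "x r \<notin> {ou_grid n (i r)<..ou_grid n (Suc (i r))} \<or> x r' \<notin> {ou_grid n (i r')<..ou_grid n (Suc (i r'))}"
          using r(4) by (auto simp: abs_real_def split: if_splits)
        then have "(\<Prod>r<q. indicat_real {ou_grid n (i r)<..ou_grid n (Suc (i r))} (x r)) = 0"
          using r(1,2) by (intro prod_zero) (auto simp: indicator_def)
        then show "(\<Prod>r<q. ou_coeff \<gamma> n s (i r)) * (\<Prod>r<q. indicat_real {ou_grid n (i r)<..ou_grid n (Suc (i r))} (x r)) = 0"
          by simp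
      qed
    qed (auto simp: offdiag_def intro: finite_PiE)
  qed
  moreover have "(\<lambda>n. \<Prod>r<q. ou_step \<gamma> n s (x r)) \<longlonglongrightarrow> ou_tensor \<gamma> q s x"
    unfolding ou_tensor_def using ou_step_tendsto[OF \<gamma> s] sx by (intro tendsto_prod) auto
  ultimately show ?thesis by (rule Lim_transform_eventually[rotated])
qed

lemma ou_tensor_bound: "\<gamma> > 0 \<Longrightarrow> ou_tensor \<gamma> q s x \<le> sqrt (2 * \<gamma>) ^ q"
proof -
  assume \<gamma>: "\<gamma> > 0"
  have "0 \<le> ou_kernel \<gamma> s y \<and> ou_kernel \<gamma> s y \<le> sqrt (2 * \<gamma>)" for y
    using \<gamma> by (auto simp: ou_kernel_def indicator_def intro!: mult_left_le)
  then have "(\<Prod>r<q. ou_kernel \<gamma> s (x r)) \<le> (\<Prod>r<q. sqrt (2 * \<gamma>))" by (intro prod_mono) auto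
  then show ?thesis by (simp add: ou_tensor_def)
qed

text \<open>The diagonals are null sets: integrating over one of the two coinciding coordinates
  first, each section is a single point.\<close>

lemma AE_lborel_power_inj: "AE x in Pi\<^sub>M {..<q::nat} (\<lambda>_. lborel :: real measure). inj_on x {..<q}"
proof -
  let ?R = "Pi\<^sub>M {..<q} (\<lambda>_. lborel :: real measure)"
  have "AE x in ?R. x r \<noteq> x r'" if r: "r < q" "r' < q" "r \<noteq> r'" for r r'
  proof -
    let ?f = "\<lambda>x :: nat \<Rightarrow> real. indicator {x. x r = x r'} x :: ennreal"
    have ins: "insert r ({..<q} - {r}) = {..<q}" using r by auto
    have m: "(\<lambda>x. x r) \<in> borel_measurable ?R" "(\<lambda>x. x r') \<in> borel_measurable ?R"
      using measurable_component_singleton[of r "{..<q}" "\<lambda>_. lborel :: real measure"]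
        measurable_component_singleton[of r' "{..<q}" "\<lambda>_. lborel :: real measure"] r by auto
    have s: "{x \<in> space ?R. x r = x r'} \<in> sets ?R" using m by measurable
    have f: "?f \<in> borel_measurable ?R"
    proof -
      have "(\<lambda>x. indicator {x \<in> space ?R. x r = x r'} x :: ennreal) \<in> borel_measurable ?R" using s by simp
      then show ?thesis by (rule measurable_cong[THEN iffD1, rotated]) (auto simp: indicator_def)
    qed
    have "(\<integral>\<^sup>+x. ?f x \<partial>?R) = (\<integral>\<^sup>+x. (\<integral>\<^sup>+y. ?f (x(r := y)) \<partial>lborel) \<partial>Pi\<^sub>M ({..<q} - {r}) (\<lambda>_. lborel))"
      using lborel_product.product_nn_integral_insert[of "{..<q} - {r}" r ?f] f unfolding ins by simp
    also have "\<dots> = (\<integral>\<^sup>+x. 0 \<partial>Pi\<^sub>M ({..<q} - {r}) (\<lambda>_. lborel :: real measure))"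
    proof (rule nn_integral_cong)
      fix x
      have "(\<integral>\<^sup>+y. ?f (x(r := y)) \<partial>lborel) = (\<integral>\<^sup>+y. indicator {x r'} y \<partial>(lborel :: real measure))"
        using r by (intro nn_integral_cong) (auto simp: indicator_def)
      then show "(\<integral>\<^sup>+y. ?f (x(r := y)) \<partial>lborel) = 0" by simp
    qed
    finally have "(\<integral>\<^sup>+x. ?f x \<partial>?R) = 0" by simp
    then have "AE x in ?R. ?f x = 0" using f by (subst (asm) nn_integral_0_iff_AE) auto
    then show ?thesis by eventually_elim (auto simp: indicator_def)
  qed
  then have "AE x in ?R. \<forall>r\<in>{..<q}. \<forall>r'\<in>{..<q}. r \<noteq> r' \<longrightarrow> x r \<noteq> x r'"
    by (intro AE_finite_allI finite_lessThan) auto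
  then show ?thesis by eventually_elim (auto simp: inj_on_def)
qed

lemma AE_unit_time_notin:
  assumes "finite F"
  shows "AE s in unit_time. s \<notin> F"
proof -
  have "AE s in lborel. s \<notin> F"
    using assms by (intro AE_not_in) (auto simp: null_sets_def emeasure_lborel_countable countable_finite intro!: borel_closed finite_imp_closed)
  then show ?thesis unfolding unit_time_def by (subst AE_restrict_space_iff) auto
qed

context ou_process
begin

text \<open>Dominated convergence twice: over time for a fixed \<open>x\<close> with distinct
  coordinates, with a constant bound, and then over \<open>x\<close> with the limit kernel itself as
  majorant. The second is possible because the approximation stays between 0 and its limit.\<close>

lemma tempered_kernel_approximation:
  fixes q :: nat
  assumes t: "0 \<le> t" "t \<le> 1"
  defines "a \<equiv> \<lambda>n i. ou_weight \<gamma> q * (\<integral>s. indicator {0..t} s * (\<Prod>r<q. ou_coeff \<gamma> n s (i r)) \<partial>unit_time)"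
  shows "(\<lambda>n. l2norm (Pi\<^sub>M {..<q} (\<lambda>_. lborel))
     (\<lambda>x. step_kernel q (Suc n * 4 ^ n) (ou_grid n) (a n) x - tempered_kernel \<gamma> q t x)) \<longlonglongrightarrow> 0"
    and "square_integrable (Pi\<^sub>M {..<q} (\<lambda>_. lborel)) (tempered_kernel \<gamma> q t)"
proof -
  let ?R = "Pi\<^sub>M {..<q} (\<lambda>_. lborel :: real measure)"
  let ?w = "ou_weight \<gamma> q"
  have w: "?w > 0" using \<gamma>_pos by (simp add: ou_weight_def)
  define \<kappa> where "\<kappa> x = (\<integral>s. indicator {0..t} s * ou_tensor \<gamma> q s x \<partial>unit_time)" for x
  define \<kappa>n where "\<kappa>n n x = (\<integral>s. indicator {0..t} s * offdiag_approx \<gamma> q n s x \<partial>unit_time)" for n x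
  have tk: "tempered_kernel \<gamma> q t = (\<lambda>x. ?w * \<kappa> x)"
    using tempered_kernel_eq[OF \<gamma>_pos t, of q] by (auto simp: \<kappa>_def)
  have K: "square_integrable ?R \<kappa>" unfolding \<kappa>_def[abs_def] by (rule ou_tensor_average(1))
  show "square_integrable ?R (tempered_kernel \<gamma> q t)"
    unfolding tk by (rule square_integrable_cmult[OF K])
  have coeff_m: "(\<lambda>s. ou_coeff \<gamma> n s j) \<in> borel_measurable unit_time" for n j
    unfolding ou_coeff_def by measurable
  have approx_m: "(\<lambda>s. offdiag_approx \<gamma> q n s x) \<in> borel_measurable unit_time" for n x
    unfolding offdiag_approx_def using coeff_m by (intro borel_measurable_sum borel_measurable_times borel_measurable_prod) auto
  have ind_m: "indicat_real {0..t} \<in> borel_measurable unit_time" by measurable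
  have tensor_m: "(\<lambda>s. ou_tensor \<gamma> q s x) \<in> borel_measurable unit_time" for x
  proof -
    have "(\<lambda>s. ou_kernel \<gamma> s y) \<in> borel_measurable unit_time" for y
      using measurable_compose[OF measurable_Pair[OF measurable_unit_time_id measurable_const[of y]] ou_kernel_measurable(1)[of \<gamma>]]
      by simp
    then show ?thesis unfolding ou_tensor_def by (intro borel_measurable_prod)
  qed
  have coeff_int: "integrable unit_time (\<lambda>s. indicator {0..t} s * (\<Prod>r<q. ou_coeff \<gamma> n s (i r)))" for n i
  proof (rule unit_time.integrable_const_bound[where B="sqrt (2 * \<gamma>) ^ q"])
    show "(\<lambda>s. indicator {0..t} s * (\<Prod>r<q. ou_coeff \<gamma> n s (i r))) \<in> borel_measurable unit_time"
      using coeff_m ind_m by (intro borel_measurable_times borel_measurable_prod) auto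
    have "norm (\<Prod>r<q. ou_coeff \<gamma> n s (i r)) \<le> (\<Prod>r<q. sqrt (2 * \<gamma>))" for s
      unfolding real_norm_def abs_prod using ou_coeff_bounds[OF \<gamma>_pos] by (intro prod_mono) auto
    then show "AE s in unit_time. norm (indicator {0..t} s * (\<Prod>r<q. ou_coeff \<gamma> n s (i r))) \<le> sqrt (2 * \<gamma>) ^ q"
      using \<gamma>_pos by (intro AE_I2) (auto simp: indicator_def)
  qed
  \<comment> \<open>The grid does not depend on the time \<open>s\<close>. Averaging the step
    kernels over \<open>s\<close> thus acts on the coefficients alone and gives again an
    off-diagonal step kernel.\<close>
  have step: "step_kernel q (Suc n * 4 ^ n) (ou_grid n) (a n) x = ?w * \<kappa>n n x" for n x
  proof -
    have "\<kappa>n n x = (\<integral>s. (\<Sum>i\<in>offdiag q (Suc n * 4 ^ n). (indicator {0..t} s * (\<Prod>r<q. ou_coeff \<gamma> n s (i r))) *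
        (\<Prod>r<q. indicator {ou_grid n (i r)<..ou_grid n (Suc (i r))} (x r))) \<partial>unit_time)"
      unfolding \<kappa>n_def offdiag_approx_def sum_distrib_left by (simp only: mult.assoc)
    also have "\<dots> = (\<Sum>i\<in>offdiag q (Suc n * 4 ^ n). (\<integral>s. indicator {0..t} s * (\<Prod>r<q. ou_coeff \<gamma> n s (i r)) \<partial>unit_time) *
        (\<Prod>r<q. indicator {ou_grid n (i r)<..ou_grid n (Suc (i r))} (x r)))"
      using coeff_int by (subst Bochner_Integration.integral_sum) auto
    finally show ?thesis unfolding step_kernel_def a_def by (simp add: sum_distrib_left mult.assoc)
  qed
  have \<kappa>n_m: "\<kappa>n n \<in> borel_measurable ?R" for n
  proof -
    have "(\<lambda>x. ?w * \<kappa>n n x) \<in> borel_measurable ?R"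
      using step_kernel_square_integrable[of q "Suc n * 4 ^ n" "ou_grid n" "a n"]
      unfolding step[symmetric] by (simp add: square_integrable_def)
    then have "(\<lambda>x. (1 / ?w) * (?w * \<kappa>n n x)) \<in> borel_measurable ?R" by (rule borel_measurable_times[OF borel_measurable_const])
    moreover have "(\<lambda>x. (1 / ?w) * (?w * \<kappa>n n x)) = \<kappa>n n" using w by auto
    ultimately show ?thesis by metis
  qed
  have dom: "\<bar>indicator {0..t} s * offdiag_approx \<gamma> q n s x\<bar> \<le> sqrt (2 * \<gamma>) ^ q"
    "0 \<le> indicator {0..t} s * offdiag_approx \<gamma> q n s x"
    "indicator {0..t} s * offdiag_approx \<gamma> q n s x \<le> indicator {0..t} s * ou_tensor \<gamma> q s x"
    "\<bar>indicator {0..t} s * ou_tensor \<gamma> q s x\<bar> \<le> sqrt (2 * \<gamma>) ^ q" if "s \<in> {0..1}" for s n x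
    using offdiag_approx_bounds[OF \<gamma>_pos, of s q n x] ou_tensor_bound[OF \<gamma>_pos, of q s x] \<gamma>_pos that
    by (auto simp: indicator_def)
  have int1: "integrable unit_time (\<lambda>s. indicator {0..t} s * offdiag_approx \<gamma> q n s x)" for n x
    by (rule unit_time.integrable_const_bound[where B="sqrt (2 * \<gamma>) ^ q"])
       (use dom(1) approx_m ind_m in \<open>auto intro: borel_measurable_times\<close>)
  have int2: "integrable unit_time (\<lambda>s. indicator {0..t} s * ou_tensor \<gamma> q s x)" for x
    by (rule unit_time.integrable_const_bound[where B="sqrt (2 * \<gamma>) ^ q"])
       (use dom(4) tensor_m ind_m in \<open>auto intro: borel_measurable_times\<close>)
  have bd: "0 \<le> \<kappa>n n x" "\<kappa>n n x \<le> \<kappa> x" for n x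
    unfolding \<kappa>n_def \<kappa>_def using dom(2,3) int1 int2 by (auto intro!: integral_nonneg_AE integral_mono)
  have lim: "AE x in ?R. (\<lambda>n. \<kappa>n n x) \<longlonglongrightarrow> \<kappa> x"
    using AE_lborel_power_inj
  proof eventually_elim
    fix x :: "nat \<Rightarrow> real" assume x: "inj_on x {..<q}"
    have notin: "AE s in unit_time. s \<notin> x ` {..<q}" by (rule AE_unit_time_notin) simp
    show "(\<lambda>n. \<kappa>n n x) \<longlonglongrightarrow> \<kappa> x"
      unfolding \<kappa>n_def \<kappa>_def
    proof (rule integral_dominated_convergence[where w="\<lambda>_. sqrt (2 * \<gamma>) ^ q"])
      show "AE s in unit_time. (\<lambda>n. indicator {0..t} s * offdiag_approx \<gamma> q n s x) \<longlonglongrightarrow> indicator {0..t} s * ou_tensor \<gamma> q s x"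
        using notin AE_space
      proof (eventually_elim)
        fix s assume "s \<notin> x ` {..<q}" "s \<in> space unit_time"
        then show "(\<lambda>n. indicator {0..t} s * offdiag_approx \<gamma> q n s x) \<longlonglongrightarrow> indicator {0..t} s * ou_tensor \<gamma> q s x"
          by (intro tendsto_mult tendsto_const offdiag_approx_tendsto[OF \<gamma>_pos _ x]) auto
      qed
    qed (use dom(1) approx_m tensor_m ind_m in \<open>auto intro: borel_measurable_times\<close>)
  qed
  have "(\<lambda>n. \<integral>x. (\<kappa>n n x - \<kappa> x)\<^sup>2 \<partial>?R) \<longlonglongrightarrow> (\<integral>x. 0 \<partial>?R)"
  proof (rule integral_dominated_convergence[where w="\<lambda>x. (\<kappa> x)\<^sup>2"])
    show "integrable ?R (\<lambda>x. (\<kappa> x)\<^sup>2)" using K by (simp add: square_integrable_def)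
    show "(\<lambda>x. (\<kappa>n n x - \<kappa> x)\<^sup>2) \<in> borel_measurable ?R" for n
      using \<kappa>n_m K by (auto simp: square_integrable_def)
    show "AE x in ?R. (\<lambda>n. (\<kappa>n n x - \<kappa> x)\<^sup>2) \<longlonglongrightarrow> 0"
      using lim
    proof eventually_elim
      fix x assume "(\<lambda>n. \<kappa>n n x) \<longlonglongrightarrow> \<kappa> x"
      then have "(\<lambda>n. (\<kappa>n n x - \<kappa> x)\<^sup>2) \<longlonglongrightarrow> (\<kappa> x - \<kappa> x)\<^sup>2" by (intro tendsto_intros)
      then show "(\<lambda>n. (\<kappa>n n x - \<kappa> x)\<^sup>2) \<longlonglongrightarrow> 0" by simp
    qed
    show "AE x in ?R. norm ((\<kappa>n n x - \<kappa> x)\<^sup>2) \<le> (\<kappa> x)\<^sup>2" for n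
    proof (rule AE_I2)
      fix x
      have "\<bar>\<kappa>n n x - \<kappa> x\<bar> \<le> \<bar>\<kappa> x\<bar>" using bd[of n x] by linarith
      then show "norm ((\<kappa>n n x - \<kappa> x)\<^sup>2) \<le> (\<kappa> x)\<^sup>2" by (simp add: abs_le_square_iff)
    qed
  qed simp
  then have "(\<lambda>n. (l2norm ?R (\<lambda>x. \<kappa>n n x - \<kappa> x))\<^sup>2) \<longlonglongrightarrow> 0" by (simp add: l2norm_power2)
  from tendsto_real_sqrt[OF this] have "(\<lambda>n. l2norm ?R (\<lambda>x. \<kappa>n n x - \<kappa> x)) \<longlonglongrightarrow> 0" by simp
  from tendsto_mult_right_zero[OF this, of "\<bar>?w\<bar>"]
  show "(\<lambda>n. l2norm ?R (\<lambda>x. step_kernel q (Suc n * 4 ^ n) (ou_grid n) (a n) x - tempered_kernel \<gamma> q t x)) \<longlonglongrightarrow> 0"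
    unfolding step tk l2norm_cmult[symmetric] right_diff_distrib .
qed

text \<open>\<open>step_integral_error\<close> bounds the distance to one fixed variable by the
  kernel distance, so the limit is the same for every approximating sequence.\<close>

lemma step_integral_limit:
  assumes t: "0 \<le> t" "t \<le> 1" and \<tau>: "\<And>j::nat. strict_mono_on {..k j} (\<tau> j)"
    and lim: "L2_tendsto (Pi\<^sub>M {..<q} (\<lambda>_. lborel)) (\<lambda>j. step_kernel q (k j) (\<tau> j) (a j)) (tempered_kernel \<gamma> q t)"
  shows "L2_tendsto N (\<lambda>j. step_integral B q (k j) (\<tau> j) (a j)) (\<lambda>\<omega>. ou_weight \<gamma> q * ou_average (hermite q) t \<omega>)"
proof -
  let ?R = "Pi\<^sub>M {..<q} (\<lambda>_. lborel)"
  let ?e = "\<lambda>j. l2norm ?R (\<lambda>x. step_kernel q (k j) (\<tau> j) (a j) x - tempered_kernel \<gamma> q t x)"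
  let ?d = "\<lambda>j. l2norm N (\<lambda>\<omega>. step_integral B q (k j) (\<tau> j) (a j) \<omega> - ou_weight \<gamma> q * ou_average (hermite q) t \<omega>)"
  have e: "?e \<longlonglongrightarrow> 0"
    using lim by (subst (asm) L2_tendsto_iff_l2norm) (auto intro: step_kernel_square_integrable tempered_kernel_approximation(2)[OF t])
  have "?d j \<le> sqrt (fact q) * ?e j" for j
  proof (rule power2_le_imp_le)
    show "(?d j)\<^sup>2 \<le> (sqrt (fact q) * ?e j)\<^sup>2"
      using step_integral_error[OF \<tau>[of j] t, of q "a j"] by (simp add: power_mult_distrib)
  qed simp
  then have "?d \<longlonglongrightarrow> 0"
    by (intro Lim_null_comparison[OF _ tendsto_mult_right_zero[OF e, of "sqrt (fact q)"]]) auto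
  then show ?thesis
    by (subst L2_tendsto_iff_l2norm)
      (auto intro: step_integral_square_integrable[OF \<tau>] square_integrable_cmult ou_average_square_integrable hermite_square_integrable)
qed

text \<open>The explicit approximation shows that \<open>SOME\<close> has a witness. The chosen
  version comes with an approximating sequence of its own, whose limit
  \<open>step_integral_limit\<close> identifies up to a null set.\<close>

lemma multiple_wiener_integral_tempered_kernel:
  assumes t: "0 \<le> t" "t \<le> 1"
  shows "multiple_wiener_integral N B q (tempered_kernel \<gamma> q t) \<in> borel_measurable N"
    and "AE \<omega> in N. multiple_wiener_integral N B q (tempered_kernel \<gamma> q t) \<omega> = ou_weight \<gamma> q * ou_average (hermite q) t \<omega>"
proof -
  let ?G = "\<lambda>\<omega>. ou_weight \<gamma> q * ou_average (hermite q) t \<omega>"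
  define a where "a n i = ou_weight \<gamma> q * (\<integral>s. indicator {0..t} s * (\<Prod>r<q. ou_coeff \<gamma> n s (i r)) \<partial>unit_time)" for n i
  have sm: "strict_mono_on {..Suc j * 4 ^ j} (ou_grid j)" for j by (rule ou_grid_strict_mono)
  have L: "L2_tendsto (Pi\<^sub>M {..<q} (\<lambda>_. lborel)) (\<lambda>j. step_kernel q (Suc j * 4 ^ j) (ou_grid j) (a j)) (tempered_kernel \<gamma> q t)"
    using tempered_kernel_approximation(1)[OF t, of q]
    by (subst L2_tendsto_iff_l2norm) (auto simp: a_def[abs_def] intro: step_kernel_square_integrable tempered_kernel_approximation(2)[OF t])
  have "is_multiple_wiener_integral N B q (tempered_kernel \<gamma> q t) ?G"
    unfolding is_multiple_wiener_integral_def
    using sm L step_integral_limit[OF t sm L] by (intro exI[of _ "\<lambda>j. Suc j * 4 ^ j"] exI[of _ ou_grid] exI[of _ a]) auto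
  then have "is_multiple_wiener_integral N B q (tempered_kernel \<gamma> q t) (multiple_wiener_integral N B q (tempered_kernel \<gamma> q t))"
    unfolding multiple_wiener_integral_def by (rule someI[where P="is_multiple_wiener_integral N B q (tempered_kernel \<gamma> q t)"])
  then obtain k \<tau> a where w: "\<forall>j::nat. strict_mono_on {..k j} (\<tau> j)"
      "L2_tendsto (Pi\<^sub>M {..<q} (\<lambda>_. lborel)) (\<lambda>j. step_kernel q (k j) (\<tau> j) (a j)) (tempered_kernel \<gamma> q t)"
      "L2_tendsto N (\<lambda>j. step_integral B q (k j) (\<tau> j) (a j)) (multiple_wiener_integral N B q (tempered_kernel \<gamma> q t))"
    unfolding is_multiple_wiener_integral_def by blast
  show "multiple_wiener_integral N B q (tempered_kernel \<gamma> q t) \<in> borel_measurable N"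
    using w(3) by (simp add: L2_tendsto_def)
  show "AE \<omega> in N. multiple_wiener_integral N B q (tempered_kernel \<gamma> q t) \<omega> = ?G \<omega>"
    by (rule L2_tendsto_AE_unique[OF w(3) step_integral_limit[OF t _ w(2)]]) (use w(1) in auto)
qed

end

section \<open>Random elements of the Skorokhod space\<close>

interpretation skorokhod: Metric_space skorokhod_D skorokhod_dist
  by (rule Metric_space_skorokhod)

lemma topspace_skorokhod [simp]: "topspace skorokhod_topology = skorokhod_D"
  by (simp add: skorokhod_topology_def)

lemma space_borel_of [simp]: "space (borel_of T) = topspace T"
  unfolding borel_of_def by (intro space_measure_of) (auto dest: openin_subset)

lemma measurable_borel_ofI:
  assumes "\<And>\<omega>. \<omega> \<in> space M \<Longrightarrow> f \<omega> \<in> topspace T"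
    and "\<And>U. openin T U \<Longrightarrow> f -` U \<inter> space M \<in> sets M"
  shows "f \<in> measurable M (borel_of T)"
  unfolding borel_of_def using assms by (intro measurable_measure_of) (auto dest: openin_subset)

lemma openin_sets_borel_of: "openin T U \<Longrightarrow> U \<in> sets (borel_of T)"
  unfolding borel_of_def by (subst sets_measure_of) (auto dest: openin_subset)

lemma continuous_map_borel_of_measurable:
  assumes "continuous_map T euclideanreal g"
  shows "g \<in> borel_measurable (borel_of T)"
proof (rule borel_measurableI)
  fix U :: "real set" assume "open U"
  then have "openin T {x \<in> topspace T. g x \<in> U}"
    using assms by (intro openin_continuous_map_preimage) auto
  moreover have "g -` U \<inter> space (borel_of T) = {x \<in> topspace T. g x \<in> U}" by auto
  ultimately show "g -` U \<inter> space (borel_of T) \<in> sets (borel_of T)" by (simp add: openin_sets_borel_of)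
qed

lemma skorokhod_dist_le:
  assumes "x \<in> skorokhod_D" "y \<in> skorokhod_D" "\<And>t. t \<in> {0..1} \<Longrightarrow> \<bar>x t - y t\<bar> \<le> e" "0 \<le> e"
  shows "skorokhod_dist x y \<le> e"
proof (rule field_le_epsilon)
  fix r :: real assume r: "r > 0"
  have "\<bar>x t - y t\<bar> \<le> e + r" if "t \<in> {0..1}" for t using assms(3)[OF that] r by simp
  then have "skorokhod_close x y (e + r)"
    unfolding skorokhod_close_def using assms(4) r by (intro bexI[OF _ time_change_id]) auto
  moreover have "bdd_below {e. 0 < e \<and> skorokhod_close x y e}" by (rule bdd_belowI[of _ 0]) auto
  ultimately show "skorokhod_dist x y \<le> e + r"
    using assms(1,2,4) r by (auto simp: skorokhod_dist_def intro!: cInf_lower)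
qed

text \<open>The limit lies in an open \<open>U\<close> exactly if, for some margin, the approximants
  eventually lie in \<open>U\<close> with more than that margin around them. This expresses the
  preimage through countably many measurable sets.\<close>

lemma skorokhod_measurable_limit:
  assumes Y: "\<And>j::nat. Y j \<in> measurable M (borel_of skorokhod_topology)"
    and Z: "\<And>\<omega>. \<omega> \<in> space M \<Longrightarrow> Z \<omega> \<in> skorokhod_D"
    and lim: "\<And>\<omega>. \<omega> \<in> space M \<Longrightarrow> (\<lambda>j. skorokhod_dist (Y j \<omega>) (Z \<omega>)) \<longlonglongrightarrow> 0"
  shows "Z \<in> measurable M (borel_of skorokhod_topology)"
proof (rule measurable_borel_ofI)
  show "Z \<omega> \<in> topspace skorokhod_topology" if "\<omega> \<in> space M" for \<omega> using Z that by simp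
  fix U assume "openin skorokhod_topology U"
  then have U: "U \<subseteq> skorokhod_D" "\<And>x. x \<in> U \<Longrightarrow> \<exists>r>0. skorokhod.mball x r \<subseteq> U"
    by (auto simp: skorokhod_topology_def skorokhod.openin_mtopology)
  have YD: "Y j \<omega> \<in> skorokhod_D" if "\<omega> \<in> space M" for j \<omega>
    using measurable_space[OF Y that] by simp
  \<comment> \<open>Points of \<open>U\<close> with a ball of radius strictly above
    \<open>1 / Suc m\<close> inside \<open>U\<close>. The strict inequality makes \<open>W m\<close>
    open, since the radius can be reduced a little when the centre moves.\<close>
  define W where "W m = {x \<in> skorokhod_D. \<exists>r > 1 / real (Suc m). skorokhod.mball x r \<subseteq> U}" for m
  have W: "openin skorokhod_topology (W m)" for m
    unfolding skorokhod_topology_def skorokhod.openin_mtopology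
  proof (intro conjI allI impI)
    show "W m \<subseteq> skorokhod_D" by (auto simp: W_def)
    fix x assume "x \<in> W m"
    then obtain r where r: "x \<in> skorokhod_D" "r > 1 / real (Suc m)" "skorokhod.mball x r \<subseteq> U" by (auto simp: W_def)
    define d where "d = (r - 1 / real (Suc m)) / 2"
    have "u < r \<Longrightarrow> 0 < (r - u) / 2 \<and> u < r - (r - u) / 2" for u :: real by (simp add: field_simps)
    from this[OF r(2)] have d: "d > 0" "r - d > 1 / real (Suc m)" by (simp_all only: d_def)
    have "skorokhod.mball x d \<subseteq> W m"
    proof
      fix y assume "y \<in> skorokhod.mball x d"
      then have y: "y \<in> skorokhod_D" "skorokhod_dist x y < d" by auto
      have "skorokhod.mball y (r - d) \<subseteq> skorokhod.mball x r"
        using y r(1) skorokhod.triangle by (fastforce simp: skorokhod.in_mball)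
      then show "y \<in> W m" using y(1) d r(3) by (auto simp: W_def)
    qed
    then show "\<exists>r>0. skorokhod.mball x r \<subseteq> W m" using d by blast
  qed
  have "Z -` U \<inter> space M = (\<Union>m. \<Union>K. \<Inter>j\<in>{K..}. Y j -` W m \<inter> space M)"
  proof (intro set_eqI iffI)
    fix \<omega> assume \<omega>: "\<omega> \<in> Z -` U \<inter> space M"
    then obtain r where r: "r > 0" "skorokhod.mball (Z \<omega>) r \<subseteq> U" using U by blast
    obtain m where m: "1 / real (Suc m) < r / 2" using r(1) nat_approx_posE[of "r / 2"] by auto
    have "\<forall>\<^sub>F j in sequentially. skorokhod_dist (Y j \<omega>) (Z \<omega>) < r / 2"
      using order_tendstoD(2)[OF lim, of \<omega> "r / 2"] \<omega> r by simp
    then obtain K where K: "\<And>j. j \<ge> K \<Longrightarrow> skorokhod_dist (Y j \<omega>) (Z \<omega>) < r / 2"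
      by (auto simp: eventually_sequentially)
    have "Y j \<omega> \<in> W m" if "j \<ge> K" for j
    proof -
      have "skorokhod.mball (Y j \<omega>) (r / 2) \<subseteq> skorokhod.mball (Z \<omega>) r"
      proof
        fix y assume y: "y \<in> skorokhod.mball (Y j \<omega>) (r / 2)"
        then have "skorokhod_dist (Z \<omega>) y \<le> skorokhod_dist (Z \<omega>) (Y j \<omega>) + skorokhod_dist (Y j \<omega>) y"
          using Z YD \<omega> by (intro skorokhod.triangle) auto
        then show "y \<in> skorokhod.mball (Z \<omega>) r"
          using y K[OF that] Z \<omega> skorokhod.commute[of "Z \<omega>" "Y j \<omega>"] by auto
      qed
      then show ?thesis using r(2) m YD \<omega> unfolding W_def by blast
    qed
    then show "\<omega> \<in> (\<Union>m. \<Union>K. \<Inter>j\<in>{K..}. Y j -` W m \<inter> space M)" using \<omega> by blast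
  next
    fix \<omega> assume "\<omega> \<in> (\<Union>m. \<Union>K. \<Inter>j\<in>{K..}. Y j -` W m \<inter> space M)"
    then obtain m K where mK: "\<And>j. j \<ge> K \<Longrightarrow> Y j \<omega> \<in> W m" "\<omega> \<in> space M" by fastforce
    have "\<forall>\<^sub>F j in sequentially. skorokhod_dist (Y j \<omega>) (Z \<omega>) < 1 / real (Suc m)"
      using order_tendstoD(2)[OF lim[OF mK(2)], of "1 / real (Suc m)"] by simp
    then obtain K' where K': "\<And>j. j \<ge> K' \<Longrightarrow> skorokhod_dist (Y j \<omega>) (Z \<omega>) < 1 / real (Suc m)"
      by (auto simp: eventually_sequentially)
    have "Y (max K K') \<omega> \<in> W m" "skorokhod_dist (Y (max K K') \<omega>) (Z \<omega>) < 1 / real (Suc m)"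
      using mK(1) K' by auto
    then have "Z \<omega> \<in> U" using Z[OF mK(2)] unfolding W_def by fastforce
    then show "\<omega> \<in> Z -` U \<inter> space M" using mK(2) by simp
  qed
  also have "\<dots> \<in> sets M"
  proof (intro sets.countable_UN sets.countable_INT image_subsetI sets.countable_INT')
  qed (auto intro!: measurable_sets[OF Y] openin_sets_borel_of W)
  finally show "Z -` U \<inter> space M \<in> sets M" .
qed

section \<open>Step paths and continuous paths as random elements\<close>

definition step_path :: "nat \<Rightarrow> (nat \<Rightarrow> real) \<Rightarrow> real \<Rightarrow> real" where
  "step_path n y = (\<lambda>t\<in>{0..1}. y (nat \<lfloor>real n * t\<rfloor>))"

lemma step_path_in_D: "step_path n y \<in> skorokhod_D"
  unfolding skorokhod_D_def
proof (intro CollectI conjI ballI)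
  show "step_path n y \<in> extensional {0..1}" by (simp add: step_path_def)
  fix t :: real assume t: "t \<in> {0..<1}"
  have "\<forall>\<^sub>F s in at_right t. step_path n y s = step_path n y t"
  proof (cases "n = 0")
    case True
    have "\<forall>\<^sub>F s in at_right t. s < 1" using t by (auto simp: eventually_at_right_field)
    then show ?thesis using eventually_at_right_less by eventually_elim (use True t in \<open>auto simp: step_path_def\<close>)
  next
    case False
    have "t < (of_int \<lfloor>real n * t\<rfloor> + 1) / real n" using False by (simp add: field_simps) linarith
    then have "\<forall>\<^sub>F s in at_right t. s < (of_int \<lfloor>real n * t\<rfloor> + 1) / real n" by (auto simp: eventually_at_right_field)
    moreover have "\<forall>\<^sub>F s in at_right t. s < 1" using t by (auto simp: eventually_at_right_field)
    ultimately show ?thesis using eventually_at_right_less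
    proof eventually_elim
      fix s assume s: "s < (of_int \<lfloor>real n * t\<rfloor> + 1) / real n" "s < 1" "t < s"
      have "real n * s < of_int \<lfloor>real n * t\<rfloor> + 1" using s(1) False by (simp add: field_simps)
      moreover have "real n * t \<le> real n * s" using s(3) by (simp add: mult_left_mono)
      ultimately have "\<lfloor>real n * s\<rfloor> = \<lfloor>real n * t\<rfloor>" by linarith
      then show "step_path n y s = step_path n y t" using s t by (simp add: step_path_def)
    qed
  qed
  then show "(step_path n y \<longlongrightarrow> step_path n y t) (at_right t)" by (rule tendsto_eventually)
next
  fix t :: real assume t: "t \<in> {0<..1}"
  \<comment> \<open>Immediately to the left of \<open>t\<close> the floor of \<open>n * s\<close> is
    the ceiling of \<open>n * t\<close> minus one, also when \<open>n * t\<close> is an integer. For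
    \<open>n = 0\<close> the path is constant, which is treated separately.\<close>
  define l where "l = y (nat (\<lceil>real n * t\<rceil> - 1))"
  have "\<forall>\<^sub>F s in at_left t. step_path n y s = (if n = 0 then y 0 else l)"
  proof (cases "n = 0")
    case True
    have "\<forall>\<^sub>F s in at_left t. 0 < s" using t by (auto simp: eventually_at_left_field)
    moreover have "\<forall>\<^sub>F s in at_left t. s < t" by (simp add: eventually_at_left_field) (meson lt_ex)
    ultimately show ?thesis by eventually_elim (use True t in \<open>auto simp: step_path_def\<close>)
  next
    case False
    have "(of_int \<lceil>real n * t\<rceil> - 1) / real n < t" using False by (simp add: field_simps) linarith
    then have "\<forall>\<^sub>F s in at_left t. (of_int \<lceil>real n * t\<rceil> - 1) / real n < s" by (auto simp: eventually_at_left_field)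
    moreover have "\<forall>\<^sub>F s in at_left t. 0 < s" using t by (auto simp: eventually_at_left_field)
    moreover have "\<forall>\<^sub>F s in at_left t. s < t" by (simp add: eventually_at_left_field) (meson lt_ex)
    ultimately show ?thesis
    proof eventually_elim
      fix s assume s: "(of_int \<lceil>real n * t\<rceil> - 1) / real n < s" "0 < s" "s < t"
      have "of_int \<lceil>real n * t\<rceil> - 1 < real n * s" using s(1) False by (simp add: field_simps)
      moreover have "real n * s < real n * t" using s(3) False by simp
      ultimately have "\<lfloor>real n * s\<rfloor> = \<lceil>real n * t\<rceil> - 1" by linarith
      then show "step_path n y s = (if n = 0 then y 0 else l)" using s t False by (simp add: step_path_def l_def)
    qed
  qed
  then show "\<exists>l. (step_path n y \<longlongrightarrow> l) (at_left t)" by (blast intro: tendsto_eventually)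
qed

lemma step_index_le: "t \<in> {0..1} \<Longrightarrow> nat \<lfloor>real n * t\<rfloor> \<le> n"
proof -
  assume "t \<in> {0..1}"
  then have "real n * t \<le> real n * 1" by (intro mult_left_mono) auto
  then show ?thesis by (simp add: nat_le_iff floor_le_iff)
qed

text \<open>A map that factors through a countable discrete space is measurable for any
  \<sigma>-algebra on the target; lists of rounded values are such a space.\<close>

lemma measurable_map_upt:
  assumes "\<And>k. k < n \<Longrightarrow> (\<lambda>\<omega>. f k \<omega>) \<in> measurable M (count_space (UNIV :: 'c::countable set))"
  shows "(\<lambda>\<omega>. map (\<lambda>k. f k \<omega>) [0..<n]) \<in> measurable M (count_space UNIV)"
proof (subst measurable_count_space_eq2_countable, intro conjI ballI)
  fix l :: "'c list"
  have "(\<lambda>\<omega>. map (\<lambda>k. f k \<omega>) [0..<n]) -` {l} \<inter> space M = {\<omega> \<in> space M. length l = n \<and> (\<forall>k<n. f k \<omega> = l ! k)}"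
  proof -
    have "map (\<lambda>k. f k \<omega>) [0..<n] = l \<longleftrightarrow> length l = n \<and> (\<forall>k<n. f k \<omega> = l ! k)" for \<omega>
      by (subst list_eq_iff_nth_eq) auto
    then show ?thesis by auto
  qed
  also have "\<dots> \<in> sets M"
  proof -
    have ks: "{\<omega> \<in> space M. f k \<omega> = l ! k} \<in> sets M" if "k < n" for k
    proof -
      have "(\<lambda>\<omega>. f k \<omega>) -` {l ! k} \<inter> space M \<in> sets M" by (rule measurable_sets[OF assms[OF that]]) simp
      moreover have "(\<lambda>\<omega>. f k \<omega>) -` {l ! k} \<inter> space M = {\<omega> \<in> space M. f k \<omega> = l ! k}" by auto
      ultimately show ?thesis by simp
    qed
    have "{\<omega> \<in> space M. \<forall>k\<in>{..<n}. f k \<omega> = l ! k} \<in> sets M"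
    proof (rule sets.sets_Collect_finite_All)
      fix k assume "k \<in> {..<n}"
      then show "{\<omega> \<in> space M. f k \<omega> = l ! k} \<in> sets M" using ks[of k] by simp
    qed simp
    moreover have "{\<omega> \<in> space M. length l = n \<and> (\<forall>k<n. f k \<omega> = l ! k)} =
        (if length l = n then {\<omega> \<in> space M. \<forall>k\<in>{..<n}. f k \<omega> = l ! k} else {})" by auto
    ultimately show ?thesis by simp
  qed
  finally show "(\<lambda>\<omega>. map (\<lambda>k. f k \<omega>) [0..<n]) -` {l} \<inter> space M \<in> sets M" .
qed auto

lemma abs_diff_divide: "b > 0 \<Longrightarrow> \<bar>a - b * z\<bar> / b = \<bar>a / b - z\<bar>" for a b z :: real
proof -
  assume b: "b > 0"
  then have "a / b - z = (a - b * z) / b" by (simp add: diff_divide_distrib)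
  then show ?thesis using b by (simp only: abs_divide abs_of_pos)
qed

text \<open>After rounding the values down to multiples of \<open>1 / Suc j\<close> the path is a
  function of a list of integers, hence measurable into the Borel sets of the Skorokhod topology.
  The rounding error tends to 0 uniformly in time, so \<open>skorokhod_measurable_limit\<close>
  applies.\<close>

lemma step_path_measurable:
  assumes y: "\<And>k. k \<le> n \<Longrightarrow> y k \<in> borel_measurable M"
  shows "(\<lambda>\<omega>. step_path n (\<lambda>k. y k \<omega>)) \<in> measurable M (borel_of skorokhod_topology)"
proof (rule skorokhod_measurable_limit[where Y="\<lambda>j \<omega>. step_path n (\<lambda>k. of_int \<lfloor>real (Suc j) * y k \<omega>\<rfloor> / real (Suc j))"])
  fix j
  let ?G = "\<lambda>l :: int list. step_path n (\<lambda>k. of_int (l ! k) / real (Suc j))"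
  let ?l = "\<lambda>\<omega>. map (\<lambda>k. \<lfloor>real (Suc j) * y k \<omega>\<rfloor>) [0..<Suc n]"
  have "?l \<in> measurable M (count_space UNIV)"
  proof (rule measurable_map_upt)
    fix k assume "k < Suc n"
    then have [measurable]: "y k \<in> borel_measurable M" using y by simp
    show "(\<lambda>\<omega>. \<lfloor>real (Suc j) * y k \<omega>\<rfloor>) \<in> measurable M (count_space UNIV)" by measurable
  qed
  then have "(\<lambda>\<omega>. ?G (?l \<omega>)) \<in> measurable M (borel_of skorokhod_topology)"
    by (rule measurable_compose) (simp add: measurable_count_space_eq1 step_path_in_D)
  moreover have "?G (?l \<omega>) = step_path n (\<lambda>k. of_int \<lfloor>real (Suc j) * y k \<omega>\<rfloor> / real (Suc j))" for \<omega>
    using step_index_le[of _ n] unfolding step_path_def by (auto simp: restrict_def fun_eq_iff nth_append less_Suc_eq_le simp del: upt_Suc)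
  ultimately show "(\<lambda>\<omega>. step_path n (\<lambda>k. of_int \<lfloor>real (Suc j) * y k \<omega>\<rfloor> / real (Suc j))) \<in> measurable M (borel_of skorokhod_topology)"
    by simp
next
  fix \<omega>
  show "(\<lambda>j. skorokhod_dist (step_path n (\<lambda>k. of_int \<lfloor>real (Suc j) * y k \<omega>\<rfloor> / real (Suc j))) (step_path n (\<lambda>k. y k \<omega>))) \<longlonglongrightarrow> 0"
  proof (rule Lim_null_comparison)
    have "skorokhod_dist (step_path n (\<lambda>k. of_int \<lfloor>real (Suc j) * y k \<omega>\<rfloor> / real (Suc j))) (step_path n (\<lambda>k. y k \<omega>)) \<le> 1 / real (Suc j)" for j
    proof (rule skorokhod_dist_le[OF step_path_in_D step_path_in_D])
      have "\<bar>of_int \<lfloor>real (Suc j) * z\<rfloor> / real (Suc j) - z\<bar> \<le> 1 / real (Suc j)" for z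
      proof -
        have "\<bar>of_int \<lfloor>real (Suc j) * z\<rfloor> - real (Suc j) * z\<bar> \<le> 1" by linarith
        then have "\<bar>of_int \<lfloor>real (Suc j) * z\<rfloor> - real (Suc j) * z\<bar> / real (Suc j) \<le> 1 / real (Suc j)"
          by (intro divide_right_mono) auto
        moreover have "\<bar>of_int \<lfloor>real (Suc j) * z\<rfloor> - real (Suc j) * z\<bar> / real (Suc j) = \<bar>of_int \<lfloor>real (Suc j) * z\<rfloor> / real (Suc j) - z\<bar>"
          by (rule abs_diff_divide) simp
        ultimately show ?thesis by simp
      qed
      then show "\<bar>step_path n (\<lambda>k. of_int \<lfloor>real (Suc j) * y k \<omega>\<rfloor> / real (Suc j)) t - step_path n (\<lambda>k. y k \<omega>) t\<bar> \<le> 1 / real (Suc j)"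
        if "t \<in> {0..1}" for t using that by (simp add: step_path_def)
    qed simp
    then show "\<forall>\<^sub>F j in sequentially. norm (skorokhod_dist (step_path n (\<lambda>k. of_int \<lfloor>real (Suc j) * y k \<omega>\<rfloor> / real (Suc j))) (step_path n (\<lambda>k. y k \<omega>))) \<le> 1 / real (Suc j)"
      by simp
    show "(\<lambda>j. 1 / real (Suc j)) \<longlonglongrightarrow> 0" by (rule LIMSEQ_Suc[OF lim_1_over_n])
  qed
qed (simp add: step_path_in_D)

lemma continuous_path_in_D:
  assumes c: "continuous_on {0..1} c"
  shows "(\<lambda>t\<in>{0..1}. c t) \<in> skorokhod_D"
  unfolding skorokhod_D_def
proof (intro CollectI conjI ballI)
  fix t :: real assume t: "t \<in> {0..<1}"
  have "(c \<longlongrightarrow> c t) (at t within {0..1})" using c t by (auto simp: continuous_on_def)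
  then have "(c \<longlongrightarrow> c t) (at t within {t..1})" by (rule tendsto_within_subset) (use t in auto)
  then have "(c \<longlongrightarrow> c t) (at_right t)" using t by (simp add: at_within_Icc_at_right)
  moreover have "\<forall>\<^sub>F s in at_right t. c s = (\<lambda>t\<in>{0..1}. c t) s"
  proof -
    have "\<forall>\<^sub>F s in at_right t. s < 1" using t by (auto simp: eventually_at_right_field)
    then show ?thesis using eventually_at_right_less by eventually_elim (use t in auto)
  qed
  ultimately have "((\<lambda>t\<in>{0..1}. c t) \<longlongrightarrow> c t) (at_right t)" by (rule Lim_transform_eventually)
  then show "((\<lambda>t\<in>{0..1}. c t) \<longlongrightarrow> (\<lambda>t\<in>{0..1}. c t) t) (at_right t)" using t by simp
next
  fix t :: real assume t: "t \<in> {0<..1}"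
  have "(c \<longlongrightarrow> c t) (at t within {0..1})" using c t by (auto simp: continuous_on_def)
  then have "(c \<longlongrightarrow> c t) (at t within {0..t})" by (rule tendsto_within_subset) (use t in auto)
  then have "(c \<longlongrightarrow> c t) (at_left t)" using t by (simp add: at_within_Icc_at_left)
  moreover have "\<forall>\<^sub>F s in at_left t. c s = (\<lambda>t\<in>{0..1}. c t) s"
  proof -
    have "\<forall>\<^sub>F s in at_left t. 0 < s" using t by (auto simp: eventually_at_left_field)
    moreover have "\<forall>\<^sub>F s in at_left t. s < t" by (simp add: eventually_at_left_field) (meson lt_ex)
    ultimately show ?thesis by eventually_elim (use t in auto)
  qed
  ultimately have "((\<lambda>t\<in>{0..1}. c t) \<longlongrightarrow> c t) (at_left t)" by (rule Lim_transform_eventually)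
  then show "\<exists>l. ((\<lambda>t\<in>{0..1}. c t) \<longlongrightarrow> l) (at_left t)" ..
qed simp

text \<open>Sampling on the grid of mesh \<open>1 / Suc j\<close> gives measurable step paths, and
  by uniform continuity they converge uniformly to the continuous one.\<close>

lemma continuous_path_measurable:
  assumes m: "\<And>t. t \<in> {0..1} \<Longrightarrow> c t \<in> borel_measurable M"
    and c: "\<And>\<omega>. \<omega> \<in> space M \<Longrightarrow> continuous_on {0..1} (\<lambda>t. c t \<omega>)"
  shows "(\<lambda>\<omega>. \<lambda>t\<in>{0..1}. c t \<omega>) \<in> measurable M (borel_of skorokhod_topology)"
proof (rule skorokhod_measurable_limit[where Y="\<lambda>j \<omega>. step_path (Suc j) (\<lambda>k. c (real k / real (Suc j)) \<omega>)"])
  fix j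
  show "(\<lambda>\<omega>. step_path (Suc j) (\<lambda>k. c (real k / real (Suc j)) \<omega>)) \<in> measurable M (borel_of skorokhod_topology)"
    by (rule step_path_measurable) (auto intro!: m)
next
  fix \<omega> assume \<omega>: "\<omega> \<in> space M"
  show D: "(\<lambda>t\<in>{0..1}. c t \<omega>) \<in> skorokhod_D" by (rule continuous_path_in_D[OF c[OF \<omega>]])
  show "(\<lambda>j. skorokhod_dist (step_path (Suc j) (\<lambda>k. c (real k / real (Suc j)) \<omega>)) (\<lambda>t\<in>{0..1}. c t \<omega>)) \<longlonglongrightarrow> 0"
  proof (rule LIMSEQ_I)
    fix e :: real assume e: "0 < e"
    have "uniformly_continuous_on {0..1} (\<lambda>t. c t \<omega>)"
      using c[OF \<omega>] by (intro compact_uniformly_continuous) auto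
    from this[unfolded uniformly_continuous_on_def, rule_format, of "e / 2"] e
    obtain d where d: "d > 0" "\<And>s t. s \<in> {0..1} \<Longrightarrow> t \<in> {0..1} \<Longrightarrow> \<bar>s - t\<bar> < d \<Longrightarrow> \<bar>c s \<omega> - c t \<omega>\<bar> < e / 2"
      unfolding dist_real_def by (metis half_gt_zero)
    obtain J where J: "1 / real (Suc J) < d" using nat_approx_posE[OF d(1)] by auto
    have "skorokhod_dist (step_path (Suc j) (\<lambda>k. c (real k / real (Suc j)) \<omega>)) (\<lambda>t\<in>{0..1}. c t \<omega>) \<le> e / 2" if j: "j \<ge> J" for j
    proof (rule skorokhod_dist_le[OF step_path_in_D D])
      fix t :: real assume t: "t \<in> {0..1}"
      let ?k = "nat \<lfloor>real (Suc j) * t\<rfloor>"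
      have k: "real ?k = of_int \<lfloor>real (Suc j) * t\<rfloor>" using t by (intro of_nat_nat) (simp add: zero_le_mult_iff)
      have "\<bar>real ?k - real (Suc j) * t\<bar> < 1" unfolding k by linarith
      then have "\<bar>real ?k - real (Suc j) * t\<bar> / real (Suc j) < 1 / real (Suc j)" by (intro divide_strict_right_mono) auto
      moreover have "\<bar>real ?k - real (Suc j) * t\<bar> / real (Suc j) = \<bar>real ?k / real (Suc j) - t\<bar>"
        by (rule abs_diff_divide) simp
      moreover have "1 / real (Suc j) \<le> 1 / real (Suc J)" using j by (intro divide_left_mono) auto
      ultimately have "\<bar>real ?k / real (Suc j) - t\<bar> < d" using J by linarith
      moreover have "real ?k / real (Suc j) \<in> {0..1}" using step_index_le[OF t, of "Suc j"] by simp
      ultimately have "\<bar>c (real ?k / real (Suc j)) \<omega> - c t \<omega>\<bar> < e / 2" using d(2) t by blast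
      then show "\<bar>step_path (Suc j) (\<lambda>k. c (real k / real (Suc j)) \<omega>) t - (\<lambda>t\<in>{0..1}. c t \<omega>) t\<bar> \<le> e / 2"
        using t by (simp add: step_path_def)
    qed (use e in simp)
    then have "\<forall>j\<ge>J. norm (skorokhod_dist (step_path (Suc j) (\<lambda>k. c (real k / real (Suc j)) \<omega>)) (\<lambda>t\<in>{0..1}. c t \<omega>) - 0) < e"
      using e by fastforce
    then show "\<exists>J. \<forall>j\<ge>J. norm (skorokhod_dist (step_path (Suc j) (\<lambda>k. c (real k / real (Suc j)) \<omega>)) (\<lambda>t\<in>{0..1}. c t \<omega>) - 0) < e" by blast
  qed
qed

section \<open>Convergence in distribution from uniform bounds in mean\<close>

lemma LIMSEQ_if_subsequences:
  fixes a :: "nat \<Rightarrow> real"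
  assumes "\<And>r :: nat \<Rightarrow> nat. strict_mono r \<Longrightarrow> \<exists>s :: nat \<Rightarrow> nat. strict_mono s \<and> (\<lambda>n. a (r (s n))) \<longlonglongrightarrow> l"
  shows "a \<longlonglongrightarrow> l"
proof (rule ccontr)
  assume "\<not> a \<longlonglongrightarrow> l"
  then obtain e where e: "e > 0" "\<exists>\<^sub>F n in sequentially. \<not> dist (a n) l < e"
    unfolding tendsto_iff frequently_def by auto
  then have "infinite {n. \<not> dist (a n) l < e}" by (simp add: cofinite_eq_sequentially[symmetric] frequently_cofinite)
  then obtain r :: "nat \<Rightarrow> nat" where r: "strict_mono r" "\<And>n. r n \<in> {n. \<not> dist (a n) l < e}"
    using infinite_enumerate by blast
  obtain s where "(\<lambda>n. a (r (s n))) \<longlonglongrightarrow> l" using assms[OF r(1)] by blast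
  from tendstoD[OF this e(1)] show False using r(2) by (auto simp: eventually_sequentially)
qed

text \<open>Convergence to 0 of \<open>R n\<close> in mean gives almost sure convergence along a
  further subsequence of any subsequence. There the paths converge uniformly, hence in the Skorokhod
  metric, and continuity and boundedness of \<open>g\<close> allow dominated convergence.\<close>

lemma (in prob_space) skorokhod_expectation_limit:
  assumes Y: "\<And>n. Y n \<in> measurable M (borel_of skorokhod_topology)" and Z: "Z \<in> measurable M (borel_of skorokhod_topology)"
    and R: "\<And>n. integrable M (R n)" "\<And>n \<omega>. 0 \<le> R n \<omega>" "(\<lambda>n. \<integral>\<omega>. R n \<omega> \<partial>M) \<longlonglongrightarrow> 0"
    and bd: "\<forall>\<^sub>F n in sequentially. AE \<omega> in M. \<forall>t\<in>{0..1}. \<bar>Y n \<omega> t - Z \<omega> t\<bar> \<le> R n \<omega>"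
    and g: "continuous_map skorokhod_topology euclideanreal g" "bounded (g ` topspace skorokhod_topology)"
  shows "(\<lambda>n. \<integral>\<omega>. g (Y n \<omega>) \<partial>M) \<longlonglongrightarrow> (\<integral>\<omega>. g (Z \<omega>) \<partial>M)"
proof (rule LIMSEQ_if_subsequences)
  fix r :: "nat \<Rightarrow> nat" assume r: "strict_mono r"
  obtain C where C: "\<And>x. x \<in> skorokhod_D \<Longrightarrow> \<bar>g x\<bar> \<le> C" using g(2) by (auto simp: bounded_iff)
  have YD: "Y n \<omega> \<in> skorokhod_D" and ZD: "Z \<omega> \<in> skorokhod_D" if "\<omega> \<in> space M" for n \<omega>
    using measurable_space[OF Y that] measurable_space[OF Z that] by auto
  have "(\<lambda>n. \<integral>\<omega>. norm (R (r n) \<omega>) \<partial>M) \<longlonglongrightarrow> 0"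
    using LIMSEQ_subseq_LIMSEQ[OF R(3) r] R(2) by (simp add: comp_def)
  from tendsto_L1_AE_subseq[OF _ this] R(1) obtain s where s: "strict_mono s" "AE \<omega> in M. (\<lambda>n. R (r (s n)) \<omega>) \<longlonglongrightarrow> 0"
    by blast
  obtain n0 where n0: "\<And>n. n \<ge> n0 \<Longrightarrow> AE \<omega> in M. \<forall>t\<in>{0..1}. \<bar>Y n \<omega> t - Z \<omega> t\<bar> \<le> R n \<omega>"
    using bd by (auto simp: eventually_sequentially)
  \<comment> \<open>Each bound holds off its own null set; there are countably many of them, so one
    null set serves all \<open>n \<ge> n0\<close>.\<close>
  have all: "AE \<omega> in M. \<forall>n. n \<ge> n0 \<longrightarrow> (\<forall>t\<in>{0..1}. \<bar>Y n \<omega> t - Z \<omega> t\<bar> \<le> R n \<omega>)"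
    using n0 by (subst AE_all_countable) auto
  have rs: "n \<le> r (s n)" for n
    using strict_mono_imp_increasing[OF strict_mono_compose[OF r s(1)], of n] by simp
  have gm: "g \<in> borel_measurable (borel_of skorokhod_topology)" by (rule continuous_map_borel_of_measurable[OF g(1)])
  have "(\<lambda>n. \<integral>\<omega>. g (Y (r (s n)) \<omega>) \<partial>M) \<longlonglongrightarrow> (\<integral>\<omega>. g (Z \<omega>) \<partial>M)"
  proof (rule integral_dominated_convergence[where w="\<lambda>_. C"])
    show "AE \<omega> in M. (\<lambda>n. g (Y (r (s n)) \<omega>)) \<longlonglongrightarrow> g (Z \<omega>)"
      using s(2) all AE_space
    proof eventually_elim
      fix \<omega> assume \<omega>: "(\<lambda>n. R (r (s n)) \<omega>) \<longlonglongrightarrow> 0" "\<forall>n. n \<ge> n0 \<longrightarrow> (\<forall>t\<in>{0..1}. \<bar>Y n \<omega> t - Z \<omega> t\<bar> \<le> R n \<omega>)" "\<omega> \<in> space M"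
      have "(\<lambda>n. skorokhod_dist (Y (r (s n)) \<omega>) (Z \<omega>)) \<longlonglongrightarrow> 0"
      proof (rule Lim_null_comparison[OF _ \<omega>(1)])
        show "\<forall>\<^sub>F n in sequentially. norm (skorokhod_dist (Y (r (s n)) \<omega>) (Z \<omega>)) \<le> R (r (s n)) \<omega>"
          using eventually_ge_at_top[of n0]
        proof eventually_elim
          fix n assume "n \<ge> n0"
          then have "r (s n) \<ge> n0" using rs[of n] by simp
          then have "skorokhod_dist (Y (r (s n)) \<omega>) (Z \<omega>) \<le> R (r (s n)) \<omega>"
            using \<omega>(2) R(2) by (intro skorokhod_dist_le YD ZD \<omega>(3)) auto
          then show "norm (skorokhod_dist (Y (r (s n)) \<omega>) (Z \<omega>)) \<le> R (r (s n)) \<omega>" by simp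
        qed
      qed
      then have "limitin skorokhod_topology (\<lambda>n. Y (r (s n)) \<omega>) (Z \<omega>) sequentially"
        unfolding skorokhod_topology_def skorokhod.limitin_metric_dist_null using YD ZD \<omega>(3) by simp
      from continuous_map_limit[OF g(1) this] show "(\<lambda>n. g (Y (r (s n)) \<omega>)) \<longlonglongrightarrow> g (Z \<omega>)"
        by (simp add: comp_def)
    qed
    show "AE \<omega> in M. norm (g (Y (r (s n)) \<omega>)) \<le> C" for n using C YD by (intro AE_I2) simp
  qed (auto intro: measurable_compose[OF Y gm] measurable_compose[OF Z gm])
  then show "\<exists>s::nat \<Rightarrow> nat. strict_mono s \<and> (\<lambda>n. \<integral>\<omega>. g (Y (r (s n)) \<omega>) \<partial>M) \<longlonglongrightarrow> (\<integral>\<omega>. g (Z \<omega>) \<partial>M)"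
    using s(1) by blast
qed

section \<open>Autoregressive sequences driven by Brownian increments\<close>

text \<open>The stationary chain with unit variance as a function of its inputs: \<open>v 0\<close>
  is the initial value, and the factor \<open>sqrt (1 - \<alpha>\<^sup>2)\<close> keeps the variance
  at 1 for standard normal inputs.\<close>

primrec ar_path :: "real \<Rightarrow> (nat \<Rightarrow> real) \<Rightarrow> nat \<Rightarrow> real" where
  "ar_path \<alpha> v 0 = v 0"
| "ar_path \<alpha> v (Suc k) = \<alpha> * ar_path \<alpha> v k + sqrt (1 - \<alpha>\<^sup>2) * v (Suc k)"

definition standard_normal_sequence :: "'a measure \<Rightarrow> nat \<Rightarrow> (nat \<Rightarrow> 'a \<Rightarrow> real) \<Rightarrow> bool" where
  "standard_normal_sequence M n \<xi> \<longleftrightarrow> prob_space M \<and> (\<forall>j\<le>n. gaussian_rv M 1 (\<xi> j)) \<and>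
     prob_space.indep_vars M (\<lambda>_. borel) \<xi> {..n}"

text \<open>The joint law of the inputs is a fixed product measure. Expectations of functions of the
  chain thus agree on the space of the model and on the space of the Brownian motion.\<close>

lemma standard_normal_sequence_distr:
  assumes "standard_normal_sequence M n \<xi>"
  shows "distr M (Pi\<^sub>M {..n} (\<lambda>_. borel)) (\<lambda>\<omega>. \<lambda>j\<in>{..n}. \<xi> j \<omega>) = Pi\<^sub>M {..n} (\<lambda>_. std_normal)"
proof -
  interpret prob_space M using assms by (simp add: standard_normal_sequence_def)
  have g: "gaussian_rv M 1 (\<xi> j)" if "j \<le> n" for j using assms that by (simp add: standard_normal_sequence_def)
  have ind: "indep_vars (\<lambda>_. borel) \<xi> {..n}" using assms by (simp add: standard_normal_sequence_def)
  have rv: "random_variable borel (\<xi> j)" if "j \<in> {..n}" for j using gaussian_rv_measurable[OF g] that by simp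
  have "distr M (Pi\<^sub>M {..n} (\<lambda>_. borel)) (\<lambda>\<omega>. \<lambda>j\<in>{..n}. \<xi> j \<omega>) = Pi\<^sub>M {..n} (\<lambda>j. distr M borel (\<xi> j))"
    using indep_vars_iff_distr_eq_PiM'[of "{..n}" \<xi> "\<lambda>_. borel"] rv ind by simp
  also have "\<dots> = Pi\<^sub>M {..n} (\<lambda>_. std_normal)"
  proof (rule PiM_cong[OF refl])
    fix j assume "j \<in> {..n}"
    then have "distr M borel (\<xi> j) = distr std_normal borel (\<lambda>x. sqrt 1 * x)" using g by (simp add: gaussian_rv_def)
    also have "\<dots> = distr std_normal borel (\<lambda>x. x)" by simp
    also have "\<dots> = std_normal" by (rule distr_id2) simp
    finally show "distr M borel (\<xi> j) = std_normal" .
  qed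
  finally show ?thesis .
qed

lemma standard_normal_sequence_integral:
  fixes \<Phi> :: "(nat \<Rightarrow> real) \<Rightarrow> real"
  assumes \<xi>: "standard_normal_sequence M n \<xi>" and \<Phi>: "\<Phi> \<in> borel_measurable (Pi\<^sub>M {..n} (\<lambda>_. borel))"
  shows "(\<integral>\<omega>. \<Phi> (\<lambda>j\<in>{..n}. \<xi> j \<omega>) \<partial>M) = (\<integral>v. \<Phi> v \<partial>Pi\<^sub>M {..n} (\<lambda>_. std_normal))"
proof -
  have "\<xi> j \<in> borel_measurable M" if "j \<le> n" for j
    using \<xi> that by (auto simp: standard_normal_sequence_def intro: gaussian_rv_measurable)
  then have m: "(\<lambda>\<omega>. \<lambda>j\<in>{..n}. \<xi> j \<omega>) \<in> measurable M (Pi\<^sub>M {..n} (\<lambda>_. borel))"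
    by (intro measurable_restrict) auto
  show ?thesis
    unfolding standard_normal_sequence_distr[OF \<xi>, symmetric] by (rule integral_distr[OF m \<Phi>, symmetric])
qed

lemma ar_path_restrict: "k \<le> n \<Longrightarrow> ar_path \<alpha> (\<lambda>j\<in>{..n}. v j) k = ar_path \<alpha> v k"
  by (induction k) auto

lemma ar_path_measurable: "k \<le> n \<Longrightarrow> (\<lambda>v. ar_path \<alpha> v k) \<in> borel_measurable (Pi\<^sub>M {..n} (\<lambda>_. borel))"
proof (induction k)
  case 0
  then show ?case by (simp add: measurable_component_singleton)
next
  case (Suc k)
  have "(\<lambda>v. v (Suc k)) \<in> borel_measurable (Pi\<^sub>M {..n} (\<lambda>_. borel :: real measure))"
    using Suc.prems by (intro measurable_component_singleton) auto
  then show ?case using Suc by (auto intro!: borel_measurable_add borel_measurable_times)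
qed

section \<open>The coupled chain and its correlation with the process\<close>

context ou_process
begin

text \<open>Mesh \<open>1 / n\<close> starting at time \<open>- n\<close>. The index
  \<open>n\<^sup>2\<close> is time 0, and \<open>n\<^sup>2 + k\<close> is time
  \<open>k / n\<close>.\<close>

definition ar_grid :: "nat \<Rightarrow> nat \<Rightarrow> real" where
  "ar_grid n i = (real i - real (n\<^sup>2)) / real n"

definition ar_increment :: "nat \<Rightarrow> nat \<Rightarrow> 'b \<Rightarrow> real" where
  "ar_increment n i \<omega> = B (ar_grid n (Suc i)) \<omega> - B (ar_grid n i) \<omega>"

text \<open>The weights of the past form a truncated geometric series with sum
  \<open>(1 - \<alpha> ^ (2 * n\<^sup>2)) / (1 - \<alpha>\<^sup>2)\<close>, each cell having
  variance \<open>1 / n\<close>; this factor brings the variance of the initial value to exactly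
  1.\<close>

definition ar_scale :: "nat \<Rightarrow> real" where
  "ar_scale n = sqrt (real n * (1 - (ar_coeff \<gamma> n)\<^sup>2) / (1 - ((ar_coeff \<gamma> n)\<^sup>2) ^ (n\<^sup>2)))"

text \<open>
  The initial value is a normalized sum over \<open>n\<^sup>2\<close> cells of length \<open>1 / n\<close> of the past, which makes the
  sequence exactly stationary while using finitely many increments only.
\<close>

definition ar_noise :: "nat \<Rightarrow> nat \<Rightarrow> 'b \<Rightarrow> real" where
  "ar_noise n j \<omega> = (if j = 0 then \<Sum>i<n\<^sup>2. (ar_scale n * ar_coeff \<gamma> n ^ (n\<^sup>2 - Suc i)) * ar_increment n i \<omega>
     else sqrt (real n) * ar_increment n (n\<^sup>2 + j - 1) \<omega>)"

definition ar_sim :: "nat \<Rightarrow> nat \<Rightarrow> 'b \<Rightarrow> real" where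
  "ar_sim n k \<omega> = ar_path (ar_coeff \<gamma> n) (\<lambda>j. ar_noise n j \<omega>) k"

lemma ar_grid_Suc: "ar_grid n (Suc i) = ar_grid n i + 1 / real n"
  by (simp add: ar_grid_def diff_divide_distrib add_divide_distrib)

lemma ar_grid_strict_mono: "n \<ge> 1 \<Longrightarrow> strict_mono_on A (ar_grid n)"
  by (auto simp: strict_mono_on_def ar_grid_def divide_strict_right_mono)

lemma ar_grid_mono: "i \<le> j \<Longrightarrow> ar_grid n i \<le> ar_grid n j"
  by (simp add: ar_grid_def divide_right_mono)

lemma ar_increment_gaussian: "gaussian_rv N (1 / real n) (ar_increment n i)"
  unfolding ar_increment_def[abs_def]
  using B_increment_gaussian[of "ar_grid n i" "ar_grid n (Suc i)"] by (simp add: ar_grid_Suc)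

context
  fixes n :: nat and \<alpha> :: real
  assumes n: "n \<ge> 1" and \<alpha>_def: "\<alpha> = ar_coeff \<gamma> n" and \<gamma>1: "\<gamma> < 1"
begin

lemma ar_coeff_bounds: "0 < \<alpha>" "\<alpha> < 1" "\<alpha>\<^sup>2 < 1" "(\<alpha>\<^sup>2) ^ (n\<^sup>2) < 1"
proof -
  have "\<gamma> / real n \<le> \<gamma> / 1" using n \<gamma>_pos by (intro divide_left_mono) auto
  moreover have "0 < \<gamma> / real n" using n \<gamma>_pos by simp
  ultimately show a: "0 < \<alpha>" "\<alpha> < 1" using \<gamma>1 by (simp_all add: \<alpha>_def ar_coeff_def)
  then show "\<alpha>\<^sup>2 < 1" by (simp add: power_less_one_iff)
  then show "(\<alpha>\<^sup>2) ^ (n\<^sup>2) < 1" using a n by (subst power_less_one_iff) auto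
qed

text \<open>The truncated series is smaller than the full one, so its normalising factor is larger.
  The lower bound on the kernel in \<open>ar_sim_kernel\<close> starts from here.\<close>

lemma ar_scale_ge: "sqrt (real n * (1 - \<alpha>\<^sup>2)) \<le> ar_scale n"
proof -
  have "real n * (1 - \<alpha>\<^sup>2) \<le> real n * (1 - \<alpha>\<^sup>2) / (1 - (\<alpha>\<^sup>2) ^ (n\<^sup>2))"
  proof (subst pos_le_divide_eq)
    show "0 < 1 - (\<alpha>\<^sup>2) ^ (n\<^sup>2)" using ar_coeff_bounds by simp
    have "0 \<le> real n * (1 - \<alpha>\<^sup>2)" using ar_coeff_bounds by simp
    then show "real n * (1 - \<alpha>\<^sup>2) * (1 - (\<alpha>\<^sup>2) ^ (n\<^sup>2)) \<le> real n * (1 - \<alpha>\<^sup>2)"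
      by (intro mult_left_le) auto
  qed
  then show ?thesis by (simp add: ar_scale_def \<alpha>_def)
qed

lemma ar_noise_gaussian: "gaussian_rv N 1 (ar_noise n j)"
proof (cases "j = 0")
  case True
  have gs: "(\<Sum>i<n\<^sup>2. (\<alpha>\<^sup>2) ^ (n\<^sup>2 - Suc i)) = (1 - (\<alpha>\<^sup>2) ^ (n\<^sup>2)) / (1 - \<alpha>\<^sup>2)"
    using ar_coeff_bounds by (subst sum.nat_diff_reindex) (simp add: sum_gp_strict)
  have "(\<Sum>i<n\<^sup>2. (ar_scale n * \<alpha> ^ (n\<^sup>2 - Suc i))\<^sup>2 * (ar_grid n (Suc i) - ar_grid n i))
     = (ar_scale n)\<^sup>2 / real n * (\<Sum>i<n\<^sup>2. (\<alpha>\<^sup>2) ^ (n\<^sup>2 - Suc i))"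
    by (simp add: ar_grid_Suc power_mult_distrib sum_distrib_left power_mult[symmetric] mult.commute[of _ "2::nat"])
  also have "(ar_scale n)\<^sup>2 = real n * (1 - \<alpha>\<^sup>2) / (1 - (\<alpha>\<^sup>2) ^ (n\<^sup>2))"
    unfolding ar_scale_def \<alpha>_def[symmetric] using ar_coeff_bounds by (intro real_sqrt_pow2) simp
  also have "real n * (1 - \<alpha>\<^sup>2) / (1 - (\<alpha>\<^sup>2) ^ (n\<^sup>2)) / real n * (\<Sum>i<n\<^sup>2. (\<alpha>\<^sup>2) ^ (n\<^sup>2 - Suc i)) = 1"
  proof -
    have "1 - \<alpha>\<^sup>2 \<noteq> 0" "1 - (\<alpha>\<^sup>2) ^ (n\<^sup>2) \<noteq> 0" "real n \<noteq> 0" using ar_coeff_bounds n by auto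
    then show ?thesis unfolding gs by simp
  qed
  finally have v: "(\<Sum>i<n\<^sup>2. (ar_scale n * \<alpha> ^ (n\<^sup>2 - Suc i))\<^sup>2 * (ar_grid n (Suc i) - ar_grid n i)) = 1" .
  have "ar_noise n j = (\<lambda>\<omega>. \<Sum>i<n\<^sup>2. (ar_scale n * \<alpha> ^ (n\<^sup>2 - Suc i)) * (B (ar_grid n (Suc i)) \<omega> - B (ar_grid n i) \<omega>))"
    using True by (auto simp: ar_noise_def \<alpha>_def ar_increment_def)
  then show ?thesis
    using grid_sum_gaussian[OF ar_grid_strict_mono[OF n, of "{..n\<^sup>2}"], of "\<lambda>i. ar_scale n * \<alpha> ^ (n\<^sup>2 - Suc i)"] v by simp
next
  case False
  have "ar_noise n j = (\<lambda>\<omega>. sqrt (real n) * ar_increment n (n\<^sup>2 + j - 1) \<omega>)" using False by (auto simp: ar_noise_def)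
  then show ?thesis
    using gaussian_rv_scale[OF ar_increment_gaussian, of "sqrt (real n)" n "n\<^sup>2 + j - 1"] n by simp
qed

text \<open>The initial value is a function of the cells before time 0, and every later input uses
  one cell of its own after time 0. Functions of disjoint blocks of independent increments are
  independent.\<close>

lemma ar_noise_standard: "standard_normal_sequence N n (ar_noise n)"
  unfolding standard_normal_sequence_def
proof (intro conjI allI impI ar_noise_gaussian prob_space_axioms)
  let ?K = "\<lambda>j. if j = 0 then {..<n\<^sup>2} else {n\<^sup>2 + j - 1}"
  have "indep_vars (\<lambda>_. borel) (ar_increment n) {..<n\<^sup>2 + n}"
    unfolding ar_increment_def[abs_def] by (rule B_increments_indep[OF ar_grid_strict_mono[OF n]])
  then have "indep_vars (\<lambda>j. Pi\<^sub>M (?K j) (\<lambda>_. borel)) (\<lambda>j \<omega>. restrict (\<lambda>i. ar_increment n i \<omega>) (?K j)) {..n}"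
  proof (rule indep_vars_restrict)
    show "?K j \<subseteq> {..<n\<^sup>2 + n}" if "j \<in> {..n}" for j using that n by (auto split: if_splits)
    show "disjoint_family_on ?K {..n}" by (auto simp: disjoint_family_on_def split: if_splits)
  qed
  then have "indep_vars (\<lambda>_. borel) (\<lambda>j \<omega>. (\<lambda>j v. if j = 0 then \<Sum>i<n\<^sup>2. (ar_scale n * ar_coeff \<gamma> n ^ (n\<^sup>2 - Suc i)) * v i
     else sqrt (real n) * v (n\<^sup>2 + j - 1)) j (restrict (\<lambda>i. ar_increment n i \<omega>) (?K j))) {..n}"
  proof (rule indep_vars_compose2)
    fix j assume "j \<in> {..n}"
    show "(\<lambda>v. if j = 0 then \<Sum>i<n\<^sup>2. (ar_scale n * ar_coeff \<gamma> n ^ (n\<^sup>2 - Suc i)) * v i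
     else sqrt (real n) * v (n\<^sup>2 + j - 1)) \<in> borel_measurable (Pi\<^sub>M (?K j) (\<lambda>_. borel))"
    proof (cases "j = 0")
      case True
      have "(\<lambda>v. \<Sum>i<n\<^sup>2. (ar_scale n * ar_coeff \<gamma> n ^ (n\<^sup>2 - Suc i)) * v i) \<in> borel_measurable (Pi\<^sub>M {..<n\<^sup>2} (\<lambda>_. borel))"
        by (intro borel_measurable_sum borel_measurable_times borel_measurable_const measurable_component_singleton) auto
      then show ?thesis using True by simp
    next
      case False
      have "(\<lambda>v. sqrt (real n) * v (n\<^sup>2 + j - 1)) \<in> borel_measurable (Pi\<^sub>M {n\<^sup>2 + j - 1} (\<lambda>_. borel))"
        by (intro borel_measurable_times borel_measurable_const measurable_component_singleton) auto
      then show ?thesis using False by simp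
    qed
  qed
  moreover have "(\<lambda>j v. if j = 0 then \<Sum>i<n\<^sup>2. (ar_scale n * ar_coeff \<gamma> n ^ (n\<^sup>2 - Suc i)) * v i
     else sqrt (real n) * v (n\<^sup>2 + j - 1)) j (restrict (\<lambda>i. ar_increment n i \<omega>) (?K j)) = ar_noise n j \<omega>" for j \<omega>
    by (simp add: ar_noise_def)
  ultimately show "indep_vars (\<lambda>_. borel) (ar_noise n) {..n}" by simp
qed

text \<open>One step of the chain multiplies the kernel by \<alpha> and adds a fresh cell beyond its
  support. The three recorded properties serve different ends: the support removes the cross term in
  the induction, the geometric lower bound controls the correlation with \<open>OU\<close>, and the
  norm is the variance.\<close>

lemma ar_sim_kernel:
  assumes "k \<le> n"
  shows "\<exists>\<phi>. step_pair (ar_sim n k) \<phi> \<and> (\<forall>x > ar_grid n (n\<^sup>2 + k). \<phi> x = 0) \<and>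
    (\<forall>x. (\<Sum>i<n\<^sup>2 + k. (sqrt (real n * (1 - \<alpha>\<^sup>2)) * \<alpha> ^ (n\<^sup>2 + k - Suc i)) * indicator {ar_grid n i<..ar_grid n (Suc i)} x) \<le> \<phi> x) \<and>
    (\<integral>x. (\<phi> x)\<^sup>2 \<partial>lborel) = 1"
  using assms
proof (induction k)
  case 0
  let ?\<phi> = "\<lambda>x. \<Sum>i<n\<^sup>2. (ar_scale n * \<alpha> ^ (n\<^sup>2 - Suc i)) * indicator {ar_grid n i<..ar_grid n (Suc i)} x"
  have "ar_sim n 0 = (\<lambda>\<omega>. \<Sum>i<n\<^sup>2. (ar_scale n * \<alpha> ^ (n\<^sup>2 - Suc i)) * (B (ar_grid n (Suc i)) \<omega> - B (ar_grid n i) \<omega>))"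
    by (auto simp: ar_sim_def ar_noise_def \<alpha>_def ar_increment_def)
  then have sp: "step_pair (ar_sim n 0) ?\<phi>"
    by (simp only:) (intro step_pair_sum step_pair_increment ar_grid_mono le_SucI order_refl)
  have "ar_sim n 0 = ar_noise n 0" by (auto simp: ar_sim_def)
  then have one: "(\<integral>x. (?\<phi> x)\<^sup>2 \<partial>lborel) = 1"
    using gaussian_rv_variance[OF prob_space_axioms step_pair_gaussian[OF sp]]
      gaussian_rv_variance[OF prob_space_axioms ar_noise_gaussian[of 0]] by simp
  have supp: "?\<phi> x = 0" if "x > ar_grid n (n\<^sup>2 + 0)" for x
  proof (rule sum.neutral, rule ballI)
    fix i assume "i \<in> {..<n\<^sup>2}"
    then have "ar_grid n (Suc i) \<le> ar_grid n (n\<^sup>2 + 0)" by (intro ar_grid_mono) auto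
    then show "ar_scale n * \<alpha> ^ (n\<^sup>2 - Suc i) * indicator {ar_grid n i<..ar_grid n (Suc i)} x = 0"
      using that by simp
  qed
  have low: "(\<Sum>i<n\<^sup>2 + 0. (sqrt (real n * (1 - \<alpha>\<^sup>2)) * \<alpha> ^ (n\<^sup>2 + 0 - Suc i)) * indicator {ar_grid n i<..ar_grid n (Suc i)} x) \<le> ?\<phi> x" for x
    unfolding add_0_right using ar_scale_ge ar_coeff_bounds by (intro sum_mono mult_right_mono) auto
  show ?case
    by (rule exI[of _ ?\<phi>]) (use sp one supp low in blast)
next
  case (Suc k)
  then obtain \<phi> where \<phi>: "step_pair (ar_sim n k) \<phi>" "\<And>x. x > ar_grid n (n\<^sup>2 + k) \<Longrightarrow> \<phi> x = 0"
    "\<And>x. (\<Sum>i<n\<^sup>2 + k. (sqrt (real n * (1 - \<alpha>\<^sup>2)) * \<alpha> ^ (n\<^sup>2 + k - Suc i)) * indicator {ar_grid n i<..ar_grid n (Suc i)} x) \<le> \<phi> x"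
    "(\<integral>x. (\<phi> x)\<^sup>2 \<partial>lborel) = 1" by auto
  let ?c = "sqrt (real n * (1 - \<alpha>\<^sup>2))"
  let ?I = "indicat_real {ar_grid n (n\<^sup>2 + k)<..ar_grid n (Suc (n\<^sup>2 + k))}"
  let ?\<psi> = "\<lambda>x. \<alpha> * \<phi> x + ?c * ?I x"
  have "ar_sim n (Suc k) = (\<lambda>\<omega>. \<alpha> * ar_sim n k \<omega> + ?c * (B (ar_grid n (Suc (n\<^sup>2 + k))) \<omega> - B (ar_grid n (n\<^sup>2 + k)) \<omega>))"
    by (auto simp: ar_sim_def ar_noise_def ar_increment_def \<alpha>_def real_sqrt_mult)
  then have sp: "step_pair (ar_sim n (Suc k)) ?\<psi>"
    by (auto intro!: step_pair_add step_pair_cmult \<phi>(1) step_pair_increment ar_grid_mono)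
  have supp: "?\<psi> x = 0" if "x > ar_grid n (n\<^sup>2 + Suc k)" for x
    using \<phi>(2)[of x] that ar_grid_mono[of "n\<^sup>2 + k" "n\<^sup>2 + Suc k" n] by simp
  have low: "(\<Sum>i<n\<^sup>2 + Suc k. (?c * \<alpha> ^ (n\<^sup>2 + Suc k - Suc i)) * indicator {ar_grid n i<..ar_grid n (Suc i)} x) \<le> ?\<psi> x" for x
  proof -
    have "(\<Sum>i<n\<^sup>2 + k. (?c * \<alpha> ^ (n\<^sup>2 + Suc k - Suc i)) * indicator {ar_grid n i<..ar_grid n (Suc i)} x)
       = \<alpha> * (\<Sum>i<n\<^sup>2 + k. (?c * \<alpha> ^ (n\<^sup>2 + k - Suc i)) * indicator {ar_grid n i<..ar_grid n (Suc i)} x)"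
      unfolding sum_distrib_left
    proof (rule sum.cong[OF refl])
      fix i assume "i \<in> {..<n\<^sup>2 + k}"
      then have "n\<^sup>2 + Suc k - Suc i = Suc (n\<^sup>2 + k - Suc i)" by auto
      then show "(?c * \<alpha> ^ (n\<^sup>2 + Suc k - Suc i)) * indicat_real {ar_grid n i<..ar_grid n (Suc i)} x =
         \<alpha> * ((?c * \<alpha> ^ (n\<^sup>2 + k - Suc i)) * indicator {ar_grid n i<..ar_grid n (Suc i)} x)" by simp
    qed
    also have "\<dots> \<le> \<alpha> * \<phi> x" using \<phi>(3)[of x] ar_coeff_bounds by (intro mult_left_mono) auto
    finally show ?thesis by simp
  qed
  have sq: "square_integrable lborel \<phi>" by (rule step_pair_square_integrable[OF \<phi>(1)])
  \<comment> \<open>The new cell starts where the support of the old kernel ends, so the squares add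
    without cross term and \<alpha>^2 + (1 - \<alpha>^2) = 1 preserves the norm.\<close>
  have "\<phi> x * ?I x = 0" for x using \<phi>(2)[of x] by (auto simp: indicator_def)
  then have "(?\<psi> x)\<^sup>2 = \<alpha>\<^sup>2 * (\<phi> x)\<^sup>2 + ?c\<^sup>2 * ?I x" for x
    by (auto simp: power2_sum power_mult_distrib indicator_def)
  then have "(\<integral>x. (?\<psi> x)\<^sup>2 \<partial>lborel) = (\<integral>x. \<alpha>\<^sup>2 * (\<phi> x)\<^sup>2 + ?c\<^sup>2 * ?I x \<partial>lborel)" by simp
  also have "\<dots> = \<alpha>\<^sup>2 + ?c\<^sup>2 * (1 / real n)"
    using sq \<phi>(4) ar_grid_mono[of "n\<^sup>2 + k" "Suc (n\<^sup>2 + k)" n] by (simp add: square_integrable_def ar_grid_Suc)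
  also have "\<dots> = 1" using n ar_coeff_bounds by simp
  finally have one: "(\<integral>x. (?\<psi> x)\<^sup>2 \<partial>lborel) = 1" .
  show ?case
    by (rule exI[of _ ?\<psi>]) (use sp one supp low in blast)
qed

text \<open>The integral of the exponential over a cell is explicit and is compared with the chain's
  weight through \<open>1 - \<gamma> / n \<le> exp (- \<gamma> / n)\<close>. The bound on
  \<open>i\<close> keeps the cell to the left of \<open>(k - 1) / n\<close>, hence entirely before
  \<open>s\<close>.\<close>

lemma cell_ou_inner:
  assumes i: "i < n\<^sup>2 + k - 1" and s: "(real k - 1) / real n < s" "s \<le> real k / real n"
  shows "sqrt (2 / \<gamma>) * (1 - exp (- \<gamma> / real n)) * \<alpha> ^ (n\<^sup>2 + k - Suc i) \<le>
    (\<integral>x. indicator {ar_grid n i<..ar_grid n (Suc i)} x * ou_kernel \<gamma> s x \<partial>lborel)"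
proof -
  define a where "a = ar_grid n i"
  define b where "b = ar_grid n (Suc i)"
  have b: "b = a + 1 / real n" by (simp add: a_def b_def ar_grid_Suc)
  have ab: "a \<le> b" unfolding b by simp
  have "real (Suc i) \<le> real (n\<^sup>2) + real k - 1" using i by linarith
  then have "b \<le> (real k - 1) / real n" using n by (simp add: b_def ar_grid_def divide_right_mono)
  then have bs: "b \<le> s" using s by simp
  have "has_bochner_integral lborel (\<lambda>x. sqrt (2 * \<gamma>) * exp (- \<gamma> * s) * (exp (\<gamma> * x) * indicator {..b} x - exp (\<gamma> * x) * indicator {..a} x))
     (sqrt (2 * \<gamma>) * exp (- \<gamma> * s) * (exp (\<gamma> * b) / \<gamma> - exp (\<gamma> * a) / \<gamma>))"
    using \<gamma>_pos by (intro has_bochner_integral_mult_right has_bochner_integral_diff has_bochner_integral_exp_left)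
  moreover have "(\<lambda>x. sqrt (2 * \<gamma>) * exp (- \<gamma> * s) * (exp (\<gamma> * x) * indicator {..b} x - exp (\<gamma> * x) * indicator {..a} x)) =
     (\<lambda>x. indicator {a<..b} x * ou_kernel \<gamma> s x)"
  proof
    fix x
    have "exp (- \<gamma> * (s - x)) = exp (- \<gamma> * s) * exp (\<gamma> * x)" by (simp add: exp_add[symmetric] algebra_simps)
    then show "sqrt (2 * \<gamma>) * exp (- \<gamma> * s) * (exp (\<gamma> * x) * indicator {..b} x - exp (\<gamma> * x) * indicator {..a} x) =
      indicator {a<..b} x * ou_kernel \<gamma> s x"
      using ab bs by (simp add: ou_kernel_def indicator_def)
  qed
  ultimately have "has_bochner_integral lborel (\<lambda>x. indicator {a<..b} x * ou_kernel \<gamma> s x)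
      (sqrt (2 * \<gamma>) * exp (- \<gamma> * s) * (exp (\<gamma> * b) / \<gamma> - exp (\<gamma> * a) / \<gamma>))" by (simp only:)
  then have I: "(\<integral>x. indicator {a<..b} x * ou_kernel \<gamma> s x \<partial>lborel) = sqrt (2 * \<gamma>) * exp (- \<gamma> * s) * (exp (\<gamma> * b) / \<gamma> - exp (\<gamma> * a) / \<gamma>)"
    by (rule has_bochner_integral_integral_eq)
  have alg: "S * E * (X / g - X * e / g) = (S / g) * (1 - e) * (E * X)" for S E X e g :: real
    by (simp add: algebra_simps diff_divide_distrib)
  have "exp (\<gamma> * a) = exp (\<gamma> * b) * exp (- \<gamma> / real n)"
    unfolding b by (simp add: exp_add[symmetric] distrib_left)
  then have eq: "sqrt (2 * \<gamma>) * exp (- \<gamma> * s) * (exp (\<gamma> * b) / \<gamma> - exp (\<gamma> * a) / \<gamma>) =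
     (sqrt (2 * \<gamma>) / \<gamma>) * (1 - exp (- \<gamma> / real n)) * (exp (- \<gamma> * s) * exp (\<gamma> * b))"
    by (simp only: alg)
  have sg: "sqrt (2 * \<gamma>) / \<gamma> = sqrt (2 / \<gamma>)"
  proof -
    have "sqrt (2 / \<gamma>) = sqrt (2 * \<gamma> / \<gamma>\<^sup>2)" using \<gamma>_pos by (simp add: power2_eq_square)
    also have "\<dots> = sqrt (2 * \<gamma>) / sqrt (\<gamma>\<^sup>2)" by (rule real_sqrt_divide)
    finally show ?thesis using \<gamma>_pos by simp
  qed
  have I2: "(\<integral>x. indicator {a<..b} x * ou_kernel \<gamma> s x \<partial>lborel) =
     sqrt (2 / \<gamma>) * (1 - exp (- \<gamma> / real n)) * (exp (- \<gamma> * s) * exp (\<gamma> * b))"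
    unfolding I eq sg ..
  have "\<alpha> ^ (n\<^sup>2 + k - Suc i) \<le> exp (- \<gamma> / real n) ^ (n\<^sup>2 + k - Suc i)"
    using ar_coeff_bounds exp_ge_add_one_self[of "- \<gamma> / real n"] by (intro power_mono) (auto simp: \<alpha>_def ar_coeff_def)
  also have "\<dots> = exp (real (n\<^sup>2 + k - Suc i) * (- \<gamma> / real n))" by (rule exp_of_nat_mult[symmetric])
  also have "real (n\<^sup>2 + k - Suc i) * (- \<gamma> / real n) = - \<gamma> * (real k / real n) + \<gamma> * b"
  proof -
    have "real (n\<^sup>2 + k - Suc i) = real (n\<^sup>2) + real k - real (Suc i)" using i by (subst of_nat_diff) auto
    moreover have "(A + K - S) * (- \<gamma> / m) = - \<gamma> * (K / m) + \<gamma> * ((S - A) / m)" for A K S m :: real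
      by (simp add: diff_divide_distrib add_divide_distrib algebra_simps)
    ultimately show ?thesis unfolding b_def ar_grid_def by (simp only:)
  qed
  also have "exp (- \<gamma> * (real k / real n) + \<gamma> * b) \<le> exp (- \<gamma> * s + \<gamma> * b)"
  proof -
    have "\<gamma> * s \<le> \<gamma> * (real k / real n)" using s(2) \<gamma>_pos by (intro mult_left_mono) auto
    then show ?thesis unfolding exp_le_cancel_iff mult_minus_left by linarith
  qed
  also have "\<dots> = exp (- \<gamma> * s) * exp (\<gamma> * b)" by (rule exp_add)
  finally have "\<alpha> ^ (n\<^sup>2 + k - Suc i) \<le> exp (- \<gamma> * s) * exp (\<gamma> * b)" .
  then show ?thesis
    unfolding a_def[symmetric] b_def[symmetric] I2 using \<gamma>_pos by (intro mult_left_mono mult_nonneg_nonneg) auto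
qed

text \<open>The correlation is the inner product of two kernels of norm 1, so it is at most 1 by
  Cauchy-Schwarz. For the lower bound both kernels are estimated cell by cell with geometric
  weights; the last cell, which \<open>s\<close> may cut, is discarded, and the exponent
  \<open>n\<^sup>2 + k\<close> is relaxed to \<open>n\<^sup>2\<close>. The result is uniform in
  \<open>k\<close> and \<open>s\<close>.\<close>

lemma ar_sim_OU_joint_gaussian:
  assumes k: "1 \<le> k" "k \<le> n" and s: "(real k - 1) / real n < s" "s \<le> real k / real n" "0 \<le> s" "s \<le> 1"
  shows "\<exists>c. sqrt (real n * (1 - \<alpha>\<^sup>2)) * sqrt (2 / \<gamma>) * (1 - exp (- \<gamma> / real n)) * ((\<alpha>\<^sup>2 - (\<alpha>\<^sup>2) ^ (n\<^sup>2)) / (1 - \<alpha>\<^sup>2)) \<le> c \<and>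
    c \<le> 1 \<and> joint_gaussian N (ar_sim n k) (OU s) 1 c 1"
proof -
  obtain \<phi> where \<phi>: "step_pair (ar_sim n k) \<phi>"
    "\<And>x. (\<Sum>i<n\<^sup>2 + k. (sqrt (real n * (1 - \<alpha>\<^sup>2)) * \<alpha> ^ (n\<^sup>2 + k - Suc i)) * indicator {ar_grid n i<..ar_grid n (Suc i)} x) \<le> \<phi> x"
    "(\<integral>x. (\<phi> x)\<^sup>2 \<partial>lborel) = 1" using ar_sim_kernel[OF k(2)] by blast
  let ?c = "sqrt (real n * (1 - \<alpha>\<^sup>2))" and ?K = "ou_kernel \<gamma> s"
  let ?I = "\<lambda>i. indicat_real {ar_grid n i<..ar_grid n (Suc i)}"
  define c where "c = (\<integral>x. \<phi> x * ?K x \<partial>lborel)"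
  have sq: "square_integrable lborel \<phi>" by (rule step_pair_square_integrable[OF \<phi>(1)])
  note sqK = ou_kernel_square_integrable[OF \<gamma>_pos, of s]
  have J: "joint_gaussian N (ar_sim n k) (OU s) 1 c 1"
    using wiener_OU_joint_gaussian[OF wiener_step[OF \<phi>(1)] s(3,4)] \<phi>(3) by (simp add: c_def)
  have "c \<le> l2norm lborel \<phi> * l2norm lborel ?K" using cauchy_schwarz[OF sq sqK] by (simp add: c_def)
  then have c1: "c \<le> 1" using \<phi>(3) ou_kernel_norm[OF \<gamma>_pos, of s] by (simp add: l2norm_def)
  let ?m = "n\<^sup>2 + k - 1"
  have m: "Suc ?m = n\<^sup>2 + k" using k by simp
  have Knn: "0 \<le> ?K x" for x using \<gamma>_pos by (simp add: ou_kernel_def)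
  have c0: "0 \<le> ?c" by (simp add: ar_coeff_bounds less_imp_le)
  have int: "integrable lborel (\<lambda>x. ?I i x * ?K x)" for i
    by (rule square_integrable_mult[OF square_integrable_indicator sqK])
  have "(\<Sum>i<n\<^sup>2 + k. (?c * \<alpha> ^ (n\<^sup>2 + k - Suc i)) * (\<integral>x. ?I i x * ?K x \<partial>lborel)) =
     (\<integral>x. (\<Sum>i<n\<^sup>2 + k. (?c * \<alpha> ^ (n\<^sup>2 + k - Suc i)) * (?I i x * ?K x)) \<partial>lborel)"
    using int by (subst Bochner_Integration.integral_sum) auto
  also have "\<dots> = (\<integral>x. (\<Sum>i<n\<^sup>2 + k. (?c * \<alpha> ^ (n\<^sup>2 + k - Suc i)) * ?I i x) * ?K x \<partial>lborel)"
    by (simp only: sum_distrib_right mult.assoc)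
  also have "\<dots> \<le> c"
    unfolding c_def
  proof (rule integral_mono)
    show "integrable lborel (\<lambda>x. (\<Sum>i<n\<^sup>2 + k. (?c * \<alpha> ^ (n\<^sup>2 + k - Suc i)) * ?I i x) * ?K x)"
      by (intro square_integrable_mult square_integrable_sum square_integrable_cmult square_integrable_indicator sqK)
    show "integrable lborel (\<lambda>x. \<phi> x * ?K x)" by (rule square_integrable_mult[OF sq sqK])
    show "(\<Sum>i<n\<^sup>2 + k. (?c * \<alpha> ^ (n\<^sup>2 + k - Suc i)) * ?I i x) * ?K x \<le> \<phi> x * ?K x" for x
      by (rule mult_right_mono[OF \<phi>(2) Knn])
  qed
  finally have up: "(\<Sum>i<n\<^sup>2 + k. (?c * \<alpha> ^ (n\<^sup>2 + k - Suc i)) * (\<integral>x. ?I i x * ?K x \<partial>lborel)) \<le> c" .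
  let ?e = "sqrt (2 / \<gamma>) * (1 - exp (- \<gamma> / real n))"
  have e0: "0 \<le> ?e" using \<gamma>_pos by (intro mult_nonneg_nonneg) auto
  have "?c * ?e * (\<Sum>i<?m. (\<alpha>\<^sup>2) ^ (n\<^sup>2 + k - Suc i)) = (\<Sum>i<?m. (?c * \<alpha> ^ (n\<^sup>2 + k - Suc i)) * (?e * \<alpha> ^ (n\<^sup>2 + k - Suc i)))"
    unfolding sum_distrib_left by (intro sum.cong refl) (simp only: power2_eq_square power_mult_distrib mult_ac)
  also have "\<dots> \<le> (\<Sum>i<?m. (?c * \<alpha> ^ (n\<^sup>2 + k - Suc i)) * (\<integral>x. ?I i x * ?K x \<partial>lborel))"
    using cell_ou_inner[OF _ s(1,2)] c0 ar_coeff_bounds by (intro sum_mono mult_left_mono mult_nonneg_nonneg) auto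
  also have "\<dots> \<le> (\<Sum>i<n\<^sup>2 + k. (?c * \<alpha> ^ (n\<^sup>2 + k - Suc i)) * (\<integral>x. ?I i x * ?K x \<partial>lborel))"
    using Knn c0 ar_coeff_bounds by (intro sum_mono2 mult_nonneg_nonneg integral_nonneg_AE AE_I2) auto
  finally have low: "?c * ?e * (\<Sum>i<?m. (\<alpha>\<^sup>2) ^ (n\<^sup>2 + k - Suc i)) \<le> c" using up by linarith
  have "(\<Sum>i<?m. (\<alpha>\<^sup>2) ^ (n\<^sup>2 + k - Suc i)) = \<alpha>\<^sup>2 * (\<Sum>i<?m. (\<alpha>\<^sup>2) ^ (?m - Suc i))"
    unfolding sum_distrib_left
  proof (rule sum.cong[OF refl])
    fix i assume "i \<in> {..<?m}"
    then have "n\<^sup>2 + k - Suc i = Suc (?m - Suc i)" using m by auto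
    then show "(\<alpha>\<^sup>2) ^ (n\<^sup>2 + k - Suc i) = \<alpha>\<^sup>2 * (\<alpha>\<^sup>2) ^ (?m - Suc i)" by (simp only: power_Suc)
  qed
  also have "(\<Sum>i<?m. (\<alpha>\<^sup>2) ^ (?m - Suc i)) = (\<Sum>i<?m. (\<alpha>\<^sup>2) ^ i)"
    by (rule sum.nat_diff_reindex)
  also have "(\<Sum>i<?m. (\<alpha>\<^sup>2) ^ i) = (1 - (\<alpha>\<^sup>2) ^ ?m) / (1 - \<alpha>\<^sup>2)"
  proof -
    have ne: "\<alpha>\<^sup>2 \<noteq> 1" using ar_coeff_bounds(3) by linarith
    show ?thesis by (simp only: sum_gp_strict ne if_False)
  qed
  finally have gs0: "(\<Sum>i<?m. (\<alpha>\<^sup>2) ^ (n\<^sup>2 + k - Suc i)) = \<alpha>\<^sup>2 * ((1 - (\<alpha>\<^sup>2) ^ ?m) / (1 - \<alpha>\<^sup>2))" .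
  have gs: "(\<Sum>i<?m. (\<alpha>\<^sup>2) ^ (n\<^sup>2 + k - Suc i)) = (\<alpha>\<^sup>2 - (\<alpha>\<^sup>2) ^ (n\<^sup>2 + k)) / (1 - \<alpha>\<^sup>2)"
  proof -
    have "(\<alpha>\<^sup>2) ^ Suc ?m = \<alpha>\<^sup>2 * (\<alpha>\<^sup>2) ^ ?m" by (rule power_Suc)
    then have "(\<alpha>\<^sup>2) ^ (n\<^sup>2 + k) = \<alpha>\<^sup>2 * (\<alpha>\<^sup>2) ^ ?m" unfolding m .
    then show ?thesis unfolding gs0 by (simp only: right_diff_distrib mult_1_right times_divide_eq_right)
  qed
  have "(\<alpha>\<^sup>2) ^ (n\<^sup>2 + k) \<le> (\<alpha>\<^sup>2) ^ (n\<^sup>2)" using ar_coeff_bounds by (intro power_decreasing) auto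
  then have "(\<alpha>\<^sup>2 - (\<alpha>\<^sup>2) ^ (n\<^sup>2)) / (1 - \<alpha>\<^sup>2) \<le> (\<alpha>\<^sup>2 - (\<alpha>\<^sup>2) ^ (n\<^sup>2 + k)) / (1 - \<alpha>\<^sup>2)"
    using ar_coeff_bounds by (intro divide_right_mono) auto
  then have "?c * ?e * ((\<alpha>\<^sup>2 - (\<alpha>\<^sup>2) ^ (n\<^sup>2)) / (1 - \<alpha>\<^sup>2)) \<le> ?c * ?e * ((\<alpha>\<^sup>2 - (\<alpha>\<^sup>2) ^ (n\<^sup>2 + k)) / (1 - \<alpha>\<^sup>2))"
    by (rule mult_left_mono) (rule mult_nonneg_nonneg[OF c0 e0])
  also have "\<dots> \<le> c" using low unfolding gs .
  finally show ?thesis using c1 J by (intro exI[of _ c] conjI) (simp_all only: mult.assoc)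
qed

lemma ar_sim_gaussian: "k \<le> n \<Longrightarrow> gaussian_rv N 1 (ar_sim n k)"
proof -
  assume "k \<le> n"
  then obtain \<phi> where "step_pair (ar_sim n k) \<phi>" "(\<integral>x. (\<phi> x)\<^sup>2 \<partial>lborel) = 1" using ar_sim_kernel by blast
  then show ?thesis using step_pair_gaussian by fastforce
qed

end

text \<open>Since 1 - \<alpha>_n^2 is about 2 \<gamma> / n and 1 - exp(-\<gamma>/n) about \<gamma> /
  n, the constants combine to sqrt(2 \<gamma>) sqrt(2 / \<gamma>) / 2 = 1. The truncated past costs
  at most exp(-2 \<gamma> n), because \<open>n\<^sup>2\<close> cells reach back to time
  \<open>- n\<close>.\<close>

lemma ar_sim_correlation_limit:
  "(\<lambda>n. sqrt (real n * (1 - (ar_coeff \<gamma> n)\<^sup>2)) * sqrt (2 / \<gamma>) * (1 - exp (- \<gamma> / real n)) *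
     (((ar_coeff \<gamma> n)\<^sup>2 - ((ar_coeff \<gamma> n)\<^sup>2) ^ (n\<^sup>2)) / (1 - (ar_coeff \<gamma> n)\<^sup>2))) \<longlonglongrightarrow> 1"
proof -
  have "(\<lambda>n. real n * (1 - (1 - \<gamma> / real n)\<^sup>2)) \<longlonglongrightarrow> 2 * \<gamma>"
    using \<gamma>_pos by real_asymp
  note A1 = tendsto_real_sqrt[OF this]
  have "(\<lambda>n. (1 - exp (- \<gamma> / real n)) / (1 - (1 - \<gamma> / real n)\<^sup>2)) \<longlonglongrightarrow> 1 / 2"
    using \<gamma>_pos by real_asymp
  note A2 = tendsto_mult[OF tendsto_mult[OF A1 tendsto_const[of "sqrt (2 / \<gamma>)"]] this]
  have one: "sqrt (2 * \<gamma>) * sqrt (2 / \<gamma>) * (1 / 2) = 1"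
    using \<gamma>_pos by (simp add: real_sqrt_mult[symmetric])
  have A: "(\<lambda>n. sqrt (real n * (1 - (1 - \<gamma> / real n)\<^sup>2)) * sqrt (2 / \<gamma>) * (1 - exp (- \<gamma> / real n)) / (1 - (1 - \<gamma> / real n)\<^sup>2)) \<longlonglongrightarrow> 1"
    using A2[unfolded one] by (simp only: times_divide_eq_right)
  have B: "(\<lambda>n. (1 - \<gamma> / real n)\<^sup>2) \<longlonglongrightarrow> 1" by real_asymp
  have C: "(\<lambda>n. ((1 - \<gamma> / real n)\<^sup>2) ^ (n\<^sup>2)) \<longlonglongrightarrow> 0"
  proof (rule Lim_null_comparison)
    show "(\<lambda>n. exp (- 2 * \<gamma> * real n)) \<longlonglongrightarrow> 0" using \<gamma>_pos by real_asymp
    show "\<forall>\<^sub>F n in sequentially. norm (((1 - \<gamma> / real n)\<^sup>2) ^ (n\<^sup>2)) \<le> exp (- 2 * \<gamma> * real n)"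
      using eventually_gt_at_top[of "nat \<lceil>\<gamma>\<rceil>"]
    proof eventually_elim
      fix n assume "n > nat \<lceil>\<gamma>\<rceil>"
      then have n: "real n > \<gamma>" "n \<ge> 1" by linarith+
      have "0 \<le> 1 - \<gamma> / real n" using n \<gamma>_pos by (simp add: field_simps)
      moreover have "1 - \<gamma> / real n \<le> exp (- \<gamma> / real n)" using exp_ge_add_one_self[of "- \<gamma> / real n"] by simp
      ultimately have "((1 - \<gamma> / real n)\<^sup>2) ^ (n\<^sup>2) \<le> ((exp (- \<gamma> / real n))\<^sup>2) ^ (n\<^sup>2)" by (intro power_mono) auto
      also have "\<dots> = exp (real (2 * n\<^sup>2) * (- \<gamma> / real n))" unfolding power_mult[symmetric] by (rule exp_of_nat_mult[symmetric])
      also have "real (2 * n\<^sup>2) * (- \<gamma> / real n) = - 2 * \<gamma> * real n" using n by (simp add: power2_eq_square)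
      finally show "norm (((1 - \<gamma> / real n)\<^sup>2) ^ (n\<^sup>2)) \<le> exp (- 2 * \<gamma> * real n)" by simp
    qed
  qed
  from tendsto_mult[OF A tendsto_diff[OF B C]] show ?thesis by (simp add: ar_coeff_def)
qed

end

section \<open>Convergence of the additive functionals along the coupling\<close>

definition hermite_sum :: "(nat \<Rightarrow> real) \<Rightarrow> nat \<Rightarrow> real \<Rightarrow> real" where
  "hermite_sum b j x = (\<Sum>q\<le>j. b q * hermite q x)"

lemma hermite_sum_square_integrable: "square_integrable std_normal (hermite_sum b j)"
  unfolding hermite_sum_def[abs_def] by (intro square_integrable_sum square_integrable_cmult hermite_square_integrable)

lemma hermite_expansion_l2norm:
  assumes "square_integrable std_normal F"
  shows "hermite_expansion F b \<longleftrightarrow> (\<lambda>j. l2norm std_normal (\<lambda>x. hermite_sum b j x - F x)) \<longlonglongrightarrow> 0"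
proof -
  have "(\<lambda>k x. \<Sum>q\<le>k. b q * hermite q x) = hermite_sum b" by (auto simp: hermite_sum_def fun_eq_iff)
  then show ?thesis
    unfolding hermite_expansion_def
    using L2_tendsto_iff_l2norm[of std_normal "hermite_sum b" F, OF hermite_sum_square_integrable assms] by (simp only:)
qed

lemma integral_unit_time_indicator:
  assumes "0 \<le> a" "a \<le> b" "b \<le> 1"
  shows "(\<integral>s. indicat_real {a<..b} s \<partial>unit_time) = b - a"
proof -
  have "(\<integral>s. indicat_real {a<..b} s \<partial>unit_time) = (LINT s|lborel. indicat_real {a<..b} s)"
    unfolding integral_unit_time set_lebesgue_integral_def
    by (intro Bochner_Integration.integral_cong) (use assms in \<open>auto simp: indicator_def\<close>)
  then show ?thesis using assms by simp
qed

lemma indicator_unit_time_measurable [measurable]: "A \<in> sets borel \<Longrightarrow> indicat_real A \<in> borel_measurable unit_time"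
  by (rule measurable_compose[OF measurable_unit_time_id, where g="indicat_real A", simplified]) simp

section \<open>Uniform comparison of the averages\<close>

context ou_process
begin

definition ar_correlation :: "nat \<Rightarrow> real" where
  "ar_correlation n = sqrt (real n * (1 - (ar_coeff \<gamma> n)\<^sup>2)) * sqrt (2 / \<gamma>) * (1 - exp (- \<gamma> / real n)) *
     (((ar_coeff \<gamma> n)\<^sup>2 - ((ar_coeff \<gamma> n)\<^sup>2) ^ (n\<^sup>2)) / (1 - (ar_coeff \<gamma> n)\<^sup>2))"

lemma ar_correlation_limit: "ar_correlation \<longlonglongrightarrow> 1"
  unfolding ar_correlation_def[abs_def] by (rule ar_sim_correlation_limit)

lemma ar_sim_measurable [measurable]: "ar_sim n k \<in> borel_measurable N"
proof -
  have [measurable]: "ar_noise n j \<in> borel_measurable N" for j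
    unfolding ar_noise_def[abs_def] ar_increment_def by measurable
  show ?thesis unfolding ar_sim_def[abs_def] by (induction k) simp_all
qed

definition ar_average :: "(real \<Rightarrow> real) \<Rightarrow> nat \<Rightarrow> nat \<Rightarrow> 'b \<Rightarrow> real" where
  "ar_average F n k \<omega> = (\<Sum>i=1..k. F (ar_sim n i \<omega>)) / real n"

text \<open>The chain as a piecewise constant process in continuous time, constant on the cells
  \<open>{(i - 1) / n<..i / n}\<close>; sums over the chain and averages of \<open>OU\<close> become
  integrals over the same time interval.\<close>

definition ar_process :: "(real \<Rightarrow> real) \<Rightarrow> nat \<Rightarrow> real \<Rightarrow> 'b \<Rightarrow> real" where
  "ar_process F n s \<omega> = (\<Sum>i=1..n. indicator {(real i - 1) / real n<..real i / real n} s * F (ar_sim n i \<omega>))"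

text \<open>The absolute value stands inside the time integral, so this single variable bounds the
  difference of the integrals over every initial interval.\<close>

definition coupling_error :: "(real \<Rightarrow> real) \<Rightarrow> nat \<Rightarrow> 'b \<Rightarrow> real" where
  "coupling_error F n \<omega> = (\<integral>s. \<bar>ar_process F n s \<omega> - F (OU s \<omega>)\<bar> \<partial>unit_time)"

definition ou_norm :: "(real \<Rightarrow> real) \<Rightarrow> 'b \<Rightarrow> real" where
  "ou_norm F \<omega> = l2norm unit_time (\<lambda>s. F (OU s \<omega>))"

context
  assumes \<gamma>1: "\<gamma> < 1"
begin

lemma ar_sim_function_square_integrable:
  assumes "square_integrable std_normal F" "1 \<le> k" "k \<le> n"
  shows "square_integrable N (\<lambda>\<omega>. F (ar_sim n k \<omega>))" "l2norm N (\<lambda>\<omega>. F (ar_sim n k \<omega>)) = l2norm std_normal F"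
proof -
  have "gaussian_rv N 1 (ar_sim n k)" using assms by (intro ar_sim_gaussian[OF _ refl \<gamma>1]) auto
  then show "square_integrable N (\<lambda>\<omega>. F (ar_sim n k \<omega>))" "l2norm N (\<lambda>\<omega>. F (ar_sim n k \<omega>)) = l2norm std_normal F"
    using gaussian_rv_unit_square_integrable[OF _ assms(1)] by auto
qed

text \<open>For standard Gaussians with correlation \<open>c\<close> the squared distance of the
  Hermite polynomials is exactly \<open>2 * fact q * (1 - c ^ q)\<close>, which decreases in
  \<open>c \<ge> 0\<close>; the uniform lower bound \<open>ar_correlation n\<close> is
  inserted.\<close>

lemma hermite_ar_sim_OU_close:
  assumes k: "1 \<le> k" "k \<le> n" and s: "(real k - 1) / real n < s" "s \<le> real k / real n" "0 \<le> s" "s \<le> 1"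
    and cor: "0 \<le> ar_correlation n"
  shows "l2norm N (\<lambda>\<omega>. hermite q (ar_sim n k \<omega>) - hermite q (OU s \<omega>)) \<le> sqrt (2 * fact q * (1 - ar_correlation n ^ q))"
proof -
  have n: "n \<ge> 1" using k by simp
  obtain c where c: "ar_correlation n \<le> c" "c \<le> 1" "joint_gaussian N (ar_sim n k) (OU s) 1 c 1"
    using ar_sim_OU_joint_gaussian[OF n refl \<gamma>1 k s] unfolding ar_correlation_def by blast
  have U: "square_integrable N (\<lambda>\<omega>. hermite q (ar_sim n k \<omega>))" "l2norm N (\<lambda>\<omega>. hermite q (ar_sim n k \<omega>)) = l2norm std_normal (hermite q)"
    using ar_sim_function_square_integrable[OF hermite_square_integrable k] by auto
  have V: "square_integrable N (\<lambda>\<omega>. hermite q (OU s \<omega>))" "l2norm N (\<lambda>\<omega>. hermite q (OU s \<omega>)) = l2norm std_normal (hermite q)"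
    using OU_function_square_integrable[OF hermite_square_integrable s(3,4)] by auto
  have H: "(l2norm std_normal (hermite q))\<^sup>2 = fact q"
    unfolding l2norm_power2 using hermite_orthogonal[of q q] by (simp add: power2_eq_square)
  have "(\<integral>\<omega>. hermite q (OU s \<omega>) * hermite q (ar_sim n k \<omega>) \<partial>N) = fact q * c ^ q"
    using joint_gaussian_hermite[OF prob_space_axioms c(3), of q q] by (simp add: mult.commute)
  then have "(l2norm N (\<lambda>\<omega>. hermite q (ar_sim n k \<omega>) - hermite q (OU s \<omega>)))\<^sup>2 = 2 * fact q * (1 - c ^ q)"
    using l2norm_diff_power2[OF U(1) V(1), of 1] unfolding U(2) V(2) H by (simp add: algebra_simps)
  also have "\<dots> \<le> 2 * fact q * (1 - ar_correlation n ^ q)"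
    using power_mono[OF c(1) cor, of q] by (intro mult_left_mono) auto
  finally show ?thesis by (rule real_le_rsqrt)
qed

text \<open>An approximation argument in three parts. Replacing \<open>F\<close> by a partial
  Hermite sum costs the same below \<open>e / 4\<close> on both sides, because
  \<open>ar_sim n k\<close> and \<open>OU s\<close> are both standard normal; the partial sums are
  compared term by term at the cost \<open>e / 2\<close>.\<close>

lemma ar_sim_OU_close:
  assumes F: "square_integrable std_normal F" and b: "hermite_expansion F b" and e: "e > 0"
  shows "\<forall>\<^sub>F n in sequentially. \<forall>k s. 1 \<le> k \<longrightarrow> k \<le> n \<longrightarrow> (real k - 1) / real n < s \<longrightarrow> s \<le> real k / real n \<longrightarrow> 0 \<le> s \<longrightarrow> s \<le> 1 \<longrightarrow>
     l2norm N (\<lambda>\<omega>. F (ar_sim n k \<omega>) - F (OU s \<omega>)) \<le> e"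
proof -
  have "(\<lambda>j. l2norm std_normal (\<lambda>x. hermite_sum b j x - F x)) \<longlonglongrightarrow> 0"
    using b hermite_expansion_l2norm[OF F] by simp
  then have "\<forall>\<^sub>F j in sequentially. l2norm std_normal (\<lambda>x. hermite_sum b j x - F x) < e / 4"
    using e by (intro order_tendstoD(2)) auto
  then obtain j where j: "l2norm std_normal (\<lambda>x. hermite_sum b j x - F x) < e / 4"
    by (auto simp: eventually_sequentially)
  let ?P = "hermite_sum b j"
  note P = hermite_sum_square_integrable[of b j]
  have d: "square_integrable std_normal (\<lambda>x. ?P x - F x)" by (rule square_integrable_diff[OF P F])
  have "(\<lambda>n. \<Sum>q\<le>j. \<bar>b q\<bar> * sqrt (2 * fact q * (1 - ar_correlation n ^ q))) \<longlonglongrightarrow> (\<Sum>q\<le>j. \<bar>b q\<bar> * sqrt (2 * fact q * (1 - 1 ^ q)))"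
    by (intro tendsto_intros ar_correlation_limit)
  then have "(\<lambda>n. \<Sum>q\<le>j. \<bar>b q\<bar> * sqrt (2 * fact q * (1 - ar_correlation n ^ q))) \<longlonglongrightarrow> 0" by simp
  then have "\<forall>\<^sub>F n in sequentially. (\<Sum>q\<le>j. \<bar>b q\<bar> * sqrt (2 * fact q * (1 - ar_correlation n ^ q))) < e / 2"
    using e by (intro order_tendstoD(2)) auto
  moreover have "\<forall>\<^sub>F n in sequentially. 0 < ar_correlation n"
    using order_tendstoD(1)[OF ar_correlation_limit, of 0] by simp
  ultimately show ?thesis
  proof eventually_elim
    fix n assume n: "(\<Sum>q\<le>j. \<bar>b q\<bar> * sqrt (2 * fact q * (1 - ar_correlation n ^ q))) < e / 2" "0 < ar_correlation n"
    show "\<forall>k s. 1 \<le> k \<longrightarrow> k \<le> n \<longrightarrow> (real k - 1) / real n < s \<longrightarrow> s \<le> real k / real n \<longrightarrow> 0 \<le> s \<longrightarrow> s \<le> 1 \<longrightarrow>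
     l2norm N (\<lambda>\<omega>. F (ar_sim n k \<omega>) - F (OU s \<omega>)) \<le> e"
    proof (intro allI impI)
      fix k s assume k: "1 \<le> k" "k \<le> n" and s: "(real k - 1) / real n < s" "s \<le> real k / real n" "0 \<le> s" "s \<le> 1"
      let ?U = "ar_sim n k" and ?V = "OU s"
      note UF = ar_sim_function_square_integrable[OF F k] and UP = ar_sim_function_square_integrable[OF P k]
        and Ud = ar_sim_function_square_integrable[OF d k]
      note VF = OU_function_square_integrable[OF F s(3,4)] and VP = OU_function_square_integrable[OF P s(3,4)]
        and Vd = OU_function_square_integrable[OF d s(3,4)]
      have trm: "square_integrable N (\<lambda>\<omega>. b q * (hermite q (?U \<omega>) - hermite q (?V \<omega>)))" for q
        by (intro square_integrable_cmult square_integrable_diff ar_sim_function_square_integrable(1)[OF hermite_square_integrable k]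
            OU_function_square_integrable(1)[OF hermite_square_integrable s(3,4)])
      have "l2norm N (\<lambda>\<omega>. \<Sum>q\<in>A. b q * (hermite q (?U \<omega>) - hermite q (?V \<omega>))) \<le>
        (\<Sum>q\<in>A. \<bar>b q\<bar> * sqrt (2 * fact q * (1 - ar_correlation n ^ q)))" if "finite A" for A
        using that
      proof (induction A)
        case empty
        then show ?case by (simp add: l2norm_def)
      next
        case (insert q A)
        have "l2norm N (\<lambda>\<omega>. b q * (hermite q (?U \<omega>) - hermite q (?V \<omega>)) + (\<Sum>q\<in>A. b q * (hermite q (?U \<omega>) - hermite q (?V \<omega>))))
          \<le> l2norm N (\<lambda>\<omega>. b q * (hermite q (?U \<omega>) - hermite q (?V \<omega>))) + l2norm N (\<lambda>\<omega>. \<Sum>q\<in>A. b q * (hermite q (?U \<omega>) - hermite q (?V \<omega>)))"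
          by (intro l2norm_triangle trm square_integrable_sum)
        also have "l2norm N (\<lambda>\<omega>. b q * (hermite q (?U \<omega>) - hermite q (?V \<omega>))) \<le> \<bar>b q\<bar> * sqrt (2 * fact q * (1 - ar_correlation n ^ q))"
          unfolding l2norm_cmult using hermite_ar_sim_OU_close[OF k s less_imp_le[OF n(2)], of q] by (intro mult_left_mono) auto
        finally show ?case using insert by simp
      qed
      from this[of "{..j}"] have PP: "l2norm N (\<lambda>\<omega>. ?P (?U \<omega>) - ?P (?V \<omega>)) \<le> e / 2"
        using n(1) by (simp add: hermite_sum_def sum_subtractf[symmetric] right_diff_distrib[symmetric])
      have "l2norm N (\<lambda>\<omega>. F (?U \<omega>) - F (?V \<omega>)) \<le> l2norm N (\<lambda>\<omega>. F (?U \<omega>) - ?P (?U \<omega>)) + l2norm N (\<lambda>\<omega>. ?P (?U \<omega>) - F (?V \<omega>))"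
        by (rule l2norm_triangle_diff[OF UF(1) UP(1) VF(1)])
      also have "l2norm N (\<lambda>\<omega>. ?P (?U \<omega>) - F (?V \<omega>)) \<le> l2norm N (\<lambda>\<omega>. ?P (?U \<omega>) - ?P (?V \<omega>)) + l2norm N (\<lambda>\<omega>. ?P (?V \<omega>) - F (?V \<omega>))"
        by (rule l2norm_triangle_diff[OF UP(1) VP(1) VF(1)])
      also have "l2norm N (\<lambda>\<omega>. F (?U \<omega>) - ?P (?U \<omega>)) = l2norm std_normal (\<lambda>x. ?P x - F x)"
        unfolding l2norm_minus_commute[of N "\<lambda>\<omega>. F (?U \<omega>)"] by (rule Ud(2))
      also have "l2norm N (\<lambda>\<omega>. ?P (?V \<omega>) - F (?V \<omega>)) = l2norm std_normal (\<lambda>x. ?P x - F x)" by (rule Vd(2))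
      finally show "l2norm N (\<lambda>\<omega>. F (?U \<omega>) - F (?V \<omega>)) \<le> e" using PP j by linarith
    qed
  qed
qed

lemma ar_process_cell:
  assumes "1 \<le> i" "i \<le> n" "(real i - 1) / real n < s" "s \<le> real i / real n"
  shows "ar_process F n s \<omega> = F (ar_sim n i \<omega>)"
proof -
  have n: "real n > 0" using assms by simp
  have "indicat_real {(real l - 1) / real n<..real l / real n} s = 0" if "l \<noteq> i" "l \<in> {1..n}" for l
  proof -
    have "real l \<le> real i - 1 \<or> real i \<le> real l - 1" using that by linarith
    then have "real l / real n \<le> (real i - 1) / real n \<or> real i / real n \<le> (real l - 1) / real n"
      using n by (auto intro: divide_right_mono)
    then show ?thesis using assms by (auto simp: indicator_def)
  qed
  then have "ar_process F n s \<omega> = (\<Sum>l\<in>{1..n}. if l = i then F (ar_sim n i \<omega>) else 0)"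
    unfolding ar_process_def using assms by (intro sum.cong) auto
  then show ?thesis using assms by simp
qed

lemma ar_process_average:
  assumes k: "k \<le> n" "n \<ge> 1"
  shows "(\<integral>s. indicator {0<..real k / real n} s * ar_process F n s \<omega> \<partial>unit_time) = ar_average F n k \<omega>"
    and "square_integrable unit_time (\<lambda>s. ar_process F n s \<omega>)"
proof -
  let ?C = "\<lambda>i. {(real i - 1) / real n<..real i / real n}"
  have sqI: "square_integrable unit_time (indicat_real {a<..b})" for a b :: real
    unfolding square_integrable_def
  proof
    show "integrable unit_time (\<lambda>s. (indicat_real {a<..b} s)\<^sup>2)"
      by (rule unit_time.integrable_const_bound[where B=1]) (auto simp: indicator_def)
  qed simp
  show "square_integrable unit_time (\<lambda>s. ar_process F n s \<omega>)"
    unfolding ar_process_def using square_integrable_cmult[OF sqI] by (intro square_integrable_sum) (simp add: mult.commute)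
  have n: "real n > 0" using k by simp
  have ind: "indicator {0<..real k / real n} s * indicat_real (?C i) s = (if i \<le> k then indicator (?C i) s else 0)"
    if "i \<in> {1..n}" for i s
  proof (cases "i \<le> k")
    case True
    have "real i / real n \<le> real k / real n" "0 \<le> (real i - 1) / real n" using True that by (auto intro: divide_right_mono)
    then show ?thesis using True by (auto simp: indicator_def)
  next
    case False
    then have "real k \<le> real i - 1" by linarith
    then have "real k / real n \<le> (real i - 1) / real n" using n by (intro divide_right_mono) auto
    then show ?thesis using False by (auto simp: indicator_def)
  qed
  have I: "(\<integral>s. indicator (?C i) s \<partial>unit_time) = 1 / real n" if "i \<in> {1..n}" for i
    using that n by (subst integral_unit_time_indicator) (auto simp: diff_divide_distrib intro: divide_right_mono)
  have "(\<integral>s. indicator {0<..real k / real n} s * ar_process F n s \<omega> \<partial>unit_time) =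
     (\<integral>s. (\<Sum>i=1..n. (indicator {0<..real k / real n} s * indicator (?C i) s) * F (ar_sim n i \<omega>)) \<partial>unit_time)"
    unfolding ar_process_def sum_distrib_left by (simp only: mult.assoc)
  also have "\<dots> = (\<integral>s. (\<Sum>i=1..n. (if i \<le> k then F (ar_sim n i \<omega>) else 0) * indicator (?C i) s) \<partial>unit_time)"
    by (intro Bochner_Integration.integral_cong refl sum.cong) (simp only: ind, simp)
  also have "\<dots> = (\<Sum>i=1..n. (if i \<le> k then F (ar_sim n i \<omega>) else 0) * (\<integral>s. indicator (?C i) s \<partial>unit_time))"
    using unit_time.square_integrable_L1[OF sqI] by (subst Bochner_Integration.integral_sum) auto
  also have "\<dots> = (\<Sum>i=1..n. (if i \<le> k then F (ar_sim n i \<omega>) / real n else 0))"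
    by (intro sum.cong refl) (simp only: I, simp)
  also have "\<dots> = (\<Sum>i\<in>{i\<in>{1..n}. i \<le> k}. F (ar_sim n i \<omega>) / real n)"
    by (rule sum.inter_filter[symmetric]) simp
  also have "{i\<in>{1..n}. i \<le> k} = {1..k}" using k by auto
  finally show "(\<integral>s. indicator {0<..real k / real n} s * ar_process F n s \<omega> \<partial>unit_time) = ar_average F n k \<omega>"
    by (simp add: ar_average_def sum_divide_distrib)
qed

text \<open>The interval is split at the last grid point \<open>k / n\<close> before
  \<open>t\<close>. Up to there the difference is an integral of the coupled difference; the
  remaining piece has length at most \<open>1 / n\<close>, and Cauchy-Schwarz on it gives the factor
  \<open>sqrt (1 / real n)\<close>. The argument is for a fixed outcome, so the bound is uniform in
  \<open>t\<close>.\<close>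

lemma ar_average_error:
  assumes n: "n \<ge> 1" and t: "t \<in> {0..1}" and sq: "square_integrable unit_time (\<lambda>s. F (OU s \<omega>))"
  shows "\<bar>ar_average F n (nat \<lfloor>real n * t\<rfloor>) \<omega> - ou_average F t \<omega>\<bar> \<le> coupling_error F n \<omega> + sqrt (1 / real n) * ou_norm F \<omega>"
proof -
  define k where "k = nat \<lfloor>real n * t\<rfloor>"
  have kn: "k \<le> n" unfolding k_def by (rule step_index_le[OF t])
  have rk: "real k = of_int \<lfloor>real n * t\<rfloor>" unfolding k_def using t by (intro of_nat_nat) (simp add: zero_le_mult_iff)
  have kt: "real k / real n \<le> t" "t - real k / real n \<le> 1 / real n"
  proof -
    have "real k \<le> real n * t" "real n * t \<le> real k + 1" unfolding rk by linarith+
    then have "real k / real n \<le> t" "t \<le> (real k + 1) / real n"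
      using n by (simp_all add: pos_le_divide_eq pos_divide_le_eq mult.commute)
    then show "real k / real n \<le> t" "t - real k / real n \<le> 1 / real n" by (simp_all add: add_divide_distrib)
  qed
  let ?g = "\<lambda>s. ar_process F n s \<omega>" and ?f = "\<lambda>s. F (OU s \<omega>)"
  let ?i = "indicat_real {0<..real k / real n}" and ?j = "indicat_real {real k / real n<..t}"
  note sg = ar_process_average(2)[OF kn n, of F \<omega>]
  have sqB: "square_integrable unit_time (\<lambda>s. indicat_real A s * h s)" if "square_integrable unit_time h" "A \<in> sets borel" for h A
  proof (rule square_integrable_bound[OF that(1)])
    show "(\<lambda>s. indicat_real A s * h s) \<in> borel_measurable unit_time"
      using that by (intro borel_measurable_times indicator_unit_time_measurable) (auto simp: square_integrable_def)
  qed (auto simp: indicator_def)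
  note L1 = unit_time.square_integrable_L1
  have ae: "AE s in unit_time. indicat_real {0..t} s = ?i s + ?j s"
  proof -
    have "AE s in unit_time. s \<notin> {0}" by (rule AE_unit_time_notin) simp
    then show ?thesis using AE_space
      by eventually_elim (use kt(1) in \<open>auto simp: indicator_def\<close>)
  qed
  have "ou_average F t \<omega> = (\<integral>s. ?i s * ?f s + ?j s * ?f s \<partial>unit_time)"
    unfolding ou_average_def
  proof (rule integral_cong_AE)
    show "AE s in unit_time. indicat_real {0..t} s * ?f s = ?i s * ?f s + ?j s * ?f s"
      using ae by eventually_elim (simp add: distrib_right)
    show "(\<lambda>s. indicat_real {0..t} s * ?f s) \<in> borel_measurable unit_time"
      using sqB[OF sq, of "{0..t}"] by (simp add: square_integrable_def)
    show "(\<lambda>s. ?i s * ?f s + ?j s * ?f s) \<in> borel_measurable unit_time"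
      using sqB[OF sq, of "{0<..real k / real n}"] sqB[OF sq, of "{real k / real n<..t}"] by (auto simp: square_integrable_def)
  qed
  also have "\<dots> = (\<integral>s. ?i s * ?f s \<partial>unit_time) + (\<integral>s. ?j s * ?f s \<partial>unit_time)"
    using L1[OF sqB[OF sq, of "{0<..real k / real n}"]] L1[OF sqB[OF sq, of "{real k / real n<..t}"]] by simp
  finally have V: "ou_average F t \<omega> = (\<integral>s. ?i s * ?f s \<partial>unit_time) + (\<integral>s. ?j s * ?f s \<partial>unit_time)" .
  have eq1: "ar_average F n k \<omega> - (\<integral>s. ?i s * ?f s \<partial>unit_time) = (\<integral>s. ?i s * (?g s - ?f s) \<partial>unit_time)"
    unfolding ar_process_average(1)[OF kn n, symmetric] right_diff_distrib
    using L1[OF sqB[OF sq, of "{0<..real k / real n}"]] L1[OF sqB[OF sg, of "{0<..real k / real n}"]] by simp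
  have "\<bar>\<integral>s. ?i s * (?g s - ?f s) \<partial>unit_time\<bar> \<le> (\<integral>s. \<bar>?i s * (?g s - ?f s)\<bar> \<partial>unit_time)" by (rule integral_abs_bound)
  also have "\<dots> \<le> coupling_error F n \<omega>"
    unfolding coupling_error_def
  proof (rule integral_mono)
    have "{0<..real k / real n} \<in> sets borel" by simp
    from L1[OF sqB[OF square_integrable_diff[OF sg sq] this]]
    show "integrable unit_time (\<lambda>s. \<bar>?i s * (?g s - ?f s)\<bar>)" by (rule integrable_abs)
    from L1[OF square_integrable_diff[OF sg sq]]
    show "integrable unit_time (\<lambda>s. \<bar>?g s - ?f s\<bar>)" by (rule integrable_abs)
    show "\<bar>?i s * (?g s - ?f s)\<bar> \<le> \<bar>?g s - ?f s\<bar>" for s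
      by (simp add: indicator_def abs_mult)
  qed
  finally have 1: "\<bar>ar_average F n k \<omega> - (\<integral>s. ?i s * ?f s \<partial>unit_time)\<bar> \<le> coupling_error F n \<omega>"
    unfolding eq1 .
  have sj: "square_integrable unit_time ?j"
    using sqB[OF unit_time.square_integrable_const[of 1], of "{real k / real n<..t}"] by simp
  have "\<bar>\<integral>s. ?j s * ?f s \<partial>unit_time\<bar> \<le> l2norm unit_time ?j * ou_norm F \<omega>"
    unfolding ou_norm_def by (rule cauchy_schwarz[OF sj sq])
  also have "l2norm unit_time ?j = sqrt (t - real k / real n)"
  proof -
    have "(\<lambda>s. (?j s)\<^sup>2) = ?j" by (auto simp: indicator_def)
    then show ?thesis unfolding l2norm_def using integral_unit_time_indicator[of "real k / real n" t] kt(1) t by simp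
  qed
  also have "sqrt (t - real k / real n) * ou_norm F \<omega> \<le> sqrt (1 / real n) * ou_norm F \<omega>"
    using kt(2) by (intro mult_right_mono real_sqrt_le_mono) (auto simp: ou_norm_def)
  finally show ?thesis using 1 unfolding V k_def[symmetric] by linarith
qed

lemma ar_process_measurable:
  assumes "F \<in> borel_measurable borel"
  shows "(\<lambda>p. ar_process F n (fst p) (snd p) - F (OU (fst p) (snd p))) \<in> borel_measurable (unit_time \<Otimes>\<^sub>M N)"
proof (rule measurable_unit_time_pair)
  have "(\<lambda>p. ar_process F n (fst p) (snd p)) \<in> borel_measurable (borel \<Otimes>\<^sub>M N)"
    unfolding ar_process_def
    by (intro borel_measurable_sum borel_measurable_times measurable_compose[OF measurable_snd]
        measurable_compose[OF ar_sim_measurable assms] measurable_compose[OF measurable_fst] borel_measurable_indicator) auto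
  moreover have "(\<lambda>p. F (OU (fst p) (snd p))) \<in> borel_measurable (borel \<Otimes>\<^sub>M N)"
    by (rule measurable_compose[OF OU_measurable(1) assms])
  ultimately show "(\<lambda>p. ar_process F n (fst p) (snd p) - F (OU (fst p) (snd p))) \<in> borel_measurable (borel \<Otimes>\<^sub>M N)"
    by (rule borel_measurable_diff)
qed

text \<open>Closeness at each time gives closeness on the product of time and outcome, and averaging
  over time does not increase the norm.\<close>

lemma coupling_error_l2norm:
  assumes F: "square_integrable std_normal F" and n: "n \<ge> 1" and e: "0 \<le> e"
    and close: "\<And>k s. 1 \<le> k \<Longrightarrow> k \<le> n \<Longrightarrow> (real k - 1) / real n < s \<Longrightarrow> s \<le> real k / real n \<Longrightarrow> 0 \<le> s \<Longrightarrow> s \<le> 1 \<Longrightarrow>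
     l2norm N (\<lambda>\<omega>. F (ar_sim n k \<omega>) - F (OU s \<omega>)) \<le> e"
  shows "square_integrable N (coupling_error F n)" "l2norm N (coupling_error F n) \<le> e"
proof -
  have Fm: "F \<in> borel_measurable borel" using F by (simp add: square_integrable_def)
  let ?g = "\<lambda>p. \<bar>ar_process F n (fst p) (snd p) - F (OU (fst p) (snd p))\<bar>"
  have m: "?g \<in> borel_measurable (unit_time \<Otimes>\<^sub>M N)" using ar_process_measurable[OF Fm] by (rule borel_measurable_abs)
  have sq0: "square_integrable N (\<lambda>\<omega>. ar_process F n s \<omega> - F (OU s \<omega>))" if "s \<in> space unit_time" for s
    unfolding ar_process_def using that
    by (intro square_integrable_diff square_integrable_sum square_integrable_cmult
        ar_sim_function_square_integrable(1)[OF F] OU_function_square_integrable(1)[OF F]) auto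
  have sq: "square_integrable N (\<lambda>\<omega>. ?g (s, \<omega>))" if "s \<in> space unit_time" for s
    using sq0[OF that] by (auto simp: square_integrable_def)
  have small: "(l2norm N (\<lambda>\<omega>. ?g (s, \<omega>)))\<^sup>2 \<le> e\<^sup>2" if s: "s \<in> space unit_time" "s \<noteq> 0" for s
  proof -
    define k where "k = nat \<lceil>real n * s\<rceil>"
    have s01: "0 < s" "s \<le> 1" using s by auto
    have pos: "0 < real n * s" using s01 n by simp
    have rk: "real k = of_int \<lceil>real n * s\<rceil>" unfolding k_def using pos by (intro of_nat_nat) linarith
    have b: "real k - 1 < real n * s" "real n * s \<le> real k" unfolding rk by linarith+
    have "real n * s \<le> real n" using s01 by (simp add: mult_left_le)
    then have "real k < real n + 1" using b by linarith
    then have k: "1 \<le> k" "k \<le> n" using b(2) pos by linarith+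
    have c: "(real k - 1) / real n < s" "s \<le> real k / real n" using b n by (simp_all add: field_simps)
    have "l2norm N (\<lambda>\<omega>. ?g (s, \<omega>)) = l2norm N (\<lambda>\<omega>. F (ar_sim n k \<omega>) - F (OU s \<omega>))"
      by (simp add: l2norm_def ar_process_cell[OF k c])
    also have "\<dots> \<le> e" using close[OF k c] s01 by simp
    finally show ?thesis by (intro power_mono) auto
  qed
  \<comment> \<open>The cells are open on the left, so time 0 belongs to none and the chain process
    vanishes there. A crude bound at this single time secures integrability; in the estimate itself
    it is a null set.\<close>
  have zero: "(l2norm N (\<lambda>\<omega>. ?g (0, \<omega>)))\<^sup>2 = (l2norm std_normal F)\<^sup>2"
  proof -
    have "ar_process F n 0 \<omega> = 0" for \<omega> unfolding ar_process_def
    proof (rule sum.neutral, rule ballI)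
      fix i assume "i \<in> {1..n}"
      then have "0 \<le> (real i - 1) / real n" by simp
      then show "indicat_real {(real i - 1) / real n<..real i / real n} 0 * F (ar_sim n i \<omega>) = 0" by simp
    qed
    then have "l2norm N (\<lambda>\<omega>. ?g (0, \<omega>)) = l2norm N (\<lambda>\<omega>. F (OU 0 \<omega>))" by (simp add: l2norm_def)
    then show ?thesis using OU_function_square_integrable(2)[OF F, of 0] by simp
  qed
  have bd: "(\<integral>\<omega>. (?g (s, \<omega>))\<^sup>2 \<partial>N) \<le> e\<^sup>2 + (l2norm std_normal F)\<^sup>2" if "s \<in> space unit_time" for s
  proof -
    have "(l2norm N (\<lambda>\<omega>. ?g (s, \<omega>)))\<^sup>2 \<le> e\<^sup>2 + (l2norm std_normal F)\<^sup>2"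
      using small[OF that] zero by (cases "s = 0") (auto intro: add_increasing2)
    then show ?thesis by (simp only: l2norm_power2)
  qed
  note G = square_integrable_pairI[OF unit_time_prob_space sigma_finite_measure_axioms m sq bd]
  have "(l2norm (unit_time \<Otimes>\<^sub>M N) ?g)\<^sup>2 = (\<integral>s. (l2norm N (\<lambda>\<omega>. ?g (s, \<omega>)))\<^sup>2 \<partial>unit_time)" by (rule G(2))
  also have "\<dots> \<le> (\<integral>s. e\<^sup>2 \<partial>unit_time)"
  proof (rule integral_mono_AE')
    show "integrable unit_time (\<lambda>s. e\<^sup>2)" by simp
    have "AE s in unit_time. s \<notin> {0}" by (rule AE_unit_time_notin) simp
    then show "AE s in unit_time. (l2norm N (\<lambda>\<omega>. ?g (s, \<omega>)))\<^sup>2 \<le> e\<^sup>2"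
      using AE_space by eventually_elim (use small in auto)
  qed auto
  also have "\<dots> = e\<^sup>2" using unit_time.prob_space by simp
  finally have le: "l2norm (unit_time \<Otimes>\<^sub>M N) ?g \<le> e" using e by (rule power2_le_imp_le)
  note A = average_square_integrable[OF unit_time_prob_space sigma_finite_measure_axioms G(1)]
  show "square_integrable N (coupling_error F n)" using A(1) by (simp add: coupling_error_def[abs_def])
  show "l2norm N (coupling_error F n) \<le> e" using A(2) le by (simp add: coupling_error_def[abs_def])
qed

lemma ou_norm_square_integrable:
  assumes F: "square_integrable std_normal F"
  shows "square_integrable N (ou_norm F)" "l2norm N (ou_norm F) \<le> l2norm std_normal F"
    "AE \<omega> in N. square_integrable unit_time (\<lambda>s. F (OU s \<omega>))"
proof -
  let ?g = "\<lambda>p. indicator {0..1} (fst p) * F (OU (fst p) (snd p))"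
  interpret T: pair_sigma_finite unit_time N ..
  note G = OU_process_square_integrable[OF F, of 1]
  have gi: "integrable (unit_time \<Otimes>\<^sub>M N) (\<lambda>(s, \<omega>). (?g (s, \<omega>))\<^sup>2)" using G(1) by (simp add: square_integrable_def case_prod_unfold)
  have eq: "(\<integral>s. (?g (s, \<omega>))\<^sup>2 \<partial>unit_time) = (ou_norm F \<omega>)\<^sup>2" for \<omega>
    unfolding ou_norm_def l2norm_power2 by (intro Bochner_Integration.integral_cong refl) auto
  have i: "integrable N (\<lambda>\<omega>. (ou_norm F \<omega>)\<^sup>2)" using T.integrable_snd[OF gi] unfolding eq .
  have m: "ou_norm F \<in> borel_measurable N"
  proof -
    have "(\<lambda>\<omega>. sqrt ((ou_norm F \<omega>)\<^sup>2)) \<in> borel_measurable N"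
      by (rule measurable_compose[OF borel_measurable_integrable[OF i] borel_measurable_continuous_onI[OF continuous_on_real_sqrt[OF continuous_on_id]]])
    moreover have "(\<lambda>\<omega>. sqrt ((ou_norm F \<omega>)\<^sup>2)) = ou_norm F" by (auto simp: ou_norm_def)
    ultimately show ?thesis by (simp only:)
  qed
  show "square_integrable N (ou_norm F)" using i m by (simp add: square_integrable_def)
  have sqe: "(l2norm N (ou_norm F))\<^sup>2 = (l2norm (unit_time \<Otimes>\<^sub>M N) ?g)\<^sup>2"
    unfolding l2norm_power2 eq[symmetric] using T.integral_snd[OF gi] by (simp add: case_prod_unfold)
  have "l2norm N (ou_norm F) = l2norm (unit_time \<Otimes>\<^sub>M N) ?g" by (rule power2_eq_imp_eq[OF sqe]) simp_all
  then show "l2norm N (ou_norm F) \<le> l2norm std_normal F" using G(2) by (simp only:)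
  have "AE \<omega> in N. square_integrable unit_time (\<lambda>s. ?g (s, \<omega>))"
    by (rule average_square_integrable(3)[OF unit_time_prob_space sigma_finite_measure_axioms G(1)])
  then show "AE \<omega> in N. square_integrable unit_time (\<lambda>s. F (OU s \<omega>))"
  proof eventually_elim
    fix \<omega> assume "square_integrable unit_time (\<lambda>s. ?g (s, \<omega>))"
    moreover have "(\<lambda>s. ?g (s, \<omega>)) \<in> borel_measurable unit_time \<longleftrightarrow> (\<lambda>s. F (OU s \<omega>)) \<in> borel_measurable unit_time"
      by (rule measurable_cong) simp
    moreover have "integrable unit_time (\<lambda>s. (?g (s, \<omega>))\<^sup>2) \<longleftrightarrow> integrable unit_time (\<lambda>s. (F (OU s \<omega>))\<^sup>2)"
      by (rule Bochner_Integration.integrable_cong) auto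
    ultimately show "square_integrable unit_time (\<lambda>s. F (OU s \<omega>))" unfolding square_integrable_def by blast
  qed
qed

end

end

lemma (in prob_space) l2norm_null_integral:
  assumes "\<And>n. square_integrable M (f n)" "\<And>n \<omega>. 0 \<le> f n \<omega>" "(\<lambda>n. l2norm M (f n)) \<longlonglongrightarrow> 0"
  shows "(\<lambda>n. \<integral>\<omega>. f n \<omega> \<partial>M) \<longlonglongrightarrow> 0"
proof (rule Lim_null_comparison[OF _ assms(3)])
  show "\<forall>\<^sub>F n in sequentially. norm (\<integral>\<omega>. f n \<omega> \<partial>M) \<le> l2norm M (f n)"
  proof (rule always_eventually, rule allI)
    fix n
    show "norm (\<integral>\<omega>. f n \<omega> \<partial>M) \<le> l2norm M (f n)"
      using order_trans[OF integral_abs_bound l1_le_l2norm[OF assms(1)[of n]]] by simp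
  qed
qed

section \<open>Functions varying with n, and the limit of the normalised sums\<close>

context ou_process
begin

context
  fixes Fn :: "nat \<Rightarrow> real \<Rightarrow> real" and F :: "real \<Rightarrow> real" and b :: "nat \<Rightarrow> real"
  assumes \<gamma>1: "\<gamma> < 1" and Fn: "\<And>n. square_integrable std_normal (Fn n)" and F: "square_integrable std_normal F"
    and b: "hermite_expansion F b" and lim: "(\<lambda>n. l2norm std_normal (\<lambda>x. Fn n x - F x)) \<longlonglongrightarrow> 0"
begin

text \<open>The cost of replacing the rescaled function of stage \<open>n\<close> by its limit.
  Summing absolute values over the full range dominates every partial sum at once.\<close>

definition triangular_error :: "nat \<Rightarrow> 'b \<Rightarrow> real" where
  "triangular_error n \<omega> = (\<Sum>i=1..n. \<bar>Fn n (ar_sim n i \<omega>) - F (ar_sim n i \<omega>)\<bar>) / real n"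

definition path_error :: "nat \<Rightarrow> 'b \<Rightarrow> real" where
  "path_error n \<omega> = triangular_error n \<omega> + (coupling_error F n \<omega> + sqrt (1 / real n) * ou_norm F \<omega>)"

lemma path_error_nonneg: "0 \<le> path_error n \<omega>"
  unfolding path_error_def triangular_error_def coupling_error_def ou_norm_def
  by (intro add_nonneg_nonneg mult_nonneg_nonneg divide_nonneg_nonneg sum_nonneg integral_nonneg_AE) auto

lemma triangular_error_l2norm:
  "square_integrable N (triangular_error n)" "l2norm N (triangular_error n) \<le> l2norm std_normal (\<lambda>x. Fn n x - F x)"
proof -
  let ?d = "\<lambda>x. \<bar>Fn n x - F x\<bar>"
  have d: "square_integrable std_normal ?d"
    using square_integrable_diff[OF Fn[of n] F] by (auto simp: square_integrable_def)
  have n: "l2norm std_normal ?d = l2norm std_normal (\<lambda>x. Fn n x - F x)" by (simp add: l2norm_def)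
  have eq: "triangular_error n = (\<lambda>\<omega>. 1 / real n * (\<Sum>i=1..n. ?d (ar_sim n i \<omega>)))"
    by (simp add: triangular_error_def[abs_def])
  have sqd: "square_integrable N (\<lambda>\<omega>. ?d (ar_sim n i \<omega>))" "l2norm N (\<lambda>\<omega>. ?d (ar_sim n i \<omega>)) = l2norm std_normal ?d"
    if "i \<in> {1..n}" for i
    using ar_sim_function_square_integrable[OF \<gamma>1 d, of i n] that by auto
  show "square_integrable N (triangular_error n)"
    unfolding eq by (intro square_integrable_cmult square_integrable_sum sqd(1))
  have "l2norm N (\<lambda>\<omega>. \<Sum>i\<in>A. ?d (ar_sim n i \<omega>)) \<le> real (card A) * l2norm std_normal ?d" if "finite A" "A \<subseteq> {1..n}" for A
    using that
  proof (induction A)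
    case empty
    then show ?case by (simp add: l2norm_def)
  next
    case (insert i A)
    have "l2norm N (\<lambda>\<omega>. ?d (ar_sim n i \<omega>) + (\<Sum>i\<in>A. ?d (ar_sim n i \<omega>))) \<le> l2norm N (\<lambda>\<omega>. ?d (ar_sim n i \<omega>)) + l2norm N (\<lambda>\<omega>. \<Sum>i\<in>A. ?d (ar_sim n i \<omega>))"
      using insert.prems by (intro l2norm_triangle square_integrable_sum sqd(1)) auto
    also have "l2norm N (\<lambda>\<omega>. ?d (ar_sim n i \<omega>)) = l2norm std_normal ?d" using insert.prems by (intro sqd(2)) auto
    finally show ?case using insert by (simp add: algebra_simps)
  qed
  from this[of "{1..n}"] have "l2norm N (\<lambda>\<omega>. \<Sum>i=1..n. ?d (ar_sim n i \<omega>)) \<le> real n * l2norm std_normal ?d" by simp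
  then have "l2norm N (triangular_error n) \<le> \<bar>1 / real n\<bar> * (real n * l2norm std_normal ?d)"
    unfolding eq l2norm_cmult by (intro mult_left_mono) auto
  also have "\<dots> \<le> l2norm std_normal ?d" by (cases "n = 0") auto
  finally show "l2norm N (triangular_error n) \<le> l2norm std_normal (\<lambda>x. Fn n x - F x)" unfolding n .
qed

lemma path_error_limit:
  "\<forall>\<^sub>F n in sequentially. square_integrable N (path_error n)" "(\<lambda>n. l2norm N (path_error n)) \<longlonglongrightarrow> 0"
proof -
  have C: "\<forall>\<^sub>F n in sequentially. square_integrable N (coupling_error F n) \<and> l2norm N (coupling_error F n) \<le> e" if "e > 0" for e
    using ar_sim_OU_close[OF \<gamma>1 F b that] eventually_ge_at_top[of 1]
  proof eventually_elim
    fix n assume n: "\<forall>k s. 1 \<le> k \<longrightarrow> k \<le> n \<longrightarrow> (real k - 1) / real n < s \<longrightarrow> s \<le> real k / real n \<longrightarrow> 0 \<le> s \<longrightarrow> s \<le> 1 \<longrightarrow>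
      l2norm N (\<lambda>\<omega>. F (ar_sim n k \<omega>) - F (OU s \<omega>)) \<le> e" "1 \<le> n"
    have close: "l2norm N (\<lambda>\<omega>. F (ar_sim n k \<omega>) - F (OU s \<omega>)) \<le> e"
      if "1 \<le> k" "k \<le> n" "(real k - 1) / real n < s" "s \<le> real k / real n" "0 \<le> s" "s \<le> 1" for k s
      using n(1) that by blast
    show "square_integrable N (coupling_error F n) \<and> l2norm N (coupling_error F n) \<le> e"
      using coupling_error_l2norm[OF \<gamma>1 F n(2) less_imp_le[OF that] close] by blast
  qed
  have Cl: "(\<lambda>n. l2norm N (coupling_error F n)) \<longlonglongrightarrow> 0"
  proof (rule tendstoI)
    fix e :: real assume "e > 0"
    then show "\<forall>\<^sub>F n in sequentially. dist (l2norm N (coupling_error F n)) 0 < e"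
      using C[of "e / 2"] by (auto elim!: eventually_mono)
  qed
  show "\<forall>\<^sub>F n in sequentially. square_integrable N (path_error n)"
    using C[of 1, simplified] unfolding path_error_def[abs_def]
    by eventually_elim (intro square_integrable_add square_integrable_cmult triangular_error_l2norm(1) ou_norm_square_integrable(1)[OF \<gamma>1 F], simp)
  show "(\<lambda>n. l2norm N (path_error n)) \<longlonglongrightarrow> 0"
  proof (rule Lim_null_comparison)
    show "\<forall>\<^sub>F n in sequentially. norm (l2norm N (path_error n)) \<le>
      l2norm std_normal (\<lambda>x. Fn n x - F x) + (l2norm N (coupling_error F n) + sqrt (1 / real n) * l2norm N (ou_norm F))"
      using C[of 1, simplified]
    proof eventually_elim
      fix n assume c: "square_integrable N (coupling_error F n) \<and> l2norm N (coupling_error F n) \<le> 1"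
      let ?q = "\<lambda>\<omega>. sqrt (1 / real n) * ou_norm F \<omega>"
      have q: "square_integrable N ?q" by (intro square_integrable_cmult ou_norm_square_integrable(1)[OF \<gamma>1 F])
      have c1: "square_integrable N (coupling_error F n)" using c by simp
      have "l2norm N (path_error n) \<le> l2norm N (triangular_error n) + l2norm N (\<lambda>\<omega>. coupling_error F n \<omega> + ?q \<omega>)"
        unfolding path_error_def[abs_def] by (intro l2norm_triangle triangular_error_l2norm(1) square_integrable_add c1 q)
      also have "l2norm N (\<lambda>\<omega>. coupling_error F n \<omega> + ?q \<omega>) \<le> l2norm N (coupling_error F n) + l2norm N ?q"
        by (rule l2norm_triangle[OF c1 q])
      also have "l2norm N ?q = sqrt (1 / real n) * l2norm N (ou_norm F)" by (simp add: l2norm_cmult)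
      finally show "norm (l2norm N (path_error n)) \<le>
        l2norm std_normal (\<lambda>x. Fn n x - F x) + (l2norm N (coupling_error F n) + sqrt (1 / real n) * l2norm N (ou_norm F))"
        using triangular_error_l2norm(2)[of n] by simp
    qed
    have "(\<lambda>n. sqrt (1 / real n)) \<longlonglongrightarrow> sqrt 0" by (intro tendsto_real_sqrt lim_1_over_n)
    from tendsto_mult_left_zero[OF this[simplified], of "l2norm N (ou_norm F)"]
    show "(\<lambda>n. l2norm std_normal (\<lambda>x. Fn n x - F x) + (l2norm N (coupling_error F n) + sqrt (1 / real n) * l2norm N (ou_norm F))) \<longlonglongrightarrow> 0"
      using tendsto_add[OF lim tendsto_add[OF Cl]] by simp
  qed
qed

lemma ar_average_path_error:
  assumes n: "n \<ge> 1" and sq: "square_integrable unit_time (\<lambda>s. F (OU s \<omega>))" and t: "t \<in> {0..1}"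
  shows "\<bar>ar_average (Fn n) n (nat \<lfloor>real n * t\<rfloor>) \<omega> - ou_average F t \<omega>\<bar> \<le> path_error n \<omega>"
proof -
  define k where "k = nat \<lfloor>real n * t\<rfloor>"
  have k: "k \<le> n" unfolding k_def by (rule step_index_le[OF t])
  have "\<bar>ar_average (Fn n) n k \<omega> - ar_average F n k \<omega>\<bar> = \<bar>\<Sum>i=1..k. Fn n (ar_sim n i \<omega>) - F (ar_sim n i \<omega>)\<bar> / real n"
    unfolding ar_average_def by (simp add: diff_divide_distrib[symmetric] sum_subtractf)
  also have "\<dots> \<le> (\<Sum>i=1..k. \<bar>Fn n (ar_sim n i \<omega>) - F (ar_sim n i \<omega>)\<bar>) / real n"
    by (intro divide_right_mono sum_abs) simp
  also have "\<dots> \<le> triangular_error n \<omega>"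
    unfolding triangular_error_def using k by (intro divide_right_mono sum_mono2) auto
  finally have "\<bar>ar_average (Fn n) n k \<omega> - ar_average F n k \<omega>\<bar> \<le> triangular_error n \<omega>" .
  moreover have "\<bar>ar_average F n k \<omega> - ou_average F t \<omega>\<bar> \<le> coupling_error F n \<omega> + sqrt (1 / real n) * ou_norm F \<omega>"
    unfolding k_def by (rule ar_average_error[OF \<gamma>1 n t sq])
  ultimately show ?thesis unfolding path_error_def k_def[symmetric] by linarith
qed

lemma ar_average_square_integrable: "square_integrable N (ar_average (Fn n) n n)"
proof -
  have "square_integrable N (\<lambda>\<omega>. 1 / real n * (\<Sum>i=1..n. Fn n (ar_sim n i \<omega>)))"
    by (intro square_integrable_cmult square_integrable_sum ar_sim_function_square_integrable(1)[OF \<gamma>1 Fn]) auto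
  then show ?thesis by (simp add: ar_average_def[abs_def])
qed

lemma ar_average_norm_limit: "(\<lambda>n. l2norm N (ar_average (Fn n) n n)) \<longlonglongrightarrow> l2norm N (ou_average F 1)"
proof (rule LIM_zero_cancel, rule Lim_null_comparison[OF _ path_error_limit(2)])
  show "\<forall>\<^sub>F n in sequentially. norm (l2norm N (ar_average (Fn n) n n) - l2norm N (ou_average F 1)) \<le> l2norm N (path_error n)"
    using path_error_limit(1) eventually_ge_at_top[of 1]
  proof eventually_elim
    fix n assume n: "square_integrable N (path_error n)" "n \<ge> (1::nat)"
    note V = ou_average_square_integrable(1)[OF F, of 1]
    have "norm (l2norm N (ar_average (Fn n) n n) - l2norm N (ou_average F 1)) \<le> l2norm N (\<lambda>\<omega>. ar_average (Fn n) n n \<omega> - ou_average F 1 \<omega>)"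
      unfolding real_norm_def by (rule l2norm_diff_abs[OF ar_average_square_integrable V])
    also have "\<dots> \<le> l2norm N (path_error n)"
    proof (rule l2norm_mono[OF n(1)])
      show "(\<lambda>\<omega>. ar_average (Fn n) n n \<omega> - ou_average F 1 \<omega>) \<in> borel_measurable N"
        using square_integrable_diff[OF ar_average_square_integrable V] by (simp add: square_integrable_def)
      show "AE \<omega> in N. \<bar>ar_average (Fn n) n n \<omega> - ou_average F 1 \<omega>\<bar> \<le> \<bar>path_error n \<omega>\<bar>"
        using ou_norm_square_integrable(3)[OF \<gamma>1 F]
        by eventually_elim (use ar_average_path_error[OF n(2), of _ 1] path_error_nonneg in auto)
    qed
    finally show "norm (l2norm N (ar_average (Fn n) n n) - l2norm N (ou_average F 1)) \<le> l2norm N (path_error n)" .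
  qed
qed

text \<open>A condition on a nonnegative integral, which makes this set measurable. It has full
  probability, and on it the time integral is defined and continuous for all \<open>t\<close>
  simultaneously.\<close>

definition good_paths :: "'b set" where
  "good_paths = {\<omega> \<in> space N. (\<integral>\<^sup>+s. ennreal ((F (OU s \<omega>))\<^sup>2) \<partial>unit_time) < \<infinity>}"

lemma good_paths:
  shows "good_paths \<in> sets N" "AE \<omega> in N. \<omega> \<in> good_paths"
    "\<omega> \<in> good_paths \<Longrightarrow> square_integrable unit_time (\<lambda>s. F (OU s \<omega>))"
proof -
  have Fm: "F \<in> borel_measurable borel" using F by (simp add: square_integrable_def)
  have m: "(\<lambda>p. F (OU (fst p) (snd p))) \<in> borel_measurable (unit_time \<Otimes>\<^sub>M N)"
    by (rule measurable_unit_time_pair[OF measurable_compose[OF OU_measurable(1) Fm]])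
  have m2: "(\<lambda>\<omega>. \<integral>\<^sup>+s. ennreal ((F (OU s \<omega>))\<^sup>2) \<partial>unit_time) \<in> borel_measurable N"
  proof (rule unit_time.borel_measurable_nn_integral)
    have "(\<lambda>p. ennreal ((F (OU (fst p) (snd p)))\<^sup>2)) \<in> borel_measurable (unit_time \<Otimes>\<^sub>M N)"
      using measurable_compose[OF m, of "\<lambda>x. ennreal (x\<^sup>2)" borel] by simp
    then have "(\<lambda>p. ennreal ((F (OU (snd p) (fst p)))\<^sup>2)) \<in> borel_measurable (N \<Otimes>\<^sub>M unit_time)"
      using measurable_compose[OF measurable_pair_swap', of "\<lambda>p. ennreal ((F (OU (fst p) (snd p)))\<^sup>2)" unit_time N borel] by (simp add: case_prod_unfold)
    then show "(\<lambda>(\<omega>, s). ennreal ((F (OU s \<omega>))\<^sup>2)) \<in> borel_measurable (N \<Otimes>\<^sub>M unit_time)"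
      by (simp add: case_prod_unfold)
  qed
  from measurable_sets[OF m2, of "{..<\<infinity>}"]
  have "(\<lambda>\<omega>. \<integral>\<^sup>+s. ennreal ((F (OU s \<omega>))\<^sup>2) \<partial>unit_time) -` {..<\<infinity>} \<inter> space N \<in> sets N" by simp
  moreover have "(\<lambda>\<omega>. \<integral>\<^sup>+s. ennreal ((F (OU s \<omega>))\<^sup>2) \<partial>unit_time) -` {..<\<infinity>} \<inter> space N = good_paths"
    unfolding good_paths_def by blast
  ultimately show "good_paths \<in> sets N" by simp
  show "AE \<omega> in N. \<omega> \<in> good_paths"
    using ou_norm_square_integrable(3)[OF \<gamma>1 F] AE_space
    by eventually_elim (auto simp: good_paths_def nn_integral_power2_l2norm)
  assume w: "\<omega> \<in> good_paths"
  have "(\<lambda>s. F (OU s \<omega>)) \<in> borel_measurable unit_time"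
  proof -
    have "(\<lambda>s. (s, \<omega>)) \<in> measurable unit_time (unit_time \<Otimes>\<^sub>M N)" using w by (auto simp: good_paths_def)
    from measurable_compose[OF this m] show ?thesis by simp
  qed
  then show "square_integrable unit_time (\<lambda>s. F (OU s \<omega>))"
    using w by (intro square_integrableI_nn) (auto simp: good_paths_def)
qed

text \<open>The indicators of \<open>{0..x n}\<close> converge at every time except possibly
  \<open>a\<close> itself; the path is integrable, so dominated convergence applies.\<close>

lemma ou_average_continuous:
  assumes w: "\<omega> \<in> good_paths"
  shows "continuous_on {0..1} (\<lambda>t. ou_average F t \<omega>)"
proof (rule continuous_on_sequentiallyI)
  fix x :: "nat \<Rightarrow> real" and a assume a: "\<forall>n. x n \<in> {0..1}" "a \<in> {0..1}" "x \<longlonglongrightarrow> a"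
  note sq = good_paths(3)[OF w]
  have m: "(\<lambda>s. F (OU s \<omega>)) \<in> borel_measurable unit_time" using sq by (simp add: square_integrable_def)
  show "(\<lambda>n. ou_average F (x n) \<omega>) \<longlonglongrightarrow> ou_average F a \<omega>"
    unfolding ou_average_def
  proof (rule integral_dominated_convergence[where w="\<lambda>s. \<bar>F (OU s \<omega>)\<bar>"])
    show "integrable unit_time (\<lambda>s. \<bar>F (OU s \<omega>)\<bar>)" using unit_time.square_integrable_L1[OF sq] by simp
    have "AE s in unit_time. s \<notin> {a}" by (rule AE_unit_time_notin) simp
    then show "AE s in unit_time. (\<lambda>n. indicat_real {0..x n} s * F (OU s \<omega>)) \<longlonglongrightarrow> indicat_real {0..a} s * F (OU s \<omega>)"
    proof eventually_elim
      fix s assume s: "s \<notin> {a}"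
      have "\<forall>\<^sub>F n in sequentially. indicat_real {0..x n} s = indicat_real {0..a} s"
      proof (cases "s < a")
        case True
        from order_tendstoD(1)[OF a(3) this] show ?thesis by eventually_elim (use True in \<open>auto simp: indicator_def\<close>)
      next
        case False
        then have "a < s" using s by auto
        from order_tendstoD(2)[OF a(3) this] show ?thesis by eventually_elim (use \<open>a < s\<close> in \<open>auto simp: indicator_def\<close>)
      qed
      then have "(\<lambda>n. indicat_real {0..x n} s) \<longlonglongrightarrow> indicat_real {0..a} s" by (rule tendsto_eventually)
      then show "(\<lambda>n. indicat_real {0..x n} s * F (OU s \<omega>)) \<longlonglongrightarrow> indicat_real {0..a} s * F (OU s \<omega>)"
        by (intro tendsto_mult tendsto_const)
    qed
    show "AE s in unit_time. norm (indicat_real {0..x n} s * F (OU s \<omega>)) \<le> \<bar>F (OU s \<omega>)\<bar>" for n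
      by (intro AE_I2) (auto simp: indicator_def)
  qed (use m in \<open>auto intro!: borel_measurable_times\<close>)
qed

text \<open>The modification that the limit theorem asks for: outside \<open>good_paths\<close> it
  is set to 0, so that every path is continuous and the map into the Skorokhod space is
  measurable.\<close>

definition limit_path :: "'b \<Rightarrow> real \<Rightarrow> real" where
  "limit_path \<omega> = (\<lambda>t\<in>{0..1}. (if \<omega> \<in> good_paths then ou_average F t \<omega> else 0) / l2norm N (ou_average F 1))"

lemma limit_path_measurable: "limit_path \<in> measurable N (borel_of skorokhod_topology)"
  unfolding limit_path_def[abs_def]
proof (rule continuous_path_measurable)
  fix t :: real assume "t \<in> {0..1}"
  have "ou_average F t \<in> borel_measurable N" using ou_average_square_integrable(1)[OF F] by (simp add: square_integrable_def)
  moreover have "{\<omega> \<in> space N. \<omega> \<in> good_paths} \<in> sets N" using good_paths(1) by (simp add: good_paths_def)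
  ultimately show "(\<lambda>\<omega>. (if \<omega> \<in> good_paths then ou_average F t \<omega> else 0) / l2norm N (ou_average F 1)) \<in> borel_measurable N"
    by (intro borel_measurable_divide measurable_If) auto
next
  fix \<omega>
  show "continuous_on {0..1} (\<lambda>t. (if \<omega> \<in> good_paths then ou_average F t \<omega> else 0) / l2norm N (ou_average F 1))"
    using ou_average_continuous by (cases "\<omega> \<in> good_paths") (auto simp: divide_inverse intro!: continuous_on_mult_right)
qed

lemma limit_path_AE: "t \<in> {0..1} \<Longrightarrow> AE \<omega> in N. limit_path \<omega> t = ou_average F t \<omega> / l2norm N (ou_average F 1)"
  using good_paths(2) by eventually_elim (simp add: limit_path_def)

text \<open>Numerators converge uniformly in time by \<open>path_error\<close>, denominators to a
  positive number. The error of the quotient is split as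
  \<open>(?U - ?V) / u n + (1 / u n - 1 / w) * ?V\<close>, and \<open>ou_norm F\<close> bounds the
  time integral for all \<open>t\<close>.\<close>

lemma ar_sim_functional_limit:
  assumes v: "0 < l2norm N (ou_average F 1)"
    and g: "continuous_map skorokhod_topology euclideanreal g" "bounded (g ` topspace skorokhod_topology)"
  shows "(\<lambda>n. \<integral>\<omega>. g (step_path n (\<lambda>k. (\<Sum>i=1..k. Fn n (ar_sim n i \<omega>)) / l2norm N (\<lambda>\<omega>. \<Sum>i=1..n. Fn n (ar_sim n i \<omega>)))) \<partial>N)
    \<longlonglongrightarrow> (\<integral>\<omega>. g (limit_path \<omega>) \<partial>N)"
proof -
  define u where "u n = l2norm N (ar_average (Fn n) n n)" for n
  define w where "w = l2norm N (ou_average F 1)"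
  have w: "w > 0" using v by (simp add: w_def)
  have u: "u \<longlonglongrightarrow> w" unfolding u_def w_def by (rule ar_average_norm_limit)
  define Y where "Y n \<omega> = step_path n (\<lambda>k. (\<Sum>i=1..k. Fn n (ar_sim n i \<omega>)) / l2norm N (\<lambda>\<omega>. \<Sum>i=1..n. Fn n (ar_sim n i \<omega>)))" for n \<omega>
  have Fm: "Fn n \<in> borel_measurable borel" for n using Fn[of n] by (simp add: square_integrable_def)
  have Ym: "Y n \<in> measurable N (borel_of skorokhod_topology)" for n
    unfolding Y_def
    by (intro step_path_measurable borel_measurable_divide borel_measurable_sum measurable_compose[OF ar_sim_measurable Fm] borel_measurable_const)
  obtain n0 where n0: "\<And>n. n \<ge> n0 \<Longrightarrow> square_integrable N (path_error n)"
    using path_error_limit(1) by (auto simp: eventually_sequentially)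
  \<comment> \<open>\<open>path_error n\<close> is known to be square integrable only from
    \<open>n0\<close> on; below that the bound is set to 0, so that \<open>R n\<close> is integrable
    for every \<open>n\<close>.\<close>
  define R where "R n \<omega> = (if n \<ge> n0 then path_error n \<omega> * \<bar>1 / u n\<bar> + \<bar>1 / u n - 1 / w\<bar> * ou_norm F \<omega> else 0)" for n \<omega>
  note Q = ou_norm_square_integrable[OF \<gamma>1 F]
  have Rsq: "square_integrable N (R n)" for n
  proof (cases "n \<ge> n0")
    case True
    have "square_integrable N (\<lambda>\<omega>. \<bar>1 / u n\<bar> * path_error n \<omega> + \<bar>1 / u n - 1 / w\<bar> * ou_norm F \<omega>)"
      by (intro square_integrable_add square_integrable_cmult n0[OF True] Q(1))
    then show ?thesis using True by (simp add: R_def[abs_def] mult.commute)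
  qed (simp add: R_def[abs_def])
  have R0: "0 \<le> R n \<omega>" for n \<omega>
    using path_error_nonneg[of n \<omega>] by (auto simp: R_def ou_norm_def intro!: add_nonneg_nonneg mult_nonneg_nonneg)
  have inv: "(\<lambda>n. 1 / u n) \<longlonglongrightarrow> 1 / w" using u w by (intro tendsto_divide tendsto_const) auto
  have "(\<lambda>n. l2norm N (R n)) \<longlonglongrightarrow> 0"
  proof (rule Lim_null_comparison)
    show "\<forall>\<^sub>F n in sequentially. norm (l2norm N (R n)) \<le> \<bar>1 / u n\<bar> * l2norm N (path_error n) + \<bar>1 / u n - 1 / w\<bar> * l2norm N (ou_norm F)"
      using eventually_ge_at_top[of n0]
    proof eventually_elim
      fix n assume n: "n \<ge> n0"
      have "R n = (\<lambda>\<omega>. \<bar>1 / u n\<bar> * path_error n \<omega> + \<bar>1 / u n - 1 / w\<bar> * ou_norm F \<omega>)"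
        using n by (auto simp: R_def mult.commute)
      then have "l2norm N (R n) \<le> l2norm N (\<lambda>\<omega>. \<bar>1 / u n\<bar> * path_error n \<omega>) + l2norm N (\<lambda>\<omega>. \<bar>1 / u n - 1 / w\<bar> * ou_norm F \<omega>)"
        by (simp only:) (intro l2norm_triangle square_integrable_cmult n0[OF n] Q(1))
      then show "norm (l2norm N (R n)) \<le> \<bar>1 / u n\<bar> * l2norm N (path_error n) + \<bar>1 / u n - 1 / w\<bar> * l2norm N (ou_norm F)"
        unfolding l2norm_cmult by simp
    qed
    have "(\<lambda>n. \<bar>1 / u n\<bar> * l2norm N (path_error n) + \<bar>1 / u n - 1 / w\<bar> * l2norm N (ou_norm F)) \<longlonglongrightarrow>
       \<bar>1 / w\<bar> * 0 + \<bar>1 / w - 1 / w\<bar> * l2norm N (ou_norm F)"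
      by (intro tendsto_intros inv path_error_limit(2))
    then show "(\<lambda>n. \<bar>1 / u n\<bar> * l2norm N (path_error n) + \<bar>1 / u n - 1 / w\<bar> * l2norm N (ou_norm F)) \<longlonglongrightarrow> 0" by simp
  qed
  then have Rl: "(\<lambda>n. \<integral>\<omega>. R n \<omega> \<partial>N) \<longlonglongrightarrow> 0" by (rule l2norm_null_integral[OF Rsq R0])
  have bd: "\<forall>\<^sub>F n in sequentially. AE \<omega> in N. \<forall>t\<in>{0..1}. \<bar>Y n \<omega> t - limit_path \<omega> t\<bar> \<le> R n \<omega>"
    using eventually_ge_at_top[of n0] eventually_ge_at_top[of 1]
  proof eventually_elim
    fix n assume n: "n \<ge> n0" "n \<ge> (1::nat)"
    have rn: "real n > 0" using n by simp
    have "(\<lambda>\<omega>. \<Sum>i=1..n. Fn n (ar_sim n i \<omega>)) = (\<lambda>\<omega>. real n * ar_average (Fn n) n n \<omega>)"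
      using rn by (simp add: ar_average_def)
    then have den: "l2norm N (\<lambda>\<omega>. \<Sum>i=1..n. Fn n (ar_sim n i \<omega>)) = real n * u n"
      unfolding u_def by (simp add: l2norm_cmult)
    show "AE \<omega> in N. \<forall>t\<in>{0..1}. \<bar>Y n \<omega> t - limit_path \<omega> t\<bar> \<le> R n \<omega>"
      using good_paths(2)
    proof eventually_elim
      fix \<omega> assume g: "\<omega> \<in> good_paths"
      note sq = good_paths(3)[OF g]
      show "\<forall>t\<in>{0..1}. \<bar>Y n \<omega> t - limit_path \<omega> t\<bar> \<le> R n \<omega>"
      proof
        fix t :: real assume t: "t \<in> {0..1}"
        let ?U = "ar_average (Fn n) n (nat \<lfloor>real n * t\<rfloor>) \<omega>" and ?V = "ou_average F t \<omega>"
        have Y: "Y n \<omega> t = ?U / u n" unfolding Y_def den using t rn by (simp add: step_path_def ar_average_def)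
        have Z: "limit_path \<omega> t = ?V / w" using t g by (simp add: limit_path_def w_def)
        have "\<bar>?V\<bar> \<le> ou_norm F \<omega>"
        proof -
          have "square_integrable unit_time (\<lambda>s. indicat_real {0..t} s * F (OU s \<omega>))"
            using sq by (intro square_integrable_bound[OF sq] borel_measurable_times) (auto simp: indicator_def square_integrable_def)
          then have "\<bar>?V\<bar> \<le> l2norm unit_time (\<lambda>s. indicat_real {0..t} s * F (OU s \<omega>))"
            unfolding ou_average_def by (rule order_trans[OF integral_abs_bound unit_time.l1_le_l2norm])
          also have "\<dots> \<le> ou_norm F \<omega>"
            unfolding ou_norm_def using sq by (intro l2norm_mono[OF sq] borel_measurable_times) (auto simp: indicator_def square_integrable_def)
          finally show ?thesis .
        qed
        then have 1: "\<bar>1 / u n - 1 / w\<bar> * \<bar>?V\<bar> \<le> \<bar>1 / u n - 1 / w\<bar> * ou_norm F \<omega>" by (intro mult_left_mono) auto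
        have 2: "\<bar>?U - ?V\<bar> * \<bar>1 / u n\<bar> \<le> path_error n \<omega> * \<bar>1 / u n\<bar>"
          using ar_average_path_error[OF n(2) sq t] by (intro mult_right_mono) auto
        have "?U / u n - ?V / w = (?U - ?V) * (1 / u n) + (1 / u n - 1 / w) * ?V" by (simp add: algebra_simps)
        then have "\<bar>?U / u n - ?V / w\<bar> \<le> \<bar>?U - ?V\<bar> * \<bar>1 / u n\<bar> + \<bar>1 / u n - 1 / w\<bar> * \<bar>?V\<bar>"
          using abs_triangle_ineq[of "(?U - ?V) * (1 / u n)" "(1 / u n - 1 / w) * ?V"] by (simp only: abs_mult)
        then show "\<bar>Y n \<omega> t - limit_path \<omega> t\<bar> \<le> R n \<omega>"
          unfolding Y Z R_def using 1 2 n(1) by simp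
      qed
    qed
  qed
  from skorokhod_expectation_limit[OF Ym limit_path_measurable square_integrable_L1[OF Rsq] R0 Rl bd g]
  show ?thesis unfolding Y_def .
qed

end

end

section \<open>Completeness of the Hermite polynomials\<close>

text \<open>The Riesz-Fischer argument: a fast subsequence has increments with summable mean, hence
  converges almost surely, and Fatou's lemma transfers the Cauchy bounds of the whole sequence to
  its limit.\<close>

lemma (in prob_space) l2_complete:
  assumes S: "\<And>k::nat. square_integrable M (S k)"
    and C: "\<And>e. e > 0 \<Longrightarrow> \<exists>K. \<forall>m\<ge>K. \<forall>n\<ge>K. l2norm M (\<lambda>x. S m x - S n x) \<le> e"
  shows "\<exists>g. square_integrable M g \<and> (\<lambda>k. l2norm M (\<lambda>x. S k x - g x)) \<longlonglongrightarrow> 0"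
proof -
  have [measurable]: "S k \<in> borel_measurable M" for k using S by (simp add: square_integrable_def)
  have "\<forall>j. \<exists>K. \<forall>m\<ge>K. \<forall>n\<ge>K. l2norm M (\<lambda>x. S m x - S n x) \<le> (1 / 2) ^ j" using C by simp
  then obtain K where K: "\<And>j m n. m \<ge> K j \<Longrightarrow> n \<ge> K j \<Longrightarrow> l2norm M (\<lambda>x. S m x - S n x) \<le> (1 / 2) ^ j" by metis
  \<comment> \<open>The sum makes both \<open>r j\<close> and \<open>r (Suc j)\<close> at least
    \<open>K j\<close>, without assuming that \<open>K\<close> is monotone; the summand
    \<open>j\<close> makes \<open>r\<close> unbounded.\<close>
  define r where "r j = (\<Sum>i\<le>j. K i) + j" for j
  have rK: "K j \<le> r j" "K j \<le> r (Suc j)" for j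
  proof -
    have "K j \<le> (\<Sum>i\<le>j. K i)" by (rule member_le_sum) auto
    then show "K j \<le> r j" "K j \<le> r (Suc j)" by (auto simp: r_def)
  qed
  have rj: "j \<le> r j" for j by (simp add: r_def)
  let ?d = "\<lambda>j x. S (r (Suc j)) x - S (r j) x"
  have E: "(\<integral>\<^sup>+x. ennreal \<bar>?d j x\<bar> \<partial>M) \<le> ennreal ((1 / 2) ^ j)" for j
  proof -
    note sq = square_integrable_diff[OF S[of "r (Suc j)"] S[of "r j"]]
    have "(\<integral>\<^sup>+x. ennreal \<bar>?d j x\<bar> \<partial>M) = ennreal (\<integral>x. \<bar>?d j x\<bar> \<partial>M)"
      using square_integrable_L1[OF sq] by (intro nn_integral_eq_integral) auto
    also have "\<dots> \<le> ennreal ((1 / 2) ^ j)"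
      using order_trans[OF l1_le_l2norm[OF sq] K[OF rK(2) rK(1)]] by (rule ennreal_leI)
    finally show ?thesis .
  qed
  have "(\<integral>\<^sup>+x. (\<Sum>j. ennreal \<bar>?d j x\<bar>) \<partial>M) = (\<Sum>j. \<integral>\<^sup>+x. ennreal \<bar>?d j x\<bar> \<partial>M)"
    by (rule nn_integral_suminf) simp
  also have "\<dots> \<le> (\<Sum>j. ennreal ((1 / 2) ^ j))" by (intro suminf_le E) auto
  also have "\<dots> = ennreal (\<Sum>j. (1 / 2) ^ j)"
    by (intro suminf_ennreal2 summable_geometric) auto
  finally have le: "(\<integral>\<^sup>+x. (\<Sum>j. ennreal \<bar>?d j x\<bar>) \<partial>M) \<le> ennreal (\<Sum>j. (1 / 2) ^ j)" .
  have "(\<integral>\<^sup>+x. (\<Sum>j. ennreal \<bar>?d j x\<bar>) \<partial>M) \<noteq> \<infinity>" using le_less_trans[OF le ennreal_less_top] by simp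
  then have "AE x in M. (\<Sum>j. ennreal \<bar>?d j x\<bar>) \<noteq> \<infinity>" by (intro nn_integral_noteq_infinite) auto
  then have conv: "AE x in M. (\<lambda>j. S (r j) x) \<longlonglongrightarrow> lim (\<lambda>j. S (r j) x)"
  proof eventually_elim
    fix x assume "(\<Sum>j. ennreal \<bar>?d j x\<bar>) \<noteq> \<infinity>"
    then have "summable (\<lambda>j. \<bar>?d j x\<bar>)" by (intro summable_suminf_not_top) auto
    then have "summable (\<lambda>j. ?d j x)" by (rule summable_rabs_cancel)
    then have "convergent (\<lambda>m. \<Sum>j<m. ?d j x)" by (simp add: summable_iff_convergent)
    then have "convergent (\<lambda>m. S (r m) x - S (r 0) x)" unfolding sum_lessThan_telescope[of "\<lambda>j. S (r j) x"] .
    then have "convergent (\<lambda>m. S (r m) x)" by (simp add: convergent_diff_const_right_iff)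
    then show "(\<lambda>j. S (r j) x) \<longlonglongrightarrow> lim (\<lambda>j. S (r j) x)" by (simp add: convergent_LIMSEQ_iff)
  qed
  define g where "g x = lim (\<lambda>j. S (r j) x)" for x
  have [measurable]: "g \<in> borel_measurable M" unfolding g_def by measurable
  have F: "(\<integral>\<^sup>+x. ennreal ((S k x - g x)\<^sup>2) \<partial>M) \<le> ennreal (e\<^sup>2)"
    if e: "e > 0" and k: "\<And>m. m \<ge> k \<Longrightarrow> l2norm M (\<lambda>x. S k x - S m x) \<le> e" for e k
  proof -
    have "(\<integral>\<^sup>+x. ennreal ((S k x - g x)\<^sup>2) \<partial>M) = (\<integral>\<^sup>+x. liminf (\<lambda>j. ennreal ((S k x - S (r j) x)\<^sup>2)) \<partial>M)"
    proof (rule nn_integral_cong_AE)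
      show "AE x in M. ennreal ((S k x - g x)\<^sup>2) = liminf (\<lambda>j. ennreal ((S k x - S (r j) x)\<^sup>2))"
        using conv
      proof eventually_elim
        fix x assume "(\<lambda>j. S (r j) x) \<longlonglongrightarrow> lim (\<lambda>j. S (r j) x)"
        then have "(\<lambda>j. ennreal ((S k x - S (r j) x)\<^sup>2)) \<longlonglongrightarrow> ennreal ((S k x - g x)\<^sup>2)"
          unfolding g_def by (intro tendsto_ennrealI tendsto_power tendsto_diff tendsto_const)
        then show "ennreal ((S k x - g x)\<^sup>2) = liminf (\<lambda>j. ennreal ((S k x - S (r j) x)\<^sup>2))"
          by (rule lim_imp_Liminf[OF trivial_limit_sequentially, symmetric])
      qed
    qed
    also have "\<dots> \<le> liminf (\<lambda>j. \<integral>\<^sup>+x. ennreal ((S k x - S (r j) x)\<^sup>2) \<partial>M)"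
      by (rule nn_integral_liminf) simp
    also have "\<dots> \<le> ennreal (e\<^sup>2)"
    proof (rule Liminf_le)
      show "\<forall>\<^sub>F j in sequentially. (\<integral>\<^sup>+x. ennreal ((S k x - S (r j) x)\<^sup>2) \<partial>M) \<le> ennreal (e\<^sup>2)"
        using eventually_ge_at_top[of k]
      proof eventually_elim
        fix j assume "k \<le> j"
        then have "l2norm M (\<lambda>x. S k x - S (r j) x) \<le> e" using k rj[of j] by simp
        then show "(\<integral>\<^sup>+x. ennreal ((S k x - S (r j) x)\<^sup>2) \<partial>M) \<le> ennreal (e\<^sup>2)"
          unfolding nn_integral_power2_l2norm[OF square_integrable_diff[OF S S]] by (intro ennreal_leI power_mono) auto
      qed
    qed simp
    finally show ?thesis .
  qed
  have ev: "\<exists>K. \<forall>k\<ge>K. square_integrable M (\<lambda>x. S k x - g x) \<and> l2norm M (\<lambda>x. S k x - g x) \<le> e" if e: "e > 0" for e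
  proof -
    obtain K where K: "\<And>m n. m \<ge> K \<Longrightarrow> n \<ge> K \<Longrightarrow> l2norm M (\<lambda>x. S m x - S n x) \<le> e" using C[OF e] by blast
    have "square_integrable M (\<lambda>x. S k x - g x) \<and> l2norm M (\<lambda>x. S k x - g x) \<le> e" if k: "k \<ge> K" for k
    proof -
      have le: "(\<integral>\<^sup>+x. ennreal ((S k x - g x)\<^sup>2) \<partial>M) \<le> ennreal (e\<^sup>2)" using k by (intro F[OF e] K) auto
      then have sq: "square_integrable M (\<lambda>x. S k x - g x)"
        using le_less_trans[OF le ennreal_less_top] by (intro square_integrableI_nn) auto
      have "(l2norm M (\<lambda>x. S k x - g x))\<^sup>2 \<le> e\<^sup>2" using le unfolding nn_integral_power2_l2norm[OF sq] by simp
      then have "l2norm M (\<lambda>x. S k x - g x) \<le> e" by (rule power2_le_imp_le) (use e in simp)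
      then show ?thesis using sq by simp
    qed
    then show ?thesis by blast
  qed
  obtain k where "square_integrable M (\<lambda>x. S k x - g x)" using ev[of 1] by auto
  from square_integrable_diff[OF S[of k] this] have "square_integrable M g" by simp
  moreover have "(\<lambda>k. l2norm M (\<lambda>x. S k x - g x)) \<longlonglongrightarrow> 0"
  proof (rule LIMSEQ_I)
    fix e :: real assume "e > 0"
    then obtain K where "\<forall>k\<ge>K. l2norm M (\<lambda>x. S k x - g x) \<le> e / 2" using ev[of "e / 2"] by auto
    then show "\<exists>K. \<forall>k\<ge>K. norm (l2norm M (\<lambda>x. S k x - g x) - 0) < e"
      using \<open>e > 0\<close> by (intro exI[of _ K]) (auto intro: le_less_trans)
  qed
  ultimately show ?thesis by blast
qed

text \<open>Induction through
  \<open>x * hermite q x = hermite (Suc q) x + q * hermite (q - 1) x\<close>. The parity clause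
  accounts for the orders \<open>p - 2 * l\<close> in the theorem, and the leading coefficient 1
  keeps the limit from degenerating.\<close>

lemma power_hermite:
  "\<exists>a. (\<forall>x. x ^ w = (\<Sum>q\<le>w. a q * hermite q x)) \<and> (\<forall>q. a q \<noteq> 0 \<longrightarrow> q \<le> w \<and> even (w + q)) \<and> a w = (1::real)"
proof (induction w)
  case 0
  show ?case by (intro exI[of _ "\<lambda>q. if q = 0 then 1 else 0"]) auto
next
  case (Suc w)
  then obtain a where a: "\<And>x. x ^ w = (\<Sum>q\<le>w. a q * hermite q x)" "\<And>q. a q \<noteq> 0 \<Longrightarrow> q \<le> w \<and> even (w + q)" "a w = 1" by blast
  define a' where "a' q = (if q = 0 then 0 else a (q - 1)) + real (Suc q) * a (Suc q)" for q
  have "x ^ Suc w = (\<Sum>q\<le>Suc w. a' q * hermite q x)" for x :: real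
  proof -
    have rec: "x * hermite q x = hermite (Suc q) x + real q * hermite (q - 1) x" for q
      by (cases q) simp_all
    have z: "a q = 0" if "q > w" for q using a(2)[of q] that by auto
    have "x ^ Suc w = (\<Sum>q\<le>w. a q * (x * hermite q x))" by (simp add: a(1) sum_distrib_left mult_ac)
    also have "\<dots> = (\<Sum>q\<le>w. a q * hermite (Suc q) x) + (\<Sum>q\<le>w. real q * a q * hermite (q - 1) x)"
      unfolding rec by (simp add: distrib_left sum.distrib mult_ac)
    also have "(\<Sum>q\<le>w. a q * hermite (Suc q) x) = (\<Sum>q\<le>Suc w. (if q = 0 then 0 else a (q - 1)) * hermite q x)"
      by (subst sum.atMost_Suc_shift) simp
    also have "(\<Sum>q\<le>w. real q * a q * hermite (q - 1) x) = (\<Sum>q\<le>Suc (Suc w). real q * a q * hermite (q - 1) x)"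
      by (simp add: z)
    also have "\<dots> = (\<Sum>q\<le>Suc w. real (Suc q) * a (Suc q) * hermite q x)"
      by (subst sum.atMost_Suc_shift) simp
    finally show ?thesis unfolding a'_def distrib_right sum.distrib .
  qed
  moreover have "q \<le> Suc w \<and> even (Suc w + q)" if "a' q \<noteq> 0" for q
  proof -
    have "(q \<noteq> 0 \<and> a (q - 1) \<noteq> 0) \<or> a (Suc q) \<noteq> 0" using that by (auto simp: a'_def split: if_splits)
    then show ?thesis using a(2)[of "q - 1"] a(2)[of "Suc q"] by (cases q) auto
  qed
  moreover have "a' (Suc w) = 1"
    using a(2)[of "Suc (Suc w)"] a(3) by (cases "a (Suc (Suc w)) = 0") (auto simp: a'_def)
  ultimately show ?case by blast
qed

section \<open>Functions orthogonal to all powers vanish\<close>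

lemma std_normal_integrable_exp: "integrable std_normal (\<lambda>x. exp (a * x))"
proof -
  have "integrable lborel (\<lambda>x. exp (a\<^sup>2 / 2) * normal_density a 1 x)" by simp
  also have "(\<lambda>x. exp (a\<^sup>2 / 2) * normal_density a 1 x) = (\<lambda>x. std_normal_density x * exp (a * x))"
    by (auto simp: normal_density_def exp_add[symmetric] power2_eq_square algebra_simps add_divide_distrib diff_divide_distrib)
  finally show ?thesis by (simp add: std_normal_def integrable_density)
qed

lemma exp_abs_square_integrable: "square_integrable std_normal (\<lambda>x. exp \<bar>t * x\<bar>)"
  unfolding square_integrable_def
proof
  show "integrable std_normal (\<lambda>x. (exp \<bar>t * x\<bar>)\<^sup>2)"
  proof (rule Bochner_Integration.integrable_bound)
    show "integrable std_normal (\<lambda>x. exp ((2 * t) * x) + exp ((- 2 * t) * x))"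
      by (intro Bochner_Integration.integrable_add std_normal_integrable_exp)
    have "(exp \<bar>y\<bar>)\<^sup>2 \<le> exp (2 * y) + exp (- 2 * y)" for y :: real
      by (cases "y \<ge> 0") (auto simp: exp_double[symmetric])
    from this[of "t * x" for x] show "AE x in std_normal. norm ((exp \<bar>t * x\<bar>)\<^sup>2) \<le> norm (exp ((2 * t) * x) + exp ((- 2 * t) * x))"
      by (intro AE_I2) (simp add: mult.assoc)
  qed simp
qed simp

text \<open>The Taylor polynomials of the exponential are dominated by
  \<open>exp \<bar>t * x\<bar>\<close>, which is square integrable for the normal law. Each of them
  integrates to 0 against \<open>u\<close>, and so does the limit.\<close>

lemma orthogonal_to_powers_fourier:
  assumes u: "square_integrable std_normal u" and orth: "\<And>k. (\<integral>x. u x * x ^ k \<partial>std_normal) = 0"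
  shows "(CLINT x|std_normal. complex_of_real (u x) * iexp (t * x)) = 0"
proof -
  have um [measurable]: "u \<in> borel_measurable borel" using u by (simp add: square_integrable_def)
  have pw: "square_integrable std_normal (\<lambda>x. x ^ k)" for k
    unfolding square_integrable_def using std_normal_integrable_power[of "k * 2"] by (simp add: power_mult)
  let ?s = "\<lambda>n x. \<Sum>k<n. (\<i> * of_real (t * x)) ^ k /\<^sub>R fact k"
  have lim: "(\<lambda>n. CLINT x|std_normal. complex_of_real (u x) * ?s n x) \<longlonglongrightarrow> (CLINT x|std_normal. complex_of_real (u x) * iexp (t * x))"
  proof (rule integral_dominated_convergence[where w="\<lambda>x. \<bar>u x * exp \<bar>t * x\<bar>\<bar>"])
    show "integrable std_normal (\<lambda>x. \<bar>u x * exp \<bar>t * x\<bar>\<bar>)"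
      by (rule integrable_abs[OF square_integrable_mult[OF u exp_abs_square_integrable]])
    have "(\<lambda>n. ?s n x) \<longlonglongrightarrow> iexp (t * x)" for x
      using exp_converges[of "\<i> * of_real (t * x)"] by (simp add: sums_def)
    then show "AE x in std_normal. (\<lambda>n. complex_of_real (u x) * ?s n x) \<longlonglongrightarrow> complex_of_real (u x) * iexp (t * x)"
      by (intro AE_I2 tendsto_mult tendsto_const)
    have "norm (?s n x) \<le> exp \<bar>t * x\<bar>" for n x
    proof -
      have "norm (?s n x) \<le> (\<Sum>k<n. norm ((\<i> * of_real (t * x)) ^ k /\<^sub>R fact k))" by (rule norm_sum)
      also have "\<dots> = (\<Sum>k<n. \<bar>t * x\<bar> ^ k /\<^sub>R fact k)" by (simp add: norm_mult norm_power abs_mult)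
      also have "\<dots> \<le> (\<Sum>k. \<bar>t * x\<bar> ^ k /\<^sub>R fact k)"
        by (rule sum_le_suminf[OF summable_exp_generic]) auto
      also have "\<dots> = exp \<bar>t * x\<bar>" by (simp add: exp_def)
      finally show ?thesis .
    qed
    then show "AE x in std_normal. norm (complex_of_real (u x) * ?s n x) \<le> \<bar>u x * exp \<bar>t * x\<bar>\<bar>" for n
      by (intro AE_I2) (simp add: norm_mult abs_mult mult_left_mono)
  qed auto
  have "(CLINT x|std_normal. complex_of_real (u x) * ?s n x) = 0" for n
  proof -
    have "(CLINT x|std_normal. complex_of_real (u x) * ?s n x) =
      (CLINT x|std_normal. (\<Sum>k<n. ((\<i> * of_real t) ^ k / fact k) * complex_of_real (u x * x ^ k)))"
      by (intro Bochner_Integration.integral_cong refl)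
        (simp add: sum_distrib_left scaleR_conv_of_real power_mult_distrib divide_inverse mult_ac)
    also have "\<dots> = (\<Sum>k<n. CLINT x|std_normal. ((\<i> * of_real t) ^ k / fact k) * complex_of_real (u x * x ^ k))"
      by (rule Bochner_Integration.integral_sum) (intro integrable_mult_right integrable_of_real square_integrable_mult u pw)
    also have "\<dots> = (\<Sum>k<n. ((\<i> * of_real t) ^ k / fact k) * complex_of_real (\<integral>x. u x * x ^ k \<partial>std_normal))"
      unfolding integral_mult_right_zero integral_complex_of_real ..
    also have "\<dots> = 0" by (simp add: orth)
    finally show ?thesis .
  qed
  with lim have "(\<lambda>n. 0) \<longlonglongrightarrow> (CLINT x|std_normal. complex_of_real (u x) * iexp (t * x))" by simp
  then show ?thesis using LIMSEQ_unique tendsto_const by blast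
qed

text \<open>The positive and negative parts of \<open>u\<close>, taken as densities, have the same
  Fourier transform. At \<open>t = 0\<close> this says that they have equal mass \<open>m\<close>;
  if \<open>m > 0\<close>, division by \<open>m\<close> turns them into probability measures, which
  Levy uniqueness identifies.\<close>

lemma orthogonal_to_powers_zero:
  assumes u: "square_integrable std_normal u" and orth: "\<And>k. (\<integral>x. u x * x ^ k \<partial>std_normal) = 0"
  shows "AE x in std_normal. u x = 0"
proof -
  have um [measurable]: "u \<in> borel_measurable borel" using u by (simp add: square_integrable_def)
  have ui: "integrable std_normal u" by (rule std_normal.square_integrable_L1[OF u])
  let ?p = "\<lambda>x. max 0 (u x)" and ?n = "\<lambda>x. max 0 (- u x)"
  have int: "integrable std_normal ?p" "integrable std_normal ?n" using ui by auto
  have split: "u x = ?p x - ?n x" for x by auto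
  have eq: "(CLINT x|std_normal. complex_of_real (?p x) * iexp (t * x)) = (CLINT x|std_normal. complex_of_real (?n x) * iexp (t * x))" for t
  proof -
    have i: "integrable std_normal (\<lambda>x. complex_of_real (h x) * iexp (t * x))" if "integrable std_normal h" for h
    proof (rule Bochner_Integration.integrable_bound[OF that])
      have [measurable]: "h \<in> borel_measurable borel" using borel_measurable_integrable[OF that] by simp
      show "(\<lambda>x. complex_of_real (h x) * iexp (t * x)) \<in> borel_measurable std_normal" by simp
    qed (simp add: norm_mult)
    have "(CLINT x|std_normal. complex_of_real (?p x) * iexp (t * x)) - (CLINT x|std_normal. complex_of_real (?n x) * iexp (t * x)) =
      (CLINT x|std_normal. complex_of_real (?p x) * iexp (t * x) - complex_of_real (?n x) * iexp (t * x))"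
      by (rule Bochner_Integration.integral_diff[OF i[OF int(1)] i[OF int(2)], symmetric])
    also have "\<dots> = (CLINT x|std_normal. complex_of_real (u x) * iexp (t * x))"
      unfolding left_diff_distrib[symmetric] of_real_diff[symmetric] split[symmetric] ..
    also have "\<dots> = 0" by (rule orthogonal_to_powers_fourier[OF u orth])
    finally show ?thesis by simp
  qed
  define m where "m = (\<integral>x. ?p x \<partial>std_normal)"
  have mn: "m = (\<integral>x. ?n x \<partial>std_normal)" using eq[of 0] by (simp add: m_def of_real_eq_iff)
  have m0: "m \<ge> 0" unfolding m_def by (intro integral_nonneg_AE) auto
  show ?thesis
  proof (cases "m = 0")
    case True
    then have "AE x in std_normal. ?p x = 0" "AE x in std_normal. ?n x = 0"
      using integral_nonneg_eq_0_iff_AE[OF int(1)] integral_nonneg_eq_0_iff_AE[OF int(2)] mn by (auto simp: m_def)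
    then show ?thesis by eventually_elim auto
  next
    case False
    then have m: "m > 0" using m0 by simp
    have rd: "real_distribution (density std_normal (\<lambda>x. ennreal (h x / m)))"
      and ch: "char (density std_normal (\<lambda>x. ennreal (h x / m))) t = (CLINT x|std_normal. complex_of_real (h x) * iexp (t * x)) / m"
      if h: "integrable std_normal h" "\<And>x. 0 \<le> h x" "(\<integral>x. h x \<partial>std_normal) = m" for h t
    proof -
      have [measurable]: "h \<in> borel_measurable borel" using borel_measurable_integrable[OF h(1)] by simp
      have "emeasure (density std_normal (\<lambda>x. ennreal (h x / m))) UNIV = (\<integral>\<^sup>+x. ennreal (h x / m) \<partial>std_normal)"
        by (subst emeasure_density) auto
      also have "\<dots> = ennreal (\<integral>x. h x / m \<partial>std_normal)"
        using h m by (intro nn_integral_eq_integral) auto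
      also have "\<dots> = 1" using h(3) m by simp
      finally show "real_distribution (density std_normal (\<lambda>x. ennreal (h x / m)))"
        by (auto simp: real_distribution_def real_distribution_axioms_def intro!: prob_spaceI)
      have "char (density std_normal (\<lambda>x. ennreal (h x / m))) t = (CLINT x|std_normal. (h x / m) *\<^sub>R iexp (t * x))"
        unfolding char_def using h(2) m by (intro integral_density) auto
      also have "\<dots> = (CLINT x|std_normal. (complex_of_real (h x) * iexp (t * x)) / m)"
        by (simp add: scaleR_conv_of_real)
      also have "\<dots> = (CLINT x|std_normal. complex_of_real (h x) * iexp (t * x)) / m" by simp
      finally show "char (density std_normal (\<lambda>x. ennreal (h x / m))) t = (CLINT x|std_normal. complex_of_real (h x) * iexp (t * x)) / m" .
    qed
    have "density std_normal (\<lambda>x. ennreal (?p x / m)) = density std_normal (\<lambda>x. ennreal (?n x / m))"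
    proof (rule Levy_uniqueness)
      show "real_distribution (density std_normal (\<lambda>x. ennreal (?p x / m)))" by (rule rd[OF int(1)]) (auto simp: m_def)
      show "real_distribution (density std_normal (\<lambda>x. ennreal (?n x / m)))" by (rule rd[OF int(2)]) (auto simp: mn)
      have "char (density std_normal (\<lambda>x. ennreal (?p x / m))) t = char (density std_normal (\<lambda>x. ennreal (?n x / m))) t" for t
        using ch[OF int(1), of t] ch[OF int(2), of t] eq[of t] by (simp add: m_def[symmetric] mn[symmetric])
      then show "char (density std_normal (\<lambda>x. ennreal (?p x / m))) = char (density std_normal (\<lambda>x. ennreal (?n x / m)))" ..
    qed
    then have "AE x in std_normal. ennreal (?p x / m) = ennreal (?n x / m)"
      by (subst (asm) std_normal.density_unique_iff) auto
    then show ?thesis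
    proof eventually_elim
      fix x assume "ennreal (?p x / m) = ennreal (?n x / m)"
      then have "?p x / m = ?n x / m" using m by (subst (asm) ennreal_inj) auto
      then have "?p x = ?n x" using m by simp
      then show "u x = 0" by (auto simp: max_def split: if_splits)
    qed
  qed
qed

section \<open>Existence and uniqueness of Hermite expansions\<close>

lemma hermite_sum_inner:
  assumes "square_integrable std_normal f"
  shows "(\<integral>x. hermite_sum b j x * f x \<partial>std_normal) = (\<Sum>q\<le>j. b q * (\<integral>x. f x * hermite q x \<partial>std_normal))"
proof -
  have "(\<integral>x. hermite_sum b j x * f x \<partial>std_normal) = (\<integral>x. (\<Sum>q\<le>j. b q * (f x * hermite q x)) \<partial>std_normal)"
    by (simp add: hermite_sum_def sum_distrib_left mult_ac)
  also have "\<dots> = (\<Sum>q\<le>j. b q * (\<integral>x. f x * hermite q x \<partial>std_normal))"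
    using square_integrable_mult[OF assms hermite_square_integrable] by (subst Bochner_Integration.integral_sum) auto
  finally show ?thesis .
qed

lemma hermite_sum_coefficient:
  "(\<integral>x. hermite_sum b j x * hermite q x \<partial>std_normal) = (if q \<le> j then b q * fact q else 0)"
  unfolding hermite_sum_inner[OF hermite_square_integrable] hermite_orthogonal by (simp add: if_distrib cong: if_cong)

lemma hermite_sum_norm: "(l2norm std_normal (hermite_sum b j))\<^sup>2 = (\<Sum>q\<le>j. (b q)\<^sup>2 * fact q)"
proof -
  have "(l2norm std_normal (hermite_sum b j))\<^sup>2 = (\<integral>x. hermite_sum b j x * hermite_sum b j x \<partial>std_normal)"
    unfolding l2norm_power2 by (simp add: power2_eq_square)
  also have "\<dots> = (\<Sum>q\<le>j. (b q)\<^sup>2 * fact q)"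
    unfolding hermite_sum_inner[OF hermite_sum_square_integrable] hermite_sum_coefficient
    by (intro sum.cong) (simp_all add: power2_eq_square)
  finally show ?thesis .
qed

definition hermite_coeff :: "(real \<Rightarrow> real) \<Rightarrow> nat \<Rightarrow> real" where
  "hermite_coeff f q = (\<integral>x. f x * hermite q x \<partial>std_normal) / fact q"

lemma hermite_expansion_unique:
  assumes f: "square_integrable std_normal f" and c: "hermite_expansion f c"
  shows "c = hermite_coeff f"
proof
  fix q
  have "(\<lambda>j. \<integral>x. hermite_sum c j x * hermite q x \<partial>std_normal) \<longlonglongrightarrow> (\<integral>x. f x * hermite q x \<partial>std_normal)"
    using c hermite_expansion_l2norm[OF f]
    by (intro l2_inner_tendsto hermite_sum_square_integrable f hermite_square_integrable) auto
  moreover have "(\<lambda>j. \<integral>x. hermite_sum c j x * hermite q x \<partial>std_normal) \<longlonglongrightarrow> c q * fact q"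
    unfolding hermite_sum_coefficient
    by (rule tendsto_eventually) (use eventually_ge_at_top[of q] in \<open>eventually_elim, simp\<close>)
  ultimately have "(\<integral>x. f x * hermite q x \<partial>std_normal) = c q * fact q" by (rule LIMSEQ_unique)
  then show "c q = hermite_coeff f q" by (simp add: hermite_coeff_def)
qed

text \<open>Bessel's inequality makes the partial sums Cauchy, and completeness gives a limit
  \<open>g\<close> with the same coefficients as \<open>f\<close>. The difference is orthogonal to
  all Hermite polynomials, hence to all powers, and vanishes almost everywhere.\<close>

lemma hermite_expansion_exists:
  assumes f: "square_integrable std_normal f"
  shows "hermite_expansion f (hermite_coeff f)"
proof -
  let ?c = "hermite_coeff f"
  let ?S = "hermite_sum ?c"
  define A where "A j = (\<Sum>q\<le>j. (?c q)\<^sup>2 * fact q)" for j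
  have Af: "(\<integral>x. ?S j x * f x \<partial>std_normal) = A j" for j
    unfolding hermite_sum_inner[OF f] A_def
    by (intro sum.cong refl) (simp add: hermite_coeff_def power2_eq_square)
  have "A j \<le> (l2norm std_normal f)\<^sup>2" for j
  proof -
    have "(l2norm std_normal (\<lambda>x. f x - 1 * ?S j x))\<^sup>2 = (l2norm std_normal f)\<^sup>2 - 2 * 1 * (\<integral>x. ?S j x * f x \<partial>std_normal) + 1\<^sup>2 * (l2norm std_normal (?S j))\<^sup>2"
    proof -
      have "(l2norm std_normal (\<lambda>x. f x - 1 * ?S j x))\<^sup>2 = (\<integral>x. (f x)\<^sup>2 - 2 * 1 * (?S j x * f x) + 1\<^sup>2 * (?S j x)\<^sup>2 \<partial>std_normal)"
        unfolding l2norm_power2 by (simp add: power2_diff algebra_simps)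
      then show ?thesis
        using square_integrable_mult[OF hermite_sum_square_integrable f] f hermite_sum_square_integrable
        by (simp add: l2norm_power2 square_integrable_def)
    qed
    then have "(l2norm std_normal (\<lambda>x. f x - 1 * ?S j x))\<^sup>2 = (l2norm std_normal f)\<^sup>2 - A j"
      unfolding Af hermite_sum_norm A_def[symmetric] by simp
    then show ?thesis using zero_le_power2[of "l2norm std_normal (\<lambda>x. f x - 1 * ?S j x)"] by linarith
  qed
  moreover have "incseq A" unfolding A_def by (intro incseq_SucI) simp
  ultimately have "convergent A"
    by (intro Bseq_monoseq_convergent incseq_imp_monoseq BseqI'[of _ "(l2norm std_normal f)\<^sup>2"])
       (auto simp: A_def abs_of_nonneg sum_nonneg)
  then have CA: "Cauchy A" by (rule convergent_Cauchy)
  have diff: "(l2norm std_normal (\<lambda>x. ?S m x - ?S n x))\<^sup>2 = A m - A n" if "n \<le> m" for m n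
  proof -
    let ?b = "\<lambda>q. if n < q then ?c q else 0"
    have sp: "{..m} = {..n} \<union> {n<..m}" "{..n} \<inter> {n<..m} = {}" using that by auto
    have "?S m x - ?S n x = hermite_sum ?b m x" for x
      unfolding hermite_sum_def sp(1) by (subst (1 2) sum.union_disjoint) (use sp(2) in auto)
    then have "(l2norm std_normal (\<lambda>x. ?S m x - ?S n x))\<^sup>2 = (l2norm std_normal (hermite_sum ?b m))\<^sup>2" by simp
    also have "\<dots> = A m - A n"
      unfolding hermite_sum_norm A_def sp(1) by (subst (1 2) sum.union_disjoint) (use sp(2) in auto)
    finally show ?thesis .
  qed
  have "\<exists>g. square_integrable std_normal g \<and> (\<lambda>k. l2norm std_normal (\<lambda>x. ?S k x - g x)) \<longlonglongrightarrow> 0"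
  proof (rule std_normal.l2_complete[OF hermite_sum_square_integrable])
    fix e :: real assume e: "e > 0"
    then obtain K where K: "\<And>m n. m \<ge> K \<Longrightarrow> n \<ge> K \<Longrightarrow> \<bar>A m - A n\<bar> < e\<^sup>2"
      using CauchyD[OF CA, of "e\<^sup>2"] by auto
    have "l2norm std_normal (\<lambda>x. ?S m x - ?S n x) \<le> e" if mn: "m \<ge> K" "n \<ge> K" for m n
    proof (rule power2_le_imp_le)
      show "(l2norm std_normal (\<lambda>x. ?S m x - ?S n x))\<^sup>2 \<le> e\<^sup>2"
      proof (cases "n \<le> m")
        case True
        then show ?thesis using diff[OF True] K[OF mn] by simp
      next
        case False
        then have "m \<le> n" by simp
        then show ?thesis unfolding l2norm_minus_commute[of _ "?S m"] using diff[of m n] K[OF mn] by simp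
      qed
    qed (use e in simp)
    then show "\<exists>K. \<forall>m\<ge>K. \<forall>n\<ge>K. l2norm std_normal (\<lambda>x. ?S m x - ?S n x) \<le> e" by blast
  qed
  then obtain g where g: "square_integrable std_normal g" "(\<lambda>k. l2norm std_normal (\<lambda>x. ?S k x - g x)) \<longlonglongrightarrow> 0" by blast
  have "hermite_expansion g ?c" using g(2) hermite_expansion_l2norm[OF g(1)] by simp
  from hermite_expansion_unique[OF g(1) this] have cg: "hermite_coeff f q = hermite_coeff g q" for q by simp
  define u where "u x = f x - g x" for x
  have u: "square_integrable std_normal u" unfolding u_def[abs_def] by (rule square_integrable_diff[OF f g(1)])
  have uq: "(\<integral>x. u x * hermite q x \<partial>std_normal) = 0" for q
  proof -
    have "(\<integral>x. u x * hermite q x \<partial>std_normal) = (\<integral>x. f x * hermite q x \<partial>std_normal) - (\<integral>x. g x * hermite q x \<partial>std_normal)"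
      unfolding u_def left_diff_distrib
      by (rule Bochner_Integration.integral_diff) (intro square_integrable_mult f g(1) hermite_square_integrable)+
    also have "\<dots> = 0" using cg[of q] by (simp add: hermite_coeff_def)
    finally show ?thesis .
  qed
  have "(\<integral>x. u x * x ^ k \<partial>std_normal) = 0" for k
  proof -
    obtain a where a: "\<And>x. x ^ k = (\<Sum>q\<le>k. a q * hermite q x)" using power_hermite[of k] by blast
    have "(\<integral>x. u x * x ^ k \<partial>std_normal) = (\<integral>x. hermite_sum a k x * u x \<partial>std_normal)"
      unfolding a hermite_sum_def by (simp only: mult.commute)
    also have "\<dots> = 0" unfolding hermite_sum_inner[OF u] by (simp add: uq)
    finally show ?thesis .
  qed
  from orthogonal_to_powers_zero[OF u this] have ae: "AE x in std_normal. f x = g x" by eventually_elim (simp add: u_def)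
  have "l2norm std_normal (\<lambda>x. ?S k x - f x) = l2norm std_normal (\<lambda>x. ?S k x - g x)" for k
  proof -
    have [measurable]: "?S k \<in> borel_measurable borel" "f \<in> borel_measurable borel" "g \<in> borel_measurable borel"
      using hermite_sum_square_integrable[of ?c k] f g(1) by (auto simp: square_integrable_def)
    show ?thesis unfolding l2norm_def
      by (intro arg_cong[where f=sqrt] integral_cong_AE) (use ae in \<open>auto elim!: eventually_mono\<close>)
  qed
  then show ?thesis using g(2) hermite_expansion_l2norm[OF f] by simp
qed

section \<open>Coefficients of Hermite polynomials\<close>

lemma hermite_zero:
  "fact u * 2 ^ u * hermite (2 * u) 0 = (- 1) ^ u * fact (2 * u)" "hermite (Suc (2 * u)) 0 = 0"
proof (induction u)
  case (Suc u)
  have f: "fact (2 * Suc u) = (2 * real u + 2) * (2 * real u + 1) * fact (2 * u)" by (simp add: algebra_simps)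
  have h: "hermite (2 * Suc u) 0 = - (2 * real u + 1) * hermite (2 * u) 0" by (simp add: algebra_simps)
  have "fact (Suc u) * 2 ^ Suc u * hermite (2 * Suc u) 0 = - ((2 * real u + 2) * (2 * real u + 1)) * (fact u * 2 ^ u * hermite (2 * u) 0)"
    unfolding h fact_Suc power_Suc by (simp add: algebra_simps)
  also have "\<dots> = - ((2 * real u + 2) * (2 * real u + 1)) * ((- 1) ^ u * fact (2 * u))" unfolding Suc.IH(1) ..
  also have "\<dots> = (- 1) ^ Suc u * fact (2 * Suc u)" unfolding f power_Suc by (simp only: mult_ac mult_minus_left mult_minus_right mult_1_left)
  finally show "fact (Suc u) * 2 ^ Suc u * hermite (2 * Suc u) 0 = (- 1) ^ Suc u * fact (2 * Suc u)" .
  show "hermite (Suc (2 * Suc u)) 0 = 0" using Suc.IH(2) by simp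
qed simp_all

text \<open>Taylor's formula at 0: by the Appell property one derivative lowers both the order and
  the degree of the coefficient, down to the value at 0. Factorials are multiplied out to avoid
  division in the induction.\<close>

lemma coeff_hermite_poly: "fact v * fact k * coeff (hermite_poly (v + k)) v = fact (v + k) * hermite k 0"
proof (induction v)
  case 0
  show ?case by (simp add: poly_0_coeff_0[symmetric])
next
  case (Suc v)
  have "real (Suc v) * coeff (hermite_poly (Suc (v + k))) (Suc v) = coeff (pderiv (hermite_poly (Suc (v + k)))) v"
    by (simp add: coeff_pderiv)
  also have "\<dots> = real (Suc (v + k)) * coeff (hermite_poly (v + k)) v" by (simp add: pderiv_hermite_poly)
  finally have e: "real (Suc v) * coeff (hermite_poly (Suc (v + k))) (Suc v) = real (Suc (v + k)) * coeff (hermite_poly (v + k)) v" .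
  have "fact (Suc v) * fact k * coeff (hermite_poly (Suc v + k)) (Suc v) = fact v * fact k * (real (Suc v) * coeff (hermite_poly (Suc (v + k))) (Suc v))"
    unfolding fact_Suc add_Suc by (simp only: mult_ac of_nat_mult)
  also have "\<dots> = real (Suc (v + k)) * (fact v * fact k * coeff (hermite_poly (v + k)) v)"
    unfolding e by (simp only: mult_ac)
  also have "\<dots> = fact (Suc v + k) * hermite k 0" unfolding Suc.IH add_Suc fact_Suc by (simp only: mult_ac of_nat_mult)
  finally show ?case .
qed

lemma coeff_hermite_poly_even:
  "coeff (hermite_poly (v + 2 * u)) v = (- 1) ^ u * fact (v + 2 * u) / (fact u * fact v * 2 ^ u)"
proof -
  have "hermite (2 * u) 0 = (- 1) ^ u * fact (2 * u) / (fact u * 2 ^ u)"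
    using hermite_zero(1)[of u] by (simp add: nonzero_eq_divide_eq mult_ac)
  then have "fact v * fact (2 * u) * coeff (hermite_poly (v + 2 * u)) v = fact (v + 2 * u) * ((- 1) ^ u * fact (2 * u) / (fact u * 2 ^ u))"
    using coeff_hermite_poly[of v "2 * u"] by simp
  moreover have "c = s * d / (a * e * g)" if "e * f * c = d * (s * f / (a * g))" "a \<noteq> 0" "e \<noteq> 0" "f \<noteq> 0" "g \<noteq> 0" for a c d e f g s :: real
    using that by (simp add: field_simps)
  ultimately show ?thesis by simp
qed

lemma coeff_hermite_poly_odd: "coeff (hermite_poly (v + Suc (2 * u))) v = 0"
  using coeff_hermite_poly[of v "Suc (2 * u)"] hermite_zero(2)[of u] by simp

section \<open>Monomial coefficients and the meaning of \<open>m_star\<close>\<close>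

definition hermite_combination :: "(nat \<Rightarrow> real) \<Rightarrow> nat \<Rightarrow> nat \<Rightarrow> real poly" where
  "hermite_combination c m p = (\<Sum>q=m..p. smult (c q) (hermite_poly q))"

lemma poly_hermite_combination: "poly (hermite_combination c m p) x = (\<Sum>q=m..p. c q * hermite q x)"
  by (simp add: hermite_combination_def poly_sum)

lemma coeff_hermite_combination: "coeff (hermite_combination c m p) w = (\<Sum>q=m..p. c q * coeff (hermite_poly q) w)"
  by (simp add: hermite_combination_def coeff_sum)

lemma coeff_hermite_combination_above: "p < w \<Longrightarrow> coeff (hermite_combination c m p) w = 0"
  unfolding coeff_hermite_combination by (intro sum.neutral ballI) (simp add: coeff_eq_0 degree_hermite_poly)

lemma lead_coeff_hermite_combination:
  assumes "m \<le> p"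
  shows "coeff (hermite_combination c m p) p = c p"
proof -
  have "(\<Sum>q=m..p. c q * coeff (hermite_poly q) p) = (\<Sum>q\<in>{p}. c q * coeff (hermite_poly q) p)"
    using assms by (intro sum.mono_neutral_right) (auto simp: coeff_eq_0 degree_hermite_poly)
  then show ?thesis by (simp add: coeff_hermite_combination lead_coeff_hermite_poly)
qed

text \<open>Only orders \<open>w + 2 * u\<close> contain the power \<open>w\<close>, since Hermite
  polynomials have a parity. This brings the coefficient into the shape of the inner sum of
  \<open>coeff_D\<close>.\<close>

lemma coeff_hermite_combination_even:
  "coeff (hermite_combination c m p) w =
    (\<Sum>u=0..p div 2. if m \<le> w + 2 * u \<and> w + 2 * u \<le> p then c (w + 2 * u) * coeff (hermite_poly (w + 2 * u)) w else 0)"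
proof -
  let ?g = "\<lambda>q. c q * coeff (hermite_poly q) w"
  let ?U = "{u \<in> {0..p div 2}. m \<le> w + 2 * u \<and> w + 2 * u \<le> p}"
  have "(\<Sum>u=0..p div 2. if m \<le> w + 2 * u \<and> w + 2 * u \<le> p then ?g (w + 2 * u) else 0) = (\<Sum>u\<in>?U. ?g (w + 2 * u))"
    by (rule sum.inter_filter[symmetric]) simp
  also have "\<dots> = sum ?g ((\<lambda>u. w + 2 * u) ` ?U)"
    by (subst sum.reindex) (auto simp: inj_on_def comp_def)
  also have "\<dots> = (\<Sum>q=m..p. ?g q)"
  proof (rule sum.mono_neutral_left)
    show "\<forall>q\<in>{m..p} - (\<lambda>u. w + 2 * u) ` ?U. ?g q = 0"
    proof
      fix q assume q: "q \<in> {m..p} - (\<lambda>u. w + 2 * u) ` ?U"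
      show "?g q = 0"
      proof (cases "q < w")
        case True
        then show ?thesis by (simp add: coeff_eq_0 degree_hermite_poly)
      next
        case False
        then have e: "q = w + (q - w)" by simp
        show ?thesis
        proof (cases "even (q - w)")
          case True
          then obtain u where u: "q - w = 2 * u" by (rule evenE)
          have "u \<in> ?U" using u e q by auto
          then have "q \<in> (\<lambda>u. w + 2 * u) ` ?U" using u e by (intro image_eqI[of _ _ u]) auto
          with q show ?thesis by simp
        next
          case False
          then obtain u where "q - w = 2 * u + 1" by (rule oddE)
          then have "q = w + Suc (2 * u)" using e by simp
          then show ?thesis using coeff_hermite_poly_odd[of w u] by simp
        qed
      qed
    qed
  qed auto
  finally show ?thesis by (simp add: coeff_hermite_combination)
qed

text \<open>With \<open>w = 2 * s + r\<close>, the summand of \<open>coeff_D\<close> splits into the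
  coefficient of x^w in the Hermite polynomial of order \<open>w + 2 * u\<close> and
  \<open>fact w / (fact s * fact r * 2 ^ s)\<close>, which is the coefficient of order
  \<open>r\<close> in the Hermite expansion of x^w. So \<open>coeff_D\<close> is the contribution of
  the monomial x^w to order \<open>r\<close>.\<close>

lemma coeff_D_eq:
  "coeff_D c m p w r = coeff (hermite_combination c m p) w * (\<Sum>s=0..p div 2. if w = 2 * s + r then fact w / (fact s * fact r * 2 ^ s) else 0)"
  unfolding coeff_D_def sum_distrib_left
proof (rule sum.cong[OF refl])
  fix s assume "s \<in> {0..p div 2}"
  have "c (w + 2 * u) * coeff_C (w + 2 * u) (s + u) * real ((s + u) choose s) * (- 1) ^ u =
      c (w + 2 * u) * coeff (hermite_poly (w + 2 * u)) w * (fact w / (fact s * fact r * 2 ^ s))" if w: "w = 2 * s + r" for u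
  proof -
    have C: "coeff_C (w + 2 * u) (s + u) = fact (w + 2 * u) / (fact (s + u) * fact r * 2 ^ (s + u))"
      using w by (simp add: coeff_C_def)
    have b: "real ((s + u) choose s) = fact (s + u) / (fact s * fact u)"
      using binomial_fact[of s "s + u"] by simp
    show ?thesis unfolding C b coeff_hermite_poly_even power_add by (simp add: mult_ac)
  qed
  then show "(if w = 2 * s + r then \<Sum>u=0..p div 2. if m \<le> w + 2 * u \<and> w + 2 * u \<le> p
          then c (w + 2 * u) * coeff_C (w + 2 * u) (s + u) * real ((s + u) choose s) * (- 1) ^ u else 0 else 0) =
      coeff (hermite_combination c m p) w * (if w = 2 * s + r then fact w / (fact s * fact r * 2 ^ s) else 0)"
    unfolding coeff_hermite_combination_even sum_distrib_right by (auto intro!: sum.cong)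
qed

text \<open>Summing over \<open>r\<close> leaves the coefficient of x^w times a sum of nonnegative
  numbers, one of which, at \<open>r = w\<close> and \<open>s = 0\<close>, is 1; nothing can cancel.
  For \<open>w > p\<close> both sides vanish.\<close>

lemma sum_coeff_D_nonzero:
  assumes "1 \<le> w"
  shows "(\<Sum>r=1..p. coeff_D c m p w r) \<noteq> 0 \<longleftrightarrow> coeff (hermite_combination c m p) w \<noteq> 0"
proof (cases "w \<le> p")
  case False
  then show ?thesis by (simp add: coeff_D_eq coeff_hermite_combination_above)
next
  case True
  let ?k = "\<lambda>r s. if w = 2 * s + r then fact w / (fact s * fact r * 2 ^ s) else (0 :: real)"
  have nn: "0 \<le> ?k r s" for r s by simp
  have "1 = ?k w 0" by simp
  also have "?k w 0 \<le> (\<Sum>s=0..p div 2. ?k w s)" by (rule member_le_sum[OF _ nn]) auto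
  also have "\<dots> \<le> (\<Sum>r=1..p. \<Sum>s=0..p div 2. ?k r s)"
    using assms True by (intro member_le_sum[where f="\<lambda>r. \<Sum>s=0..p div 2. ?k r s"] sum_nonneg nn) auto
  finally have "(\<Sum>r=1..p. \<Sum>s=0..p div 2. ?k r s) \<noteq> 0" by linarith
  then show ?thesis unfolding coeff_D_eq sum_distrib_left[symmetric] by simp
qed

lemma m_star_eq: "m_star c m p = (LEAST w. 1 \<le> w \<and> coeff (hermite_combination c m p) w \<noteq> 0)"
  unfolding m_star_def using sum_coeff_D_nonzero by (intro arg_cong[where f=Least]) blast

section \<open>The limiting variance\<close>

lemma square_integrable_power: "square_integrable std_normal (\<lambda>x. x ^ k)"
  unfolding square_integrable_def using std_normal_integrable_power[of "k * 2"] by (simp add: power_mult)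

lemma l2norm_sum:
  assumes "finite A" "\<And>i. i \<in> A \<Longrightarrow> square_integrable M (f i)"
  shows "l2norm M (\<lambda>x. \<Sum>i\<in>A. f i x) \<le> (\<Sum>i\<in>A. l2norm M (f i))"
  using assms
proof (induction A)
  case empty
  then show ?case by (simp add: l2norm_def)
next
  case (insert i A)
  have "l2norm M (\<lambda>x. f i x + (\<Sum>i\<in>A. f i x)) \<le> l2norm M (f i) + l2norm M (\<lambda>x. \<Sum>i\<in>A. f i x)"
    using insert.prems by (intro l2norm_triangle square_integrable_sum) auto
  with insert show ?case by auto
qed

text \<open>The variance of the time integral over the unit interval of a partial Hermite sum of the
  process, written without any probability space. \<open>ou_sd\<close> and the constants of the
  theorem can thus be fixed before the spaces.\<close>

definition ou_variance :: "real \<Rightarrow> (nat \<Rightarrow> real) \<Rightarrow> nat \<Rightarrow> real" where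
  "ou_variance \<gamma> b j = (\<integral>s. (\<integral>u. (\<Sum>q\<le>j. (b q)\<^sup>2 * (fact q * exp (- \<gamma> * \<bar>s - u\<bar>) ^ q)) \<partial>unit_time) \<partial>unit_time)"

definition ou_sd :: "real \<Rightarrow> (nat \<Rightarrow> real) \<Rightarrow> real" where
  "ou_sd \<gamma> b = sqrt (lim (ou_variance \<gamma> b))"

text \<open>Within the unit interval \<open>\<bar>s - u\<bar> \<le> 1\<close>, so the covariance of
  order \<open>q\<close> is at least \<open>exp (- \<gamma>) ^ q\<close>, and all other terms are
  nonnegative. One nonzero coefficient therefore keeps the limiting variance away from 0.\<close>

lemma ou_variance_ge:
  assumes \<gamma>: "\<gamma> > 0" and q: "q \<le> j"
  shows "(b q)\<^sup>2 * (fact q * exp (- \<gamma>) ^ q) \<le> ou_variance \<gamma> b j"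
proof -
  define K where "K s u = (\<Sum>q\<le>j. (b q)\<^sup>2 * (fact q * exp (- \<gamma> * \<bar>s - u\<bar>) ^ q))" for s u
  define c where "c = (b q)\<^sup>2 * (fact q * exp (- \<gamma>) ^ q)"
  define C where "C = (\<Sum>q\<le>j. (b q)\<^sup>2 * (fact q * 1 ^ q))"
  have c0: "0 \<le> c" by (simp add: c_def)
  have "(\<lambda>p::real \<times> real. K (fst p) (snd p)) \<in> borel_measurable (borel \<Otimes>\<^sub>M borel)"
    unfolding K_def by measurable
  moreover have "(\<lambda>p. (fst p, snd p)) \<in> measurable (unit_time \<Otimes>\<^sub>M unit_time) (borel \<Otimes>\<^sub>M borel)"
    by (intro measurable_Pair measurable_compose[OF measurable_fst measurable_unit_time_id] measurable_compose[OF measurable_snd measurable_unit_time_id])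
  ultimately have m: "(\<lambda>p. K (fst p) (snd p)) \<in> borel_measurable (unit_time \<Otimes>\<^sub>M unit_time)"
    using measurable_compose by fastforce
  have le: "K s u \<le> C" for s u
    unfolding K_def C_def using \<gamma> by (intro sum_mono mult_left_mono power_mono) auto
  have ge: "c \<le> K s u" if "s \<in> space unit_time" "u \<in> space unit_time" for s u
  proof -
    have "\<bar>s - u\<bar> \<le> 1" using that by auto
    then have "\<gamma> * \<bar>s - u\<bar> \<le> \<gamma> * 1" using \<gamma> by (intro mult_left_mono) auto
    then have "c \<le> (b q)\<^sup>2 * (fact q * exp (- \<gamma> * \<bar>s - u\<bar>) ^ q)"
      unfolding c_def by (intro mult_left_mono power_mono) auto
    also have "\<dots> \<le> K s u" unfolding K_def using q by (intro member_le_sum) auto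
    finally show ?thesis .
  qed
  have inner: "c \<le> (\<integral>u. K s u \<partial>unit_time) \<and> (\<integral>u. K s u \<partial>unit_time) \<le> C" if s: "s \<in> space unit_time" for s
  proof -
    have "(\<lambda>u. K s u) \<in> borel_measurable unit_time" using measurable_Pair2[OF m s] by simp
    moreover have "\<bar>K s u\<bar> \<le> C" if "u \<in> space unit_time" for u using ge[OF s that] le[of s u] c0 by linarith
    ultimately have i: "integrable unit_time (\<lambda>u. K s u)"
      by (intro unit_time.integrable_const_bound[where B=C] AE_I2) auto
    have "AE u in unit_time. c \<le> K s u" "AE u in unit_time. K s u \<le> C"
      by (rule AE_I2, rule ge[OF s], assumption) (rule AE_I2, rule le)
    then show ?thesis using unit_time.integral_ge_const[OF i] unit_time.integral_le_const[OF i] by blast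
  qed
  have m2: "(\<lambda>s. \<integral>u. K s u \<partial>unit_time) \<in> borel_measurable unit_time"
    using m by (intro unit_time.borel_measurable_lebesgue_integral) (simp add: case_prod_unfold)
  have "integrable unit_time (\<lambda>s. \<integral>u. K s u \<partial>unit_time)"
  proof (rule unit_time.integrable_const_bound[where B=C, OF AE_I2 m2])
    fix s assume "s \<in> space unit_time"
    from inner[OF this] c0 show "norm (\<integral>u. K s u \<partial>unit_time) \<le> C" by (simp add: abs_le_iff)
  qed
  moreover have "AE s in unit_time. c \<le> (\<integral>u. K s u \<partial>unit_time)"
    by (rule AE_I2) (use inner in blast)
  ultimately have "c \<le> (\<integral>s. (\<integral>u. K s u \<partial>unit_time) \<partial>unit_time)" by (rule unit_time.integral_ge_const)
  then show ?thesis by (simp add: ou_variance_def K_def c_def)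
qed

lemma tempered_const_pos:
  assumes "\<gamma> > 0" "q \<ge> 1"
  shows "tempered_const \<gamma> q > 0"
proof -
  define y where "y = \<gamma> * real q"
  have y: "y > 0" using assms by (simp add: y_def)
  \<comment> \<open>Strictness comes from squaring \<open>1 - y / 2 \<le> exp (- y / 2)\<close>,
    which gains \<open>y\<^sup>2 / 4\<close>; squaring is allowed while \<open>1 - y / 2\<close> is
    nonnegative, and for larger \<open>y\<close> the claim is trivial.\<close>
  have "exp (- y) - 1 + y > 0"
  proof (cases "y < 2")
    case True
    have "exp (- y) = (exp (- y / 2))\<^sup>2" using exp_double[of "- y / 2"] by simp
    moreover have "(1 - y / 2)\<^sup>2 \<le> (exp (- y / 2))\<^sup>2"
      using True exp_ge_add_one_self[of "- y / 2"] by (intro power_mono) auto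
    moreover have "(1 - y / 2)\<^sup>2 = 1 - y + y\<^sup>2 / 4" by (simp add: power2_eq_square field_simps)
    moreover have "y\<^sup>2 > 0" using y by simp
    ultimately show ?thesis by linarith
  next
    case False
    then show ?thesis using exp_gt_zero[of "- y"] by linarith
  qed
  then have "0 < fact q * (exp (- \<gamma> * real q) - 1 + \<gamma> * real q)" by (simp add: y_def)
  moreover have "0 < 2 ^ (q - 1) * (real q)\<^sup>2 * \<gamma> ^ (q + 2)" using assms by simp
  ultimately show ?thesis unfolding tempered_const_def by simp
qed

text \<open>
  The last two factors undo the normalization of the tempered Hermite process, which leaves the time
  integral of the Hermite polynomial of the Ornstein-Uhlenbeck process.
\<close>

definition limit_coeff :: "real \<Rightarrow> (nat \<Rightarrow> real) \<Rightarrow> nat \<Rightarrow> real" where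
  "limit_coeff \<gamma> b q = b q / (ou_sd \<gamma> b * (tempered_const \<gamma> q * ou_weight \<gamma> q))"

section \<open>The limit in terms of tempered Hermite processes\<close>

context ou_process
begin

lemma OU_hermite_sum_inner:
  assumes su: "0 \<le> s" "s \<le> 1" "0 \<le> u" "u \<le> 1"
  shows "(\<integral>\<omega>. hermite_sum b j (OU s \<omega>) * hermite_sum b j (OU u \<omega>) \<partial>N) = (\<Sum>q\<le>j. (b q)\<^sup>2 * (fact q * exp (- \<gamma> * \<bar>s - u\<bar>) ^ q))"
proof -
  let ?h = "\<lambda>p q \<omega>. b p * b q * (hermite p (OU s \<omega>) * hermite q (OU u \<omega>))"
  have i: "integrable N (?h p q)" for p q
    by (intro integrable_mult_right square_integrable_mult OU_function_square_integrable(1) hermite_square_integrable su)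
  have "(\<integral>\<omega>. hermite_sum b j (OU s \<omega>) * hermite_sum b j (OU u \<omega>) \<partial>N) = (\<integral>\<omega>. (\<Sum>p\<le>j. \<Sum>q\<le>j. ?h p q \<omega>) \<partial>N)"
    unfolding hermite_sum_def sum_product by (intro Bochner_Integration.integral_cong sum.cong refl) (simp only: mult_ac)
  also have "\<dots> = (\<Sum>p\<le>j. (\<integral>\<omega>. (\<Sum>q\<le>j. ?h p q \<omega>) \<partial>N))"
    by (rule Bochner_Integration.integral_sum) (intro Bochner_Integration.integrable_sum i)
  also have "\<dots> = (\<Sum>p\<le>j. \<Sum>q\<le>j. (\<integral>\<omega>. ?h p q \<omega> \<partial>N))"
    by (intro sum.cong refl Bochner_Integration.integral_sum i)
  also have "\<dots> = (\<Sum>p\<le>j. \<Sum>q\<le>j. if p = q then (b p)\<^sup>2 * (fact p * exp (- \<gamma> * \<bar>s - u\<bar>) ^ p) else 0)"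
    by (intro sum.cong refl) (simp add: OU_hermite_inner[OF su] power2_eq_square)
  also have "\<dots> = (\<Sum>q\<le>j. (b q)\<^sup>2 * (fact q * exp (- \<gamma> * \<bar>s - u\<bar>) ^ q))"
    by (intro sum.cong refl) (simp add: sum.delta)
  finally show ?thesis .
qed

lemma ou_average_hermite_sum_norm: "(l2norm N (ou_average (hermite_sum b j) 1))\<^sup>2 = ou_variance \<gamma> b j"
proof -
  let ?g = "\<lambda>p. indicator {0..1} (fst p) * hermite_sum b j (OU (fst p) (snd p))"
  have sq: "square_integrable N (\<lambda>\<omega>. ?g (s, \<omega>))" if "s \<in> space unit_time" for s
    using OU_function_square_integrable(1)[OF hermite_sum_square_integrable, of s b j] that
    by (auto intro!: square_integrable_cmult)
  have "(l2norm N (ou_average (hermite_sum b j) 1))\<^sup>2 = (\<integral>s. (\<integral>u. (\<integral>\<omega>. ?g (s, \<omega>) * ?g (u, \<omega>) \<partial>N) \<partial>unit_time) \<partial>unit_time)"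
    unfolding ou_average_def[abs_def]
    using average_l2norm[OF unit_time_prob_space sigma_finite_measure_axioms
        OU_process_square_integrable(1)[OF hermite_sum_square_integrable[of b j], of 1] sq] by simp
  also have "\<dots> = ou_variance \<gamma> b j"
    unfolding ou_variance_def
  proof (intro Bochner_Integration.integral_cong refl)
    fix s u assume "s \<in> space unit_time" "u \<in> space unit_time"
    then show "(\<integral>\<omega>. ?g (s, \<omega>) * ?g (u, \<omega>) \<partial>N) = (\<Sum>q\<le>j. (b q)\<^sup>2 * (fact q * exp (- \<gamma> * \<bar>s - u\<bar>) ^ q))"
      using OU_hermite_sum_inner[of s u b j] by simp
  qed
  finally show ?thesis .
qed

lemma ou_path_integrable:
  assumes "square_integrable unit_time (\<lambda>s. f (OU s \<omega>))"
  shows "integrable unit_time (\<lambda>s. indicat_real {0..t} s * f (OU s \<omega>))"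
proof (rule unit_time.square_integrable_L1, rule square_integrable_bound[OF assms])
  show "(\<lambda>s. indicat_real {0..t} s * f (OU s \<omega>)) \<in> borel_measurable unit_time"
    using assms by (intro borel_measurable_times) (auto simp: square_integrable_def)
qed (auto simp: indicator_def)

context
  assumes \<gamma>1: "\<gamma> < 1"
begin

text \<open>Linearity of the time integral in the function holds on outcomes for which both paths
  are integrable, that is, almost surely; then averaging contracts the norm.\<close>

lemma ou_average_diff_l2norm:
  assumes f: "square_integrable std_normal f" and g: "square_integrable std_normal g"
  shows "l2norm N (\<lambda>\<omega>. ou_average f t \<omega> - ou_average g t \<omega>) \<le> l2norm std_normal (\<lambda>x. f x - g x)"
proof -
  note d = square_integrable_diff[OF f g]
  have "AE \<omega> in N. ou_average f t \<omega> - ou_average g t \<omega> = ou_average (\<lambda>x. f x - g x) t \<omega>"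
    using ou_norm_square_integrable(3)[OF \<gamma>1 f] ou_norm_square_integrable(3)[OF \<gamma>1 g]
  proof eventually_elim
    fix \<omega> assume "square_integrable unit_time (\<lambda>s. f (OU s \<omega>))" "square_integrable unit_time (\<lambda>s. g (OU s \<omega>))"
    note i = this[THEN ou_path_integrable]
    show "ou_average f t \<omega> - ou_average g t \<omega> = ou_average (\<lambda>x. f x - g x) t \<omega>"
      unfolding ou_average_def Bochner_Integration.integral_diff[OF i, symmetric] right_diff_distrib ..
  qed
  then have "AE \<omega> in N. \<bar>ou_average f t \<omega> - ou_average g t \<omega>\<bar> \<le> \<bar>ou_average (\<lambda>x. f x - g x) t \<omega>\<bar>"
    by eventually_elim simp
  moreover have "(\<lambda>\<omega>. ou_average f t \<omega> - ou_average g t \<omega>) \<in> borel_measurable N"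
    using square_integrable_diff[OF ou_average_square_integrable(1)[OF f] ou_average_square_integrable(1)[OF g]]
    by (simp add: square_integrable_def)
  ultimately have "l2norm N (\<lambda>\<omega>. ou_average f t \<omega> - ou_average g t \<omega>) \<le> l2norm N (ou_average (\<lambda>x. f x - g x) t)"
    by (intro l2norm_mono ou_average_square_integrable(1)[OF d])
  also have "\<dots> \<le> l2norm std_normal (\<lambda>x. f x - g x)" by (rule ou_average_square_integrable(2)[OF d])
  finally show ?thesis .
qed

lemma ou_average_hermite_sum:
  "AE \<omega> in N. ou_average (hermite_sum b j) t \<omega> = (\<Sum>q\<le>j. b q * ou_average (hermite q) t \<omega>)"
proof -
  have "AE \<omega> in N. \<forall>q. square_integrable unit_time (\<lambda>s. hermite q (OU s \<omega>))"
    using ou_norm_square_integrable(3)[OF \<gamma>1 hermite_square_integrable] by (simp add: AE_all_countable)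
  then show ?thesis
  proof eventually_elim
    fix \<omega> assume "\<forall>q. square_integrable unit_time (\<lambda>s. hermite q (OU s \<omega>))"
    then have i: "integrable unit_time (\<lambda>s. b q * (indicat_real {0..t} s * hermite q (OU s \<omega>)))" for q
      by (intro integrable_mult_right ou_path_integrable) simp
    have "ou_average (hermite_sum b j) t \<omega> = (\<integral>s. (\<Sum>q\<le>j. b q * (indicat_real {0..t} s * hermite q (OU s \<omega>))) \<partial>unit_time)"
      unfolding ou_average_def hermite_sum_def sum_distrib_left by (simp only: mult_ac)
    also have "\<dots> = (\<Sum>q\<le>j. b q * ou_average (hermite q) t \<omega>)"
      unfolding ou_average_def by (subst Bochner_Integration.integral_sum[OF i]) simp
    finally show "ou_average (hermite_sum b j) t \<omega> = (\<Sum>q\<le>j. b q * ou_average (hermite q) t \<omega>)" .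
  qed
qed

text \<open>The norms of the partial sums converge by the contraction estimate, and their squares
  are \<open>ou_variance\<close>. Hence the norm depends on \<gamma> and the coefficients only, and
  the lower bound for the partial sums survives in the limit.\<close>

lemma ou_average_sd:
  assumes F: "square_integrable std_normal F" and b: "hermite_expansion F b"
  shows "l2norm N (ou_average F 1) = ou_sd \<gamma> b" "b q \<noteq> 0 \<Longrightarrow> ou_sd \<gamma> b > 0"
proof -
  have lim: "(\<lambda>j. l2norm N (ou_average (hermite_sum b j) 1)) \<longlonglongrightarrow> l2norm N (ou_average F 1)"
  proof (rule LIM_zero_cancel, rule Lim_null_comparison)
    show "(\<lambda>j. l2norm std_normal (\<lambda>x. hermite_sum b j x - F x)) \<longlonglongrightarrow> 0" using b hermite_expansion_l2norm[OF F] by simp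
    show "\<forall>\<^sub>F j in sequentially. norm (l2norm N (ou_average (hermite_sum b j) 1) - l2norm N (ou_average F 1)) \<le> l2norm std_normal (\<lambda>x. hermite_sum b j x - F x)"
    proof (rule always_eventually, rule allI)
      fix j
      note S = hermite_sum_square_integrable[of b j]
      show "norm (l2norm N (ou_average (hermite_sum b j) 1) - l2norm N (ou_average F 1)) \<le> l2norm std_normal (\<lambda>x. hermite_sum b j x - F x)"
        unfolding real_norm_def
        by (rule order_trans[OF l2norm_diff_abs[OF ou_average_square_integrable(1)[OF S] ou_average_square_integrable(1)[OF F]] ou_average_diff_l2norm[OF S F]])
    qed
  qed
  from tendsto_power[OF this, of 2] have v: "ou_variance \<gamma> b \<longlonglongrightarrow> (l2norm N (ou_average F 1))\<^sup>2"
    by (simp add: ou_average_hermite_sum_norm)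
  then show e: "l2norm N (ou_average F 1) = ou_sd \<gamma> b" by (simp add: ou_sd_def limI)
  assume "b q \<noteq> 0"
  then have "0 < (b q)\<^sup>2 * (fact q * exp (- \<gamma>) ^ q)" by simp
  also have "\<dots> \<le> (l2norm N (ou_average F 1))\<^sup>2"
    using v by (rule LIMSEQ_le_const) (use ou_variance_ge[OF \<gamma>_pos] in blast)
  finally show "ou_sd \<gamma> b > 0" using l2norm_nonneg[of N "ou_average F 1"] by (simp add: e zero_less_power2)
qed

text \<open>The free index set \<open>A\<close> serves the different ranges of orders in the three
  cases. It excludes order 0, where \<open>tempered_const\<close> is 0 and cannot be divided
  out.\<close>

lemma tempered_hermite_sum:
  assumes t: "t \<in> {0..1}" and A: "A \<subseteq> {1..j}" and b: "\<And>q. q \<le> j \<Longrightarrow> q \<notin> A \<Longrightarrow> b q = 0"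
  shows "AE \<omega> in N. (\<Sum>q\<in>A. limit_coeff \<gamma> b q * tempered_hermite N B \<gamma> q t \<omega>) = ou_average (hermite_sum b j) t \<omega> / ou_sd \<gamma> b"
proof -
  have "AE \<omega> in N. \<forall>q. multiple_wiener_integral N B q (tempered_kernel \<gamma> q t) \<omega> = ou_weight \<gamma> q * ou_average (hermite q) t \<omega>"
    using multiple_wiener_integral_tempered_kernel(2) t by (simp add: AE_all_countable)
  then show ?thesis using ou_average_hermite_sum[of b j t]
  proof eventually_elim
    fix \<omega> assume w: "\<forall>q. multiple_wiener_integral N B q (tempered_kernel \<gamma> q t) \<omega> = ou_weight \<gamma> q * ou_average (hermite q) t \<omega>"
      "ou_average (hermite_sum b j) t \<omega> = (\<Sum>q\<le>j. b q * ou_average (hermite q) t \<omega>)"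
    have "limit_coeff \<gamma> b q * tempered_hermite N B \<gamma> q t \<omega> = b q * ou_average (hermite q) t \<omega> / ou_sd \<gamma> b" if "q \<in> A" for q
    proof -
      have "tempered_const \<gamma> q > 0" using A that by (intro tempered_const_pos \<gamma>_pos) auto
      moreover have "ou_weight \<gamma> q > 0" using \<gamma>_pos by (simp add: ou_weight_def)
      ultimately show ?thesis using w(1) by (simp add: limit_coeff_def tempered_hermite_def)
    qed
    then have "(\<Sum>q\<in>A. limit_coeff \<gamma> b q * tempered_hermite N B \<gamma> q t \<omega>) = (\<Sum>q\<in>A. b q * ou_average (hermite q) t \<omega> / ou_sd \<gamma> b)"
      by (rule sum.cong[OF refl])
    also have "\<dots> = (\<Sum>q\<le>j. b q * ou_average (hermite q) t \<omega> / ou_sd \<gamma> b)"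
      using A b by (intro sum.mono_neutral_left) auto
    finally show "(\<Sum>q\<in>A. limit_coeff \<gamma> b q * tempered_hermite N B \<gamma> q t \<omega>) = ou_average (hermite_sum b j) t \<omega> / ou_sd \<gamma> b"
      by (simp add: w(2) sum_divide_distrib)
  qed
qed

end

end

section \<open>Transfer to the autoregressive model\<close>

lemma standard_normal_sequence_transfer:
  fixes \<Phi> :: "(nat \<Rightarrow> real) \<Rightarrow> real"
  assumes "standard_normal_sequence M n \<xi>" "standard_normal_sequence N n \<zeta>" "\<Phi> \<in> borel_measurable (Pi\<^sub>M {..n} (\<lambda>_. borel))"
  shows "(\<integral>\<omega>. \<Phi> (\<lambda>j\<in>{..n}. \<xi> j \<omega>) \<partial>M) = (\<integral>\<omega>. \<Phi> (\<lambda>j\<in>{..n}. \<zeta> j \<omega>) \<partial>N)"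
  unfolding standard_normal_sequence_integral[OF assms(1,3)] standard_normal_sequence_integral[OF assms(2,3)] ..

lemma standard_normal_sequence_path_distr:
  assumes \<xi>: "standard_normal_sequence M n \<xi>" and k: "k \<le> n"
  shows "(\<lambda>\<omega>. ar_path \<alpha> (\<lambda>j. \<xi> j \<omega>) k) \<in> borel_measurable M"
    "distr M borel (\<lambda>\<omega>. ar_path \<alpha> (\<lambda>j. \<xi> j \<omega>) k) = distr (Pi\<^sub>M {..n} (\<lambda>_. std_normal)) borel (\<lambda>v. ar_path \<alpha> v k)"
proof -
  let ?r = "\<lambda>\<omega>. \<lambda>j\<in>{..n}. \<xi> j \<omega>"
  have "\<xi> j \<in> borel_measurable M" if "j \<le> n" for j
    using \<xi> that by (auto simp: standard_normal_sequence_def intro: gaussian_rv_measurable)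
  then have r: "?r \<in> measurable M (Pi\<^sub>M {..n} (\<lambda>_. borel))" by (intro measurable_restrict) auto
  from measurable_compose[OF r ar_path_measurable[OF k, of \<alpha>]]
  show "(\<lambda>\<omega>. ar_path \<alpha> (\<lambda>j. \<xi> j \<omega>) k) \<in> borel_measurable M" by (simp only: ar_path_restrict[OF k])
  have "distr (Pi\<^sub>M {..n} (\<lambda>_. std_normal)) borel (\<lambda>v. ar_path \<alpha> v k) = distr M borel ((\<lambda>v. ar_path \<alpha> v k) \<circ> ?r)"
    unfolding standard_normal_sequence_distr[OF \<xi>, symmetric] by (rule distr_distr[OF ar_path_measurable[OF k] r])
  then show "distr M borel (\<lambda>\<omega>. ar_path \<alpha> (\<lambda>j. \<xi> j \<omega>) k) = distr (Pi\<^sub>M {..n} (\<lambda>_. std_normal)) borel (\<lambda>v. ar_path \<alpha> v k)"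
    by (simp only: comp_def ar_path_restrict[OF k])
qed

lemma step_path_cong: "(\<And>k. k \<le> n \<Longrightarrow> y k = z k) \<Longrightarrow> step_path n y = step_path n z"
  unfolding step_path_def by (intro restrict_ext) (use step_index_le in blast)

lemma conv_in_D_cong_AE:
  assumes "conv_in_D M Y N V" "\<And>t. t \<in> {0..1} \<Longrightarrow> AE \<omega> in N. V t \<omega> = V' t \<omega>"
  shows "conv_in_D M Y N V'"
proof -
  obtain Z where Z: "\<forall>t\<in>{0..1}. AE \<omega> in N. Z \<omega> t = V t \<omega>"
    "conv_in_distr skorokhod_topology M (\<lambda>n \<omega>. \<lambda>t\<in>{0..1}. Y n t \<omega>) N Z"
    using assms(1) unfolding conv_in_D_def by blast
  have "AE \<omega> in N. Z \<omega> t = V' t \<omega>" if "t \<in> {0..1}" for t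
    using Z(1)[rule_format, OF that] assms(2)[OF that] by eventually_elim simp
  with Z(2) show ?thesis unfolding conv_in_D_def by blast
qed

context ou_process
begin

context
  assumes \<gamma>1: "\<gamma> < 1"
begin

text \<open>Division by the stationary standard deviation \<open>\<tau>\<close> turns a row of the
  model into the unit-variance chain \<open>ar_path\<close>, driven by the rescaled initial value
  and the given noise.\<close>

lemma ar_model_standard:
  assumes model: "ar_model M \<gamma> \<sigma> \<epsilon> X" and n: "n \<ge> 1"
  defines "\<tau> \<equiv> sqrt ((\<sigma> n)\<^sup>2 / (1 - (ar_coeff \<gamma> n)\<^sup>2))"
  defines "\<xi> \<equiv> \<lambda>j \<omega>. if j = 0 then X n 0 \<omega> / \<tau> else \<epsilon> j \<omega>"
  shows "\<tau> > 0" "standard_normal_sequence M n \<xi>"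
    "\<omega> \<in> space M \<Longrightarrow> X n k \<omega> = \<tau> * ar_path (ar_coeff \<gamma> n) (\<lambda>j. \<xi> j \<omega>) k"
proof -
  interpret M: prob_space M using model by (simp add: ar_model_def)
  have m: "\<sigma> n > 0" "distributed M lborel (X n 0) (normal_density 0 \<tau>)"
    "M.indep_vars (\<lambda>_. borel) (\<lambda>j. if j = 0 then X n 0 else \<epsilon> j) UNIV"
    "\<And>j \<omega>. j \<ge> 1 \<Longrightarrow> \<omega> \<in> space M \<Longrightarrow> X n j \<omega> = ar_coeff \<gamma> n * X n (j - 1) \<omega> + \<sigma> n * \<epsilon> j \<omega>"
    "\<And>j. j \<ge> 1 \<Longrightarrow> distributed M lborel (\<epsilon> j) std_normal_density"
    using model n by (auto simp: ar_model_def \<tau>_def)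
  have a: "1 - (ar_coeff \<gamma> n)\<^sup>2 > 0" using ar_coeff_bounds(3)[OF n refl \<gamma>1] by simp
  show \<tau>: "\<tau> > 0" using m(1) a by (simp add: \<tau>_def)
  \<comment> \<open>This matches the innovation coefficient of the model with the factor
    \<open>sqrt (1 - \<alpha>\<^sup>2)\<close> in \<open>ar_path\<close>.\<close>
  have s: "\<tau> * sqrt (1 - (ar_coeff \<gamma> n)\<^sup>2) = \<sigma> n" using m(1) a by (simp add: \<tau>_def real_sqrt_divide)
  show "standard_normal_sequence M n \<xi>"
    unfolding standard_normal_sequence_def
  proof (intro conjI allI impI)
    show "prob_space M" by (rule M.prob_space_axioms)
    fix j
    show "gaussian_rv M 1 (\<xi> j)"
    proof (cases "j = 0")
      case True
      have "gaussian_rv M ((1 / \<tau>)\<^sup>2 * \<tau>\<^sup>2) (\<lambda>\<omega>. 1 / \<tau> * X n 0 \<omega>)"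
        by (rule gaussian_rv_scale[OF gaussian_rv_of_normal[OF M.prob_space_axioms m(2) \<tau>]])
      then show ?thesis using True \<tau> by (simp add: \<xi>_def power_divide)
    next
      case False
      then show ?thesis using gaussian_rv_of_normal[OF M.prob_space_axioms m(5)[of j]] by (simp add: \<xi>_def)
    qed
  next
    have "M.indep_vars (\<lambda>_. borel) (\<lambda>j. if j = 0 then X n 0 else \<epsilon> j) {..n}"
      by (rule M.indep_vars_subset[OF m(3)]) auto
    then have "M.indep_vars (\<lambda>_. borel) (\<lambda>j \<omega>. (if j = 0 then (\<lambda>x. x / \<tau>) else (\<lambda>x. x)) ((if j = 0 then X n 0 else \<epsilon> j) \<omega>)) {..n}"
      by (rule M.indep_vars_compose2) auto
    also have "(\<lambda>j \<omega>. (if j = 0 then (\<lambda>x. x / \<tau>) else (\<lambda>x. x)) ((if j = 0 then X n 0 else \<epsilon> j) \<omega>)) = \<xi>"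
      by (auto simp: \<xi>_def fun_eq_iff)
    finally show "M.indep_vars (\<lambda>_. borel) \<xi> {..n}" .
  qed
  assume \<omega>: "\<omega> \<in> space M"
  show "X n k \<omega> = \<tau> * ar_path (ar_coeff \<gamma> n) (\<lambda>j. \<xi> j \<omega>) k"
  proof (induction k)
    case 0
    then show ?case using \<tau> by (simp add: \<xi>_def)
  next
    case (Suc k)
    have "X n (Suc k) \<omega> = ar_coeff \<gamma> n * X n k \<omega> + \<sigma> n * \<epsilon> (Suc k) \<omega>" using m(4)[of "Suc k"] \<omega> by simp
    also have "\<dots> = \<tau> * ar_path (ar_coeff \<gamma> n) (\<lambda>j. \<xi> j \<omega>) (Suc k)"
      unfolding Suc.IH s[symmetric] by (simp add: \<xi>_def algebra_simps)
    finally show ?case .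
  qed
qed

text \<open>Standardisation is invariant under affine changes of \<open>f\<close>: the mean and the
  positive scale \<open>s n\<close> cancel, so \<open>f\<close> may be replaced by
  \<open>Fn n\<close> evaluated on the unit-variance chain. Row by row the law of that chain is the
  law of \<open>ar_sim\<close>, for which the limit is known.\<close>

lemma ar_functional_limit:
  assumes model: "ar_model M \<gamma> \<sigma> \<epsilon> X" and f: "f \<in> borel_measurable borel"
    and \<tau>_def: "\<tau> = (\<lambda>n. sqrt ((\<sigma> n)\<^sup>2 / (1 - (ar_coeff \<gamma> n)\<^sup>2)))"
    and s: "\<And>n. n \<ge> 1 \<Longrightarrow> s n > (0::real)" and Fn: "\<And>n. square_integrable std_normal (Fn n)"
    and eq: "\<And>n z. n \<ge> 1 \<Longrightarrow> Fn n z = (f (\<tau> n * z) - (\<integral>y. f (\<tau> n * y) \<partial>std_normal)) / s n"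
    and F: "square_integrable std_normal F" and b: "hermite_expansion F b"
    and lim: "(\<lambda>n. l2norm std_normal (\<lambda>x. Fn n x - F x)) \<longlonglongrightarrow> 0" and pos: "ou_sd \<gamma> b > 0"
  shows "conv_in_D M (std_functional M X f) N (\<lambda>t \<omega>. ou_average F t \<omega> / ou_sd \<gamma> b)"
proof -
  interpret M: prob_space M using model by (simp add: ar_model_def)
  define \<xi> where "\<xi> n j \<omega> = (if j = 0 then X n 0 \<omega> / \<tau> n else \<epsilon> j \<omega>)" for n j \<omega>
  define x where "x n k \<omega> = ar_path (ar_coeff \<gamma> n) (\<lambda>j. \<xi> n j \<omega>) k" for n k \<omega>
  define L where "L n = l2norm N (\<lambda>\<omega>. \<Sum>i=1..n. Fn n (ar_sim n i \<omega>))" for n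
  define S where "S n k \<omega> = (\<Sum>i=1..k. Fn n (x n i \<omega>))" for n k \<omega>
  have st: "standard_normal_sequence M n (\<xi> n)" if "n \<ge> 1" for n
    using ar_model_standard(2)[OF model that] unfolding \<xi>_def \<tau>_def .
  have path: "X n k \<omega> = \<tau> n * x n k \<omega>" if "n \<ge> 1" "\<omega> \<in> space M" for n k \<omega>
    using ar_model_standard(3)[OF model that, of k] unfolding \<xi>_def \<tau>_def x_def .
  have stN: "standard_normal_sequence N n (ar_noise n)" if "n \<ge> 1" for n by (rule ar_noise_standard[OF that refl \<gamma>1])
  have Fm: "Fn n \<in> borel_measurable borel" for n using Fn[of n] by (simp add: square_integrable_def)
  have gx: "gaussian_rv M 1 (x n k)" if "n \<ge> 1" "k \<le> n" for n k
  proof -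
    have "gaussian_rv N 1 (ar_sim n k)" by (rule ar_sim_gaussian[OF that(1) refl \<gamma>1 that(2)])
    moreover have "distr M borel (x n k) = distr N borel (ar_sim n k)"
      unfolding x_def[abs_def] ar_sim_def[abs_def]
      using standard_normal_sequence_path_distr(2)[OF st[OF that(1)] that(2)] standard_normal_sequence_path_distr(2)[OF stN[OF that(1)] that(2)]
      by (simp only:)
    moreover have "x n k \<in> borel_measurable M"
      unfolding x_def[abs_def] by (rule standard_normal_sequence_path_distr(1)[OF st[OF that(1)] that(2)])
    ultimately show ?thesis by (simp add: gaussian_rv_def)
  qed
  have Sm: "S n k \<in> borel_measurable M" if "k \<le> n" for n k
    unfolding S_def[abs_def]
  proof (rule borel_measurable_sum)
    fix i assume "i \<in> {1..k}"
    then have "gaussian_rv M 1 (x n i)" using that by (intro gx) auto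
    from measurable_compose[OF gaussian_rv_measurable[OF this] Fm] show "(\<lambda>\<omega>. Fn n (x n i \<omega>)) \<in> borel_measurable M" .
  qed
  \<comment> \<open>The laws are compared for the inputs up to index \<open>n\<close> only;
    condition \<open>c\<close> says that \<Phi> looks at the partial sums no further than
    that.\<close>
  have transfer: "(\<integral>\<omega>. \<Phi> (\<lambda>k. S n k \<omega>) \<partial>M) = (\<integral>\<omega>. \<Phi> (\<lambda>k. \<Sum>i=1..k. Fn n (ar_sim n i \<omega>)) \<partial>N)"
    if n: "n \<ge> 1" and m: "(\<lambda>v. \<Phi> (\<lambda>k. \<Sum>i=1..k. Fn n (ar_path (ar_coeff \<gamma> n) v i))) \<in> borel_measurable (Pi\<^sub>M {..n} (\<lambda>_. borel))"
      and c: "\<And>y z. (\<And>k. k \<le> n \<Longrightarrow> y k = z k) \<Longrightarrow> \<Phi> y = \<Phi> z" for n and \<Phi> :: "(nat \<Rightarrow> real) \<Rightarrow> real"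
  proof -
    have r: "\<Phi> (\<lambda>k. \<Sum>i=1..k. Fn n (ar_path (ar_coeff \<gamma> n) (\<lambda>j\<in>{..n}. v j) i)) = \<Phi> (\<lambda>k. \<Sum>i=1..k. Fn n (ar_path (ar_coeff \<gamma> n) v i))" for v
      by (rule c, rule sum.cong[OF refl]) (simp add: ar_path_restrict)
    show ?thesis
      using standard_normal_sequence_transfer[OF st[OF n] stN[OF n] m] unfolding r S_def x_def ar_sim_def .
  qed
  have LM: "l2norm M (S n n) = L n" if n: "n \<ge> 1" for n
  proof -
    have "(\<integral>\<omega>. (S n n \<omega>)\<^sup>2 \<partial>M) = (\<integral>\<omega>. (\<Sum>i=1..n. Fn n (ar_sim n i \<omega>))\<^sup>2 \<partial>N)"
    proof (rule transfer[OF n, of "\<lambda>y. (y n)\<^sup>2"])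
      show "(\<lambda>v. (\<Sum>i=1..n. Fn n (ar_path (ar_coeff \<gamma> n) v i))\<^sup>2) \<in> borel_measurable (Pi\<^sub>M {..n} (\<lambda>_. borel))"
        by (intro borel_measurable_power borel_measurable_sum measurable_compose[OF ar_path_measurable Fm]) auto
    qed simp
    then show ?thesis by (simp add: L_def l2norm_def)
  qed
  have rep: "std_functional M X f n t \<omega> = S n (nat \<lfloor>real n * t\<rfloor>) \<omega> / L n" if t: "t \<in> {0..1}" and \<omega>: "\<omega> \<in> space M" for n t \<omega>
  proof (cases "n = 0")
    case True
    then show ?thesis by (simp add: std_functional_def add_functional_def S_def)
  next
    case False
    then have n: "n \<ge> 1" by simp
    define \<mu> where "\<mu> = (\<integral>y. f (\<tau> n * y) \<partial>std_normal)"
    have sn: "s n > 0" by (rule s[OF n])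
    have fz: "f (\<tau> n * z) = s n * Fn n z + \<mu>" for z using eq[OF n, of z] sn by (simp add: \<mu>_def)
    \<comment> \<open>Integrating \<open>fz\<close> reproduces \<mu> on both sides, so
      \<open>Fn n\<close> is centred; the expectation of a partial sum of \<open>f\<close> is then
      the number of terms times \<mu>.\<close>
    have "\<mu> = (\<integral>z. s n * Fn n z + \<mu> \<partial>std_normal)" by (simp only: fz[symmetric]) (simp only: \<mu>_def)
    also have "\<dots> = s n * (\<integral>z. Fn n z \<partial>std_normal) + \<mu>"
      using std_normal.square_integrable_L1[OF Fn[of n]] std_normal.prob_space by simp
    finally have F0: "(\<integral>z. Fn n z \<partial>std_normal) = 0" using sn by simp
    have X: "f (X n i \<omega>') = s n * Fn n (x n i \<omega>') + \<mu>" if "\<omega>' \<in> space M" for i \<omega>'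
      unfolding path[OF n that] fz ..
    have add: "(\<Sum>i=1..k. f (X n i \<omega>')) = s n * S n k \<omega>' + real k * \<mu>" if "\<omega>' \<in> space M" for k \<omega>'
      by (simp add: X[OF that] S_def sum.distrib sum_distrib_left)
    have int: "integrable M (S n k)" "(\<integral>\<omega>. S n k \<omega> \<partial>M) = 0" if "k \<le> n" for k
    proof -
      have g: "gaussian_rv M 1 (x n i)" if "i \<in> {1..k}" for i using that \<open>k \<le> n\<close> by (intro gx n) auto
      have i: "integrable M (\<lambda>\<omega>. Fn n (x n i \<omega>))" if "i \<in> {1..k}" for i
        by (rule M.square_integrable_L1[OF gaussian_rv_unit_square_integrable(1)[OF g[OF that] Fn]])
      then show "integrable M (S n k)" unfolding S_def[abs_def] by (rule Bochner_Integration.integrable_sum)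
      have "(\<integral>\<omega>. Fn n (x n i \<omega>) \<partial>M) = 0" if "i \<in> {1..k}" for i
        using gaussian_rv_integral(1)[OF g[OF that] Fm[of n]] F0 by simp
      then show "(\<integral>\<omega>. S n k \<omega> \<partial>M) = 0" unfolding S_def by (subst Bochner_Integration.integral_sum[OF i]) auto
    qed
    have E: "(\<integral>\<omega>'. (\<Sum>i=1..k. f (X n i \<omega>')) \<partial>M) = real k * \<mu>" if "k \<le> n" for k
    proof -
      have "(\<integral>\<omega>'. (\<Sum>i=1..k. f (X n i \<omega>')) \<partial>M) = (\<integral>\<omega>'. s n * S n k \<omega>' + real k * \<mu> \<partial>M)"
        by (rule Bochner_Integration.integral_cong[OF refl]) (rule add)
      also have "\<dots> = real k * \<mu>" using int[OF that] M.prob_space by simp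
      finally show ?thesis .
    qed
    have "(\<integral>\<omega>'. ((\<Sum>i=1..n. f (X n i \<omega>')) - real n * \<mu>)\<^sup>2 \<partial>M) = (\<integral>\<omega>'. (s n)\<^sup>2 * (S n n \<omega>')\<^sup>2 \<partial>M)"
      by (rule Bochner_Integration.integral_cong[OF refl]) (simp only: add power_mult_distrib add_diff_cancel_right')
    then have V: "sqrt (\<integral>\<omega>'. ((\<Sum>i=1..n. f (X n i \<omega>')) - real n * \<mu>)\<^sup>2 \<partial>M) = s n * L n"
      using sn by (simp add: LM[OF n, symmetric] l2norm_def real_sqrt_mult)
    have k: "nat \<lfloor>real n * t\<rfloor> \<le> n" by (rule step_index_le[OF t])
    have "std_functional M X f n t \<omega> = (s n * S n (nat \<lfloor>real n * t\<rfloor>) \<omega>) / (s n * L n)"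
      unfolding std_functional_def add_functional_def E[OF k] add[OF \<omega>]
      using V E[of n] by simp
    then show ?thesis using sn by simp
  qed
  define W where "W n \<omega> = step_path n (\<lambda>k. S n k \<omega> / L n)" for n \<omega>
  have W: "(\<lambda>t\<in>{0..1}. std_functional M X f n t \<omega>) = W n \<omega>" if "\<omega> \<in> space M" for n \<omega>
    unfolding W_def step_path_def by (rule restrict_ext) (rule rep[OF _ that])
  have Wm: "W n \<in> measurable M (borel_of skorokhod_topology)" for n
    unfolding W_def[abs_def] by (intro step_path_measurable borel_measurable_divide Sm borel_measurable_const)
  note sd = ou_average_sd(1)[OF \<gamma>1 F b]
  have "conv_in_distr skorokhod_topology M (\<lambda>n \<omega>. \<lambda>t\<in>{0..1}. std_functional M X f n t \<omega>) N (limit_path F)"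
    unfolding conv_in_distr_def
  proof (intro conjI allI impI)
    show "(\<lambda>\<omega>. \<lambda>t\<in>{0..1}. std_functional M X f n t \<omega>) \<in> measurable M (borel_of skorokhod_topology)" for n
      using Wm[of n] W by (subst measurable_cong[of _ _ "W n"]) auto
    show "limit_path F \<in> measurable N (borel_of skorokhod_topology)" by (rule limit_path_measurable[OF \<gamma>1 Fn F b lim])
    fix g :: "(real \<Rightarrow> real) \<Rightarrow> real"
    assume g: "continuous_map skorokhod_topology euclideanreal g \<and> bounded (g ` topspace skorokhod_topology)"
    have gm: "g \<in> borel_measurable (borel_of skorokhod_topology)" by (rule continuous_map_borel_of_measurable) (use g in blast)
    have "(\<lambda>n. \<integral>\<omega>. g (step_path n (\<lambda>k. (\<Sum>i=1..k. Fn n (ar_sim n i \<omega>)) / L n)) \<partial>N) \<longlonglongrightarrow> (\<integral>\<omega>. g (limit_path F \<omega>) \<partial>N)"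
      unfolding L_def by (rule ar_sim_functional_limit[OF \<gamma>1 Fn F b lim]) (use g pos sd in auto)
    moreover have "\<forall>\<^sub>F n in sequentially. (\<integral>\<omega>. g (step_path n (\<lambda>k. (\<Sum>i=1..k. Fn n (ar_sim n i \<omega>)) / L n)) \<partial>N) = (\<integral>\<omega>. g (\<lambda>t\<in>{0..1}. std_functional M X f n t \<omega>) \<partial>M)"
      using eventually_ge_at_top[of 1]
    proof eventually_elim
      fix n :: nat assume n: "1 \<le> n"
      have "(\<integral>\<omega>. g (\<lambda>t\<in>{0..1}. std_functional M X f n t \<omega>) \<partial>M) = (\<integral>\<omega>. g (step_path n (\<lambda>k. S n k \<omega> / L n)) \<partial>M)"
        by (rule Bochner_Integration.integral_cong[OF refl]) (simp only: W W_def)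
      also have "\<dots> = (\<integral>\<omega>. g (step_path n (\<lambda>k. (\<Sum>i=1..k. Fn n (ar_sim n i \<omega>)) / L n)) \<partial>N)"
      proof (rule transfer[OF n, of "\<lambda>y. g (step_path n (\<lambda>k. y k / L n))"])
        show "(\<lambda>v. g (step_path n (\<lambda>k. (\<Sum>i=1..k. Fn n (ar_path (ar_coeff \<gamma> n) v i)) / L n))) \<in> borel_measurable (Pi\<^sub>M {..n} (\<lambda>_. borel))"
          by (rule measurable_compose[OF step_path_measurable gm], rule borel_measurable_divide, rule borel_measurable_sum, rule measurable_compose[OF ar_path_measurable Fm]) auto
        show "g (step_path n (\<lambda>k. y k / L n)) = g (step_path n (\<lambda>k. z k / L n))" if "\<And>k. k \<le> n \<Longrightarrow> y k = z k" for y z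
          by (rule arg_cong[where f=g], rule step_path_cong) (simp add: that)
      qed
      finally show "(\<integral>\<omega>. g (step_path n (\<lambda>k. (\<Sum>i=1..k. Fn n (ar_sim n i \<omega>)) / L n)) \<partial>N) = (\<integral>\<omega>. g (\<lambda>t\<in>{0..1}. std_functional M X f n t \<omega>) \<partial>M)" by simp
    qed
    ultimately show "(\<lambda>n. \<integral>\<omega>. g (\<lambda>t\<in>{0..1}. std_functional M X f n t \<omega>) \<partial>M) \<longlonglongrightarrow> (\<integral>\<omega>. g (limit_path F \<omega>) \<partial>N)"
      by (rule Lim_transform_eventually)
  qed
  moreover have "AE \<omega> in N. limit_path F \<omega> t = ou_average F t \<omega> / ou_sd \<gamma> b" if "t \<in> {0..1}" for t
    using limit_path_AE[OF \<gamma>1 Fn F b lim that] unfolding sd .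
  ultimately show ?thesis unfolding conv_in_D_def by blast
qed

text \<open>After division by \<open>\<tau> n ^ w\<close> the monomial of degree \<open>v\<close>
  carries the factor \<open>\<tau> n ^ v / \<tau> n ^ w\<close>, which by \<open>dominant\<close>
  tends to 0 for all other positive degrees present; degree 0 is removed by centring. What remains
  is the centred monomial of degree \<open>w\<close>, whose Hermite coefficients are
  \<open>b\<close>. The order \<open>w\<close> itself has a nonzero coefficient, which makes the
  limiting variance positive.\<close>

lemma ar_polynomial_limit:
  assumes model: "ar_model M \<gamma> \<sigma> \<epsilon> X" and w: "w \<ge> 1" "coeff P w \<noteq> 0"
    and \<tau>_def: "\<tau> = (\<lambda>n. sqrt ((\<sigma> n)\<^sup>2 / (1 - (ar_coeff \<gamma> n)\<^sup>2)))"
    and dominant: "\<And>v. v \<ge> 1 \<Longrightarrow> v \<noteq> w \<Longrightarrow> coeff P v \<noteq> 0 \<Longrightarrow> (\<lambda>n. \<tau> n ^ v / \<tau> n ^ w) \<longlonglongrightarrow> 0"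
    and a: "\<And>x. x ^ w = (\<Sum>q\<le>w. a q * hermite q x)" "a w = 1"
    and b_def: "b = (\<lambda>q. if q = 0 \<or> q > w then 0 else coeff P w * a q)"
  shows "conv_in_D M (std_functional M X (poly P)) N (\<lambda>t \<omega>. \<Sum>q=1..w. limit_coeff \<gamma> b q * tempered_hermite N B \<gamma> q t \<omega>)"
proof -
  define \<mu> where "\<mu> v = (\<integral>z. z ^ v \<partial>std_normal)" for v
  have \<tau>: "\<tau> n > 0" if "n \<ge> 1" for n using ar_model_standard(1)[OF model that] unfolding \<tau>_def .
  define G where "G v z = z ^ v - \<mu> v" for v and z :: real
  have G: "square_integrable std_normal (G v)" for v
    unfolding G_def[abs_def] by (intro square_integrable_diff square_integrable_power std_normal.square_integrable_const)
  define Fn where "Fn n z = (\<Sum>v\<le>degree P. (coeff P v * (\<tau> n ^ v / \<tau> n ^ w)) * G v z)" for n z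
  define F where "F z = coeff P w * G w z" for z
  have Fsq: "square_integrable std_normal F" unfolding F_def[abs_def] by (intro square_integrable_cmult G)
  have Fnsq: "square_integrable std_normal (Fn n)" for n
    unfolding Fn_def[abs_def] by (intro square_integrable_sum square_integrable_cmult G)
  have h0: "(\<integral>z. hermite q z \<partial>std_normal) = (if q = 0 then 1 else 0)" for q
    using hermite_orthogonal[of 0 q] by (auto split: if_splits)
  have "\<mu> w = (\<Sum>q\<le>w. a q * (\<integral>z. hermite q z \<partial>std_normal))"
    unfolding \<mu>_def a(1) using std_normal.square_integrable_L1[OF hermite_square_integrable]
    by (subst Bochner_Integration.integral_sum) auto
  then have \<mu>w: "\<mu> w = a 0" by (simp add: h0 sum.delta if_distrib cong: if_cong)
  have FS: "hermite_sum b j = F" if j: "j \<ge> w" for j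
  proof
    fix z
    have "hermite_sum b j z = (\<Sum>q\<le>w. b q * hermite q z)"
      unfolding hermite_sum_def using j by (intro sum.mono_neutral_right) (auto simp: b_def)
    also have "\<dots> = (\<Sum>q\<le>w. coeff P w * (a q * hermite q z) - (if q = 0 then coeff P w * a 0 else 0))"
      by (intro sum.cong) (auto simp: b_def)
    also have "\<dots> = coeff P w * (\<Sum>q\<le>w. a q * hermite q z) - coeff P w * a 0"
      by (simp add: sum_subtractf sum_distrib_left)
    also have "\<dots> = F z" unfolding a(1)[symmetric] F_def G_def \<mu>w by (simp add: right_diff_distrib)
    finally show "hermite_sum b j z = F z" .
  qed
  have bF: "hermite_expansion F b"
    unfolding hermite_expansion_l2norm[OF Fsq]
  proof (rule tendsto_eventually)
    show "\<forall>\<^sub>F j in sequentially. l2norm std_normal (\<lambda>x. hermite_sum b j x - F x) = 0"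
      using eventually_ge_at_top[of w] by eventually_elim (simp add: FS l2norm_def)
  qed
  have pos: "ou_sd \<gamma> b > 0" using w a(2) by (intro ou_average_sd(2)[OF \<gamma>1 Fsq bF, of w]) (simp add: b_def)
  have eq: "Fn n z = (poly P (\<tau> n * z) - (\<integral>y. poly P (\<tau> n * y) \<partial>std_normal)) / \<tau> n ^ w" for n z
  proof -
    have p: "poly P (\<tau> n * y) = (\<Sum>v\<le>degree P. (coeff P v * \<tau> n ^ v) * y ^ v)" for y
      by (simp add: poly_altdef power_mult_distrib mult.assoc)
    have "(\<integral>y. poly P (\<tau> n * y) \<partial>std_normal) = (\<Sum>v\<le>degree P. (coeff P v * \<tau> n ^ v) * \<mu> v)"
      unfolding p \<mu>_def using std_normal_integrable_power by (subst Bochner_Integration.integral_sum) auto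
    then show ?thesis
      unfolding p Fn_def G_def by (simp add: sum_subtractf[symmetric] sum_divide_distrib right_diff_distrib[symmetric])
  qed
  have wd: "w \<in> {..degree P}" using w(2) le_degree by simp
  have lim: "(\<lambda>n. l2norm std_normal (\<lambda>x. Fn n x - F x)) \<longlonglongrightarrow> 0"
  proof (rule Lim_null_comparison)
    let ?A = "{..degree P} - {w}"
    show "\<forall>\<^sub>F n in sequentially. norm (l2norm std_normal (\<lambda>x. Fn n x - F x)) \<le> (\<Sum>v\<in>?A. \<bar>coeff P v * (\<tau> n ^ v / \<tau> n ^ w)\<bar> * l2norm std_normal (G v))"
      using eventually_ge_at_top[of 1]
    proof eventually_elim
      fix n :: nat assume n: "1 \<le> n"
      have "Fn n x - F x = (\<Sum>v\<in>?A. (coeff P v * (\<tau> n ^ v / \<tau> n ^ w)) * G v x)" for x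
        unfolding Fn_def F_def sum.remove[OF finite_atMost wd] using \<tau>[OF n] by simp
      moreover have "l2norm std_normal (\<lambda>x. \<Sum>v\<in>?A. (coeff P v * (\<tau> n ^ v / \<tau> n ^ w)) * G v x)
          \<le> (\<Sum>v\<in>?A. l2norm std_normal (\<lambda>x. (coeff P v * (\<tau> n ^ v / \<tau> n ^ w)) * G v x))"
      proof (rule l2norm_sum)
        show "square_integrable std_normal (\<lambda>x. (coeff P v * (\<tau> n ^ v / \<tau> n ^ w)) * G v x)" for v
          by (rule square_integrable_cmult[OF G])
      qed simp
      ultimately show "norm (l2norm std_normal (\<lambda>x. Fn n x - F x)) \<le> (\<Sum>v\<in>?A. \<bar>coeff P v * (\<tau> n ^ v / \<tau> n ^ w)\<bar> * l2norm std_normal (G v))"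
        by (simp only: l2norm_cmult real_norm_def abs_of_nonneg[OF l2norm_nonneg])
    qed
    have "(\<lambda>n. \<bar>coeff P v * (\<tau> n ^ v / \<tau> n ^ w)\<bar> * l2norm std_normal (G v)) \<longlonglongrightarrow> 0" if v: "v \<in> ?A" for v
    proof -
      consider "v = 0" | "coeff P v = 0" | "v \<ge> 1" "coeff P v \<noteq> 0" by linarith
      then show ?thesis
      proof cases
        case 1
        then have "G v = (\<lambda>_. 0)" using std_normal.prob_space by (simp add: G_def[abs_def] \<mu>_def)
        then show ?thesis by (simp add: l2norm_def)
      next
        case 3
        have "(\<lambda>n. \<bar>coeff P v * (\<tau> n ^ v / \<tau> n ^ w)\<bar> * l2norm std_normal (G v)) \<longlonglongrightarrow> \<bar>coeff P v * 0\<bar> * l2norm std_normal (G v)"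
          by (intro tendsto_mult tendsto_rabs tendsto_const dominant) (use 3 v in auto)
        then show ?thesis by simp
      qed simp
    qed
    then show "(\<lambda>n. \<Sum>v\<in>?A. \<bar>coeff P v * (\<tau> n ^ v / \<tau> n ^ w)\<bar> * l2norm std_normal (G v)) \<longlonglongrightarrow> 0"
      by (rule tendsto_null_sum)
  qed
  have "(\<lambda>x. \<Sum>i\<le>degree P. coeff P i * x ^ i) \<in> borel_measurable borel" by measurable
  then have pm: "poly P \<in> borel_measurable borel" by (simp add: poly_altdef[symmetric])
  have "conv_in_D M (std_functional M X (poly P)) N (\<lambda>t \<omega>. ou_average F t \<omega> / ou_sd \<gamma> b)"
    by (rule ar_functional_limit[OF model pm \<tau>_def _ Fnsq eq Fsq bF lim pos]) (use \<tau> in auto)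
  then show ?thesis
  proof (rule conv_in_D_cong_AE)
    fix t :: real assume t: "t \<in> {0..1}"
    have "AE \<omega> in N. (\<Sum>q\<in>{1..w}. limit_coeff \<gamma> b q * tempered_hermite N B \<gamma> q t \<omega>) = ou_average (hermite_sum b w) t \<omega> / ou_sd \<gamma> b"
      by (rule tempered_hermite_sum[OF \<gamma>1 t order_refl]) (auto simp: b_def)
    then show "AE \<omega> in N. ou_average F t \<omega> / ou_sd \<gamma> b = (\<Sum>q=1..w. limit_coeff \<gamma> b q * tempered_hermite N B \<gamma> q t \<omega>)"
      by eventually_elim (simp add: FS)
  qed
qed

lemma tempered_hermite_square_integrable:
  assumes t: "t \<in> {0..1}"
  shows "square_integrable N (tempered_hermite N B \<gamma> q t)"
proof -
  have t': "0 \<le> t" "t \<le> 1" using t by auto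
  have "square_integrable N (multiple_wiener_integral N B q (tempered_kernel \<gamma> q t))"
  proof (rule square_integrable_bound)
    show "square_integrable N (\<lambda>\<omega>. ou_weight \<gamma> q * ou_average (hermite q) t \<omega>)"
      by (intro square_integrable_cmult ou_average_square_integrable(1) hermite_square_integrable)
    show "AE \<omega> in N. \<bar>multiple_wiener_integral N B q (tempered_kernel \<gamma> q t) \<omega>\<bar> \<le> \<bar>ou_weight \<gamma> q * ou_average (hermite q) t \<omega>\<bar>"
      using multiple_wiener_integral_tempered_kernel(2)[OF t', of q] by eventually_elim simp
  qed (rule multiple_wiener_integral_tempered_kernel(1)[OF t'])
  then show ?thesis unfolding tempered_hermite_def[abs_def] by (rule square_integrable_cmult)
qed

text \<open>Here the stationary variance is 1, so the function on the chain is the centred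
  \<open>f\<close> for every \<open>n\<close>. The series of tempered Hermite processes converges to
  the normalised time integral because the latter depends on the function as a contraction, up to
  the constant \<open>1 / ou_sd\<close>.\<close>

lemma ar_square_integrable_limit:
  assumes model: "ar_model M \<gamma> \<sigma> \<epsilon> X" and \<sigma>: "\<forall>n\<ge>1. (\<sigma> n)\<^sup>2 = 1 - (ar_coeff \<gamma> n)\<^sup>2"
    and f: "square_integrable std_normal f"
    and F_def: "F = (\<lambda>x. f x - (\<integral>y. f y \<partial>std_normal))"
    and r: "r \<ge> 1" "hermite_coeff F r \<noteq> 0" "\<And>q. q < r \<Longrightarrow> hermite_coeff F q = 0"
  shows "\<exists>V. (\<forall>t\<in>{0..1}. L2_tendsto N (\<lambda>k \<omega>. \<Sum>q=r..k. limit_coeff \<gamma> (hermite_coeff F) q * tempered_hermite N B \<gamma> q t \<omega>) (V t)) \<and>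
    conv_in_D M (std_functional M X f) N V"
proof -
  let ?b = "hermite_coeff F"
  define V where "V t \<omega> = ou_average F t \<omega> / ou_sd \<gamma> ?b" for t \<omega>
  have fm: "f \<in> borel_measurable borel" using f by (simp add: square_integrable_def)
  have F: "square_integrable std_normal F"
    unfolding F_def by (intro square_integrable_diff f std_normal.square_integrable_const)
  have b: "hermite_expansion F ?b" by (rule hermite_expansion_exists[OF F])
  have pos: "ou_sd \<gamma> ?b > 0" by (rule ou_average_sd(2)[OF \<gamma>1 F b r(2)])
  define \<tau> where "\<tau> = (\<lambda>n. sqrt ((\<sigma> n)\<^sup>2 / (1 - (ar_coeff \<gamma> n)\<^sup>2)))"
  have \<tau>1: "\<tau> n = 1" if n: "n \<ge> 1" for n
    using \<sigma> n ar_coeff_bounds(3)[OF n refl \<gamma>1] by (simp add: \<tau>_def)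
  have "conv_in_D M (std_functional M X f) N (\<lambda>t \<omega>. ou_average F t \<omega> / ou_sd \<gamma> ?b)"
  proof (rule ar_functional_limit[OF model fm \<tau>_def, where s="\<lambda>_. 1" and Fn="\<lambda>_. F"])
    show "F z = (f (\<tau> n * z) - (\<integral>y. f (\<tau> n * y) \<partial>std_normal)) / 1" if "n \<ge> 1" for n z
      by (simp add: \<tau>1[OF that] F_def)
    show "(\<lambda>n. l2norm std_normal (\<lambda>x. F x - F x)) \<longlonglongrightarrow> 0" by (simp add: l2norm_def)
  qed (use F b pos in auto)
  moreover have "L2_tendsto N (\<lambda>k \<omega>. \<Sum>q=r..k. limit_coeff \<gamma> ?b q * tempered_hermite N B \<gamma> q t \<omega>) (V t)" if t: "t \<in> {0..1}" for t
  proof -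
    let ?Y = "\<lambda>k \<omega>. \<Sum>q=r..k. limit_coeff \<gamma> ?b q * tempered_hermite N B \<gamma> q t \<omega>"
    have Ysq: "square_integrable N (?Y k)" for k
      by (intro square_integrable_sum square_integrable_cmult tempered_hermite_square_integrable[OF t])
    have Vsq: "square_integrable N (V t)"
      unfolding V_def[abs_def] divide_inverse mult.commute[of _ "inverse _"]
      by (intro square_integrable_cmult ou_average_square_integrable(1) F)
    have "(\<lambda>k. l2norm N (\<lambda>\<omega>. ?Y k \<omega> - V t \<omega>)) \<longlonglongrightarrow> 0"
    proof (rule Lim_null_comparison)
      have "(\<lambda>k. l2norm std_normal (\<lambda>x. hermite_sum ?b k x - F x)) \<longlonglongrightarrow> 0" using b hermite_expansion_l2norm[OF F] by simp
      from tendsto_mult_left[OF this, of "\<bar>1 / ou_sd \<gamma> ?b\<bar>"]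
      show "(\<lambda>k. \<bar>1 / ou_sd \<gamma> ?b\<bar> * l2norm std_normal (\<lambda>x. hermite_sum ?b k x - F x)) \<longlonglongrightarrow> 0" by simp
      show "\<forall>\<^sub>F k in sequentially. norm (l2norm N (\<lambda>\<omega>. ?Y k \<omega> - V t \<omega>)) \<le> \<bar>1 / ou_sd \<gamma> ?b\<bar> * l2norm std_normal (\<lambda>x. hermite_sum ?b k x - F x)"
      proof (rule always_eventually, rule allI)
        fix k
        note S = hermite_sum_square_integrable[of ?b k]
        let ?D = "\<lambda>\<omega>. 1 / ou_sd \<gamma> ?b * (ou_average (hermite_sum ?b k) t \<omega> - ou_average F t \<omega>)"
        have "AE \<omega> in N. ?Y k \<omega> = ou_average (hermite_sum ?b k) t \<omega> / ou_sd \<gamma> ?b"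
          by (rule tempered_hermite_sum[OF \<gamma>1 t]) (use r in auto)
        then have "AE \<omega> in N. \<bar>?Y k \<omega> - V t \<omega>\<bar> \<le> \<bar>?D \<omega>\<bar>"
          by eventually_elim (simp add: V_def diff_divide_distrib)
        moreover have "square_integrable N ?D"
          by (intro square_integrable_cmult square_integrable_diff ou_average_square_integrable(1) S F)
        moreover have "(\<lambda>\<omega>. ?Y k \<omega> - V t \<omega>) \<in> borel_measurable N"
          using square_integrable_diff[OF Ysq Vsq] by (simp add: square_integrable_def)
        ultimately have "l2norm N (\<lambda>\<omega>. ?Y k \<omega> - V t \<omega>) \<le> l2norm N ?D" by (intro l2norm_mono)
        also have "\<dots> \<le> \<bar>1 / ou_sd \<gamma> ?b\<bar> * l2norm std_normal (\<lambda>x. hermite_sum ?b k x - F x)"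
          unfolding l2norm_cmult by (intro mult_left_mono ou_average_diff_l2norm[OF \<gamma>1 S F]) auto
        finally show "norm (l2norm N (\<lambda>\<omega>. ?Y k \<omega> - V t \<omega>)) \<le> \<bar>1 / ou_sd \<gamma> ?b\<bar> * l2norm std_normal (\<lambda>x. hermite_sum ?b k x - F x)" by simp
      qed
    qed
    then show ?thesis using L2_tendsto_iff_l2norm[of N ?Y, OF Ysq Vsq] by simp
  qed
  ultimately show ?thesis unfolding V_def[symmetric] by blast
qed

end

end

section \<open>The three variance regimes\<close>

text \<open>Centring changes the coefficient of order 0 only. If all higher ones vanished,
  completeness would make the centred function null and \<open>f\<close> constant almost everywhere;
  so the minimum that defines the rank exists. Uniqueness of expansions resolves the
  \<open>THE\<close>.\<close>

lemma hermite_rank_nonconstant: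
  assumes f: "square_integrable std_normal f" and nc: "\<not> (\<exists>a. AE x in std_normal. f x = a)"
    and F_def: "F = (\<lambda>x. f x - (\<integral>y. f y \<partial>std_normal))"
  shows "hermite_rank f \<ge> 1" "hermite_coeff F (hermite_rank f) \<noteq> 0" "\<And>q. q < hermite_rank f \<Longrightarrow> hermite_coeff F q = 0"
proof -
  let ?\<mu> = "\<integral>y. f y \<partial>std_normal"
  have F: "square_integrable std_normal F"
    unfolding F_def by (intro square_integrable_diff f std_normal.square_integrable_const)
  have the: "(THE c. hermite_expansion f c) = hermite_coeff f"
    by (rule the_equality) (rule hermite_expansion_exists[OF f], rule hermite_expansion_unique[OF f])
  have FC: "hermite_coeff F q = (if q = 0 then 0 else hermite_coeff f q)" for q
  proof -
    have h0: "(\<integral>z. hermite q z \<partial>std_normal) = (if q = 0 then 1 else 0)"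
      using hermite_orthogonal[of 0 q] by (auto split: if_splits)
    have "(\<integral>x. F x * hermite q x \<partial>std_normal) = (\<integral>x. f x * hermite q x \<partial>std_normal) - ?\<mu> * (\<integral>x. hermite q x \<partial>std_normal)"
      unfolding F_def left_diff_distrib
      using square_integrable_mult[OF f hermite_square_integrable[of q]] std_normal.square_integrable_L1[OF hermite_square_integrable[of q]]
      by simp
    then show ?thesis by (auto simp: hermite_coeff_def h0)
  qed
  have rank: "hermite_rank f = (LEAST q. 1 \<le> q \<and> hermite_coeff f q \<noteq> 0)" by (simp add: hermite_rank_def the)
  have "\<exists>q. 1 \<le> q \<and> hermite_coeff f q \<noteq> 0"
  proof (rule ccontr)
    assume "\<not> (\<exists>q. 1 \<le> q \<and> hermite_coeff f q \<noteq> 0)"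
    then have z: "hermite_coeff F q = 0" for q using FC[of q] by (cases q) auto
    have "(\<lambda>j. l2norm std_normal (\<lambda>x. hermite_sum (hermite_coeff F) j x - F x)) \<longlonglongrightarrow> 0"
      using hermite_expansion_exists[OF F] hermite_expansion_l2norm[OF F] by simp
    moreover have "l2norm std_normal (\<lambda>x. hermite_sum (hermite_coeff F) j x - F x) = l2norm std_normal F" for j
      by (simp add: hermite_sum_def z l2norm_def)
    ultimately have "l2norm std_normal F = 0" by (simp add: LIMSEQ_const_iff)
    from l2norm_eq_0[OF F this] have "AE x in std_normal. f x = ?\<mu>" by eventually_elim (simp add: F_def)
    with nc show False by blast
  qed
  from LeastI_ex[OF this] have L: "1 \<le> hermite_rank f" "hermite_coeff f (hermite_rank f) \<noteq> 0" unfolding rank by auto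
  then show "hermite_rank f \<ge> 1" "hermite_coeff F (hermite_rank f) \<noteq> 0" by (auto simp: FC)
  show "hermite_coeff F q = 0" if "q < hermite_rank f" for q
    using not_less_Least[of q "\<lambda>q. 1 \<le> q \<and> hermite_coeff f q \<noteq> 0"] that unfolding rank FC by (cases q) auto
qed

lemma hermite_combination_nonconstant:
  assumes "\<not> poly (hermite_combination c m p) constant_on UNIV"
  shows "1 \<le> m_star c m p" "coeff (hermite_combination c m p) (m_star c m p) \<noteq> 0"
    "\<And>v. 1 \<le> v \<Longrightarrow> coeff (hermite_combination c m p) v \<noteq> 0 \<Longrightarrow> m_star c m p \<le> v"
proof -
  let ?P = "hermite_combination c m p"
  have "\<exists>w. 1 \<le> w \<and> coeff ?P w \<noteq> 0"
  proof (rule ccontr)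
    assume n: "\<not> (\<exists>w. 1 \<le> w \<and> coeff ?P w \<noteq> 0)"
    have "?P = [:coeff ?P 0:]"
    proof (rule poly_eqI)
      fix v show "coeff ?P v = coeff [:coeff ?P 0:] v" using n by (cases v) auto
    qed
    then have "poly ?P x = coeff ?P 0" for x by (metis add_0_right mult_zero_right poly_0 poly_pCons)
    then show False using assms unfolding constant_on_def by blast
  qed
  from LeastI_ex[OF this] show "1 \<le> m_star c m p" "coeff ?P (m_star c m p) \<noteq> 0" unfolding m_star_eq by auto
  show "m_star c m p \<le> v" if "1 \<le> v" "coeff ?P v \<noteq> 0" for v unfolding m_star_eq using that by (intro Least_le) auto
qed

lemma tendsto_power_ratio:
  fixes \<tau> :: "nat \<Rightarrow> real"
  assumes "\<And>n. n \<ge> 1 \<Longrightarrow> \<tau> n > 0" "v < w"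
  shows "\<tau> \<longlonglongrightarrow> 0 \<Longrightarrow> (\<lambda>n. \<tau> n ^ w / \<tau> n ^ v) \<longlonglongrightarrow> 0" "(\<lambda>n. 1 / \<tau> n) \<longlonglongrightarrow> 0 \<Longrightarrow> (\<lambda>n. \<tau> n ^ v / \<tau> n ^ w) \<longlonglongrightarrow> 0"
proof -
  have z: "(0::real) ^ (w - v) = 0" using assms(2) by simp
  {
  assume t: "\<tau> \<longlonglongrightarrow> 0"
  have "(\<lambda>n. \<tau> n ^ (w - v)) \<longlonglongrightarrow> 0" using tendsto_power[OF t, of "w - v"] by (simp only: z)
  moreover have "\<forall>\<^sub>F n in sequentially. \<tau> n ^ (w - v) = \<tau> n ^ w / \<tau> n ^ v"
    using eventually_ge_at_top[of 1]
    by eventually_elim (use assms in \<open>force simp: power_diff\<close>)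
  ultimately show "(\<lambda>n. \<tau> n ^ w / \<tau> n ^ v) \<longlonglongrightarrow> 0" by (rule Lim_transform_eventually)
  }
  assume t: "(\<lambda>n. 1 / \<tau> n) \<longlonglongrightarrow> 0"
  have "(\<lambda>n. (1 / \<tau> n) ^ (w - v)) \<longlonglongrightarrow> 0" using tendsto_power[OF t, of "w - v"] by (simp only: z)
  moreover have "\<forall>\<^sub>F n in sequentially. (1 / \<tau> n) ^ (w - v) = \<tau> n ^ v / \<tau> n ^ w"
    using eventually_ge_at_top[of 1]
  proof eventually_elim
    fix n :: nat assume "1 \<le> n"
    then have "\<tau> n \<noteq> 0" using assms(1)[of n] by simp
    moreover have "\<tau> n ^ w = \<tau> n ^ v * \<tau> n ^ (w - v)" using assms(2) by (simp add: power_add[symmetric])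
    ultimately show "(1 / \<tau> n) ^ (w - v) = \<tau> n ^ v / \<tau> n ^ w" by (simp add: power_one_over)
  qed
  ultimately show "(\<lambda>n. \<tau> n ^ v / \<tau> n ^ w) \<longlonglongrightarrow> 0" by (rule Lim_transform_eventually)
qed

theorem theorem4p3:
  fixes \<gamma> :: real
  assumes "0 < \<gamma>" and "\<gamma> < 1"
  shows
    "(\<forall>m p c f. 1 \<le> p \<and> m \<le> p \<and> c p \<noteq> 0 \<and> f = (\<lambda>x. \<Sum>q=m..p. c q * hermite q x) \<longrightarrow>
       (\<exists>e :: nat \<Rightarrow> real. \<forall>(M :: 'a measure) \<sigma> \<epsilon> X (N :: 'b measure) B.
          ar_model M \<gamma> \<sigma> \<epsilon> X \<and> two_sided_BM N B \<and>
          (\<lambda>n. 1 - (ar_coeff \<gamma> n)\<^sup>2) \<in> o(\<lambda>n. (\<sigma> n)\<^sup>2) \<longrightarrow>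
          conv_in_D M (std_functional M X f) N
            (\<lambda>t \<omega>. \<Sum>l=0..(p - 1) div 2. e (p - 2 * l) * tempered_hermite N B \<gamma> (p - 2 * l) t \<omega>)))
   \<and> (\<forall>f. f \<in> borel_measurable borel \<and> integrable std_normal (\<lambda>x. (f x)\<^sup>2) \<and>
         \<not> (\<exists>a. AE x in std_normal. f x = a) \<longrightarrow>
       (\<exists>d :: nat \<Rightarrow> real. \<forall>(M :: 'a measure) \<sigma> \<epsilon> X (N :: 'b measure) B.
          ar_model M \<gamma> \<sigma> \<epsilon> X \<and> two_sided_BM N B \<and>
          (\<forall>n\<ge>1. (\<sigma> n)\<^sup>2 = 1 - (ar_coeff \<gamma> n)\<^sup>2) \<longrightarrow>
          (\<exists>V. (\<forall>t\<in>{0..1}. L2_tendsto N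
                  (\<lambda>k \<omega>. \<Sum>q=hermite_rank f..k. d q * tempered_hermite N B \<gamma> q t \<omega>) (V t)) \<and>
               conv_in_D M (std_functional M X f) N V)))
   \<and> (\<forall>m p c f. 1 \<le> p \<and> m \<le> p \<and> c p \<noteq> 0 \<and> f = (\<lambda>x. \<Sum>q=m..p. c q * hermite q x) \<and>
         \<not> f constant_on UNIV \<longrightarrow>
       (\<exists>g :: nat \<Rightarrow> real. \<forall>(M :: 'a measure) \<sigma> \<epsilon> X (N :: 'b measure) B.
          ar_model M \<gamma> \<sigma> \<epsilon> X \<and> two_sided_BM N B \<and>
          (\<lambda>n. (\<sigma> n)\<^sup>2) \<in> o(\<lambda>n. 1 - (ar_coeff \<gamma> n)\<^sup>2) \<longrightarrow>
          conv_in_D M (std_functional M X f) N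
            (\<lambda>t \<omega>. \<Sum>q=1..m_star c m p. g q * tempered_hermite N B \<gamma> q t \<omega>)))"
proof (intro conjI allI impI; elim conjE)
  fix m p c f
  assume p: "1 \<le> (p::nat)" "m \<le> p" "c p \<noteq> (0::real)" "f = (\<lambda>x. \<Sum>q=m..p. c q * hermite q x)"
  let ?P = "hermite_combination c m p"
  have f: "f = poly ?P" by (simp add: p(4) poly_hermite_combination fun_eq_iff)
  obtain a where a: "\<And>x. x ^ p = (\<Sum>q\<le>p. a q * hermite q x)" "\<And>q. a q \<noteq> 0 \<Longrightarrow> q \<le> p \<and> even (p + q)" "a p = 1"
    using power_hermite[of p] by blast
  define b where "b = (\<lambda>q. if q = 0 \<or> q > p then 0 else coeff ?P p * a q)"
  have lc: "coeff ?P p \<noteq> 0" using lead_coeff_hermite_combination[OF p(2), of c] p(3) by simp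
  show "\<exists>e :: nat \<Rightarrow> real. \<forall>(M :: 'a measure) \<sigma> \<epsilon> X (N :: 'b measure) B.
      ar_model M \<gamma> \<sigma> \<epsilon> X \<and> two_sided_BM N B \<and> (\<lambda>n. 1 - (ar_coeff \<gamma> n)\<^sup>2) \<in> o(\<lambda>n. (\<sigma> n)\<^sup>2) \<longrightarrow>
      conv_in_D M (std_functional M X f) N
        (\<lambda>t \<omega>. \<Sum>l=0..(p - 1) div 2. e (p - 2 * l) * tempered_hermite N B \<gamma> (p - 2 * l) t \<omega>)"
  \<comment> \<open>The witness depends on \<gamma> and \<open>f\<close> only, as the order of the
    quantifiers demands; \<open>b\<close> lists the Hermite coefficients of the centred monomial of
    degree \<open>p\<close>.\<close>
  proof (intro exI[of _ "limit_coeff \<gamma> b"] allI impI; elim conjE)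
    fix M :: "'a measure" and \<sigma> \<epsilon> X and N :: "'b measure" and B
    assume model: "ar_model M \<gamma> \<sigma> \<epsilon> X" and BM: "two_sided_BM N B" and o: "(\<lambda>n. 1 - (ar_coeff \<gamma> n)\<^sup>2) \<in> o(\<lambda>n. (\<sigma> n)\<^sup>2)"
    interpret prob_space N using BM by (simp add: two_sided_BM_def)
    interpret ou_process N B \<gamma> by unfold_locales (use BM assms in auto)
    define \<tau> where "\<tau> = (\<lambda>n. sqrt ((\<sigma> n)\<^sup>2 / (1 - (ar_coeff \<gamma> n)\<^sup>2)))"
    have \<tau>: "\<tau> n > 0" if "n \<ge> 1" for n using ar_model_standard(1)[OF assms(2) model that] unfolding \<tau>_def .
    have "(\<lambda>n. (1 - (ar_coeff \<gamma> n)\<^sup>2) / (\<sigma> n)\<^sup>2) \<longlonglongrightarrow> 0" by (rule smalloD_tendsto[OF o])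
    \<comment> \<open>Divergence of \<open>\<tau>\<close> to infinity is kept in the form that its
      reciprocal tends to 0, so that lower degrees are negligible against the top degree.\<close>
    from tendsto_real_sqrt[OF this] have "(\<lambda>n. 1 / \<tau> n) \<longlonglongrightarrow> 0" by (simp add: \<tau>_def real_sqrt_divide)
    note ratio = tendsto_power_ratio(2)[OF \<tau> _ this]
    have "conv_in_D M (std_functional M X (poly ?P)) N (\<lambda>t \<omega>. \<Sum>q=1..p. limit_coeff \<gamma> b q * tempered_hermite N B \<gamma> q t \<omega>)"
    proof (rule ar_polynomial_limit[OF assms(2) model p(1) lc \<tau>_def _ a(1) a(3) b_def])
      fix v assume v: "v \<ge> 1" "v \<noteq> p" "coeff ?P v \<noteq> 0"
      have "v < p" by (rule ccontr) (use v coeff_hermite_combination_above[of p v c m] in auto)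
      then show "(\<lambda>n. \<tau> n ^ v / \<tau> n ^ p) \<longlonglongrightarrow> 0" by (intro ratio) auto
    qed
    \<comment> \<open>Orders whose parity differs from that of \<open>p\<close> have coefficient 0,
      so the sum over all orders reduces to \<open>p - 2 * l\<close>; the upper limit
      \<open>(p - 1) div 2\<close> is the last one with positive order.\<close>
    moreover have "(\<Sum>q=1..p. limit_coeff \<gamma> b q * Y q) = (\<Sum>l=0..(p - 1) div 2. limit_coeff \<gamma> b (p - 2 * l) * Y (p - 2 * l))" for Y
    proof -
      let ?I = "(\<lambda>l. p - 2 * l) ` {0..(p - 1) div 2}"
      have "(\<Sum>q=1..p. limit_coeff \<gamma> b q * Y q) = (\<Sum>q\<in>?I. limit_coeff \<gamma> b q * Y q)"
      proof (rule sum.mono_neutral_right)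
        show "?I \<subseteq> {1..p}" using p(1) by auto
        show "\<forall>q\<in>{1..p} - ?I. limit_coeff \<gamma> b q * Y q = 0"
        proof
          fix q assume q: "q \<in> {1..p} - ?I"
          have "a q = 0"
          proof (rule ccontr)
            assume "a q \<noteq> 0"
            then have "even (p - q)" using a(2)[of q] by auto
            then obtain l where l: "p - q = 2 * l" by (rule evenE)
            have "q = p - 2 * l" "l \<in> {0..(p - 1) div 2}" using l q by auto
            then have "q \<in> ?I" by blast
            with q show False by simp
          qed
          then show "limit_coeff \<gamma> b q * Y q = 0" by (simp add: limit_coeff_def b_def)
        qed
      qed simp
      also have "\<dots> = (\<Sum>l=0..(p - 1) div 2. limit_coeff \<gamma> b (p - 2 * l) * Y (p - 2 * l))"
        using p(1) by (subst sum.reindex) (auto simp: inj_on_def comp_def)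
      finally show ?thesis .
    qed
    ultimately show "conv_in_D M (std_functional M X f) N
        (\<lambda>t \<omega>. \<Sum>l=0..(p - 1) div 2. limit_coeff \<gamma> b (p - 2 * l) * tempered_hermite N B \<gamma> (p - 2 * l) t \<omega>)"
      by (simp only: f)
  qed
next
  fix f :: "real \<Rightarrow> real"
  assume "f \<in> borel_measurable borel" "integrable std_normal (\<lambda>x. (f x)\<^sup>2)" and nc: "\<not> (\<exists>a. AE x in std_normal. f x = a)"
  then have f: "square_integrable std_normal f" by (simp add: square_integrable_def)
  define F where "F = (\<lambda>x. f x - (\<integral>y. f y \<partial>std_normal))"
  note rank = hermite_rank_nonconstant[OF f nc F_def]
  show "\<exists>d :: nat \<Rightarrow> real. \<forall>(M :: 'a measure) \<sigma> \<epsilon> X (N :: 'b measure) B.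
      ar_model M \<gamma> \<sigma> \<epsilon> X \<and> two_sided_BM N B \<and> (\<forall>n\<ge>1. (\<sigma> n)\<^sup>2 = 1 - (ar_coeff \<gamma> n)\<^sup>2) \<longrightarrow>
      (\<exists>V. (\<forall>t\<in>{0..1}. L2_tendsto N (\<lambda>k \<omega>. \<Sum>q=hermite_rank f..k. d q * tempered_hermite N B \<gamma> q t \<omega>) (V t)) \<and>
           conv_in_D M (std_functional M X f) N V)"
  proof (intro exI[of _ "limit_coeff \<gamma> (hermite_coeff F)"] allI impI; elim conjE)
    fix M :: "'a measure" and \<sigma> \<epsilon> X and N :: "'b measure" and B
    assume model: "ar_model M \<gamma> \<sigma> \<epsilon> X" and BM: "two_sided_BM N B" and \<sigma>: "\<forall>n\<ge>1. (\<sigma> n)\<^sup>2 = 1 - (ar_coeff \<gamma> n)\<^sup>2"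
    interpret prob_space N using BM by (simp add: two_sided_BM_def)
    interpret ou_process N B \<gamma> by unfold_locales (use BM assms in auto)
    show "\<exists>V. (\<forall>t\<in>{0..1}. L2_tendsto N (\<lambda>k \<omega>. \<Sum>q=hermite_rank f..k. limit_coeff \<gamma> (hermite_coeff F) q * tempered_hermite N B \<gamma> q t \<omega>) (V t)) \<and>
        conv_in_D M (std_functional M X f) N V"
      by (rule ar_square_integrable_limit[OF assms(2) model \<sigma> f F_def rank])
  qed
next
  fix m p c f
  assume p: "1 \<le> (p::nat)" "m \<le> p" "c p \<noteq> (0::real)" "f = (\<lambda>x. \<Sum>q=m..p. c q * hermite q x)" and nc: "\<not> f constant_on UNIV"
  let ?P = "hermite_combination c m p" and ?w = "m_star c m p"
  have f: "f = poly ?P" by (simp add: p(4) poly_hermite_combination fun_eq_iff)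
  note w = hermite_combination_nonconstant[OF nc[unfolded f]]
  obtain a where a: "\<And>x. x ^ ?w = (\<Sum>q\<le>?w. a q * hermite q x)" "a ?w = 1"
    using power_hermite[of ?w] by blast
  define b where "b = (\<lambda>q. if q = 0 \<or> q > ?w then 0 else coeff ?P ?w * a q)"
  show "\<exists>g :: nat \<Rightarrow> real. \<forall>(M :: 'a measure) \<sigma> \<epsilon> X (N :: 'b measure) B.
      ar_model M \<gamma> \<sigma> \<epsilon> X \<and> two_sided_BM N B \<and> (\<lambda>n. (\<sigma> n)\<^sup>2) \<in> o(\<lambda>n. 1 - (ar_coeff \<gamma> n)\<^sup>2) \<longrightarrow>
      conv_in_D M (std_functional M X f) N (\<lambda>t \<omega>. \<Sum>q=1..?w. g q * tempered_hermite N B \<gamma> q t \<omega>)"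
  proof (intro exI[of _ "limit_coeff \<gamma> b"] allI impI; elim conjE)
    fix M :: "'a measure" and \<sigma> \<epsilon> X and N :: "'b measure" and B
    assume model: "ar_model M \<gamma> \<sigma> \<epsilon> X" and BM: "two_sided_BM N B" and o: "(\<lambda>n. (\<sigma> n)\<^sup>2) \<in> o(\<lambda>n. 1 - (ar_coeff \<gamma> n)\<^sup>2)"
    interpret prob_space N using BM by (simp add: two_sided_BM_def)
    interpret ou_process N B \<gamma> by unfold_locales (use BM assms in auto)
    define \<tau> where "\<tau> = (\<lambda>n. sqrt ((\<sigma> n)\<^sup>2 / (1 - (ar_coeff \<gamma> n)\<^sup>2)))"
    have \<tau>: "\<tau> n > 0" if "n \<ge> 1" for n using ar_model_standard(1)[OF assms(2) model that] unfolding \<tau>_def .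
    have "(\<lambda>n. (\<sigma> n)\<^sup>2 / (1 - (ar_coeff \<gamma> n)\<^sup>2)) \<longlonglongrightarrow> 0" by (rule smalloD_tendsto[OF o])
    from tendsto_real_sqrt[OF this] have "\<tau> \<longlonglongrightarrow> 0" by (simp add: \<tau>_def)
    note ratio = tendsto_power_ratio(1)[OF \<tau> _ this]
    have "conv_in_D M (std_functional M X (poly ?P)) N (\<lambda>t \<omega>. \<Sum>q=1..?w. limit_coeff \<gamma> b q * tempered_hermite N B \<gamma> q t \<omega>)"
    proof (rule ar_polynomial_limit[OF assms(2) model w(1,2) \<tau>_def _ a b_def])
      \<comment> \<open>By minimality of \<open>m_star\<close> every other positive degree that
        occurs is higher, and higher powers of \<open>\<tau>\<close> are negligible as
        \<open>\<tau>\<close> tends to 0.\<close>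
      fix v assume "v \<ge> 1" "v \<noteq> ?w" "coeff ?P v \<noteq> 0"
      then show "(\<lambda>n. \<tau> n ^ v / \<tau> n ^ ?w) \<longlonglongrightarrow> 0" using w(3)[of v] by (intro ratio) auto
    qed
    then show "conv_in_D M (std_functional M X f) N (\<lambda>t \<omega>. \<Sum>q=1..?w. limit_coeff \<gamma> b q * tempered_hermite N B \<gamma> q t \<omega>)"
      by (simp only: f)
  qed
qed

end
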